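(* In the class of parity games, the Nash rational verification problem, the deterministic Nash rational verification problem, the subgame-perfect rational verification problem and the deterministic subgame-perfect rational verification problem are all $\mathsf{coNP}$-complete.
   Context: Games. A game $G=(\Pi,V,(V_i)_{i\in\Pi},E,\mu)$ consists of a finite set $\Pi$ of players, a finite directed graph $(V,E)$ in which every vertex has at least one outgoing edge, a partition $(V_i)_{i\in\Pi}$ of $V$ (parts may be empty; $V_i$ is controlled by $i$), and a payoff function $\mu=(\mu_i)_{i\in\Pi}$ mapping plays (infinite paths) to $\mathbb R^\Pi$. Histories are finite paths. $G_{\upharpoonright v_0}$ denotes the game with initial vertex $v_0$ (plays and histories start at $v_0$). It is a parity game if each player $i$ has a colouring $\kappa_i:V\to\mathbb N$ such that $\mu_i(\pi)=1$ if the minimal $\kappa_i$-colour of a vertex occurring infinitely often in $\pi$ is even, and $\mu_i(\pi)=0$ otherwise. Strategies and equilibria. A strategy $\sigma_i$ of player $i$ maps each history $hv$ from $v_0$ with $v\in V_i$ to a successor of $v$; a profile $\bar\sigma=(\sigma_i)_{i\in\Pi}$ has a unique compatible play, its outcome $\langle\bar\sigma\rangle$. A distinguished player, Leader, is denoted $\mathbb L\in\Pi$. $\bar\sigma$ is an $\mathbb L$-fixed NE if $\mu_i(\langle\sigma'_i,\bar\sigma_{-i}\rangle)\le\mu_i(\langle\bar\sigma\rangle)$ for all players $i\ne\mathbb L$ and all strategies $\sigma'_i$. For a history $hv$, the subgame after $hv$ is the game on the same arena from $v$ with payoff $\pi\mapsto\mu(h\pi)$, and $\bar\sigma_{\upharpoonright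 hv}(h')=\bar\sigma(hh')$. $\bar\sigma$ is an $\mathbb L$-fixed SPE if $\bar\sigma_{\upharpoonright h}$ is an $\mathbb L$-fixed NE in the subgame after $h$ for every history $h$ from $v_0$ compatible with $\sigma_{\mathbb L}$. Mealy machines. A Mealy machine for Leader on $G$ is $M=(Q,q_0,\Delta)$ with $Q$ finite, $q_0\in Q$, $\Delta\subseteq(Q\times(V\setminus V_{\mathbb L})\times Q)\cup(Q\times V_{\mathbb L}\times Q\times V)$ with $uv\in E$ for every $(p,u,q,v)\in\Delta$, such that for all $p\in Q,u\in V$ there is at least one transition $(p,u,q)$ or $(p,u,q,v)$ in $\Delta$; it is deterministic if there is exactly one for all $p,u$. $\sigma_{\mathbb L}\in\mathrm{Comp}_{\upharpoonright v_0}(M)$ if there is a map $h\mapsto q_h\in Q$ (on histories from $v_0$ and the empty history, the latter mapped to $q_0$) such that, for each history $hv$ from $v_0$, $(q_h,v,q_{hv})\in\Delta$ if $v\notin V_{\mathbb L}$ and $(q_h,v,q_{hv},\sigma_{\mathbb L}(hv))\in\Delta$ if $v\in V_{\mathbb L}$. Problems. The (deterministic) Nash (resp. subgame-perfect) rational verification problem in a class $\mathcal C$: given $G_{\upharpoonright v_0}\in\mathcal C$, $t\in\mathbb Q$ and a (deterministic) Mealy machine $M$ for Leader on $G$, does every $\mathbb L$-fixed NE (resp. $\mathbb L$-fixed SPE) $\bar\sigma$ with $\sigma_{\mathbb L}\in\mathrm{Comp}_{\upharpoonright v_0}(M)$ satisfy $\mu_{\mathbb L}(\langle\bar\sigma\rangle)>t$?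 *)

theory Defs
  imports
    Complex_Main
    "HOL-Library.Omega_Words_Fun"
    "HOL-Computational_Algebra.Polynomial"
begin

section \<open>Games\<close>

text \<open>The partition of the vertices is given by the map sending a vertex to its controller; a play is
  a function on the natural numbers. The payoff function is only meaningful on plays.\<close>

record ('p, 'v) game =
  players :: "'p set"
  vertices :: "'v set"
  controller :: "'v \<Rightarrow> 'p"
  edges :: "('v \<times> 'v) set"
  payoff :: "'v word \<Rightarrow> 'p \<Rightarrow> real"

definition is_game :: "('p, 'v) game \<Rightarrow> bool" where
  "is_game G \<longleftrightarrow>
     finite (players G) \<and> finite (vertices G) \<and>
     (\<forall>v\<in>vertices G. controller G v \<in> players G) \<and>
     edges G \<subseteq> vertices G \<times> vertices G \<and>
     (\<forall>u\<in>vertices G. \<exists>v. (u, v) \<in> edges G)"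

definition region :: "('p, 'v) game \<Rightarrow> 'p \<Rightarrow> 'v set" where
  "region G i = {v \<in> vertices G. controller G v = i}"

definition is_play :: "('p, 'v) game \<Rightarrow> 'v \<Rightarrow> 'v word \<Rightarrow> bool" where
  "is_play G v0 \<pi> \<longleftrightarrow> \<pi> 0 = v0 \<and> (\<forall>n. (\<pi> n, \<pi> (Suc n)) \<in> edges G)"

definition is_history :: "('p, 'v) game \<Rightarrow> 'v \<Rightarrow> 'v list \<Rightarrow> bool" where
  "is_history G v0 h \<longleftrightarrow> h \<noteq> [] \<and> hd h = v0 \<and> successively (\<lambda>u v. (u, v) \<in> edges G) h"

definition parity_payoff :: "('p \<Rightarrow> 'v \<Rightarrow> nat) \<Rightarrow> 'v word \<Rightarrow> 'p \<Rightarrow> real" where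
  "parity_payoff \<kappa> \<pi> i = (if even (Min (\<kappa> i ` limit \<pi>)) then 1 else 0)"

section \<open>Strategies and equilibria\<close>

text \<open>A strategy is a total function on lists; its values outside the histories that end in a vertex
  of the player are irrelevant.\<close>

type_synonym 'v strategy = "'v list \<Rightarrow> 'v"
type_synonym ('p, 'v) profile = "'p \<Rightarrow> 'v strategy"

definition is_strategy :: "('p, 'v) game \<Rightarrow> 'v \<Rightarrow> 'p \<Rightarrow> 'v strategy \<Rightarrow> bool" where
  "is_strategy G v0 i s \<longleftrightarrow>
     (\<forall>h v. is_history G v0 (h @ [v]) \<and> v \<in> region G i \<longrightarrow> (v, s (h @ [v])) \<in> edges G)"

definition is_profile :: "('p, 'v) game \<Rightarrow> 'v \<Rightarrow> ('p, 'v) profile \<Rightarrow> bool" where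
  "is_profile G v0 \<sigma> \<longleftrightarrow> (\<forall>i\<in>players G. is_strategy G v0 i (\<sigma> i))"

definition play_compatible :: "('p, 'v) game \<Rightarrow> 'p \<Rightarrow> 'v strategy \<Rightarrow> 'v word \<Rightarrow> bool" where
  "play_compatible G i s \<pi> \<longleftrightarrow>
     (\<forall>n. \<pi> n \<in> region G i \<longrightarrow> \<pi> (Suc n) = s (map \<pi> [0..<Suc n]))"

definition history_compatible :: "('p, 'v) game \<Rightarrow> 'p \<Rightarrow> 'v strategy \<Rightarrow> 'v list \<Rightarrow> bool" where
  "history_compatible G i s h \<longleftrightarrow>
     (\<forall>n. Suc n < length h \<and> h ! n \<in> region G i \<longrightarrow> h ! Suc n = s (take (Suc n) h))"

definition outcome :: "('p, 'v) game \<Rightarrow> 'v \<Rightarrow> ('p, 'v) profile \<Rightarrow> 'v word" where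
  "outcome G v0 \<sigma> =
     (THE \<pi>. is_play G v0 \<pi> \<and> (\<forall>i\<in>players G. play_compatible G i (\<sigma> i) \<pi>))"

definition fixed_NE :: "('p, 'v) game \<Rightarrow> 'p \<Rightarrow> 'v \<Rightarrow> ('p, 'v) profile \<Rightarrow> bool" where
  "fixed_NE G L v0 \<sigma> \<longleftrightarrow>
     is_profile G v0 \<sigma> \<and>
     (\<forall>i\<in>players G - {L}. \<forall>s. is_strategy G v0 i s \<longrightarrow>
        payoff G (outcome G v0 (\<sigma>(i := s))) i \<le> payoff G (outcome G v0 \<sigma>) i)"

text \<open>The subgame after \<open>hv\<close> is \<open>subgame G h\<close> with initial vertex \<open>v\<close>.\<close>

definition subgame :: "('p, 'v) game \<Rightarrow> 'v list \<Rightarrow> ('p, 'v) game" where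
  "subgame G h = G\<lparr>payoff := \<lambda>\<pi>. payoff G (h \<frown> \<pi>)\<rparr>"

definition fixed_SPE :: "('p, 'v) game \<Rightarrow> 'p \<Rightarrow> 'v \<Rightarrow> ('p, 'v) profile \<Rightarrow> bool" where
  "fixed_SPE G L v0 \<sigma> \<longleftrightarrow>
     is_profile G v0 \<sigma> \<and>
     (\<forall>h v. is_history G v0 (h @ [v]) \<and> history_compatible G L (\<sigma> L) (h @ [v]) \<longrightarrow>
        fixed_NE (subgame G h) L v (\<lambda>i h'. \<sigma> i (h @ h')))"

section \<open>Mealy machines for Leader\<close>

text \<open>The transition relation is split into its two parts: transitions read at vertices of the other
  players, and transitions read at vertices of Leader, which also output a vertex.\<close>

record ('q, 'v) mealy =
  mstates :: "'q set"
  minit :: 'q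
  mtrans :: "('q \<times> 'v \<times> 'q) set"
  mtransL :: "('q \<times> 'v \<times> 'q \<times> 'v) set"

definition is_mealy :: "('p, 'v) game \<Rightarrow> 'p \<Rightarrow> ('q, 'v) mealy \<Rightarrow> bool" where
  "is_mealy G L M \<longleftrightarrow>
     finite (mstates M) \<and> minit M \<in> mstates M \<and>
     mtrans M \<subseteq> mstates M \<times> (vertices G - region G L) \<times> mstates M \<and>
     mtransL M \<subseteq> mstates M \<times> region G L \<times> mstates M \<times> vertices G \<and>
     (\<forall>(p, u, q, v) \<in> mtransL M. (u, v) \<in> edges G) \<and>
     (\<forall>p\<in>mstates M. \<forall>u\<in>vertices G - region G L. \<exists>q. (p, u, q) \<in> mtrans M) \<and>
     (\<forall>p\<in>mstates M. \<forall>u\<in>region G L. \<exists>q v. (p, u, q, v) \<in> mtransL M)"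

definition is_deterministic :: "('p, 'v) game \<Rightarrow> 'p \<Rightarrow> ('q, 'v) mealy \<Rightarrow> bool" where
  "is_deterministic G L M \<longleftrightarrow>
     (\<forall>p\<in>mstates M. \<forall>u\<in>vertices G - region G L. \<exists>!q. (p, u, q) \<in> mtrans M) \<and>
     (\<forall>p\<in>mstates M. \<forall>u\<in>region G L. \<exists>!(q, v). (p, u, q, v) \<in> mtransL M)"

definition Comp :: "('p, 'v) game \<Rightarrow> 'p \<Rightarrow> 'v \<Rightarrow> ('q, 'v) mealy \<Rightarrow> 'v strategy set" where
  "Comp G L v0 M =
     {s. is_strategy G v0 L s \<and>
         (\<exists>\<rho>. \<rho> [] = minit M \<and>
            (\<forall>h v. is_history G v0 (h @ [v]) \<longrightarrow>
               (v \<notin> region G L \<longrightarrow> (\<rho> h, v, \<rho> (h @ [v])) \<in> mtrans M) \<and>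
               (v \<in> region G L \<longrightarrow> (\<rho> h, v, \<rho> (h @ [v]), s (h @ [v])) \<in> mtransL M)))}"

section \<open>Rational verification\<close>

definition nash_verified ::
    "('p, 'v) game \<Rightarrow> 'p \<Rightarrow> 'v \<Rightarrow> rat \<Rightarrow> ('q, 'v) mealy \<Rightarrow> bool" where
  "nash_verified G L v0 t M \<longleftrightarrow>
     (\<forall>\<sigma>. fixed_NE G L v0 \<sigma> \<and> \<sigma> L \<in> Comp G L v0 M \<longrightarrow> payoff G (outcome G v0 \<sigma>) L > of_rat t)"

definition subgame_perfect_verified ::
    "('p, 'v) game \<Rightarrow> 'p \<Rightarrow> 'v \<Rightarrow> rat \<Rightarrow> ('q, 'v) mealy \<Rightarrow> bool" where
  "subgame_perfect_verified G L v0 t M \<longleftrightarrow>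
     (\<forall>\<sigma>. fixed_SPE G L v0 \<sigma> \<and> \<sigma> L \<in> Comp G L v0 M \<longrightarrow> payoff G (outcome G v0 \<sigma>) L > of_rat t)"

section \<open>Complexity classes\<close>

text \<open>Deterministic Turing machines with \<open>tapes M\<close> two-way infinite tapes, alphabet
  \<open>{..<symbols M}\<close> and states \<open>{..<states M}\<close>. Symbol 0 is the blank, 1 and 2 stand for the
  two bits. The transition function maps a state and the list of scanned symbols to the next state
  and, for each tape, a symbol to write and a head movement.\<close>

datatype move = Move_Left | Stay | Move_Right

record tm =
  tapes :: nat
  symbols :: nat
  states :: nat
  start :: nat
  accept :: nat
  reject :: nat
  delta :: "nat \<Rightarrow> nat list \<Rightarrow> nat \<times> (nat \<times> move) list"

definition is_tm :: "tm \<Rightarrow> bool" where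
  "is_tm M \<longleftrightarrow>
     1 \<le> tapes M \<and> 3 \<le> symbols M \<and>
     start M < states M \<and> accept M < states M \<and> reject M < states M \<and> accept M \<noteq> reject M \<and>
     (\<forall>q xs. q < states M \<and> length xs = tapes M \<and> set xs \<subseteq> {..<symbols M} \<longrightarrow>
        (case delta M q xs of (q', as) \<Rightarrow>
           q' < states M \<and> length as = tapes M \<and> fst ` set as \<subseteq> {..<symbols M}))"

text \<open>A tape consists of a head position and the tape contents.\<close>

type_synonym tape = "int \<times> (int \<Rightarrow> nat)"
type_synonym config = "nat \<times> tape list"

fun scanned :: "tape \<Rightarrow> nat" where
  "scanned (p, c) = c p"

fun shift :: "move \<Rightarrow> int \<Rightarrow> int" where
  "shift Move_Left p = p - 1"
| "shift Stay p = p"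
| "shift Move_Right p = p + 1"

fun act :: "nat \<times> move \<Rightarrow> tape \<Rightarrow> tape" where
  "act (a, d) (p, c) = (shift d p, c(p := a))"

definition halted :: "tm \<Rightarrow> config \<Rightarrow> bool" where
  "halted M cfg \<longleftrightarrow> fst cfg = accept M \<or> fst cfg = reject M"

definition step :: "tm \<Rightarrow> config \<Rightarrow> config" where
  "step M cfg =
     (if halted M cfg then cfg
      else case delta M (fst cfg) (map scanned (snd cfg)) of
        (q, as) \<Rightarrow> (q, map2 act as (snd cfg)))"

definition bit_symbol :: "bool \<Rightarrow> nat" where
  "bit_symbol b = (if b then 2 else 1)"

definition input_tape :: "bool list \<Rightarrow> tape" where
  "input_tape x = (0, \<lambda>p. if 0 \<le> p \<and> p < int (length x) then bit_symbol (x ! nat p) else 0)"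

definition initial :: "tm \<Rightarrow> bool list \<Rightarrow> config" where
  "initial M x = (start M, input_tape x # replicate (tapes M - 1) (input_tape []))"

definition run :: "tm \<Rightarrow> bool list \<Rightarrow> nat \<Rightarrow> config" where
  "run M x n = (step M ^^ n) (initial M x)"

text \<open>The output is the word on the last tape between position 0 and the first blank.\<close>

definition outputs :: "config \<Rightarrow> bool list \<Rightarrow> bool" where
  "outputs cfg y \<longleftrightarrow>
     (\<forall>k<length y. snd (last (snd cfg)) (int k) = bit_symbol (y ! k)) \<and>
     snd (last (snd cfg)) (int (length y)) = 0"

type_synonym language = "bool list set"

definition poly_time_computable :: "(bool list \<Rightarrow> bool list) \<Rightarrow> bool" where
  "poly_time_computable f \<longleftrightarrow>
     (\<exists>M (p :: nat poly). is_tm M \<and>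
        (\<forall>x. \<exists>n \<le> poly p (length x). halted M (run M x n) \<and> outputs (run M x n) (f x)))"

definition P_class :: "language set" where
  "P_class =
     {A. \<exists>M (p :: nat poly). is_tm M \<and>
        (\<forall>x. \<exists>n \<le> poly p (length x).
           fst (run M x n) = (if x \<in> A then accept M else reject M))}"

text \<open>Self-delimiting (prefix-free) codes: every list element is announced by a 1, and the end of the
  list is marked by a 0.\<close>

fun enc_list :: "('a \<Rightarrow> bool list) \<Rightarrow> 'a list \<Rightarrow> bool list" where
  "enc_list f [] = [False]"
| "enc_list f (x # xs) = True # f x @ enc_list f xs"

definition pair_word :: "bool list \<Rightarrow> bool list \<Rightarrow> bool list" where
  "pair_word x u = enc_list (\<lambda>b. [b]) x @ u"

definition NP_class :: "language set" where
  "NP_class =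
     {A. \<exists>R\<in>P_class. \<exists>p :: nat poly.
        \<forall>x. x \<in> A \<longleftrightarrow> (\<exists>u. length u \<le> poly p (length x) \<and> pair_word x u \<in> R)}"

definition coNP_class :: "language set" where
  "coNP_class = {A. - A \<in> NP_class}"

definition poly_time_reducible :: "language \<Rightarrow> language \<Rightarrow> bool" where
  "poly_time_reducible A B \<longleftrightarrow> (\<exists>f. poly_time_computable f \<and> (\<forall>x. x \<in> A \<longleftrightarrow> f x \<in> B))"

definition coNP_complete :: "language \<Rightarrow> bool" where
  "coNP_complete A \<longleftrightarrow> A \<in> coNP_class \<and> (\<forall>B\<in>coNP_class. poly_time_reducible B A)"

section \<open>Parity instances and their encoding\<close>

text \<open>Up to renaming, the players are \<open>{..<k}\<close>, vertices \<open>{..<n}\<close> and the states of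
  the Mealy machine \<open>{..<m}\<close>. Here \<open>k\<close> is the length of \<open>colours\<close>, \<open>n\<close> the
  length of \<open>owners\<close>, and \<open>m\<close> is given explicitly. The colour of vertex \<open>v\<close> for
  player \<open>i\<close> is \<open>colours ! i ! v\<close>, and the threshold is the fraction \<open>tnum / tden\<close>.\<close>

record parity_instance =
  owners :: "nat list"
  arcs :: "(nat \<times> nat) list"
  colours :: "nat list list"
  leader :: nat
  source :: nat
  tnum :: int
  tden :: nat
  mcount :: nat
  mstart :: nat
  marcs :: "(nat \<times> nat \<times> nat) list"
  marcsL :: "(nat \<times> nat \<times> nat \<times> nat) list"

definition inst_game :: "parity_instance \<Rightarrow> (nat, nat) game" where
  "inst_game I =
     \<lparr>players = {..<length (colours I)},
      vertices = {..<length (owners I)},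
      controller = (\<lambda>v. owners I ! v),
      edges = set (arcs I),
      payoff = parity_payoff (\<lambda>i v. colours I ! i ! v)\<rparr>"

definition inst_mealy :: "parity_instance \<Rightarrow> (nat, nat) mealy" where
  "inst_mealy I =
     \<lparr>mstates = {..<mcount I}, minit = mstart I,
      mtrans = set (marcs I), mtransL = set (marcsL I)\<rparr>"

definition inst_threshold :: "parity_instance \<Rightarrow> rat" where
  "inst_threshold I = of_int (tnum I) / of_nat (tden I)"

definition is_instance :: "parity_instance \<Rightarrow> bool" where
  "is_instance I \<longleftrightarrow>
     is_game (inst_game I) \<and>
     (\<forall>c\<in>set (colours I). length c = length (owners I)) \<and>
     leader I \<in> players (inst_game I) \<and>
     source I \<in> vertices (inst_game I) \<and>
     0 < tden I \<and>
     is_mealy (inst_game I) (leader I) (inst_mealy I)"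

definition is_det_instance :: "parity_instance \<Rightarrow> bool" where
  "is_det_instance I \<longleftrightarrow>
     is_instance I \<and> is_deterministic (inst_game I) (leader I) (inst_mealy I)"

text \<open>Natural numbers are written in binary, least significant bit first.\<close>

fun binary :: "nat \<Rightarrow> bool list" where
  "binary n = (if n = 0 then [] else odd n # binary (n div 2))"

declare binary.simps [simp del]

definition enc_nat :: "nat \<Rightarrow> bool list" where
  "enc_nat n = enc_list (\<lambda>b. [b]) (binary n)"

definition enc_int :: "int \<Rightarrow> bool list" where
  "enc_int z = (z < 0) # enc_nat (nat \<bar>z\<bar>)"

fun enc_prod :: "('a \<Rightarrow> bool list) \<Rightarrow> ('b \<Rightarrow> bool list) \<Rightarrow> 'a \<times> 'b \<Rightarrow> bool list" where
  "enc_prod f g (x, y) = f x @ g y"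

definition encode :: "parity_instance \<Rightarrow> bool list" where
  "encode I =
     enc_list enc_nat (owners I) @
     enc_list (enc_prod enc_nat enc_nat) (arcs I) @
     enc_list (enc_list enc_nat) (colours I) @
     enc_nat (leader I) @
     enc_nat (source I) @
     enc_int (tnum I) @
     enc_nat (tden I) @
     enc_nat (mcount I) @
     enc_nat (mstart I) @
     enc_list (enc_prod enc_nat (enc_prod enc_nat enc_nat)) (marcs I) @
     enc_list (enc_prod enc_nat (enc_prod enc_nat (enc_prod enc_nat enc_nat))) (marcsL I)"

definition nash_rational_verification :: language where
  "nash_rational_verification =
     {encode I | I. is_instance I \<and>
        nash_verified (inst_game I) (leader I) (source I) (inst_threshold I) (inst_mealy I)}"

definition det_nash_rational_verification :: language where
  "det_nash_rational_verification =
     {encode I | I. is_det_instance I \<and>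
        nash_verified (inst_game I) (leader I) (source I) (inst_threshold I) (inst_mealy I)}"

definition subgame_perfect_rational_verification :: language where
  "subgame_perfect_rational_verification =
     {encode I | I. is_instance I \<and>
        subgame_perfect_verified
          (inst_game I) (leader I) (source I) (inst_threshold I) (inst_mealy I)}"

definition det_subgame_perfect_rational_verification :: language where
  "det_subgame_perfect_rational_verification =
     {encode I | I. is_det_instance I \<and>
        subgame_perfect_verified
          (inst_game I) (leader I) (source I) (inst_threshold I) (inst_mealy I)}"

end

theory Submission
  imports Defs
begin

text \<open>Membership: a counterexample equilibrium is certified by ultimately periodic words over the
  transitions of the Mealy machine. One word is the main play; for each player, machine state and
  vertex that a deviation can reach, a further word proposes how the others answer it. Every
  deviation from a word leads to another proposal, so a repeated deviation runs through infinitely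
  many proposals, and ranks, which exist by positional determinacy of parity games, show that the
  deviator loses. Lassos of polynomial length suffice, and checking them takes polynomial time.

  Hardness: the computation of a verifier on a certificate is written as a set of clauses, and a
  formula becomes a game in which one player cycles through the clauses and picks a literal in each.
  The owner of a picked occurrence can leave for a sink and does so if the complementary literal
  keeps being picked; the play can cycle forever, which is what Leader loses, iff the choices can be
  made consistently.

  Polynomial time is established once and for all for a class of functions on binary trees that is
  closed under the usual list operations; the functions are computed by a while language on stacks,
  which is compiled to Turing machines.\<close>

section \<open>A structured language for stack programs on Turing tapes\<close>

text \<open>Equilibrium strategies may depend on the whole history, while a certificate can afford
  only one proposal per player, machine state and vertex. Parity payoffs ignore finite prefixes, so
  a continuation taken from one history can be replayed after another with the same state and
  vertex. The obstacle is gluing: each proposal alone is lost by the deviator, but pieces of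
  infinitely many of them, taken from different histories, might together be won. Hence an auxiliary
  game on pairs of state and vertex: one side picks a history ending there, the other a deviation
  from its continuation. Its positional solution fixes one history per pair, and its ranks make
  gluing harmless by conditions that are local and checkable. Since the words run over transitions,
  they also resolve the nondeterminism of the machine. The flags \<open>spe\<close> and
  \<open>det\<close> select one of the four problems, so that every argument is made once. In the
  hardness game Leader owns no vertex; hence a deterministic machine with one state suffices, and
  the profile read off a valuation is positional and an equilibrium from every vertex, so subgame
  perfection comes for free.\<close>

datatype cmd =
    Skip
  | Do nat "nat \<Rightarrow> nat \<times> move"
  | Seq cmd cmd
  | Cond nat "nat \<Rightarrow> bool" cmd cmd
  | While nat "nat \<Rightarrow> bool" cmd

definition idle :: "nat list \<Rightarrow> (nat \<times> move) list" where
  "idle xs = map (\<lambda>a. (a, Stay)) xs"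

text \<open>Control costs a full step: tests and the dismissal of a finished first half of a
  \<open>Seq\<close> leave the tapes idle. The scanned symbols determine both the next program and
  the actions, which is the format of a transition function.\<close>

fun nxt :: "cmd \<Rightarrow> nat list \<Rightarrow> cmd \<times> (nat \<times> move) list" where
  "nxt Skip xs = (Skip, idle xs)"
| "nxt (Do i f) xs = (Skip, (idle xs)[i := f (xs ! i)])"
| "nxt (Seq c d) xs =
     (if c = Skip then (d, idle xs) else (Seq (fst (nxt c xs)) d, snd (nxt c xs)))"
| "nxt (Cond i P c d) xs = (if P (xs ! i) then c else d, idle xs)"
| "nxt (While i P c) xs = (if P (xs ! i) then Seq c (While i P c) else Skip, idle xs)"

definition sstep :: "cmd \<times> tape list \<Rightarrow> cmd \<times> tape list" where
  "sstep z = (fst (nxt (fst z) (map scanned (snd z))),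
     map2 act (snd (nxt (fst z) (map scanned (snd z)))) (snd z))"

text \<open>The states of the machine of a program are its residual programs; the transition function of a
  machine being arbitrary, no jump addresses have to be computed.\<close>

fun resid :: "cmd \<Rightarrow> cmd set" where
  "resid Skip = {Skip}"
| "resid (Do i f) = {Do i f, Skip}"
| "resid (Seq c d) = (\<lambda>c'. Seq c' d) ` resid c \<union> resid d"
| "resid (Cond i P c d) = insert (Cond i P c d) (resid c \<union> resid d)"
| "resid (While i P c) =
     {While i P c, Skip} \<union> (\<lambda>c'. Seq c' (While i P c)) ` resid c"

text \<open>Four symbols are used: the blank, the two bits and the delimiter. Tests are arbitrary
  predicates, so only the written symbols are restricted.\<close>

fun wf_cmd :: "cmd \<Rightarrow> bool" where
  "wf_cmd Skip = True"
| "wf_cmd (Do i f) = (\<forall>a<4. fst (f a) < 4)"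
| "wf_cmd (Seq c d) = (wf_cmd c \<and> wf_cmd d)"
| "wf_cmd (Cond i P c d) = (wf_cmd c \<and> wf_cmd d)"
| "wf_cmd (While i P c) = wf_cmd c"

text \<open>\<open>Skip\<close> is a fixpoint of \<open>sstep\<close>, so the number is an upper
  bound on the running time and can be enlarged freely.\<close>

definition runs :: "cmd \<Rightarrow> tape list \<Rightarrow> nat \<Rightarrow> tape list \<Rightarrow> bool" where
  "runs c ts n ts' \<longleftrightarrow> (sstep ^^ n) (c, ts) = (Skip, ts')"

lemma length_idle [simp]: "length (idle xs) = length xs"
  by (simp add: idle_def)

lemma length_nxt [simp]: "length (snd (nxt c xs)) = length xs"
  by (induction c) auto

lemma act_idle [simp]: "map2 act (idle (map scanned ts)) ts = ts"
proof (induction ts)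
  case (Cons t ts)
  then show ?case by (cases t) (auto simp: idle_def)
qed (simp add: idle_def)

lemma sstep_simps [simp]:
  "sstep (Skip, ts) = (Skip, ts)"
  "sstep (Seq Skip d, ts) = (d, ts)"
  "c \<noteq> Skip \<Longrightarrow> sstep (Seq c d, ts) = (Seq (fst (sstep (c, ts))) d, snd (sstep (c, ts)))"
  "i < length ts \<Longrightarrow>
     sstep (Cond i P c d, ts) = (if P (scanned (ts ! i)) then c else d, ts)"
  "i < length ts \<Longrightarrow>
     sstep (While i P c, ts) = (if P (scanned (ts ! i)) then Seq c (While i P c) else Skip, ts)"
  by (auto simp: sstep_def)

lemma sstep_Do:
  assumes "i < length ts"
  shows "sstep (Do i f, ts) = (Skip, ts[i := act (f (scanned (ts ! i))) (ts ! i)])"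
proof -
  have "map2 act ((idle (map scanned ts))[i := f (scanned (ts ! i))]) ts =
      ts[i := act (f (scanned (ts ! i))) (ts ! i)]"
    (is "?l = ?r")
  proof (rule nth_equalityI)
    fix k assume "k < length ?l"
    then have k: "k < length ts" by simp
    have "act (idle (map scanned ts) ! k) (ts ! k) = map2 act (idle (map scanned ts)) ts ! k"
      using k by (simp del: act_idle)
    then have "act (idle (map scanned ts) ! k) (ts ! k) = ts ! k" by simp
    then show "?l ! k = ?r ! k"
      using k assms by (cases "k = i") auto
  qed simp
  then show ?thesis using assms by (simp add: sstep_def)
qed

lemma sstep_Skip_funpow [simp]: "(sstep ^^ n) (Skip, ts) = (Skip, ts)"
  by (induction n) auto

lemma runs_mono: "runs c ts n ts' \<Longrightarrow> n \<le> m \<Longrightarrow> runs c ts m ts'"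
  by (auto simp: runs_def funpow_add add.commute[of n] dest!: le_Suc_ex)

lemma runs_step: "runs (fst (sstep (c, ts))) (snd (sstep (c, ts))) n ts' \<Longrightarrow> runs c ts (Suc n) ts'"
  by (simp add: runs_def funpow_Suc_right del: funpow.simps)

text \<open>Only an inequality holds for the time: \<open>c\<close> may end early and idle in
  \<open>Skip\<close>, whereas \<open>Seq c d\<close> moves on at once.\<close>

lemma sstep_Seq_funpow:
  "(sstep ^^ n) (c, ts) = (Skip, ts') \<Longrightarrow> \<exists>m\<le>n. (sstep ^^ m) (Seq c d, ts) = (Seq Skip d, ts')"
proof (induction n arbitrary: c ts)
  case (Suc n)
  show ?case
  proof (cases "c = Skip")
    case True
    then have "ts' = ts" using Suc.prems by (auto simp del: funpow.simps)
    then show ?thesis using True by (intro exI[of _ 0]) auto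
  next
    case False
    obtain c1 ts1 where 1: "sstep (c, ts) = (c1, ts1)" by fastforce
    have "(sstep ^^ n) (c1, ts1) = (Skip, ts')"
      using Suc.prems 1 by (simp add: funpow_Suc_right del: funpow.simps)
    then obtain m where "m \<le> n" "(sstep ^^ m) (Seq c1 d, ts1) = (Seq Skip d, ts')"
      using Suc.IH by blast
    then show ?thesis using False 1
      by (intro exI[of _ "Suc m"]) (simp add: funpow_Suc_right del: funpow.simps)
  qed
qed auto

lemma runs_Seq:
  assumes "runs c ts n ts'" "runs d ts' k ts''"
  shows "runs (Seq c d) ts (n + k + 1) ts''"
proof -
  obtain m where m: "m \<le> n" "(sstep ^^ m) (Seq c d, ts) = (Seq Skip d, ts')"
    using sstep_Seq_funpow assms(1) unfolding runs_def by blast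
  have "(sstep ^^ (k + 1 + m)) (Seq c d, ts) = (Skip, ts'')"
    unfolding funpow_add using m assms(2)
    by (simp add: runs_def funpow_swap1)
  then have "runs (Seq c d) ts (k + 1 + m) ts''" by (simp only: runs_def)
  then show ?thesis by (rule runs_mono) (use m in auto)
qed

section \<open>Compilation of programs to Turing machines\<close>

lemma finite_resid [simp]: "finite (resid c)"
  by (induction c) auto

lemma resid_self: "c \<in> resid c"
  by (induction c) auto

lemma Skip_resid: "Skip \<in> resid c"
  by (induction c) auto

text \<open>Unfolding a loop puts a residual of the body in front of the loop itself, and the loop
  is again a residual; so the set stays finite although loops unfold without end.\<close>

lemma resid_nxt: "c' \<in> resid c \<Longrightarrow> fst (nxt c' xs) \<in> resid c"
proof (induction c arbitrary: c')
  case (Seq c d)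
  then show ?case by (cases "c' \<in> resid d") (auto simp: resid_self)
next
  case (While i P c)
  from While.prems consider "c' = While i P c" | "c' = Skip" | c1 where "c' = Seq c1 (While i P c)" "c1 \<in> resid c"
    by auto
  then show ?case
  proof cases
    case 3
    then show ?thesis using While.IH[of c1] by simp
  qed (auto simp: resid_self)
qed (auto simp: resid_self Skip_resid)

lemma resid_wf: "wf_cmd c \<Longrightarrow> c' \<in> resid c \<Longrightarrow> wf_cmd c'"
proof (induction c arbitrary: c')
  case (Do i f)
  then show ?case by (metis insertE resid.simps(2) singletonD wf_cmd.simps(1))
next
  case (Seq c d)
  from Seq.prems(2) have "c' \<in> resid d \<or> (\<exists>c1\<in>resid c. c' = Seq c1 d)" by auto
  with Seq.prems(1) Seq.IH show ?case by (metis wf_cmd.simps(3))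
next
  case (Cond i P c d)
  from Cond.prems(2) have "c' = Cond i P c d \<or> c' \<in> resid c \<or> c' \<in> resid d" by simp
  with Cond.prems(1) Cond.IH show ?case by (metis wf_cmd.simps(4))
next
  case (While i P c)
  from While.prems(2) have "c' = While i P c \<or> c' = Skip \<or> (\<exists>c1\<in>resid c. c' = Seq c1 (While i P c))" by auto
  with While.prems(1) While.IH show ?case by (metis wf_cmd.simps(1,3,5))
qed simp

lemma nxt_symbols:
  "wf_cmd c \<Longrightarrow> set xs \<subseteq> {..<4} \<Longrightarrow> fst ` set (snd (nxt c xs)) \<subseteq> {..<4}"
proof (induction c)
  case (Do i f)
  have "xs ! i < 4" if "i < length xs" using Do that nth_mem by fastforce
  then have "i < length xs \<Longrightarrow> fst (f (xs ! i)) < 4" using Do by simp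
  moreover have "(idle xs)[i := f (xs ! i)] = idle xs" if "\<not> i < length xs"
    using that by (intro list_update_beyond) simp
  ultimately show ?case using Do.prems
    by (cases "i < length xs")
      (auto simp: idle_def dest!: set_update_subset_insert[THEN subsetD])
qed (auto simp: idle_def)

definition init4 :: "bool list \<Rightarrow> tape list" where
  "init4 x = input_tape x # replicate 3 (input_tape [])"

text \<open>The residual programs are numbered below \<open>N\<close>; \<open>N\<close> and
  \<open>N + 1\<close> are the accepting and the rejecting state. One more step is made at
  \<open>Skip\<close>, to decide by the symbol on tape 0: 2 is the first symbol of a serialised
  \<open>Node\<close>, hence of the tree of \<open>True\<close>.\<close>

lemma tm_of_cmd:
  assumes "wf_cmd c"
  shows "\<exists>M. is_tm M \<and> (\<forall>x B ts'. runs c (init4 x) B ts' \<longrightarrow>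
    (\<exists>n \<le> B + 1. run M x n = (if scanned (ts' ! 0) = 2 then accept M else reject M, ts')))"
proof -
  let ?R = "resid c"
  obtain num where num: "bij_betw num ?R {..<card ?R}"
    using ex_bij_betw_finite_nat[of ?R] by (auto simp: atLeast0LessThan)
  define N where "N = card ?R"
  define dec where "dec = inv_into ?R num"
  define dl where "dl q xs = (if q < N then
      (if dec q = Skip then (if xs ! 0 = 2 then N else N + 1, idle xs)
       else (num (fst (nxt (dec q) xs)), snd (nxt (dec q) xs)))
    else (q, idle xs))" for q :: nat and xs :: "nat list"
  define M where "M = \<lparr>tapes = 4, symbols = 4, states = N + 2, start = num c, accept = N,
    reject = N + 1, delta = dl\<rparr>"
  have numR: "num d < N" "dec (num d) = d" if "d \<in> ?R" for d
    using num that unfolding N_def dec_def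
    by (auto dest: bij_betwE) (metis bij_betw_inv_into_left[OF num])+
  have decR: "dec q \<in> ?R" if "q < N" for q
    using num that unfolding N_def dec_def by (metis bij_betw_def inv_into_into lessThan_iff)
  have nxtR: "fst (nxt d xs) \<in> ?R" if "d \<in> ?R" for d xs
    using that resid_nxt by blast
  have tm: "is_tm M"
  proof -
    have "case dl q xs of (q', as) \<Rightarrow>
        q' < N + 2 \<and> length as = 4 \<and> fst ` set as \<subseteq> {..<4}"
      if "q < N + 2" "length xs = 4" "set xs \<subseteq> {..<4}" for q xs
    proof -
      have "wf_cmd (dec q)" if "q < N"
        using decR[OF that] assms resid_wf by auto
      moreover have "num (fst (nxt (dec q) xs)) < N + 2" if "q < N"
        using numR(1)[OF nxtR[OF decR[OF that]], of xs] by linarith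
      ultimately show ?thesis
        using that nxt_symbols[of "dec q" xs] by (auto simp: dl_def idle_def)
    qed
    then show ?thesis
      using numR(1)[of c] resid_self[of c] by (auto simp: is_tm_def M_def)
  qed
  have "\<exists>n \<le> B + 1. run M x n = (if scanned (ts' ! 0) = 2 then accept M else reject M, ts')"
    if r: "runs c (init4 x) B ts'" for x B ts'
  proof -
    define z where "z n = (sstep ^^ n) (c, init4 x)" for n
    \<comment> \<open>The first time at which the program has ended. Until then machine and program
      agree step by step, and one step later the machine halts.\<close>
    define m where "m = (LEAST n. fst (z n) = Skip)"
    have "fst (z B) = Skip" using r by (simp add: runs_def z_def)
    then have m: "fst (z m) = Skip" "m \<le> B" and
      nm: "\<And>n. n < m \<Longrightarrow> fst (z n) \<noteq> Skip"
      unfolding m_def by (auto intro: LeastI Least_le dest: not_less_Least)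
    have zS: "z (Suc n) = sstep (z n)" for n by (simp add: z_def)
    have zR: "fst (z n) \<in> ?R \<and> length (snd (z n)) = 4" for n
    proof (induction n)
      case 0 then show ?case by (simp add: z_def resid_self init4_def)
    next
      case (Suc n) then show ?case using nxtR by (auto simp: zS sstep_def)
    qed
    have zm: "snd (z m) = ts'"
    proof -
      have "z (m + k) = z m" for k
        using m(1) by (induction k) (auto simp: zS, metis prod.collapse sstep_simps(1))
      from this[of "B - m"] show ?thesis using m(2) r by (simp add: runs_def z_def)
    qed
    have run: "n \<le> m \<Longrightarrow> run M x n = (num (fst (z n)), snd (z n))" for n
    proof (induction n)
      case 0 then show ?case
        by (simp add: run_def initial_def M_def z_def init4_def)
    next
      case (Suc n)
      then have ne: "fst (z n) \<noteq> Skip" using nm by simp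
      have lt: "num (fst (z n)) < N" "dec (num (fst (z n))) = fst (z n)" using numR zR by auto
      have "run M x (Suc n) = step M (num (fst (z n)), snd (z n))"
        using Suc by (simp add: run_def)
      also have "\<dots> = (num (fst (z (Suc n))), snd (z (Suc n)))"
        using lt ne by (simp add: step_def halted_def M_def dl_def zS sstep_def)
      finally show ?case .
    qed
    have "run M x (Suc m) = step M (num Skip, ts')"
      using run[of m] m zm by (simp add: run_def)
    also have "\<dots> = (if scanned (ts' ! 0) = 2 then accept M else reject M, ts')"
    proof -
      have "num Skip < N" "dec (num Skip) = Skip" using numR Skip_resid by auto
      moreover have "length ts' = 4" using zR[of m] zm by simp
      ultimately show ?thesis
        by (simp add: step_def halted_def M_def dl_def)
    qed
    finally show ?thesis using m(2) by (intro exI[of _ "Suc m"]) auto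
  qed
  with tm show ?thesis by blast
qed

text \<open>Tapes 0, 1 and 2 hold stacks whose top is under the head; tape 3 is the output tape, on
  which one can only append. Symbol 3 serves as a delimiter on the stacks.\<close>

type_synonym store = "nat \<Rightarrow> nat list"

text \<open>Left of the head of a stack the tape is arbitrary, so popping does not erase. Beyond the
  stack it is blank, so an empty stack shows symbol 0. The head of the output tape stands just
  behind the written word.\<close>

definition rep :: "store \<Rightarrow> tape list \<Rightarrow> bool" where
  "rep s ts \<longleftrightarrow> length ts = 4 \<and>
     (\<forall>i<3. \<forall>k. snd (ts ! i) (fst (ts ! i) + int k) = (if k < length (s i) then s i ! k else 0)) \<and>
     fst (ts ! 3) = int (length (s 3)) \<and>
     (\<forall>k. snd (ts ! 3) (int k) = (if k < length (s 3) then s 3 ! k else 0))"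

definition top :: "nat list \<Rightarrow> nat" where
  "top xs = (if xs = [] then 0 else hd xs)"

lemma top_simps [simp]: "top [] = 0" "top (x # xs) = x"
  by (auto simp: top_def)

text \<open>All representing tapes are considered, since a store does not determine the cells to the
  left of the stack heads.\<close>

definition exec :: "cmd \<Rightarrow> store \<Rightarrow> nat \<Rightarrow> store \<Rightarrow> bool" where
  "exec c s B s' \<longleftrightarrow> (\<forall>ts. rep s ts \<longrightarrow> (\<exists>ts'. runs c ts B ts' \<and> rep s' ts'))"

lemma exec_mono: "exec c s B s' \<Longrightarrow> B \<le> B' \<Longrightarrow> exec c s B' s'"
  unfolding exec_def using runs_mono by blast

lemma exec_Seq: "exec c s B s' \<Longrightarrow> exec d s' B' s'' \<Longrightarrow> exec (Seq c d) s (B + B' + 1) s''"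
  unfolding exec_def using runs_Seq by blast

lemma exec_Skip: "exec Skip s 0 s"
  by (auto simp: exec_def runs_def)

lemma rep_top: "rep s ts \<Longrightarrow> i < 3 \<Longrightarrow> scanned (ts ! i) = top (s i)"
proof -
  assume "rep s ts" "i < 3"
  then have "snd (ts ! i) (fst (ts ! i) + int 0) = (if 0 < length (s i) then s i ! 0 else 0)"
    unfolding rep_def by blast
  then show ?thesis by (cases "ts ! i") (auto simp: top_def hd_conv_nth)
qed

lemma rep_length: "rep s ts \<Longrightarrow> length ts = 4"
  by (simp add: rep_def)

lemma exec_Cond:
  assumes "i < 3" "exec (if P (top (s i)) then c else d) s B s'"
  shows "exec (Cond i P c d) s (B + 1) s'"
  unfolding exec_def
proof (intro allI impI)
  fix ts assume r: "rep s ts"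
  then obtain ts' where 1: "runs (if P (top (s i)) then c else d) ts B ts'" "rep s' ts'"
    using assms(2) unfolding exec_def by blast
  have "runs (Cond i P c d) ts (Suc B) ts'"
    using 1 rep_top[OF r assms(1)] rep_length[OF r] assms(1) by (intro runs_step) simp
  then show "\<exists>ts'. runs (Cond i P c d) ts (B + 1) ts' \<and> rep s' ts'" using 1 by auto
qed

lemma exec_While_False:
  assumes "i < 3" "\<not> P (top (s i))"
  shows "exec (While i P c) s 1 s"
  unfolding exec_def
proof (intro allI impI)
  fix ts assume r: "rep s ts"
  have "runs (While i P c) ts (Suc 0) ts"
    using rep_top[OF r assms(1)] rep_length[OF r] assms by (intro runs_step) (simp add: runs_def)
  then show "\<exists>ts'. runs (While i P c) ts 1 ts' \<and> rep s ts'" using r by auto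
qed

lemma exec_While_True:
  assumes "i < 3" "P (top (s i))" "exec c s B s'" "exec (While i P c) s' B' s''"
  shows "exec (While i P c) s (B + B' + 2) s''"
  unfolding exec_def
proof (intro allI impI)
  fix ts assume r: "rep s ts"
  obtain ts' where 1: "runs (Seq c (While i P c)) ts (B + B' + 1) ts'" "rep s'' ts'"
    using exec_Seq[OF assms(3,4)] r unfolding exec_def by blast
  have "runs (While i P c) ts (Suc (B + B' + 1)) ts'"
    using 1 rep_top[OF r assms(1)] rep_length[OF r] assms(1,2) by (intro runs_step) simp
  then show "\<exists>ts'. runs (While i P c) ts (B + B' + 2) ts' \<and> rep s'' ts'" using 1 by auto
qed

section \<open>Primitive operations on stacks\<close>

definition Pop :: "nat \<Rightarrow> cmd" where
  "Pop i = Do i (\<lambda>a. (a, Move_Right))"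

text \<open>\<open>Do\<close> writes before it moves, so a push takes two actions: a move to the
  left that keeps the old symbol, then the overwriting of the new cell.\<close>

definition Push :: "nat \<Rightarrow> nat \<Rightarrow> cmd" where
  "Push i a = Seq (Do i (\<lambda>b. (b, Move_Left))) (Do i (\<lambda>_. (a, Stay)))"

definition Emit :: "nat \<Rightarrow> cmd" where
  "Emit a = Do 3 (\<lambda>_. (a, Move_Right))"

lemma wf_basic [simp]: "wf_cmd (Pop i)" "a < 4 \<Longrightarrow> wf_cmd (Push i a)" "a < 4 \<Longrightarrow> wf_cmd (Emit a)"
  by (auto simp: Pop_def Push_def Emit_def)

lemma runs_Do: "i < length ts \<Longrightarrow> runs (Do i f) ts 1 (ts[i := act (f (scanned (ts ! i))) (ts ! i)])"
  by (simp add: runs_def sstep_Do)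

lemma exec_Pop:
  assumes "i < 3"
  shows "exec (Pop i) s 1 (s(i := tl (s i)))"
  unfolding exec_def
proof (intro allI impI)
  fix ts assume r: "rep s ts"
  obtain p t where pt: "ts ! i = (p, t)" by fastforce
  have "runs (Pop i) ts 1 (ts[i := (p + 1, t)])"
    using runs_Do[of i ts "\<lambda>a. (a, Move_Right)"] assms rep_length[OF r] pt by (simp add: Pop_def)
  moreover have "rep (s(i := tl (s i))) (ts[i := (p + 1, t)])"
  proof -
    have t: "t (p + int k) = (if k < length (s i) then s i ! k else 0)" for k
      using r assms pt unfolding rep_def by (metis fst_conv snd_conv)
    have "t (p + 1 + int k) = (if k < length (tl (s i)) then tl (s i) ! k else 0)" for k
      using t[of "Suc k"] by (auto simp: nth_tl add_ac)
    then show ?thesis using r assms unfolding rep_def by (auto simp: nth_list_update)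
  qed
  ultimately show "\<exists>ts'. runs (Pop i) ts 1 ts' \<and> rep (s(i := tl (s i))) ts'" by blast
qed

lemma exec_Push:
  assumes "i < 3"
  shows "exec (Push i a) s 3 (s(i := a # s i))"
  unfolding exec_def
proof (intro allI impI)
  fix ts assume r: "rep s ts"
  obtain p t where pt: "ts ! i = (p, t)" by fastforce
  have len: "i < length ts" using rep_length[OF r] assms by simp
  have 1: "runs (Do i (\<lambda>b. (b, Move_Left))) ts 1 (ts[i := (p - 1, t)])"
    using runs_Do[OF len, of "\<lambda>a. (a, Move_Left)"] pt by simp
  have 2: "runs (Do i (\<lambda>_. (a, Stay))) (ts[i := (p - 1, t)]) 1 (ts[i := (p - 1, t(p - 1 := a))])"
    using runs_Do[of i "ts[i := (p - 1, t)]" "\<lambda>_. (a, Stay)"] len by simp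
  have "runs (Push i a) ts 3 (ts[i := (p - 1, t(p - 1 := a))])"
    using runs_Seq[OF 1 2] by (simp add: Push_def numeral_3_eq_3)
  moreover have "rep (s(i := a # s i)) (ts[i := (p - 1, t(p - 1 := a))])"
  proof -
    have t: "t (p + int k) = (if k < length (s i) then s i ! k else 0)" for k
      using r assms pt unfolding rep_def by (metis fst_conv snd_conv)
    have "(t(p - 1 := a)) (p - 1 + int k) =
        (if k < length (a # s i) then (a # s i) ! k else 0)" for k
      using t[of "k - 1"] by (cases k) (auto simp: algebra_simps)
    then show ?thesis using r assms unfolding rep_def by (auto simp: nth_list_update)
  qed
  ultimately show "\<exists>ts'. runs (Push i a) ts 3 ts' \<and> rep (s(i := a # s i)) ts'" by blast
qed

lemma exec_Emit: "exec (Emit a) s 1 (s(3 := s 3 @ [a]))"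
  unfolding exec_def
proof (intro allI impI)
  fix ts assume r: "rep s ts"
  obtain p t where pt: "ts ! 3 = (p, t)" by fastforce
  have "runs (Emit a) ts 1 (ts[3 := (p + 1, t(p := a))])"
    using runs_Do[of 3 ts "\<lambda>_. (a, Move_Right)"] rep_length[OF r] pt by (simp add: Emit_def)
  moreover have "rep (s(3 := s 3 @ [a])) (ts[3 := (p + 1, t(p := a))])"
  proof -
    have t: "t (int k) = (if k < length (s 3) then s 3 ! k else 0)" "p = int (length (s 3))" for k
      using r pt unfolding rep_def by auto
    then have "(t(p := a)) (int k) =
        (if k < length (s 3 @ [a]) then (s 3 @ [a]) ! k else 0)" for k
      by (auto simp: nth_append)
    then show ?thesis using r t(2) unfolding rep_def by (auto simp: nth_list_update)
  qed
  ultimately show "\<exists>ts'. runs (Emit a) ts 1 ts' \<and> rep (s(3 := s 3 @ [a])) ts'" by blast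
qed

lemma rep_init4:
  "rep ((\<lambda>_. [])(0 := map bit_symbol x)) (init4 x)"
  by (auto simp: rep_def init4_def input_tape_def nth_Cons' nth_replicate)

section \<open>Polynomial-time functions on binary trees\<close>

datatype tree = Leaf | Node tree tree

text \<open>Prefix notation is self-delimiting: the end of a tree on a stack is found by counting,
  without an end marker.\<close>

fun ser :: "tree \<Rightarrow> nat list" where
  "ser Leaf = [1]"
| "ser (Node a b) = 2 # ser a @ ser b"

definition tsz :: "tree \<Rightarrow> nat" where
  "tsz t = length (ser t)"

lemma tsz_simps [simp]: "tsz Leaf = 1" "tsz (Node a b) = tsz a + tsz b + 1"
  by (auto simp: tsz_def)

lemma tsz_pos [simp]: "0 < tsz t"
  by (cases t) auto

lemma set_ser: "set (ser t) \<subseteq> {1, 2}"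
  by (induction t) auto

lemma top_ser [simp]: "top (ser t @ r) = (if t = Leaf then 1 else 2)"
  by (cases t) auto

lemma exec_weaken: "exec c s B0 s0 \<Longrightarrow> B0 \<le> B \<Longrightarrow> s0 = s' \<Longrightarrow> exec c s B s'"
  using exec_mono by blast

lemma exec_CondI:
  assumes "i < 3" "P (top (s i)) \<Longrightarrow> exec c s B s'" "\<not> P (top (s i)) \<Longrightarrow> exec d s B s'"
  shows "exec (Cond i P c d) s (B + 1) s'"
  using assms by (intro exec_Cond) auto

abbreviation copy :: "nat \<Rightarrow> nat \<Rightarrow> cmd" where
  "copy i j \<equiv> Cond i (\<lambda>a. a = 2) (Seq (Pop i) (Push j 2)) (Seq (Pop i) (Push j 1))"

abbreviation copy_until :: "nat \<Rightarrow> nat \<Rightarrow> nat \<Rightarrow> cmd" where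
  "copy_until k i j \<equiv> While i (\<lambda>a. a \<noteq> k) (copy i j)"

section \<open>Moving, deleting, duplicating and swapping serialised trees\<close>

definition xfer :: "nat \<Rightarrow> nat \<Rightarrow> cmd" where
  "xfer i j = Seq (copy_until 3 i j) (Pop i)"

lemma exec_xfer_loop:
  assumes "i < 3" "j < 3" "i \<noteq> j" "set xs \<subseteq> {1, 2}" "s i = xs @ 3 # r"
  shows "exec (copy_until 3 i j) s
     (8 * length xs + 1) (s(i := 3 # r, j := rev xs @ s j))"
  using assms(4,5)
proof (induction xs arbitrary: s)
  case Nil
  then show ?case
    by (intro exec_weaken[OF exec_While_False]) (auto simp: assms fun_eq_iff)
next
  case (Cons x xs)
  have 1: "exec (copy i j) s 6
      (s(i := xs @ 3 # r, j := x # s j))"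
  proof (rule exec_weaken[OF exec_CondI[where B = 5]])
    assume "top (s i) = 2"
    then show "exec (Seq (Pop i) (Push j 2)) s 5 (s(i := xs @ 3 # r, j := x # s j))"
      using Cons.prems assms
      by (intro exec_weaken[OF exec_Seq[OF exec_Pop exec_Push]]) auto
  next
    assume "top (s i) \<noteq> 2"
    then show "exec (Seq (Pop i) (Push j 1)) s 5 (s(i := xs @ 3 # r, j := x # s j))"
      using Cons.prems assms
      by (intro exec_weaken[OF exec_Seq[OF exec_Pop exec_Push]]) auto
  qed (use assms in auto)
  have 2: "exec (copy_until 3 i j)
     (s(i := xs @ 3 # r, j := x # s j)) (8 * length xs + 1)
     (s(i := 3 # r, j := rev (x # xs) @ s j))"
    using Cons.prems assms
    by (intro exec_weaken[OF Cons.IH]) (auto simp: fun_eq_iff)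
  show ?case
    using Cons.prems assms(1)
    by (intro exec_weaken[OF exec_While_True[OF _ _ 1 2]]) auto
qed

lemma exec_xfer:
  assumes "i < 3" "j < 3" "i \<noteq> j" "set xs \<subseteq> {1, 2}" "s i = xs @ 3 # r"
  shows "exec (xfer i j) s (8 * length xs + 3) (s(i := r, j := rev xs @ s j))"
  unfolding xfer_def using assms
  by (intro exec_weaken[OF exec_Seq[OF exec_xfer_loop exec_Pop]]) (auto simp: fun_eq_iff)

text \<open>Stack 2 counts the trees that are still to be read.\<close>

definition mv_loop :: cmd where
  "mv_loop = While 2 (\<lambda>a. a = 1) (Cond 0 (\<lambda>a. a = 2)
     (Seq (Pop 0) (Seq (Push 1 2) (Push 2 1))) (Seq (Pop 0) (Seq (Push 1 1) (Pop 2))))"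

definition mv :: cmd where
  "mv = Seq (Push 1 3) (Seq (Push 2 3) (Seq (Push 2 1) (Seq mv_loop (Pop 2))))"

text \<open>Generalised from one tree to the list of trees still to be read: a \<open>Node\<close>
  replaces a pending tree by its two subtrees, a \<open>Leaf\<close> removes one. The induction is
  on the number of symbols left.\<close>

lemma exec_mv_loop:
  assumes "s 0 = concat (map ser ts) @ r" "s 2 = replicate (length ts) 1 @ 3 # z"
  shows "exec mv_loop s (12 * length (concat (map ser ts)) + 1)
    (s(0 := r, 1 := rev (concat (map ser ts)) @ s 1, 2 := 3 # z))"
  using assms
proof (induction "length (concat (map ser ts))" arbitrary: s ts rule: less_induct)
  case less
  show ?case
  proof (cases ts)
    case Nil
    then show ?thesis using less.prems unfolding mv_loop_def
      by (intro exec_weaken[OF exec_While_False]) (auto simp: fun_eq_iff)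
  next
    case (Cons t ts')
    let ?body = "Cond 0 (\<lambda>a. a = 2)
     (Seq (Pop 0) (Seq (Push 1 2) (Push 2 1))) (Seq (Pop 0) (Seq (Push 1 1) (Pop 2)))"
    define us where "us = (case t of Leaf \<Rightarrow> ts' | Node a b \<Rightarrow> a # b # ts')"
    define x :: nat where "x = (case t of Leaf \<Rightarrow> 1 | Node a b \<Rightarrow> 2)"
    define s1 where "s1 = s(0 := concat (map ser us) @ r, 1 := x # s 1,
      2 := replicate (length us) 1 @ 3 # z)"
    have ser: "concat (map ser ts) = x # concat (map ser us)"
      by (cases t) (auto simp: Cons us_def x_def)
    have 1: "exec ?body s 10 s1"
    proof (rule exec_weaken[OF exec_CondI[where B = 9]])
      assume "top (s 0) = 2"
      then obtain a b where "t = Node a b" using less.prems Cons by (cases t) auto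
      then show "exec (Seq (Pop 0) (Seq (Push 1 2) (Push 2 1))) s 9 s1"
        using less.prems Cons
        by (intro exec_weaken[OF exec_Seq[OF exec_Pop exec_Seq[OF exec_Push exec_Push]]])
          (auto simp: s1_def us_def x_def fun_eq_iff)
    next
      assume "top (s 0) \<noteq> 2"
      then have "t = Leaf" using less.prems Cons by (cases t) auto
      then show "exec (Seq (Pop 0) (Seq (Push 1 1) (Pop 2))) s 9 s1"
        using less.prems Cons
        by (intro exec_weaken[OF exec_Seq[OF exec_Pop exec_Seq[OF exec_Push exec_Pop]]])
          (auto simp: s1_def us_def x_def fun_eq_iff)
    qed auto
    have 2: "exec mv_loop s1 (12 * length (concat (map ser us)) + 1)
      (s1(0 := r, 1 := rev (concat (map ser us)) @ s1 1, 2 := 3 # z))"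
      by (rule less.hyps) (auto simp: s1_def ser)
    show ?thesis
      using less.prems Cons ser unfolding mv_loop_def
      by (intro exec_weaken[OF exec_While_True[OF _ _ 1 2[unfolded mv_loop_def]]]) (auto simp: s1_def fun_eq_iff)
  qed
qed

lemma exec_mv:
  assumes "s 0 = ser t @ r"
  shows "exec mv s (12 * tsz t + 15) (s(0 := r, 1 := rev (ser t) @ 3 # s 1))"
proof -
  have "exec mv_loop (s(1 := 3 # s 1, 2 := 1 # 3 # s 2)) (12 * tsz t + 1)
    (s(0 := r, 1 := rev (ser t) @ 3 # s 1, 2 := 3 # s 2))"
    using assms
    by (intro exec_weaken[OF exec_mv_loop[where ts = "[t]" and r = r and z = "s 2"]])
      (auto simp: tsz_def fun_eq_iff)
  then have "exec (Seq mv_loop (Pop 2)) (s(1 := 3 # s 1, 2 := 1 # 3 # s 2)) (12 * tsz t + 3)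
    (s(0 := r, 1 := rev (ser t) @ 3 # s 1))"
    by (intro exec_weaken[OF exec_Seq[OF _ exec_Pop]]) (auto simp: fun_eq_iff)
  moreover have "(s(1 := 3 # s 1, 2 := 1 # 3 # s 2)) =
    ((s(1 := 3 # s 1))(2 := 3 # (s(1 := 3 # s 1)) 2))(2 := 1 #
       ((s(1 := 3 # s 1))(2 := 3 # (s(1 := 3 # s 1)) 2)) 2)"
    by (auto simp: fun_eq_iff)
  ultimately show ?thesis unfolding mv_def
    by (intro exec_weaken[OF exec_Seq[OF exec_Push exec_Seq[OF exec_Push exec_Seq[OF exec_Push]]]])
      auto
qed

definition drop_tree :: cmd where
  "drop_tree = Seq mv (Seq (While 1 (\<lambda>a. a \<noteq> 3) (Pop 1)) (Pop 1))"

lemma exec_drop_loop: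
  assumes "s 1 = xs @ 3 # r" "3 \<notin> set xs"
  shows "exec (While 1 (\<lambda>a. a \<noteq> 3) (Pop 1)) s (3 * length xs + 1) (s(1 := 3 # r))"
  using assms
proof (induction xs arbitrary: s)
  case Nil
  then show ?case
    by (intro exec_weaken[OF exec_While_False]) (auto simp: fun_eq_iff)
next
  case (Cons x xs)
  then have 1: "exec (While 1 (\<lambda>a. a \<noteq> 3) (Pop 1)) (s(1 := xs @ 3 # r)) (3 * length xs + 1)
    (s(1 := 3 # r))"
    by (intro exec_weaken[OF Cons.IH]) auto
  have 2: "exec (Pop 1) s 1 (s(1 := xs @ 3 # r))"
    using Cons.prems by (intro exec_weaken[OF exec_Pop]) auto
  show ?case using Cons.prems
    by (intro exec_weaken[OF exec_While_True[OF _ _ 2 1]]) auto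
qed

lemma exec_drop:
  assumes "s 0 = ser t @ r"
  shows "exec drop_tree s (15 * tsz t + 19) (s(0 := r))"
proof -
  have "3 \<notin> set (rev (ser t))" using set_ser[of t] by auto
  then have "exec (Seq (While 1 (\<lambda>a. a \<noteq> 3) (Pop 1)) (Pop 1))
      (s(0 := r, 1 := rev (ser t) @ 3 # s 1)) (3 * tsz t + 3) (s(0 := r))"
    by (intro exec_weaken[OF exec_Seq[OF exec_drop_loop[where xs = "rev (ser t)" and r = "s 1"] exec_Pop]])
      (auto simp: tsz_def fun_eq_iff)
  then show ?thesis unfolding drop_tree_def using assms
    by (intro exec_weaken[OF exec_Seq[OF exec_mv[of s t r]]]) auto
qed

abbreviation dup_symbol :: cmd where
  "dup_symbol \<equiv> Cond 1 (\<lambda>a. a = 2) (Seq (Pop 1) (Seq (Push 0 2) (Push 2 2)))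
     (Seq (Pop 1) (Seq (Push 0 1) (Push 2 1)))"

abbreviation dup_symbols :: cmd where
  "dup_symbols \<equiv> While 1 (\<lambda>a. a \<noteq> 3) dup_symbol"

text \<open>The reversed tree on stack 1 is popped onto stacks 0 and 2 simultaneously, which turns
  both copies the right way round; the copy on stack 2 is then reversed twice on its way to stack
  0.\<close>

definition dup_tree :: cmd where
  "dup_tree = Seq mv (Seq (Push 2 3) (Seq dup_symbols
     (Seq (Pop 1) (Seq (Push 1 3) (Seq (xfer 2 1) (xfer 1 0))))))"

lemma exec_dup_loop:
  assumes "set xs \<subseteq> {1, 2}" "s 1 = xs @ 3 # r"
  shows "exec dup_symbols s
     (12 * length xs + 1) (s(0 := rev xs @ s 0, 1 := 3 # r, 2 := rev xs @ s 2))"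
  using assms
proof (induction xs arbitrary: s)
  case Nil
  then show ?case
    by (intro exec_weaken[OF exec_While_False]) (auto simp: fun_eq_iff)
next
  case (Cons x xs)
  let ?s = "s(0 := x # s 0, 1 := xs @ 3 # r, 2 := x # s 2)"
  have 1: "exec dup_symbol s 10 ?s"
  proof (rule exec_weaken[OF exec_CondI[where B = 9]])
    assume "top (s 1) = 2"
    then show "exec (Seq (Pop 1) (Seq (Push 0 2) (Push 2 2))) s 9 ?s"
      using Cons.prems
      by (intro exec_weaken[OF exec_Seq[OF exec_Pop exec_Seq[OF exec_Push exec_Push]]])
        (auto simp: fun_eq_iff)
  next
    assume "top (s 1) \<noteq> 2"
    then show "exec (Seq (Pop 1) (Seq (Push 0 1) (Push 2 1))) s 9 ?s"
      using Cons.prems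
      by (intro exec_weaken[OF exec_Seq[OF exec_Pop exec_Seq[OF exec_Push exec_Push]]])
        (auto simp: fun_eq_iff)
  qed auto
  have 2: "exec dup_symbols ?s (12 * length xs + 1)
     (s(0 := rev (x # xs) @ s 0, 1 := 3 # r, 2 := rev (x # xs) @ s 2))"
    using Cons.prems by (intro exec_weaken[OF Cons.IH]) (auto simp: fun_eq_iff)
  show ?case
    using Cons.prems
    by (intro exec_weaken[OF exec_While_True[OF _ _ 1 2]]) auto
qed

lemma exec_dup:
  assumes "s 0 = ser t @ r"
  shows "exec dup_tree s (40 * tsz t + 40) (s(0 := ser t @ ser t @ r))"
proof -
  let ?x = "rev (ser t)"
  have x: "set ?x \<subseteq> {1, 2}" using set_ser by auto
  have l: "length ?x = tsz t" by (simp add: tsz_def)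
  have 4: "exec (Seq (Pop 1) (Seq (Push 1 3) (Seq (xfer 2 1) (xfer 1 0))))
      (s(0 := ser t @ r, 1 := 3 # s 1, 2 := ser t @ 3 # s 2)) (16 * tsz t + 13)
      (s(0 := ser t @ ser t @ r))"
    using x l set_ser
    by (intro exec_weaken[OF exec_Seq[OF exec_Pop exec_Seq[OF exec_Push exec_Seq[OF
       exec_xfer[where xs = "ser t" and r = "s 2"] exec_xfer[where xs = "?x" and r = "s 1"]]]]])
      (auto simp: fun_eq_iff tsz_def)
  have 3: "exec dup_symbols
     (s(0 := r, 1 := ?x @ 3 # s 1, 2 := 3 # s 2)) (12 * tsz t + 1)
     (s(0 := ser t @ r, 1 := 3 # s 1, 2 := ser t @ 3 # s 2))"
    using x l by (intro exec_weaken[OF exec_dup_loop[where xs = ?x and r = "s 1"]]) (auto simp: fun_eq_iff)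
  have 2: "exec (Push 2 3) (s(0 := r, 1 := ?x @ 3 # s 1)) 3
     (s(0 := r, 1 := ?x @ 3 # s 1, 2 := 3 # s 2))"
    by (intro exec_weaken[OF exec_Push]) (auto simp: fun_eq_iff)
  show ?thesis unfolding dup_tree_def
    by (rule exec_weaken[OF exec_Seq[OF exec_mv[of s t r, OF assms] exec_Seq[OF 2 exec_Seq[OF 3 4]]]])
      auto
qed

text \<open>Every transfer reverses a word. The first tree returns to stack 0 after two transfers;
  the second has to wait on stack 2 meanwhile and comes back through stack 1, after four.\<close>

definition swap_tree :: cmd where
  "swap_tree = Seq mv (Seq mv (Seq (Push 2 3) (Seq (xfer 1 2) (Seq (xfer 1 0)
     (Seq (Push 1 3) (Seq (xfer 2 1) (xfer 1 0)))))))"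

lemma exec_swap:
  assumes "s 0 = ser a @ ser b @ r"
  shows "exec swap_tree s (40 * (tsz a + tsz b) + 60) (s(0 := ser b @ ser a @ r))"
proof -
  let ?a = "rev (ser a)" let ?b = "rev (ser b)"
  have 1: "exec mv s (12 * tsz a + 15) (s(0 := ser b @ r, 1 := ?a @ 3 # s 1))"
    by (rule exec_mv) (simp add: assms)
  have 2: "exec mv (s(0 := ser b @ r, 1 := ?a @ 3 # s 1)) (12 * tsz b + 15)
     (s(0 := r, 1 := ?b @ 3 # ?a @ 3 # s 1))"
    by (rule exec_weaken[OF exec_mv]) (auto simp: fun_eq_iff)
  have 3: "exec (Push 2 3) (s(0 := r, 1 := ?b @ 3 # ?a @ 3 # s 1)) 3
     (s(0 := r, 1 := ?b @ 3 # ?a @ 3 # s 1, 2 := 3 # s 2))"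
    by (intro exec_weaken[OF exec_Push]) (auto simp: fun_eq_iff)
  have 4: "exec (xfer 1 2) (s(0 := r, 1 := ?b @ 3 # ?a @ 3 # s 1, 2 := 3 # s 2))
     (8 * tsz b + 3) (s(0 := r, 1 := ?a @ 3 # s 1, 2 := ser b @ 3 # s 2))"
    using set_ser by (intro exec_weaken[OF exec_xfer[where xs = ?b and r = "?a @ 3 # s 1"]])
      (auto simp: fun_eq_iff tsz_def)
  have 5: "exec (xfer 1 0) (s(0 := r, 1 := ?a @ 3 # s 1, 2 := ser b @ 3 # s 2))
     (8 * tsz a + 3) (s(0 := ser a @ r, 2 := ser b @ 3 # s 2))"
    using set_ser by (intro exec_weaken[OF exec_xfer[where xs = ?a and r = "s 1"]])
      (auto simp: fun_eq_iff tsz_def)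
  have 6: "exec (Push 1 3) (s(0 := ser a @ r, 2 := ser b @ 3 # s 2)) 3
     (s(0 := ser a @ r, 1 := 3 # s 1, 2 := ser b @ 3 # s 2))"
    by (intro exec_weaken[OF exec_Push]) (auto simp: fun_eq_iff)
  have 7: "exec (xfer 2 1) (s(0 := ser a @ r, 1 := 3 # s 1, 2 := ser b @ 3 # s 2))
     (8 * tsz b + 3) (s(0 := ser a @ r, 1 := ?b @ 3 # s 1))"
    using set_ser by (intro exec_weaken[OF exec_xfer[where xs = "ser b" and r = "s 2"]])
      (auto simp: fun_eq_iff tsz_def)
  have 8: "exec (xfer 1 0) (s(0 := ser a @ r, 1 := ?b @ 3 # s 1))
     (8 * tsz b + 3) (s(0 := ser b @ ser a @ r))"
    using set_ser by (intro exec_weaken[OF exec_xfer[where xs = ?b and r = "s 1"]])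
      (auto simp: fun_eq_iff tsz_def)
  show ?thesis unfolding swap_tree_def
    by (rule exec_weaken[OF exec_Seq[OF 1 exec_Seq[OF 2 exec_Seq[OF 3 exec_Seq[OF 4 exec_Seq[OF 5
      exec_Seq[OF 6 exec_Seq[OF 7 8]]]]]]]]) auto
qed

lemma wf_tree_cmds [simp]:
  "wf_cmd mv" "wf_cmd drop_tree" "wf_cmd dup_tree" "wf_cmd swap_tree" "wf_cmd (xfer i j)"
  by (auto simp: mv_def mv_loop_def drop_tree_def dup_tree_def swap_tree_def xfer_def)

subsection \<open>Polynomial bounds\<close>

text \<open>Bounds are functions majorised by a polynomial, so that no polynomial has to be written
  out. Composition works because polynomials over the naturals are monotone.\<close>

definition pbd :: "(nat \<Rightarrow> nat) \<Rightarrow> bool" where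
  "pbd b \<longleftrightarrow> (\<exists>p :: nat poly. \<forall>n. b n \<le> poly p n)"

lemma poly_nat_mono: "m \<le> n \<Longrightarrow> poly (p :: nat poly) m \<le> poly p n"
  by (induction p) (auto intro: mult_le_mono)

lemma pbd_const: "pbd (\<lambda>n. k)"
  unfolding pbd_def by (intro exI[of _ "[:k:]"]) auto

lemma pbd_id: "pbd (\<lambda>n. n)"
  unfolding pbd_def by (intro exI[of _ "[:0, 1:]"]) auto

lemma pbd_poly: "pbd (poly p)"
  unfolding pbd_def by blast

lemma pbd_add: "pbd f \<Longrightarrow> pbd g \<Longrightarrow> pbd (\<lambda>n. f n + g n)"
  unfolding pbd_def by (metis add_mono poly_add)

lemma pbd_mult: "pbd f \<Longrightarrow> pbd g \<Longrightarrow> pbd (\<lambda>n. f n * g n)"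
  unfolding pbd_def by (metis mult_le_mono poly_mult)

lemma pbd_comp: "pbd f \<Longrightarrow> pbd g \<Longrightarrow> pbd (\<lambda>n. f (g n))"
  unfolding pbd_def by (metis poly_pcompose poly_nat_mono order_trans)

lemma pbd_Suc: "pbd f \<Longrightarrow> pbd (\<lambda>n. Suc (f n))"
  using pbd_add[OF _ pbd_const[of 1]] by simp

lemma pbd_power: "pbd f \<Longrightarrow> pbd (\<lambda>n. f n ^ k)"
  by (induction k) (auto intro: pbd_const pbd_mult)

lemma pbd_polyf: "pbd g \<Longrightarrow> pbd (\<lambda>n. poly p (g n))"
  by (rule pbd_comp[OF pbd_poly])

lemmas pbd_intros = pbd_const pbd_id pbd_Suc pbd_add pbd_mult pbd_power pbd_polyf

text \<open>Inputs are indexed by an arbitrary type: the program sees only the tree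
  \<open>D t\<close>, while \<open>F\<close> is stated on indices, which may carry invariants or a
  hidden counter. The rest of the stack and the other stacks are restored, so programs compose; the
  output size is bounded as well because the time of the next program depends on it.\<close>

definition implements :: "cmd \<Rightarrow> nat poly \<Rightarrow> ('a \<Rightarrow> tree) \<Rightarrow> ('a \<Rightarrow> tree) \<Rightarrow> bool" where
  "implements c p D F \<longleftrightarrow> wf_cmd c \<and> (\<forall>t. tsz (F t) \<le> poly p (tsz (D t)) \<and>
     (\<forall>r s. s 0 = ser (D t) @ r \<longrightarrow> exec c s (poly p (tsz (D t))) (s(0 := ser (F t) @ r))))"

definition PT :: "('a \<Rightarrow> tree) \<Rightarrow> ('a \<Rightarrow> tree) \<Rightarrow> bool" where
  "PT D F \<longleftrightarrow> (\<exists>c p. implements c p D F)"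

lemma PTI:
  assumes "wf_cmd c" "pbd b" "\<And>t. tsz (F t) \<le> b (tsz (D t))"
    "\<And>t r s. s 0 = ser (D t) @ r \<Longrightarrow> exec c s (b (tsz (D t))) (s(0 := ser (F t) @ r))"
  shows "PT D F"
proof -
  obtain p :: "nat poly" where "\<And>n. b n \<le> poly p n" using assms(2) unfolding pbd_def by blast
  then show ?thesis unfolding PT_def implements_def using assms(1,3,4)
    by (intro exI[of _ c] exI[of _ p]) (meson exec_mono order_trans)
qed

lemma implementsD:
  assumes "implements c p D F"
  shows "wf_cmd c" "tsz (F t) \<le> poly p (tsz (D t))"
    "s 0 = ser (D t) @ r \<Longrightarrow> exec c s (poly p (tsz (D t))) (s(0 := ser (F t) @ r))"
  using assms unfolding implements_def by blast+

section \<open>Closure properties of the polynomial-time functions on trees\<close>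

lemma PT_id: "PT D D"
  by (rule PTI[where c = Skip and b = "\<lambda>n. n"]) (auto intro!: pbd_intros exec_weaken[OF exec_Skip])

fun pushes :: "nat list \<Rightarrow> cmd" where
  "pushes [] = Skip"
| "pushes (x # xs) = Seq (pushes xs) (Push 0 x)"

lemma exec_pushes: "exec (pushes xs) s (4 * length xs) (s(0 := xs @ s 0))"
proof (induction xs)
  case Nil
  show ?case by (auto intro: exec_weaken[OF exec_Skip])
next
  case (Cons x xs)
  show ?case unfolding pushes.simps by (rule exec_weaken[OF exec_Seq[OF Cons exec_Push]]) auto
qed

lemma PT_const: "PT D (\<lambda>t. k)"
proof (rule PTI[where c = "Seq drop_tree (pushes (ser k))" and b = "\<lambda>n. 15 * n + 20 + 4 * tsz k"])
  have "set xs \<subseteq> {1,2} \<Longrightarrow> wf_cmd (pushes xs)" for xs by (induction xs) auto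
  then show "wf_cmd (Seq drop_tree (pushes (ser k)))" using set_ser by simp
  show "pbd (\<lambda>n. 15 * n + 20 + 4 * tsz k)" by (intro pbd_intros)
  show "exec (Seq drop_tree (pushes (ser k))) s (15 * tsz (D t) + 20 + 4 * tsz k) (s(0 := ser k @ r))"
    if "s 0 = ser (D t) @ r" for t r s
    by (rule exec_weaken[OF exec_Seq[OF exec_drop[of s "D t" r, OF that] exec_pushes]]) (auto simp: tsz_def)
qed auto

lemma PT_comp:
  assumes "PT G F" "PT D G" shows "PT D F"
proof -
  obtain c p where "implements c p G F" using assms(1) unfolding PT_def by blast
  note c = implementsD[OF this]
  obtain d q where "implements d q D G" using assms(2) unfolding PT_def by blast
  note d = implementsD[OF this]
  have m: "poly p (tsz (G t)) \<le> poly p (poly q (tsz (D t)))" for t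
    using d(2) poly_nat_mono by blast
  show ?thesis
  proof (rule PTI[where c = "Seq d c" and b = "\<lambda>n. poly q n + poly p (poly q n) + 1"])
    show "exec (Seq d c) s (poly q (tsz (D t)) + poly p (poly q (tsz (D t))) + 1) (s(0 := ser (F t) @ r))"
      if "s 0 = ser (D t) @ r" for t r s
      by (rule exec_weaken[OF exec_Seq[OF d(3)[of s t r, OF that] c(3)[where t = t and r = r]]]) (use m in auto)
    show "tsz (F t) \<le> poly q (tsz (D t)) + poly p (poly q (tsz (D t))) + 1" for t
      using c(2)[of t] m[of t] by simp
  qed (use c d in \<open>auto intro!: pbd_intros\<close>)
qed

text \<open>The input is duplicated, \<open>G\<close> is computed on the upper copy and swapped
  below the other, on which \<open>F\<close> is then computed. The symbol 2 pushed last joins the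
  two results.\<close>

lemma PT_Node:
  assumes "PT D F" "PT D G" shows "PT D (\<lambda>t. Node (F t) (G t))"
proof -
  obtain c p where "implements c p D F" using assms(1) unfolding PT_def by blast
  note c = implementsD[OF this]
  obtain d q where "implements d q D G" using assms(2) unfolding PT_def by blast
  note d = implementsD[OF this]
  let ?b = "\<lambda>n. 40 * n + 40 + poly q n + 40 * (poly q n + n) + 60 + poly p n + 7"
  show ?thesis
  proof (rule PTI[where c = "Seq dup_tree (Seq d (Seq swap_tree (Seq c (Push 0 2))))" and b = ?b])
    fix t r and s :: store assume s: "s 0 = ser (D t) @ r"
    have 1: "exec dup_tree s (40 * tsz (D t) + 40) (s(0 := ser (D t) @ ser (D t) @ r))"
      by (rule exec_dup[of s "D t" r, OF s])
    have 2: "exec d (s(0 := ser (D t) @ ser (D t) @ r)) (poly q (tsz (D t))) (s(0 := ser (G t) @ ser (D t) @ r))"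
      by (rule exec_weaken[OF d(3)]) auto
    have 3: "exec swap_tree (s(0 := ser (G t) @ ser (D t) @ r)) (40 * (poly q (tsz (D t)) + tsz (D t)) + 60)
      (s(0 := ser (D t) @ ser (G t) @ r))"
      by (rule exec_weaken[OF exec_swap]) (use d(2)[of t] in auto)
    have 4: "exec c (s(0 := ser (D t) @ ser (G t) @ r)) (poly p (tsz (D t))) (s(0 := ser (F t) @ ser (G t) @ r))"
      by (rule exec_weaken[OF c(3)]) auto
    have 5: "exec (Push 0 2) (s(0 := ser (F t) @ ser (G t) @ r)) 3 (s(0 := ser (Node (F t) (G t)) @ r))"
      by (rule exec_weaken[OF exec_Push]) auto
    show "exec (Seq dup_tree (Seq d (Seq swap_tree (Seq c (Push 0 2))))) s (?b (tsz (D t)))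
      (s(0 := ser (Node (F t) (G t)) @ r))"
      by (rule exec_weaken[OF exec_Seq[OF 1 exec_Seq[OF 2 exec_Seq[OF 3 exec_Seq[OF 4 5]]]]]) auto
  next
    show "tsz (Node (F t) (G t)) \<le> ?b (tsz (D t))" for t
      using c(2)[of t] d(2)[of t] by simp
  qed (use c d in \<open>auto intro!: pbd_intros\<close>)
qed

fun lft :: "tree \<Rightarrow> tree" where
  "lft Leaf = Leaf" | "lft (Node a b) = a"

fun rgt :: "tree \<Rightarrow> tree" where
  "rgt Leaf = Leaf" | "rgt (Node a b) = b"

lemma PT_lft: "PT D (\<lambda>t. lft (D t))"
proof (rule PTI[where c = "Cond 0 (\<lambda>a. a = 2) (Seq (Pop 0) (Seq swap_tree drop_tree)) Skip"
      and b = "\<lambda>n. 60 * n + 100"])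
  fix t r and s :: store assume s: "s 0 = ser (D t) @ r"
  show "exec (Cond 0 (\<lambda>a. a = 2) (Seq (Pop 0) (Seq swap_tree drop_tree)) Skip) s (60 * tsz (D t) + 100)
      (s(0 := ser (lft (D t)) @ r))"
  proof (cases "D t")
    case Leaf
    then show ?thesis using s
      by (intro exec_weaken[OF exec_Cond[where B = 0 and s' = s]]) (auto intro: exec_Skip)
  next
    case (Node a b)
    have 1: "exec (Pop 0) s 1 (s(0 := ser a @ ser b @ r))"
      using s Node by (intro exec_weaken[OF exec_Pop]) auto
    have 2: "exec swap_tree (s(0 := ser a @ ser b @ r)) (40 * (tsz a + tsz b) + 60)
        (s(0 := ser b @ ser a @ r))"
      by (intro exec_weaken[OF exec_swap]) auto
    have 3: "exec drop_tree (s(0 := ser b @ ser a @ r)) (15 * tsz b + 19) (s(0 := ser a @ r))"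
      by (intro exec_weaken[OF exec_drop]) auto
    show ?thesis
      by (rule exec_weaken[OF exec_Cond])
        (use s Node exec_Seq[OF 1 exec_Seq[OF 2 3]] in auto)
  qed
next
  show "tsz (lft (D t)) \<le> 60 * tsz (D t) + 100" for t by (cases "D t") auto
qed (auto intro!: pbd_intros)

lemma PT_rgt: "PT D (\<lambda>t. rgt (D t))"
proof (rule PTI[where c = "Cond 0 (\<lambda>a. a = 2) (Seq (Pop 0) drop_tree) Skip"
      and b = "\<lambda>n. 60 * n + 100"])
  fix t r and s :: store assume s: "s 0 = ser (D t) @ r"
  show "exec (Cond 0 (\<lambda>a. a = 2) (Seq (Pop 0) drop_tree) Skip) s (60 * tsz (D t) + 100)
      (s(0 := ser (rgt (D t)) @ r))"
  proof (cases "D t")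
    case Leaf
    then show ?thesis using s
      by (intro exec_weaken[OF exec_Cond[where B = 0 and s' = s]]) (auto intro: exec_Skip)
  next
    case (Node a b)
    have 1: "exec (Pop 0) s 1 (s(0 := ser a @ ser b @ r))"
      using s Node by (intro exec_weaken[OF exec_Pop]) auto
    have 3: "exec drop_tree (s(0 := ser a @ ser b @ r)) (15 * tsz a + 19) (s(0 := ser b @ r))"
      by (intro exec_weaken[OF exec_drop]) auto
    show ?thesis
      by (rule exec_weaken[OF exec_Cond])
        (use s Node exec_Seq[OF 1 3] in auto)
  qed
next
  show "tsz (rgt (D t)) \<le> 60 * tsz (D t) + 100" for t by (cases "D t") auto
qed (auto intro!: pbd_intros)

lemma PT_if:
  assumes "PT D B" "PT D F" "PT D G" shows "PT D (\<lambda>t. if B t = Leaf then G t else F t)"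
proof -
  obtain e u where "implements e u D B" using assms(1) unfolding PT_def by blast
  note e = implementsD[OF this]
  obtain c p where "implements c p D F" using assms(2) unfolding PT_def by blast
  note c = implementsD[OF this]
  obtain d q where "implements d q D G" using assms(3) unfolding PT_def by blast
  note d = implementsD[OF this]
  let ?b = "\<lambda>n. 40 * n + 40 + poly u n + 15 * poly u n + poly p n + poly q n + 25"
  let ?c = "Seq dup_tree (Seq e (Cond 0 (\<lambda>a. a = 2) (Seq drop_tree c) (Seq drop_tree d)))"
  show ?thesis
  proof (rule PTI[where c = ?c and b = ?b])
    fix t r and s :: store assume s: "s 0 = ser (D t) @ r"
    let ?F = "if B t = Leaf then G t else F t"
    have 1: "exec dup_tree s (40 * tsz (D t) + 40) (s(0 := ser (D t) @ ser (D t) @ r))"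
      by (rule exec_dup[of s "D t" r, OF s])
    have 2: "exec e (s(0 := ser (D t) @ ser (D t) @ r)) (poly u (tsz (D t))) (s(0 := ser (B t) @ ser (D t) @ r))"
      by (rule exec_weaken[OF e(3)]) auto
    have 3: "exec drop_tree (s(0 := ser (B t) @ ser (D t) @ r)) (15 * poly u (tsz (D t)) + 19) (s(0 := ser (D t) @ r))"
      by (rule exec_weaken[OF exec_drop]) (use e(2)[of t] in auto)
    have 4: "exec (if B t = Leaf then d else c) (s(0 := ser (D t) @ r)) (poly p (tsz (D t)) + poly q (tsz (D t)))
      (s(0 := ser ?F @ r))"
      by (cases "B t = Leaf") (auto intro: exec_weaken[OF c(3)] exec_weaken[OF d(3)])
    have 5: "exec (Cond 0 (\<lambda>a. a = 2) (Seq drop_tree c) (Seq drop_tree d)) (s(0 := ser (B t) @ ser (D t) @ r))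
      (15 * poly u (tsz (D t)) + 19 + (poly p (tsz (D t)) + poly q (tsz (D t))) + 1 + 1) (s(0 := ser ?F @ r))"
      by (rule exec_Cond) (use exec_Seq[OF 3 4] in \<open>auto split: if_splits\<close>)
    show "exec ?c s (?b (tsz (D t))) (s(0 := ser ?F @ r))"
      by (rule exec_weaken[OF exec_Seq[OF 1 exec_Seq[OF 2 5]]]) auto
  next
    show "tsz (if B t = Leaf then G t else F t) \<le> ?b (tsz (D t))" for t
      using c(2)[of t] d(2)[of t] by simp
  qed (use c d e in \<open>auto intro!: pbd_intros\<close>)
qed

text \<open>The loop tests a value of \<open>B\<close> that is computed on a copy of the current
  tree and lies on top of it. Besides the number of iterations, the sizes of all intermediate trees
  must be bounded, as otherwise the cost of an iteration could double each time.\<close>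

lemma PT_while:
  assumes "PT D B" "PT D (\<lambda>t. D (F t))" "pbd b"
    and H: "\<And>t. \<exists>n \<le> b (tsz (D t)). (\<forall>i<n. B ((F ^^ i) t) \<noteq> Leaf) \<and> B ((F ^^ n) t) = Leaf \<and>
      (\<forall>i\<le>n. tsz (D ((F ^^ i) t)) \<le> b (tsz (D t))) \<and> H t = (F ^^ n) t"
  shows "PT D (\<lambda>t. D (H t))"
proof -
  obtain e u where "implements e u D B" using assms(1) unfolding PT_def by blast
  note e = implementsD[OF this]
  obtain c p where "implements c p D (\<lambda>t. D (F t))" using assms(2) unfolding PT_def by blast
  note c = implementsD[OF this]
  obtain q where q: "\<And>n. b n \<le> poly q n" using assms(3) unfolding pbd_def by blast
  \<comment> \<open>Cost of one iteration on trees of size at most \<open>m\<close>: dropping the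
    old test value, running the body, duplicating the result and testing it.\<close>
  define C where "C m = 40 * m + 16 * poly u m + poly p m + 70" for m
  define W where "W = While 0 (\<lambda>a. a = 2) (Seq drop_tree (Seq c (Seq dup_tree e)))"
  have Cm: "C m \<le> C m'" if "m \<le> m'" for m m'
    using that poly_nat_mono[OF that, of u] poly_nat_mono[OF that, of p] by (simp add: C_def)
  have test: "exec (Seq dup_tree e) s (40 * m + 41 + poly u m) (s(0 := ser (B t) @ ser (D t) @ r))"
    if "s 0 = ser (D t) @ r" "tsz (D t) \<le> m" for s t r m
  proof -
    have 2: "exec e (s(0 := ser (D t) @ ser (D t) @ r)) (poly u (tsz (D t))) (s(0 := ser (B t) @ ser (D t) @ r))"
      by (rule exec_weaken[OF e(3)]) auto
    show ?thesis
      by (rule exec_weaken[OF exec_Seq[OF exec_dup[of s "D t" r, OF that(1)] 2]])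
        (use poly_nat_mono[OF that(2), of u] that(2) in auto)
  qed
  have loop: "exec W (s(0 := ser (B t) @ ser (D t) @ r)) (n * C m + 1)
      (s(0 := ser Leaf @ ser (D ((F ^^ n) t)) @ r))"
    if "\<forall>i<n. B ((F ^^ i) t) \<noteq> Leaf" "B ((F ^^ n) t) = Leaf" "\<forall>i\<le>n. tsz (D ((F ^^ i) t)) \<le> m"
    for s :: store and t r n m
    using that
  proof (induction n arbitrary: t)
    case 0
    then show ?case unfolding W_def
      by (intro exec_weaken[OF exec_While_False]) auto
  next
    case (Suc n)
    let ?s0 = "s(0 := ser (B t) @ ser (D t) @ r)"
    have tm: "tsz (D t) \<le> m" "tsz (D (F t)) \<le> m" using Suc.prems(3)[rule_format, of 0] Suc.prems(3)[rule_format, of 1] by auto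
    have nl: "B t \<noteq> Leaf" using Suc.prems(1)[rule_format, of 0] by simp
    have 1: "exec drop_tree ?s0 (15 * poly u m + 19) (s(0 := ser (D t) @ r))"
      by (rule exec_weaken[OF exec_drop]) (use e(2)[of t] poly_nat_mono[OF tm(1), of u] in auto)
    have 2: "exec c (s(0 := ser (D t) @ r)) (poly p m) (s(0 := ser (D (F t)) @ r))"
      by (rule exec_weaken[OF c(3)]) (use poly_nat_mono[OF tm(1), of p] in auto)
    have 3: "exec (Seq dup_tree e) (s(0 := ser (D (F t)) @ r)) (40 * m + 41 + poly u m)
        (s(0 := ser (B (F t)) @ ser (D (F t)) @ r))"
      by (rule exec_weaken[OF test[where t = "F t" and r = r, OF _ tm(2)]]) auto
    have 4: "exec W (s(0 := ser (B (F t)) @ ser (D (F t)) @ r)) (n * C m + 1)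
        (s(0 := ser Leaf @ ser (D ((F ^^ n) (F t))) @ r))"
    proof (rule Suc.IH)
      have sh: "(F ^^ i) (F t) = (F ^^ Suc i) t" for i by (simp add: funpow_swap1)
      show "\<forall>i<n. B ((F ^^ i) (F t)) \<noteq> Leaf" "B ((F ^^ n) (F t)) = Leaf"
        "\<forall>i\<le>n. tsz (D ((F ^^ i) (F t))) \<le> m"
        unfolding sh using Suc.prems by (blast intro: Suc_mono Suc_le_mono[THEN iffD2])+
    qed
    have 5: "exec W ?s0 (15 * poly u m + 19 + (poly p m + (40 * m + 41 + poly u m) + 1) + 1 +
        (n * C m + 1) + 2) (s(0 := ser Leaf @ ser (D ((F ^^ n) (F t))) @ r))"
      unfolding W_def
      by (rule exec_While_True[OF _ _ exec_Seq[OF 1 exec_Seq[OF 2 3]] 4[unfolded W_def]])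
        (use nl in auto)
    show ?case by (rule exec_weaken[OF 5]) (auto simp: C_def funpow_swap1)
  qed
  let ?b = "\<lambda>n. 40 * poly q n + 41 + poly u (poly q n) + poly q n * C (poly q n) + 1 + 40"
  show ?thesis
  proof (rule PTI[where c = "Seq (Seq dup_tree e) (Seq W drop_tree)" and b = ?b])
    fix t r and s :: store assume s: "s 0 = ser (D t) @ r"
    obtain n where n: "n \<le> b (tsz (D t))" "\<forall>i<n. B ((F ^^ i) t) \<noteq> Leaf" "B ((F ^^ n) t) = Leaf"
      "\<forall>i\<le>n. tsz (D ((F ^^ i) t)) \<le> b (tsz (D t))" "H t = (F ^^ n) t" using H by blast
    let ?m = "poly q (tsz (D t))"
    have m: "\<forall>i\<le>n. tsz (D ((F ^^ i) t)) \<le> ?m" "n \<le> ?m" using n q order_trans by blast+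
    have 1: "exec (Seq dup_tree e) s (40 * ?m + 41 + poly u ?m) (s(0 := ser (B t) @ ser (D t) @ r))"
      by (rule test[of s t r, OF s]) (use m(1)[rule_format, of 0] in simp)
    have 3: "exec drop_tree (s(0 := ser Leaf @ ser (D ((F ^^ n) t)) @ r)) (15 * tsz Leaf + 19)
       (s(0 := ser (D ((F ^^ n) t)) @ r))"
      by (rule exec_weaken[OF exec_drop[of _ Leaf]]) auto
    have nC: "n * C ?m \<le> ?m * C ?m" using m by simp
    show "exec (Seq (Seq dup_tree e) (Seq W drop_tree)) s (?b (tsz (D t))) (s(0 := ser (D (H t)) @ r))"
      by (rule exec_weaken[OF exec_Seq[OF 1 exec_Seq[OF loop[OF n(2,3) m(1)] 3]]])
        (use nC in \<open>unfold tsz_simps, linarith\<close>, simp add: n(5))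
  next
    show "pbd ?b" unfolding C_def by (intro pbd_intros)
    show "wf_cmd (Seq (Seq dup_tree e) (Seq W drop_tree))" using c e by (simp add: W_def)
  next
    fix t
    obtain n where n: "\<forall>i\<le>n. tsz (D ((F ^^ i) t)) \<le> b (tsz (D t))" "H t = (F ^^ n) t" using H by blast
    then show "tsz (D (H t)) \<le> ?b (tsz (D t))" using q[of "tsz (D t)"] by (auto dest!: spec[of _ n])
  qed
qed

subsection \<open>Words as trees\<close>

fun tb :: "bool \<Rightarrow> tree" where
  "tb False = Leaf" | "tb True = Node Leaf Leaf"

fun tbl :: "bool list \<Rightarrow> tree" where
  "tbl [] = Leaf" | "tbl (b # bs) = Node (tb b) (tbl bs)"

lemma tsz_tbl: "tsz (tbl x) \<le> 4 * length x + 1"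
proof (induction x)
  case (Cons b x)
  then show ?case by (cases b) auto
qed simp

abbreviation push_bit :: cmd where
  "push_bit \<equiv> Cond 1 (\<lambda>a. a = 2) (Seq (Pop 1) (pushes [2, 2, 1, 1])) (Seq (Pop 1) (pushes [2, 1]))"

abbreviation push_bits :: cmd where
  "push_bits \<equiv> While 1 (\<lambda>a. a \<noteq> 3) push_bit"

text \<open>The word is first moved to stack 1 because a list tree is pushed from its end. The words
  \<open>[2, 2, 1, 1]\<close> and \<open>[2, 1]\<close> are a \<open>Node\<close> followed by the
  serialised bit, put in front of the serialised rest.\<close>

definition read_input :: cmd where
  "read_input = Seq (Push 1 3) (Seq
     (copy_until 0 0 1)
     (Seq (Push 0 1) (Seq push_bits (Pop 1))))"

lemma exec_read1:
  assumes "s 0 = map bit_symbol x"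
  shows "exec (copy_until 0 0 1)
    s (8 * length x + 1) (s(0 := [], 1 := rev (map bit_symbol x) @ s 1))"
  using assms
proof (induction x arbitrary: s)
  case Nil
  then show ?case
    by (intro exec_weaken[OF exec_While_False]) (auto simp: fun_eq_iff)
next
  case (Cons b x)
  let ?s = "s(0 := map bit_symbol x, 1 := bit_symbol b # s 1)"
  have 1: "exec (copy 0 1) s 6 ?s"
  proof (rule exec_weaken[OF exec_CondI[where B = 5]])
    assume "top (s 0) = 2"
    then show "exec (Seq (Pop 0) (Push 1 2)) s 5 ?s"
      using Cons.prems
      by (intro exec_weaken[OF exec_Seq[OF exec_Pop exec_Push]])
        (auto simp: fun_eq_iff bit_symbol_def)
  next
    assume "top (s 0) \<noteq> 2"
    then show "exec (Seq (Pop 0) (Push 1 1)) s 5 ?s"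
      using Cons.prems
      by (intro exec_weaken[OF exec_Seq[OF exec_Pop exec_Push]])
        (auto simp: fun_eq_iff bit_symbol_def split: if_splits)
  qed auto
  have 2: "exec (copy_until 0 0 1)
    ?s (8 * length x + 1) (s(0 := [], 1 := rev (map bit_symbol (b # x)) @ s 1))"
    using Cons.prems by (intro exec_weaken[OF Cons.IH]) (auto simp: fun_eq_iff)
  show ?case
    using Cons.prems
    by (intro exec_weaken[OF exec_While_True[OF _ _ 1 2]])
      (auto simp: bit_symbol_def)
qed

lemma exec_read2:
  assumes "s 1 = map bit_symbol x @ 3 # r" "s 0 = ser (tbl y) @ z"
  shows "exec push_bits s
    (30 * length x + 1) (s(0 := ser (tbl (rev x @ y)) @ z, 1 := 3 # r))"
  using assms
proof (induction x arbitrary: s y)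
  case Nil
  then show ?case
    by (intro exec_weaken[OF exec_While_False]) (auto simp: fun_eq_iff)
next
  case (Cons b x)
  let ?s = "s(0 := ser (tbl (b # y)) @ z, 1 := map bit_symbol x @ 3 # r)"
  have 1: "exec push_bit s 20 ?s"
  proof (rule exec_weaken[OF exec_CondI[where B = 19]])
    assume "top (s 1) = 2"
    then show "exec (Seq (Pop 1) (pushes [2, 2, 1, 1])) s 19 ?s"
      using Cons.prems
      by (intro exec_weaken[OF exec_Seq[OF exec_Pop exec_pushes]])
        (auto simp: fun_eq_iff bit_symbol_def split: if_splits)
  next
    assume "top (s 1) \<noteq> 2"
    then show "exec (Seq (Pop 1) (pushes [2, 1])) s 19 ?s"
      using Cons.prems
      by (intro exec_weaken[OF exec_Seq[OF exec_Pop exec_pushes]])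
        (auto simp: fun_eq_iff bit_symbol_def split: if_splits)
  qed auto
  have 2: "exec push_bits ?s
      (30 * length x + 1) (s(0 := ser (tbl (rev (b # x) @ y)) @ z, 1 := 3 # r))"
    using Cons.prems by (intro exec_weaken[OF Cons.IH[where y = "b # y"]]) (auto simp: fun_eq_iff)
  show ?case
    using Cons.prems
    by (intro exec_weaken[OF exec_While_True[OF _ _ 1 2]])
      (auto simp: bit_symbol_def)
qed

lemma exec_read_input:
  assumes "s 0 = map bit_symbol x"
  shows "exec read_input s (38 * length x + 20) (s(0 := ser (tbl x)))"
proof -
  have 1: "exec (Push 1 3) s 3 (s(1 := 3 # s 1))" by (rule exec_Push) simp
  have 2: "exec (copy_until 0 0 1)
    (s(1 := 3 # s 1)) (8 * length x + 1) (s(0 := [], 1 := map bit_symbol (rev x) @ 3 # s 1))"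
    using assms by (intro exec_weaken[OF exec_read1]) (auto simp: rev_map)
  have 3: "exec (Push 0 1) (s(0 := [], 1 := map bit_symbol (rev x) @ 3 # s 1)) 3
    (s(0 := [1], 1 := map bit_symbol (rev x) @ 3 # s 1))"
    by (intro exec_weaken[OF exec_Push]) (auto simp: fun_eq_iff)
  have 4: "exec push_bits
     (s(0 := [1], 1 := map bit_symbol (rev x) @ 3 # s 1)) (30 * length x + 1)
     (s(0 := ser (tbl x), 1 := 3 # s 1))"
    by (intro exec_weaken[OF exec_read2[where x = "rev x" and y = "[]" and z = "[]"]])
      (auto simp: fun_eq_iff)
  have 5: "exec (Pop 1) (s(0 := ser (tbl x), 1 := 3 # s 1)) 1 (s(0 := ser (tbl x)))"
    by (intro exec_weaken[OF exec_Pop]) (auto simp: fun_eq_iff)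
  show ?thesis unfolding read_input_def
    by (rule exec_weaken[OF exec_Seq[OF 1 exec_Seq[OF 2 exec_Seq[OF 3 exec_Seq[OF 4 5]]]]]) auto
qed

definition write_output :: cmd where
  "write_output = While 0 (\<lambda>a. a = 2) (Seq (Pop 0) (Cond 0 (\<lambda>a. a = 2)
     (Seq (Pop 0) (Seq (Pop 0) (Seq (Pop 0) (Emit 2)))) (Seq (Pop 0) (Emit 1))))"

lemma exec_write_output:
  assumes "s 0 = ser (tbl x) @ r"
  shows "exec write_output s (30 * length x + 1) (s(0 := 1 # r, 3 := s 3 @ map bit_symbol x))"
  using assms
proof (induction x arbitrary: s)
  case Nil
  then show ?case unfolding write_output_def
    by (intro exec_weaken[OF exec_While_False]) (auto simp: fun_eq_iff)
next
  case (Cons b x)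
  let ?t = "s(0 := ser (tb b) @ ser (tbl x) @ r)"
  let ?s = "s(0 := ser (tbl x) @ r, 3 := s 3 @ [bit_symbol b])"
  have 1: "exec (Pop 0) s 1 ?t"
    using Cons.prems by (intro exec_weaken[OF exec_Pop]) (auto simp: fun_eq_iff)
  have 2: "exec (Cond 0 (\<lambda>a. a = 2)
     (Seq (Pop 0) (Seq (Pop 0) (Seq (Pop 0) (Emit 2)))) (Seq (Pop 0) (Emit 1))) ?t 20 ?s"
  proof (rule exec_weaken[OF exec_CondI[where B = 19]])
    assume "top (?t 0) = 2"
    then have b by (cases b) auto
    then show "exec (Seq (Pop 0) (Seq (Pop 0) (Seq (Pop 0) (Emit 2)))) ?t 19 ?s"
      by (intro exec_weaken[OF exec_Seq[OF exec_Pop exec_Seq[OF exec_Pop exec_Seq[OF exec_Pop exec_Emit]]]])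
        (auto simp: fun_eq_iff bit_symbol_def)
  next
    assume "top (?t 0) \<noteq> 2"
    then have "\<not> b" by (cases b) auto
    then show "exec (Seq (Pop 0) (Emit 1)) ?t 19 ?s"
      by (intro exec_weaken[OF exec_Seq[OF exec_Pop exec_Emit]])
        (auto simp: fun_eq_iff bit_symbol_def)
  qed auto
  have 3: "exec write_output ?s (30 * length x + 1) (s(0 := 1 # r, 3 := s 3 @ map bit_symbol (b # x)))"
    using Cons.prems by (intro exec_weaken[OF Cons.IH]) (auto simp: fun_eq_iff)
  show ?case
    using Cons.prems unfolding write_output_def
    by (intro exec_weaken[OF exec_While_True[OF _ _ exec_Seq[OF 1 2] 3[unfolded write_output_def]]]) auto
qed

lemma wf_io [simp]: "wf_cmd read_input" "wf_cmd write_output"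
  by (auto simp: read_input_def write_output_def)

lemma PT_run:
  assumes "PT tbl F"
  obtains c and b where "wf_cmd c" "pbd b"
    "\<And>x. exec c ((\<lambda>_. [])(0 := map bit_symbol x)) (b (length x)) ((\<lambda>_. [])(0 := ser (F x)))"
    "\<And>x. tsz (F x) \<le> b (length x)"
proof -
  obtain c p where "implements c p tbl F" using assms unfolding PT_def by blast
  note c = implementsD[OF this]
  let ?b = "\<lambda>n. 38 * n + 20 + poly p (4 * n + 1) + 1"
  show thesis
  proof (rule that[of "Seq read_input c" ?b])
    fix x
    have m: "poly p (tsz (tbl x)) \<le> poly p (4 * length x + 1)"
      using tsz_tbl poly_nat_mono by blast
    have 1: "exec read_input ((\<lambda>_. [])(0 := map bit_symbol x)) (38 * length x + 20)
       ((\<lambda>_. [])(0 := ser (tbl x)))"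
      by (rule exec_weaken[OF exec_read_input[where x = x]]) auto
    have 2: "exec c ((\<lambda>_. [])(0 := ser (tbl x))) (poly p (tsz (tbl x))) ((\<lambda>_. [])(0 := ser (F x)))"
      by (rule exec_weaken[OF c(3)[of _ x "[]"]]) auto
    show "exec (Seq read_input c) ((\<lambda>_. [])(0 := map bit_symbol x)) (?b (length x))
       ((\<lambda>_. [])(0 := ser (F x)))"
      by (rule exec_weaken[OF exec_Seq[OF 1 2]]) (use m in auto)
    show "tsz (F x) \<le> ?b (length x)" using c(2)[of x] m by simp
  qed (use c in \<open>auto intro!: pbd_intros\<close>)
qed

theorem PT_computable:
  assumes "PT tbl F" "\<And>x. F x = tbl (f x)"
  shows "poly_time_computable f"
proof -
  obtain c b where c: "wf_cmd c" "pbd b"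
    "\<And>x. exec c ((\<lambda>_. [])(0 := map bit_symbol x)) (b (length x)) ((\<lambda>_. [])(0 := ser (F x)))"
    "\<And>x. tsz (F x) \<le> b (length x)"
    using PT_run[OF assms(1)] by blast
  have "wf_cmd (Seq c write_output)" using c by simp
  from tm_of_cmd[OF this] obtain M where M: "is_tm M"
    "\<And>x B ts'. runs (Seq c write_output) (init4 x) B ts' \<Longrightarrow>
      (\<exists>n \<le> B + 1. run M x n = (if scanned (ts' ! 0) = 2 then accept M else reject M, ts'))"
    by blast
  have "pbd (\<lambda>n. b n + (30 * b n + 1) + 1 + 1)" using c(2) by (intro pbd_intros)
  then obtain p :: "nat poly" where p: "\<And>n. b n + (30 * b n + 1) + 1 + 1 \<le> poly p n"
    unfolding pbd_def by blast
  have "\<exists>n \<le> poly p (length x). halted M (run M x n) \<and> outputs (run M x n) (f x)" for x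
  proof -
    let ?s = "(\<lambda>_. [])(0 := [1], 3 := map bit_symbol (f x))"
    have len: "length y \<le> tsz (tbl y)" for y by (induction y) auto
    have "exec write_output ((\<lambda>_. [])(0 := ser (F x))) (30 * length (f x) + 1) ?s"
      by (rule exec_weaken[OF exec_write_output[where x = "f x" and r = "[]"]]) (auto simp: assms(2))
    from exec_Seq[OF c(3) this] obtain ts' where ts':
      "runs (Seq c write_output) (init4 x) (b (length x) + (30 * length (f x) + 1) + 1) ts'" "rep ?s ts'"
      unfolding exec_def using rep_init4 by blast
    from M(2)[OF ts'(1)] obtain n where n: "n \<le> b (length x) + (30 * length (f x) + 1) + 1 + 1"
      "run M x n = (if scanned (ts' ! 0) = 2 then accept M else reject M, ts')" by blast
    have "length (f x) \<le> b (length x)" using c(4)[of x] len[of "f x"] assms(2) by simp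
    then have "n \<le> poly p (length x)" using n(1) p[of "length x"] by simp
    moreover have "halted M (run M x n)" using n(2) by (simp add: halted_def)
    moreover have "outputs (run M x n) (f x)"
    proof -
      have "last ts' = ts' ! 3" using ts'(2) by (subst last_conv_nth) (auto simp: rep_def)
      then show ?thesis using ts'(2) n(2) by (auto simp: outputs_def rep_def)
    qed
    ultimately show ?thesis by blast
  qed
  then show ?thesis unfolding poly_time_computable_def using M(1) by blast
qed

theorem PT_decidable:
  assumes "PT tbl F" "\<And>x. F x = tb (x \<in> A)"
  shows "A \<in> P_class"
proof -
  obtain c b where c: "wf_cmd c" "pbd b"
    "\<And>x. exec c ((\<lambda>_. [])(0 := map bit_symbol x)) (b (length x)) ((\<lambda>_. [])(0 := ser (F x)))"
    "\<And>x. tsz (F x) \<le> b (length x)"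
    using PT_run[OF assms(1)] by blast
  from tm_of_cmd[OF c(1)] obtain M where M: "is_tm M"
    "\<And>x B ts'. runs c (init4 x) B ts' \<Longrightarrow>
      (\<exists>n \<le> B + 1. run M x n = (if scanned (ts' ! 0) = 2 then accept M else reject M, ts'))"
    by blast
  have "pbd (\<lambda>n. b n + 1)" using c(2) by (intro pbd_intros)
  then obtain p :: "nat poly" where p: "\<And>n. b n + 1 \<le> poly p n"
    unfolding pbd_def by blast
  have "\<exists>n \<le> poly p (length x). fst (run M x n) = (if x \<in> A then accept M else reject M)" for x
  proof -
    obtain ts' where ts': "runs c (init4 x) (b (length x)) ts'" "rep ((\<lambda>_. [])(0 := ser (F x))) ts'"
      using c(3)[of x] unfolding exec_def using rep_init4 by blast
    from M(2)[OF ts'(1)] obtain n where n: "n \<le> b (length x) + 1"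
      "run M x n = (if scanned (ts' ! 0) = 2 then accept M else reject M, ts')" by blast
    have "scanned (ts' ! 0) = 2 \<longleftrightarrow> x \<in> A"
      using rep_top[OF ts'(2), of 0] by (cases "x \<in> A") (auto simp: assms(2))
    then show ?thesis using n p[of "length x"] by (intro exI[of _ n]) auto
  qed
  then show ?thesis unfolding P_class_def using M(1) by blast
qed

section \<open>Polynomial-time functions on structured data\<close>

text \<open>Injectivity allows equality of values to be decided by comparing trees.\<close>

class treeable =
  fixes tree_of :: "'a \<Rightarrow> tree"
  assumes tree_of_inject: "tree_of x = tree_of y \<Longrightarrow> x = y"

lemma tree_of_eq_iff [simp]: "tree_of x = tree_of y \<longleftrightarrow> x = y"
  using tree_of_inject by blast

instantiation tree :: treeable
begin
definition "tree_of (t :: tree) = t"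
instance by standard (simp add: tree_of_tree_def)
end

instantiation bool :: treeable
begin
definition "tree_of b = tb b"
instance
proof
  fix x y :: bool
  show "tree_of x = tree_of y \<Longrightarrow> x = y" by (cases x; cases y) (auto simp: tree_of_bool_def)
qed
end

instantiation prod :: (treeable, treeable) treeable
begin
definition "tree_of z = Node (tree_of (fst z)) (tree_of (snd z))"
instance by standard (auto simp: tree_of_prod_def prod_eq_iff)
end

instantiation list :: (treeable) treeable
begin
primrec tree_of_list :: "'a list \<Rightarrow> tree" where
  "tree_of_list [] = Leaf"
| "tree_of_list (x # xs) = Node (tree_of x) (tree_of_list xs)"
instance
proof
  fix xs ys :: "'a list"
  show "tree_of xs = tree_of ys \<Longrightarrow> xs = ys"
  proof (induction xs arbitrary: ys)
    case Nil then show ?case by (cases ys) auto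
  next
    case (Cons x xs) then show ?case by (cases ys) auto
  qed
qed
end

fun nat_of_bits :: "bool list \<Rightarrow> nat" where
  "nat_of_bits [] = 0"
| "nat_of_bits (b # bs) = of_bool b + 2 * nat_of_bits bs"

lemma nat_of_binary [simp]: "nat_of_bits (binary n) = n"
proof (induction n rule: binary.induct)
  case (1 n)
  show ?case
  proof (cases "n = 0")
    case True
    then show ?thesis by (subst binary.simps) simp
  next
    case False
    then have "nat_of_bits (binary n) = of_bool (odd n) + 2 * (n div 2)"
      using 1 by (subst binary.simps) simp
    then show ?thesis by (cases "odd n") (auto elim: oddE evenE)
  qed
qed

lemma binary_inject [simp]: "binary m = binary n \<longleftrightarrow> m = n"
  by (metis nat_of_binary)

lemma binary_0 [simp]: "binary 0 = []"
  by (subst binary.simps) simp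

lemma binary_pos: "0 < n \<Longrightarrow> binary n = odd n # binary (n div 2)"
  by (subst binary.simps) simp

lemma length_binary: "length (binary n) \<le> n"
proof (induction n rule: binary.induct)
  case (1 n)
  then show ?case by (cases "n = 0") (auto simp: binary_pos)
qed

text \<open>Numbers are in binary, as in the encoding of instances. Counting up to a number may thus
  take exponential time, so all loops run over lists.\<close>

instantiation nat :: treeable
begin
definition "tree_of (n :: nat) = tree_of (binary n)"
instance by standard (simp add: tree_of_nat_def)
end

definition sz :: "'a :: treeable \<Rightarrow> nat" where
  "sz x = tsz (tree_of x)"

definition pt :: "('a :: treeable \<Rightarrow> 'b :: treeable) \<Rightarrow> bool" where
  "pt f \<longleftrightarrow> PT tree_of (\<lambda>x. tree_of (f x))"

lemma tbl_eq: "tbl = tree_of"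
proof
  show "tbl x = tree_of x" for x by (induction x) (auto simp: tree_of_bool_def)
qed

lemma pt_computable: "pt f \<Longrightarrow> poly_time_computable f"
  unfolding pt_def by (erule PT_computable[unfolded tbl_eq]) (rule refl)

lemma pt_decidable: "pt (\<lambda>x. x \<in> A) \<Longrightarrow> A \<in> P_class"
  unfolding pt_def by (erule PT_decidable[unfolded tbl_eq]) (rule tree_of_bool_def)

lemma tb_Leaf_iff [simp]: "tb b = Leaf \<longleftrightarrow> \<not> b"
  by (cases b) auto

lemma sz_pos [simp]: "0 < sz x"
  by (simp add: sz_def)

lemma sz_simps [simp]:
  "sz (x, y) = sz x + sz y + 1" "sz [] = 1" "sz (z # zs) = sz z + sz zs + 1"
  "sz True = 3" "sz False = 1"
  by (auto simp: sz_def tree_of_prod_def tree_of_bool_def)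

lemma sz_bool: "sz (b :: bool) \<le> 3"
  by (cases b) auto

lemma sz_append [simp]: "sz (xs @ ys) = sz xs + sz ys - 1"
  by (induction xs) auto

lemma sz_list: "sz xs = (\<Sum>x\<leftarrow>xs. sz x + 1) + 1"
  by (induction xs) auto

lemma length_le_sz: "length xs < sz xs"
  by (induction xs) auto

lemma sz_elem: "x \<in> set xs \<Longrightarrow> sz x \<le> sz xs"
  by (induction xs) auto

lemma sz_tl: "sz (tl xs) \<le> sz xs"
  by (cases xs) auto

lemma sz_rev [simp]: "sz (rev xs) = sz xs"
  by (simp add: sz_list rev_map[symmetric] sum_list_rev)

lemma sz_bits: "sz (bs :: bool list) \<le> 4 * length bs + 1"
  using tsz_tbl by (simp add: sz_def tbl_eq)

lemma sz_nat: "sz (n :: nat) \<le> 4 * n + 1"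
  using sz_bits[of "binary n"] length_binary[of n] by (simp add: sz_def tree_of_nat_def)

named_theorems pt_intros

lemma PT_reindex: "PT D E \<Longrightarrow> PT (\<lambda>x. D (g x)) (\<lambda>x. E (g x))"
  unfolding PT_def implements_def by blast

lemma pt_comp: "pt f \<Longrightarrow> pt g \<Longrightarrow> pt (\<lambda>x. f (g x))"
  unfolding pt_def by (rule PT_comp[OF PT_reindex[where g = g]])

lemma pt_id [pt_intros]: "pt (\<lambda>x. x)"
  unfolding pt_def by (rule PT_id)

lemma pt_const [pt_intros]: "pt (\<lambda>x. k)"
  unfolding pt_def by (rule PT_const)

lemma pt_bound:
  assumes "pt f"
  obtains b where "pbd b" "\<And>x. sz (f x) \<le> b (sz x)" "mono b"
proof -
  obtain p :: "nat poly" where "\<And>x. sz (f x) \<le> poly p (sz x)"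
    using assms unfolding pt_def PT_def implements_def sz_def by blast
  moreover have "mono (poly p)" by (auto simp: mono_def intro: poly_nat_mono)
  ultimately show thesis using that pbd_poly by blast
qed

lemma pt_Pair [pt_intros]: "pt f \<Longrightarrow> pt g \<Longrightarrow> pt (\<lambda>x. (f x, g x))"
  unfolding pt_def tree_of_prod_def by (simp add: PT_Node)

lemma pt_Cons [pt_intros]: "pt f \<Longrightarrow> pt g \<Longrightarrow> pt (\<lambda>x. f x # g x)"
  unfolding pt_def by (simp add: PT_Node)

lemma pt_fst [pt_intros]: "pt (g :: 'a :: treeable \<Rightarrow> 'b :: treeable \<times> 'c :: treeable) \<Longrightarrow> pt (\<lambda>x. fst (g x))"
proof (erule pt_comp[rotated])
  have "tree_of (fst z) = lft (tree_of z)" for z :: "'b \<times> 'c" by (simp add: tree_of_prod_def)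
  then show "pt (fst :: 'b \<times> 'c \<Rightarrow> 'b)" using PT_lft[of tree_of] by (simp add: pt_def)
qed

lemma pt_snd [pt_intros]: "pt (g :: 'a :: treeable \<Rightarrow> 'b :: treeable \<times> 'c :: treeable) \<Longrightarrow> pt (\<lambda>x. snd (g x))"
proof (erule pt_comp[rotated])
  have "tree_of (snd z) = rgt (tree_of z)" for z :: "'b \<times> 'c" by (simp add: tree_of_prod_def)
  then show "pt (snd :: 'b \<times> 'c \<Rightarrow> 'c)" using PT_rgt[of tree_of] by (simp add: pt_def)
qed

lemma pt_if [pt_intros]:
  assumes "pt b" "pt f" "pt g" shows "pt (\<lambda>x. if b x then f x else g x)"
proof -
  have "tree_of (if b x then f x else g x) =
      (if tree_of (b x) = Leaf then tree_of (g x) else tree_of (f x))" for x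
    by (cases "b x") (auto simp: tree_of_bool_def)
  then show ?thesis using PT_if assms unfolding pt_def by (simp only:)
qed

lemma pt_case_prod [pt_intros]:
  "pt (\<lambda>x. f x (fst (g x)) (snd (g x))) \<Longrightarrow> pt (\<lambda>x. case g x of (a, b) \<Rightarrow> f x a b)"
  by (simp add: case_prod_beta)

lemma pt_Let [pt_intros]:
  assumes "pt (\<lambda>z. f (fst z) (snd z))" "pt g" shows "pt (\<lambda>x. let y = g x in f x y)"
  using pt_comp[OF assms(1), of "\<lambda>x. (x, g x)"] assms(2) by (simp add: pt_Pair pt_id)

lemma pt_not [pt_intros]: "pt b \<Longrightarrow> pt (\<lambda>x. \<not> b x)"
proof -
  have "(\<not> b x) = (if b x then False else True)" for x by simp
  then show "pt b \<Longrightarrow> pt (\<lambda>x. \<not> b x)"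
    by (simp only:) (intro pt_intros)
qed

lemma pt_conj [pt_intros]: "pt b \<Longrightarrow> pt c \<Longrightarrow> pt (\<lambda>x. b x \<and> c x)"
proof -
  have "(b x \<and> c x) = (if b x then c x else False)" for x by simp
  then show "pt b \<Longrightarrow> pt c \<Longrightarrow> pt (\<lambda>x. b x \<and> c x)"
    by (simp only:) (intro pt_intros)
qed

lemma pt_disj [pt_intros]: "pt b \<Longrightarrow> pt c \<Longrightarrow> pt (\<lambda>x. b x \<or> c x)"
proof -
  have "(b x \<or> c x) = (if b x then True else c x)" for x by simp
  then show "pt b \<Longrightarrow> pt c \<Longrightarrow> pt (\<lambda>x. b x \<or> c x)"
    by (simp only:) (intro pt_intros)
qed

lemma pt_imp [pt_intros]: "pt b \<Longrightarrow> pt c \<Longrightarrow> pt (\<lambda>x. b x \<longrightarrow> c x)"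
proof -
  have "(b x \<longrightarrow> c x) = (if b x then c x else True)" for x by simp
  then show "pt b \<Longrightarrow> pt c \<Longrightarrow> pt (\<lambda>x. b x \<longrightarrow> c x)"
    by (simp only:) (intro pt_intros)
qed

lemma pt_is_Leaf: "pt (\<lambda>t. t = Leaf)"
  using PT_if[OF PT_id PT_const[of _ "tb False"] PT_const[of _ "tb True"], of tree_of]
  unfolding pt_def by (rule back_subst[of "PT tree_of"]) (auto simp: tree_of_bool_def tree_of_tree_def)

lemma pt_tree_of [pt_intros]: "pt g \<Longrightarrow> pt (\<lambda>x. tree_of (g x))"
  unfolding pt_def tree_of_tree_def .

lemma pt_null [pt_intros]:
  assumes "pt f" shows "pt (\<lambda>x. f x = [])"
proof -
  have "(f x = []) = (tree_of (f x) = Leaf)" for x by (cases "f x") auto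
  then show ?thesis using pt_comp[OF pt_is_Leaf pt_tree_of[OF assms]] by simp
qed

lemma pt_lft [pt_intros]: "pt g \<Longrightarrow> pt (\<lambda>x. lft (g x))"
proof (erule pt_comp[rotated])
  show "pt lft" using PT_lft[of "tree_of :: tree \<Rightarrow> tree"] by (simp add: pt_def tree_of_tree_def)
qed

lemma pt_rgt [pt_intros]: "pt g \<Longrightarrow> pt (\<lambda>x. rgt (g x))"
proof (erule pt_comp[rotated])
  show "pt rgt" using PT_rgt[of "tree_of :: tree \<Rightarrow> tree"] by (simp add: pt_def tree_of_tree_def)
qed

text \<open>The head of the empty list is an unknown but fixed value.\<close>

lemma pt_hd [pt_intros]: "pt (f :: 'b :: treeable \<Rightarrow> 'a :: treeable list) \<Longrightarrow> pt (\<lambda>x. hd (f x))"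
proof (erule pt_comp[rotated])
  have "tree_of (hd xs) = (if tree_of xs = Leaf then tree_of (hd [] :: 'a) else lft (tree_of xs))"
    for xs :: "'a list" by (cases xs) auto
  then show "pt (hd :: 'a list \<Rightarrow> 'a)"
    unfolding pt_def using PT_if[OF PT_id PT_lft PT_const, of tree_of "tree_of (hd [] :: 'a)"]
    by simp
qed

lemma pt_tl [pt_intros]: "pt (f :: 'b :: treeable \<Rightarrow> 'a :: treeable list) \<Longrightarrow> pt (\<lambda>x. tl (f x))"
proof (erule pt_comp[rotated])
  have "tree_of (tl xs) = rgt (tree_of xs)" for xs :: "'a list" by (cases xs) auto
  then show "pt (tl :: 'a list \<Rightarrow> 'a list)"
    unfolding pt_def using PT_rgt[of tree_of] by simp
qed

subsection \<open>Bounded iteration\<close>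

text \<open>The number \<open>N x\<close> of iterations is never computed; the test \<open>b\<close>
  ends the loop.\<close>

lemma pt_iterate:
  fixes f :: "'s :: treeable \<Rightarrow> 's" and g :: "'a :: treeable \<Rightarrow> 's"
  assumes "pt f" "pt b" "pt g" "pbd B"
    and N: "\<And>x. N x \<le> B (sz x)" "\<And>x i. i < N x \<Longrightarrow> b ((f ^^ i) (g x))"
      "\<And>x. \<not> b ((f ^^ N x) (g x))"
    and size: "\<And>x i. i \<le> N x \<Longrightarrow> sz ((f ^^ i) (g x)) \<le> B (sz x)"
  shows "pt (\<lambda>x. (f ^^ N x) (g x))"
proof -
  \<comment> \<open>Indices pair an input with an iteration count, but the program sees only the
    input and the current value. The count is cut off at \<open>N\<close>, so that the loop behaves
    well also from indices beyond the end; the input is kept because all bounds refer to its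
    size.\<close>
  define st where "st i = (fst i, (f ^^ min (snd i) (N (fst i))) (g (fst i)))" for i :: "'a \<times> nat"
  define D where "D i = tree_of (st i)" for i
  define F where "F i = (fst i, Suc (snd i))" for i :: "'a \<times> nat"
  define H where "H i = (fst i, max (snd i) (N (fst i)))" for i :: "'a \<times> nat"
  have bst: "b (snd (st i)) \<longleftrightarrow> snd i < N (fst i)" for i
    using N(3)[of "fst i"] N(2)[of "snd i" "fst i"]
    by (cases "snd i" "N (fst i)" rule: linorder_cases) (auto simp: st_def)
  have reind: "pt h \<Longrightarrow> PT D (\<lambda>i. tree_of (h (st i)))" for h :: "'a \<times> 's \<Rightarrow> 'c :: treeable"
    unfolding pt_def D_def by (rule PT_reindex)
  have 1: "PT D (\<lambda>i. tree_of (b (snd (st i))))"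
    by (rule reind[where h1 = "\<lambda>z. b (snd z)"]) (intro pt_comp[OF assms(2)] pt_intros)
  have 2: "PT D (\<lambda>i. D (F i))"
  proof -
    have "D (F i) = tree_of (fst (st i), if b (snd (st i)) then f (snd (st i)) else snd (st i))" for i
      unfolding bst by (auto simp: D_def F_def st_def min_def)
    moreover have "PT D (\<lambda>i. tree_of (fst (st i), if b (snd (st i)) then f (snd (st i)) else snd (st i)))"
      by (rule reind[where h1 = "\<lambda>z. (fst z, if b (snd z) then f (snd z) else snd z)"])
        (intro pt_intros pt_comp[OF assms(2)] pt_comp[OF assms(1)])
    ultimately show ?thesis by simp
  qed
  obtain p :: "nat poly" where p: "\<And>n. B n \<le> poly p n" using assms(4) unfolding pbd_def by blast
  have Fi: "(F ^^ j) i = (fst i, snd i + j)" for i j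
    by (induction j) (auto simp: F_def)
  have szx: "sz (fst i) \<le> tsz (D i)" for i
    by (simp add: D_def st_def flip: sz_def)
  have 3: "PT D (\<lambda>i. D (H i))"
  proof (rule PT_while[OF 1 2, where b = "\<lambda>n. poly p n + n + 1"])
    show "pbd (\<lambda>n. poly p n + n + 1)" by (intro pbd_intros)
    fix i
    have m: "B (sz (fst i)) \<le> poly p (tsz (D i))"
      using p[of "sz (fst i)"] poly_nat_mono[OF szx, of p i] by linarith
    let ?n = "N (fst i) - snd i"
    have "?n \<le> poly p (tsz (D i)) + tsz (D i) + 1"
      using N(1)[of "fst i"] m by linarith
    moreover have "\<forall>j<?n. tree_of (b (snd (st ((F ^^ j) i)))) \<noteq> Leaf"
      by (auto simp: bst Fi tree_of_bool_def less_diff_conv add.commute)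
    moreover have "tree_of (b (snd (st ((F ^^ ?n) i)))) = Leaf"
      by (auto simp: bst Fi tree_of_bool_def)
    moreover have "tsz (D ((F ^^ j) i)) \<le> poly p (tsz (D i)) + tsz (D i) + 1" for j
    proof -
      have "tsz (D ((F ^^ j) i)) =
          sz (fst i) + sz ((f ^^ min (snd i + j) (N (fst i))) (g (fst i))) + 1"
        by (simp add: D_def st_def Fi flip: sz_def)
      then show ?thesis using size[of "min (snd i + j) (N (fst i))" "fst i"] m szx[of i] by simp
    qed
    moreover have "H i = (F ^^ ?n) i" by (auto simp: H_def Fi max_def)
    ultimately show "\<exists>n\<le>poly p (tsz (D i)) + tsz (D i) + 1.
      (\<forall>j<n. tree_of (b (snd (st ((F ^^ j) i)))) \<noteq> Leaf) \<and>
      tree_of (b (snd (st ((F ^^ n) i)))) = Leaf \<and>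
      (\<forall>j\<le>n. tsz (D ((F ^^ j) i)) \<le> poly p (tsz (D i)) + tsz (D i) + 1) \<and> H i = (F ^^ n) i"
      by blast
  qed
  have "PT (\<lambda>x. tree_of (x, g x)) (\<lambda>x. tree_of (x, (f ^^ N x) (g x)))"
    using PT_reindex[OF 3, of "\<lambda>x. (x, 0)"] by (simp add: D_def st_def H_def)
  then have "PT tree_of (\<lambda>x. tree_of (x, (f ^^ N x) (g x)))"
    using PT_comp pt_Pair[OF pt_id assms(3)] unfolding pt_def by blast
  then have "pt (\<lambda>x. (x, (f ^^ N x) (g x)))" by (simp add: pt_def)
  from pt_snd[OF this] show ?thesis by simp
qed

text \<open>An iteration on triples of parameter, remaining list and accumulator, which stops when
  the list is empty. The bound is needed on all intermediate accumulators.\<close>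

lemma pt_fold:
  fixes f :: "'a :: treeable \<Rightarrow> 'b :: treeable \<Rightarrow> 'c :: treeable \<Rightarrow> 'c"
  assumes f: "pt (\<lambda>z. f (fst z) (fst (snd z)) (snd (snd z)))"
    and "pt l" "pt g" "pbd B"
    and size: "\<And>x k. sz (fold (f x) (take k (l x)) (g x)) \<le> B (sz x)"
  shows "pt (\<lambda>x. fold (f x) (l x) (g x))"
proof -
  define F :: "'a \<times> 'b list \<times> 'c \<Rightarrow> 'a \<times> 'b list \<times> 'c" where
    "F s = (fst s, tl (fst (snd s)), f (fst s) (hd (fst (snd s))) (snd (snd s)))" for s
  have "pt (\<lambda>s :: 'a \<times> 'b list \<times> 'c. (fst s, hd (fst (snd s)), snd (snd s)))" by (intro pt_intros)
  from pt_comp[OF f this] have ptF: "pt F" unfolding F_def by simp (intro pt_intros)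
  obtain b where b: "pbd b" "\<And>x. sz (l x) \<le> b (sz x)" using pt_bound[OF assms(2)] by blast
  have Fi: "i \<le> length (l x) \<Longrightarrow> (F ^^ i) (x, l x, g x) =
      (x, drop i (l x), fold (f x) (take i (l x)) (g x))" for i x
  proof (induction i)
    case (Suc i)
    then have "take (Suc i) (l x) = take i (l x) @ [hd (drop i (l x))]"
      by (simp add: hd_drop_conv_nth take_Suc_conv_app_nth)
    with Suc show ?case by (simp add: F_def drop_Suc tl_drop)
  qed simp
  have szd: "sz (drop i xs) \<le> sz xs" for i and xs :: "'b list"
    by (induction xs arbitrary: i) (auto simp: drop_Cons split: nat.split intro: le_SucI trans_le_add2)
  have "pt (\<lambda>x. (F ^^ length (l x)) (x, l x, g x))"
  proof (rule pt_iterate[where b = "\<lambda>s. fst (snd s) \<noteq> []" and B = "\<lambda>n. n + b n + B n + 2"])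
    show "pt (\<lambda>s :: 'a \<times> 'b list \<times> 'c. fst (snd s) \<noteq> [])" "pt (\<lambda>x. (x, l x, g x))"
      by (intro pt_intros assms)+
    show "pbd (\<lambda>n. n + b n + B n + 2)" by (intro pbd_intros b assms)
    show "length (l x) \<le> sz x + b (sz x) + B (sz x) + 2" for x
      using length_le_sz[of "l x"] b(2)[of x] by linarith
    show "fst (snd ((F ^^ i) (x, l x, g x))) \<noteq> []" if "i < length (l x)" for x i
      using that by (simp add: Fi)
    show "\<not> fst (snd ((F ^^ length (l x)) (x, l x, g x))) \<noteq> []" for x
      by (simp add: Fi)
    show "sz ((F ^^ i) (x, l x, g x)) \<le> sz x + b (sz x) + B (sz x) + 2" if "i \<le> length (l x)" for x i
      using size[of x i] szd[of i "l x"] b(2)[of x] that by (simp add: Fi)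
  qed (rule ptF)
  from pt_snd[OF pt_snd[OF this]] show ?thesis by (simp add: Fi)
qed

text \<open>The size bound is trivial when each step adds a bounded amount.\<close>

lemma pt_fold_add:
  fixes f :: "'a :: treeable \<Rightarrow> 'b :: treeable \<Rightarrow> 'c :: treeable \<Rightarrow> 'c"
  assumes f: "pt (\<lambda>z. f (fst z) (fst (snd z)) (snd (snd z)))"
    and l: "pt l" and g: "pt g" and "pbd B"
    and size: "\<And>x y a. y \<in> set (l x) \<Longrightarrow> sz (f x y a) \<le> sz a + B (sz x)"
  shows "pt (\<lambda>x. fold (f x) (l x) (g x))"
proof -
  obtain b where b: "pbd b" "\<And>x. sz (l x) \<le> b (sz x)" using pt_bound[OF l] by blast
  obtain c where c: "pbd c" "\<And>x. sz (g x) \<le> c (sz x)" using pt_bound[OF g] by blast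
  show ?thesis
  proof (rule pt_fold[OF f l g, where B = "\<lambda>n. c n + b n * B n"])
    show "pbd (\<lambda>n. c n + b n * B n)" by (intro pbd_intros b c assms)
    fix x k
    have "set ys \<subseteq> set (l x) \<Longrightarrow> sz (fold (f x) ys a) \<le> sz a + length ys * B (sz x)" for ys a
    proof (induction ys arbitrary: a)
      case (Cons y ys)
      have "sz (fold (f x) ys (f x y a)) \<le> sz (f x y a) + length ys * B (sz x)"
        using Cons by auto
      also have "\<dots> \<le> sz a + B (sz x) + length ys * B (sz x)" using size[of y x a] Cons.prems by simp
      finally show ?case by simp
    qed simp
    from this[of "take k (l x)" "g x"]
    have "sz (fold (f x) (take k (l x)) (g x)) \<le> sz (g x) + length (take k (l x)) * B (sz x)"
      using set_take_subset by fast
    also have "\<dots> \<le> c (sz x) + b (sz x) * B (sz x)"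
      using c(2)[of x] b(2)[of x] length_le_sz[of "l x"]
      by (intro add_mono mult_right_mono) auto
    finally show "sz (fold (f x) (take k (l x)) (g x)) \<le> c (sz x) + b (sz x) * B (sz x)" .
  qed
qed

subsection \<open>Lists\<close>

lemma pt_rev [pt_intros]:
  assumes "pt l" shows "pt (\<lambda>x. rev (l x))"
proof -
  obtain b where b: "pbd b" "\<And>x. sz (l x) \<le> b (sz x)" using pt_bound[OF assms] by blast
  have "pt (\<lambda>x. fold Cons (l x) [])"
  proof (rule pt_fold_add[where B = "\<lambda>n. b n + 1"])
    fix x y and a :: "'b list" assume "y \<in> set (l x)"
    then show "sz (y # a) \<le> sz a + (b (sz x) + 1)"
      using sz_elem[of y "l x"] b(2)[of x] by simp
  qed (intro pt_intros assms pbd_intros b)+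
  then show ?thesis by (simp add: rev_conv_fold)
qed

lemma pt_append [pt_intros]:
  assumes l: "pt l" and m: "pt m" shows "pt (\<lambda>x. l x @ m x)"
proof -
  obtain b where b: "pbd b" "\<And>x. sz (l x) \<le> b (sz x)" using pt_bound[OF l] by blast
  have "pt (\<lambda>x. fold Cons (rev (l x)) (m x))"
  proof (rule pt_fold_add[where B = "\<lambda>n. b n + 1"])
    fix x y and a :: "'b list" assume "y \<in> set (rev (l x))"
    then show "sz (y # a) \<le> sz a + (b (sz x) + 1)"
      using sz_elem[of y "l x"] b(2)[of x] by simp
  qed (intro pt_intros assms pbd_intros b)+
  moreover have "fold Cons (rev xs) ys = xs @ ys" for xs ys :: "'b list"
    by (induction xs) auto
  ultimately show ?thesis by simp
qed

lemma pt_map [pt_intros]: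
  fixes f :: "'a :: treeable \<Rightarrow> 'c :: treeable \<Rightarrow> 'b :: treeable"
  assumes f: "pt (\<lambda>z. f (fst z) (snd z))" and l: "pt l"
  shows "pt (\<lambda>x. map (f x) (l x))"
proof -
  obtain b where b: "pbd b" "\<And>x. sz (l x) \<le> b (sz x)" using pt_bound[OF l] by blast
  obtain c where c: "pbd c" "\<And>z. sz (f (fst z) (snd z)) \<le> c (sz z)" "mono c" using pt_bound[OF f] by blast
  have "pt (\<lambda>x. fold (\<lambda>y a. f x y # a) (l x) [])"
  proof (rule pt_fold_add[where B = "\<lambda>n. c (n + b n + 1) + 1"])
    have "pt (\<lambda>z :: 'a \<times> 'c \<times> 'b list. (fst z, fst (snd z)))" by (intro pt_intros)
    from pt_comp[OF f this] show "pt (\<lambda>z. f (fst z) (fst (snd z)) # snd (snd z))"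
      by simp (intro pt_intros)
    show "pbd (\<lambda>n. c (n + b n + 1) + 1)"
      by (intro pbd_intros pbd_comp[OF c(1)] b)
    fix x y and a :: "'b list" assume "y \<in> set (l x)"
    then have "sz (x, y) \<le> sz x + b (sz x) + 1" using sz_elem[of y "l x"] b(2)[of x] by simp
    then have "c (sz (x, y)) \<le> c (sz x + b (sz x) + 1)" using c(3) by (auto simp: mono_def)
    then show "sz (f x y # a) \<le> sz a + (c (sz x + b (sz x) + 1) + 1)"
      using c(2)[of "(x, y)"] by simp
  qed (intro pt_intros l)+
  moreover have "fold (\<lambda>y a. f x y # a) ys zs = rev (map (f x) ys) @ zs" for x ys zs
    by (induction ys arbitrary: zs) auto
  ultimately have "pt (\<lambda>x. rev (map (f x) (l x)))" by simp
  from pt_rev[OF this] show ?thesis by simp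
qed

lemma pt_concat [pt_intros]:
  assumes l: "pt l" shows "pt (\<lambda>x. concat (l x))"
proof -
  obtain b where b: "pbd b" "\<And>x. sz (l x) \<le> b (sz x)" using pt_bound[OF l] by blast
  have "pt (\<lambda>x. fold (\<lambda>ys a. a @ ys) (l x) [])"
  proof (rule pt_fold_add[where B = b])
    fix x y and a :: "'b list" assume "y \<in> set (l x)"
    then show "sz (a @ y) \<le> sz a + b (sz x)"
      using sz_elem[of y "l x"] b(2)[of x] by simp
  qed (intro pt_intros l b)+
  moreover have "fold (\<lambda>ys a. a @ ys) ls zs = zs @ concat ls" for ls and zs :: "'b list"
    by (induction ls arbitrary: zs) auto
  ultimately show ?thesis by simp
qed

lemma pt_filter [pt_intros]:
  assumes f: "pt (\<lambda>z. P (fst z) (snd z))" and l: "pt l"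
  shows "pt (\<lambda>x. filter (P x) (l x))"
proof -
  have "filter (P x) ys = concat (map (\<lambda>y. if P x y then [y] else []) ys)" for x ys
    by (induction ys) auto
  then show ?thesis by (simp only:) (intro pt_intros assms)
qed

lemma pt_Ball [pt_intros]:
  assumes f: "pt (\<lambda>z. P (fst z) (snd z))" and l: "pt l"
  shows "pt (\<lambda>x. \<forall>y\<in>set (l x). P x y)"
proof -
  have "(\<forall>y\<in>set ys. P x y) \<longleftrightarrow> filter (\<lambda>y. \<not> P x y) ys = []" for x ys
    by (auto simp: filter_empty_conv)
  then show ?thesis by (simp only:) (intro pt_intros assms)
qed

lemma pt_Bex [pt_intros]:
  assumes f: "pt (\<lambda>z. P (fst z) (snd z))" and l: "pt l"
  shows "pt (\<lambda>x. \<exists>y\<in>set (l x). P x y)"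
proof -
  have "(\<exists>y\<in>set ys. P x y) \<longleftrightarrow> \<not> (\<forall>y\<in>set ys. \<not> P x y)" for x ys by blast
  then show ?thesis by (simp only:) (intro pt_intros assms)
qed

subsection \<open>Equality\<close>

text \<open>Equality of trees by a worklist of pairs that still have to agree. A mismatch empties
  the worklist, so emptiness is the only stopping condition.\<close>

definition eq_step :: "bool \<times> (tree \<times> tree) list \<Rightarrow> bool \<times> (tree \<times> tree) list" where
  "eq_step s = (if fst (hd (snd s)) = Leaf \<and> snd (hd (snd s)) = Leaf then (fst s, tl (snd s))
     else if fst (hd (snd s)) = Leaf \<or> snd (hd (snd s)) = Leaf then (False, [])
     else (fst s, (lft (fst (hd (snd s))), lft (snd (hd (snd s)))) #
       (rgt (fst (hd (snd s))), rgt (snd (hd (snd s)))) # tl (snd s)))"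

definition wsz :: "(tree \<times> tree) list \<Rightarrow> nat" where
  "wsz ws = (\<Sum>w\<leftarrow>ws. tsz (fst w) + tsz (snd w))"

lemma eq_step_correct:
  "\<exists>n \<le> wsz ws. (\<forall>i<n. snd ((eq_step ^^ i) (True, ws)) \<noteq> []) \<and>
     (eq_step ^^ n) (True, ws) = (\<forall>w\<in>set ws. fst w = snd w, []) \<and>
     (\<forall>i\<le>n. wsz (snd ((eq_step ^^ i) (True, ws))) \<le> wsz ws)"
proof (induction "wsz ws" arbitrary: ws rule: less_induct)
  case less
  show ?case
  proof (cases ws)
    case Nil
    then show ?thesis by (intro exI[of _ 0]) auto
  next
    case (Cons w ws')
    obtain t u where w: "w = (t, u)" by fastforce
    consider (bad) "(t = Leaf) \<noteq> (u = Leaf)" | (leaf) "t = Leaf" "u = Leaf" | (node) a b c d where "t = Node a b" "u = Node c d"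
      by (cases t; cases u) auto
    then show ?thesis
    proof cases
      case bad
      then have "eq_step (True, ws) = (False, [])" by (auto simp: eq_step_def Cons w)
      moreover have "\<not> (\<forall>w\<in>set ws. fst w = snd w)" using bad by (auto simp: Cons w)
      moreover have "1 \<le> wsz ws" by (simp add: Cons w wsz_def Suc_leI)
      ultimately show ?thesis
        by (intro exI[of _ 1]) (auto simp: Cons less_Suc_eq_le le_Suc_eq wsz_def)
    next
      case leaf
      then have st: "eq_step (True, ws) = (True, ws')" by (auto simp: eq_step_def Cons w)
      have lt: "wsz ws' < wsz ws" by (simp add: Cons w wsz_def leaf)
      obtain n where n: "n \<le> wsz ws'" "\<forall>i<n. snd ((eq_step ^^ i) (True, ws')) \<noteq> []"
        "(eq_step ^^ n) (True, ws') = (\<forall>w\<in>set ws'. fst w = snd w, [])"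
        "\<forall>i\<le>n. wsz (snd ((eq_step ^^ i) (True, ws'))) \<le> wsz ws'"
        using less[OF lt] by blast
      show ?thesis
      proof (intro exI[of _ "Suc n"] conjI allI impI)
        fix i
        show "i < Suc n \<Longrightarrow> snd ((eq_step ^^ i) (True, ws)) \<noteq> []"
          using n(2) by (cases i) (auto simp: funpow_Suc_right st[unfolded Cons] Cons simp del: funpow.simps(2))
        show "i \<le> Suc n \<Longrightarrow> wsz (snd ((eq_step ^^ i) (True, ws))) \<le> wsz ws"
          using n(4) lt by (cases i) (auto simp: funpow_Suc_right st simp del: funpow.simps(2))
        have "(eq_step ^^ Suc n) (True, ws) = (eq_step ^^ n) (True, ws')"
          by (simp add: funpow_Suc_right st del: funpow.simps(2))
        then show "(eq_step ^^ Suc n) (True, ws) = (\<forall>w\<in>set ws. fst w = snd w, [])"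
          unfolding n(3) using leaf w Cons by simp
        show "Suc n \<le> wsz ws" using n(1) lt by simp
      qed
    next
      case node
      let ?ws = "(a, c) # (b, d) # ws'"
      have st: "eq_step (True, ws) = (True, ?ws)" using node by (auto simp: eq_step_def Cons w)
      have lt: "wsz ?ws < wsz ws" by (simp add: Cons w wsz_def node)
      obtain n where n: "n \<le> wsz ?ws" "\<forall>i<n. snd ((eq_step ^^ i) (True, ?ws)) \<noteq> []"
        "(eq_step ^^ n) (True, ?ws) = (\<forall>w\<in>set ?ws. fst w = snd w, [])"
        "\<forall>i\<le>n. wsz (snd ((eq_step ^^ i) (True, ?ws))) \<le> wsz ?ws"
        using less[OF lt] by blast
      show ?thesis
      proof (intro exI[of _ "Suc n"] conjI allI impI)
        fix i
        show "i < Suc n \<Longrightarrow> snd ((eq_step ^^ i) (True, ws)) \<noteq> []"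
          using n(2) by (cases i) (auto simp: funpow_Suc_right st[unfolded Cons] Cons simp del: funpow.simps(2))
        show "i \<le> Suc n \<Longrightarrow> wsz (snd ((eq_step ^^ i) (True, ws))) \<le> wsz ws"
          using n(4) lt by (cases i) (auto simp: funpow_Suc_right st simp del: funpow.simps(2)
            intro: order_trans less_imp_le)
        have "(eq_step ^^ Suc n) (True, ws) = (eq_step ^^ n) (True, ?ws)"
          by (simp add: funpow_Suc_right st del: funpow.simps(2))
        then show "(eq_step ^^ Suc n) (True, ws) = (\<forall>w\<in>set ws. fst w = snd w, [])"
          unfolding n(3) using node w Cons by simp
        show "Suc n \<le> wsz ws" using n(1) lt by simp
      qed
    qed
  qed
qed

lemma pt_eq_tree: "pt (\<lambda>z :: tree \<times> tree. fst z = snd z)"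
proof -
  have "\<forall>z. \<exists>n \<le> wsz [z]. (\<forall>i<n. snd ((eq_step ^^ i) (True, [z])) \<noteq> []) \<and>
     (eq_step ^^ n) (True, [z]) = (fst z = snd z, []) \<and>
     (\<forall>i\<le>n. wsz (snd ((eq_step ^^ i) (True, [z]))) \<le> wsz [z])"
    using eq_step_correct[of "[z]" for z] by simp
  then obtain N where N: "\<And>z. N z \<le> wsz [z]"
    "\<And>z i. i < N z \<Longrightarrow> snd ((eq_step ^^ i) (True, [z])) \<noteq> []"
    "\<And>z. (eq_step ^^ N z) (True, [z]) = (fst z = snd z, [])"
    "\<And>z i. i \<le> N z \<Longrightarrow> wsz (snd ((eq_step ^^ i) (True, [z]))) \<le> wsz [z]"
    by metis
  have wz: "wsz [z] \<le> sz z" for z by (cases z) (simp add: wsz_def sz_def tree_of_prod_def tree_of_tree_def)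
  have sw: "sz ws \<le> 2 * wsz ws + 1" for ws
  proof (induction ws)
    case (Cons w ws)
    have "1 \<le> tsz (fst w)" "1 \<le> tsz (snd w)" by (simp_all add: Suc_leI)
    then show ?case using Cons
      by (cases w) (simp add: wsz_def sz_def tree_of_prod_def tree_of_tree_def)
  qed (simp add: wsz_def)
  have "pt (\<lambda>z. (eq_step ^^ N z) (True, [z]))"
  proof (rule pt_iterate[where b = "\<lambda>s. snd s \<noteq> []" and B = "\<lambda>n. 2 * n + 10"])
    show "pt eq_step" unfolding eq_step_def
      by (intro pt_intros pt_comp[OF pt_is_Leaf])
    show "N z \<le> 2 * sz z + 10" for z using N(1)[of z] wz[of z] by linarith
    show "sz ((eq_step ^^ i) (True, [z])) \<le> 2 * sz z + 10" if "i \<le> N z" for z i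
    proof -
      obtain b ws where bw: "(eq_step ^^ i) (True, [z]) = (b, ws)" by fastforce
      show ?thesis using N(4)[OF that] wz[of z] sw[of ws] sz_bool[of b] unfolding bw by simp
    qed
  qed (use N in \<open>auto intro!: pt_intros pbd_intros\<close>)
  from pt_fst[OF this] show ?thesis by (simp add: N(3))
qed

lemma pt_eq [pt_intros]: "pt f \<Longrightarrow> pt g \<Longrightarrow> pt (\<lambda>x. f x = g x)"
  using pt_comp[OF pt_eq_tree, of "\<lambda>x. (tree_of (f x), tree_of (g x))"]
  by (simp add: pt_Pair pt_tree_of)

lemma pt_member [pt_intros]:
  assumes "pt f" "pt l" shows "pt (\<lambda>x. f x \<in> set (l x))"
proof -
  have "(f x \<in> set (l x)) = (\<exists>y\<in>set (l x). f x = y)" for x by auto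
  then show ?thesis
    by (simp only:) (intro pt_intros assms pt_comp[OF assms(1)])
qed

subsection \<open>Natural numbers in binary\<close>

lemma pt_nat_iff: "pt (f :: 'a :: treeable \<Rightarrow> nat) \<longleftrightarrow> pt (\<lambda>x. binary (f x))"
  unfolding pt_def tree_of_nat_def ..

lemma pt_binary [pt_intros]: "pt f \<Longrightarrow> pt (\<lambda>x. binary (f x))"
  by (simp add: pt_nat_iff)

text \<open>Drops the zeros at the most significant end, because a number is represented by its
  canonical bit list \<open>binary\<close>.\<close>

definition strip :: "bool list \<Rightarrow> bool list" where
  "strip bs = fold (\<lambda>b a. if a = [] \<and> \<not> b then [] else b # a) (rev bs) []"

lemma strip_eq: "strip bs = binary (nat_of_bits bs)"
proof (induction bs)
  case (Cons b bs)
  have "strip (b # bs) = (if strip bs = [] \<and> \<not> b then [] else b # strip bs)"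
    by (simp add: strip_def)
  moreover have "binary n = [] \<longleftrightarrow> n = 0" for n by (metis binary_0 binary_inject)
  ultimately show ?case using Cons
    by (cases "nat_of_bits (b # bs) = 0") (auto simp: binary_pos)
qed (simp add: strip_def)

lemma pt_nat_of_bits [pt_intros]:
  assumes "pt f" shows "pt (\<lambda>x. nat_of_bits (f x))"
proof -
  have "pt strip" unfolding strip_def
  proof (rule pt_fold_add[where B = "\<lambda>n. 4"])
    fix x y and a :: "bool list"
    show "sz (if a = [] \<and> \<not> y then [] else y # a) \<le> sz a + 4"
      using sz_bool[of y] by auto
  qed (intro pt_intros pbd_intros)+
  from pt_comp[OF this assms] show ?thesis by (simp add: pt_nat_iff strip_eq)
qed

lemma pt_Suc [pt_intros]:
  assumes "pt f" shows "pt (\<lambda>x. Suc (f x))"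
proof -
  define st where "st b z = (fst z \<and> b, (fst z \<noteq> b) # snd z)" for b and z :: "bool \<times> bool list"
  define inc where "inc bs = fold st bs (True, [])" for bs
  have app: "nat_of_bits (xs @ ys) = nat_of_bits xs + 2 ^ length xs * nat_of_bits ys" for xs ys
    by (induction xs) (auto simp: algebra_simps)
  \<comment> \<open>The bits produced so far stand reversed in the second component, and the carry
    has the weight of the next bit.\<close>
  have inc: "nat_of_bits (rev (snd (fold st bs z)) @ [fst (fold st bs z)]) =
     nat_of_bits (rev (snd z)) + 2 ^ length (snd z) * (of_bool (fst z) + nat_of_bits bs)" for bs z
  proof (induction bs arbitrary: z)
    case (Cons b bs)
    have "nat_of_bits (rev (snd (st b z))) +
        2 ^ length (snd (st b z)) * (of_bool (fst (st b z)) + nat_of_bits bs) =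
      nat_of_bits (rev (snd z)) + 2 ^ length (snd z) * (of_bool (fst z) + nat_of_bits (b # bs))"
      by (cases "fst z"; cases b) (auto simp: st_def app algebra_simps)
    then show ?case using Cons.IH[of "st b z"] by simp
  qed (simp add: app)
  have pt_inc: "pt inc" unfolding inc_def
  proof (rule pt_fold_add[where B = "\<lambda>n. 10"])
    fix x y and a :: "bool \<times> bool list"
    show "sz (st y a) \<le> sz a + 10"
      using sz_bool[of "fst a \<and> y"] sz_bool[of "fst a \<noteq> y"] by (cases a) (simp add: st_def)
  qed (unfold st_def, (intro pt_intros pbd_intros)+)
  then have "pt (\<lambda>x. nat_of_bits (rev (snd (inc (binary (f x)))) @ [fst (inc (binary (f x)))]))"
    by (intro pt_intros pt_comp[OF pt_inc] assms)
  then show ?thesis by (simp add: inc_def inc)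
qed

text \<open>Bits are compared from the least significant one, so that a later difference overrides
  the verdict so far. The state holds the unread bits of the first number; if some are left when the
  second number is exhausted, the first is larger.\<close>

lemma pt_less [pt_intros]:
  assumes f: "pt f" and g: "pt g" shows "pt (\<lambda>x. (f x :: nat) < g x)"
proof -
  define st where "st b z = (tl (fst z), if (fst z \<noteq> [] \<and> hd (fst z)) = b then snd z else b)"
    for b and z :: "bool list \<times> bool"
  have hdb: "(binary n \<noteq> [] \<and> hd (binary n)) = odd n" "tl (binary n) = binary (n div 2)" for n
    by (cases "n = 0"; simp add: binary_pos)+
  have st: "(fst (fold st (binary m) (binary n, c)) = [] \<and> snd (fold st (binary m) (binary n, c))) \<longleftrightarrow>
      n < m \<or> n = m \<and> c" for m n c
  proof (induction m arbitrary: n c rule: binary.induct)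
    case (1 m)
    show ?case
    proof (cases "m = 0")
      case True
      then show ?thesis using binary_inject[of n 0] by auto
    next
      case False
      have "(n div 2 < m div 2 \<or> n div 2 = m div 2 \<and> (if odd n = odd m then c else odd m)) \<longleftrightarrow>
          n < m \<or> n = m \<and> c"
      proof -
        have A: "n < m \<longleftrightarrow> n div 2 < m div 2 \<or> n div 2 = m div 2 \<and> even n \<and> odd m"
          and B: "n = m \<longleftrightarrow> n div 2 = m div 2 \<and> (odd n \<longleftrightarrow> odd m)"
          by presburger+
        show ?thesis unfolding A B by auto
      qed
      moreover have "st (odd m) (binary n, c) = (binary (n div 2), if odd n = odd m then c else odd m)"
        by (simp only: st_def fst_conv snd_conv hdb)
      moreover have "binary m = odd m # binary (m div 2)" using False by (simp add: binary_pos)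
      ultimately show ?thesis
        using 1[OF False, of "n div 2" "if odd n = odd m then c else odd m"]
        by (simp only: fold_simps)
    qed
  qed
  have "pt (\<lambda>x. fold st (binary (g x)) (binary (f x), False))"
  proof (rule pt_fold_add[where B = "\<lambda>n. 10"])
    fix x y and a :: "bool list \<times> bool"
    show "sz (st y a) \<le> sz a + 10"
      using sz_bool[of y] sz_tl[of "fst a"] by (cases a) (simp add: st_def)
  qed (unfold st_def, (intro pt_intros pbd_intros f g)+)
  then have "pt (\<lambda>x. fst (fold st (binary (g x)) (binary (f x), False)) = [] \<and>
      snd (fold st (binary (g x)) (binary (f x), False)))"
    by (intro pt_intros)
  then show ?thesis by (simp only: st) simp
qed

lemma pt_le [pt_intros]: "pt f \<Longrightarrow> pt g \<Longrightarrow> pt (\<lambda>x. (f x :: nat) \<le> g x)"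
  using pt_not[OF pt_less, of g f] by (simp add: not_less)

lemma pt_even [pt_intros]:
  assumes f: "pt f" shows "pt (\<lambda>x. even (f x :: nat))"
proof -
  have "even n \<longleftrightarrow> \<not> (binary n \<noteq> [] \<and> hd (binary n))" for n
    by (cases "n = 0") (auto simp: binary_pos)
  then show ?thesis by (simp only:) (intro pt_intros f)
qed

lemma pt_upt_length [pt_intros]:
  assumes l: "pt l" shows "pt (\<lambda>x. [0..<length (l x)])"
proof -
  obtain b where b: "pbd b" "\<And>x. sz (l x) \<le> b (sz x)" using pt_bound[OF l] by blast
  have eq: "fold (\<lambda>_ z. (Suc (fst z), fst z # snd z)) ys (0, []) = (length ys, rev [0..<length ys])"
    for ys :: "'b list"
    by (induction ys rule: rev_induct) auto
  have "pt (\<lambda>x. fold (\<lambda>_ z. (Suc (fst z), fst z # snd z)) (l x) (0, []))"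
  proof (rule pt_fold[where B = "\<lambda>n. 10 + 10 * b n * (b n + 1)"])
    fix x k
    let ?n = "length (take k (l x))"
    have n: "?n \<le> b (sz x)" using length_le_sz[of "l x"] b(2)[of x] by simp
    have "(\<Sum>x\<leftarrow>[0..<m]. sz x + 1) \<le> m * (4 * m + 2)" for m
    proof -
      have "(\<Sum>x\<leftarrow>[0..<m]. sz x + 1) \<le> (\<Sum>x\<leftarrow>[0..<m]. 4 * m + 2)"
      proof (rule sum_list_mono)
        fix y assume "y \<in> set [0..<m]"
        then show "sz y + 1 \<le> 4 * m + 2" using sz_nat[of y] by simp
      qed
      then show ?thesis by (simp add: sum_list_triv)
    qed
    from this[of ?n] have "sz [0..<?n] \<le> ?n * (4 * ?n + 2) + 1" by (simp add: sz_list)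
    also have "\<dots> \<le> b (sz x) * (4 * b (sz x) + 2) + 1" using n by (intro add_mono mult_mono) auto
    finally have 1: "sz [0..<?n] \<le> b (sz x) * (4 * b (sz x) + 2) + 1" .
    have "sz ?n \<le> 4 * b (sz x) + 1" using sz_nat[of ?n] n by simp
    then show "sz (fold (\<lambda>_ z. (Suc (fst z), fst z # snd z)) (take k (l x)) (0, [])) \<le>
        10 + 10 * b (sz x) * (b (sz x) + 1)"
      unfolding eq using 1 by (simp add: algebra_simps)
  qed (intro pt_intros pbd_intros l b)+
  then have "pt (\<lambda>x. rev (snd (fold (\<lambda>_ z. (Suc (fst z), fst z # snd z)) (l x) (0, []))))"
    by (intro pt_intros)
  then show ?thesis by (simp add: eq)
qed

lemma pt_length [pt_intros]:
  assumes l: "pt l" shows "pt (\<lambda>x. length (l x))"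
proof -
  have "length ys = (if ys = [] then 0 else Suc (hd (rev [0..<length ys])))" for ys :: "'b list"
    by (cases ys rule: rev_cases) auto
  then have "(\<lambda>x. length (l x)) = (\<lambda>x. if l x = [] then 0 else Suc (hd (rev [0..<length (l x)])))"
    by blast
  then show ?thesis by (rule ssubst) (intro pt_intros l)
qed

lemma pt_zip [pt_intros]:
  assumes l: "pt l" and m: "pt m" shows "pt (\<lambda>x. zip (l x) (m x))"
proof -
  define st where "st y z = (if fst z = [] then z else (tl (fst z), (y, hd (fst z)) # snd z))"
    for y :: 'b and z :: "'c list \<times> ('b \<times> 'c) list"
  obtain b where b: "pbd b" "\<And>x. sz (l x) \<le> b (sz x)" using pt_bound[OF l] by blast
  have st: "snd (fold st ys (zs, ws)) = rev (zip ys zs) @ ws" for ys zs ws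
  proof (induction ys arbitrary: zs ws)
    case (Cons y ys)
    then show ?case by (cases zs) (auto simp: st_def)
  qed simp
  have "pt (\<lambda>x. fold st (l x) (m x, []))"
  proof (rule pt_fold_add[where B = "\<lambda>n. b n + 2"])
    fix x y and z :: "'c list \<times> ('b \<times> 'c) list" assume "y \<in> set (l x)"
    then have "sz y \<le> b (sz x)" using sz_elem[of y "l x"] b(2)[of x] by simp
    then show "sz (st y z) \<le> sz z + (b (sz x) + 2)"
      by (cases z; cases "fst z") (auto simp: st_def)
  qed (unfold st_def, (intro pt_intros pbd_intros l m b)+)
  then have "pt (\<lambda>x. rev (snd (fold st (l x) (m x, []))))" by (intro pt_intros)
  then show ?thesis by (simp add: st)
qed

text \<open>Beyond the end of a list \<open>xs ! i\<close> is unspecified, so no program can be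
  given for it; the checker indexes with a default instead.\<close>

definition nthd :: "'a \<Rightarrow> 'a list \<Rightarrow> nat \<Rightarrow> 'a" where
  "nthd d xs i = (if i < length xs then xs ! i else d)"

lemma nthd_simp [simp]: "i < length xs \<Longrightarrow> nthd d xs i = xs ! i"
  by (simp add: nthd_def)

lemma pt_nthd [pt_intros]:
  assumes l: "pt l" and i: "pt i" and d: "pt d" shows "pt (\<lambda>x. nthd (d x) (l x) (i x))"
proof -
  have filt: "filter (\<lambda>z. fst z = j) (zip [k..<k + length xs] xs) =
      (if k \<le> j \<and> j < k + length xs then [(j, xs ! (j - k))] else [])" for j k and xs :: "'b list"
  proof (induction xs arbitrary: k)
    case (Cons x xs)
    have "[k..<k + length (x # xs)] = k # [Suc k..<Suc k + length xs]"
      by (subst upt_conv_Cons) auto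
    then show ?case using Cons[of "Suc k"] by (auto simp: nth_Cons' Suc_le_eq)
  qed simp
  have "nthd e xs j = (let ys = filter (\<lambda>z. fst z = j) (zip [0..<length xs] xs) in
      if ys = [] then e else snd (hd ys))" for e j and xs :: "'b list"
    using filt[of j 0 xs] by (simp add: nthd_def Let_def)
  then show ?thesis
    by (simp only:) (intro pt_intros assms pt_comp[OF i] pt_comp[OF d])
qed

text \<open>Lists of polynomial length serve as unary clocks: time and space of a tableau are ranges
  over such lists. The induction follows Horner's scheme.\<close>

lemma pt_polynomial_list:
  "\<exists>f :: 'a :: treeable list \<Rightarrow> nat list. pt f \<and> (\<forall>xs. length (f xs) = poly (p :: nat poly) (length xs))"
proof (induction p)
  case 0
  show ?case by (intro exI[of _ "\<lambda>xs. []"]) (auto intro: pt_intros)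
next
  case (pCons a p)
  then obtain f :: "'a list \<Rightarrow> nat list" where f: "pt f" "\<And>xs. length (f xs) = poly p (length xs)" by blast
  have "pt (\<lambda>xs. replicate a 0 @ concat (map (\<lambda>_. f xs) xs))"
    by (intro pt_intros pt_comp[OF f(1)])
  moreover have "length (concat (map (\<lambda>_. ys) xs)) = length xs * length ys" for xs :: "'a list" and ys :: "nat list"
    by (induction xs) auto
  ultimately show ?case
    by (intro exI[of _ "\<lambda>xs. replicate a 0 @ concat (map (\<lambda>_. f xs) xs)"]) (auto simp: f)
qed

section \<open>Outcomes and equilibria\<close>

lemma is_history_prefix:
  assumes "is_play G v \<pi>" shows "is_history G v (map \<pi> [0..<Suc n])"
proof -
  have "successively (\<lambda>u v. (u, v) \<in> edges G) (map \<pi> [0..<Suc n])"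
  proof (induction n)
    case (Suc n)
    then show ?case using assms
      by (simp add: successively_append_iff is_play_def)
  qed simp
  moreover have "hd (map \<pi> [0..<Suc n]) = v"
    using assms by (simp add: is_play_def hd_map del: upt_Suc)
  ultimately show ?thesis by (simp add: is_history_def del: upt_Suc)
qed

lemma is_history_append_play:
  assumes "is_history G v0 (h @ [v])" "is_play G v \<pi>"
  shows "is_history G v0 (h @ map \<pi> [0..<Suc n])"
proof (induction n)
  case 0
  then show ?case using assms by (simp add: is_play_def)
next
  case (Suc n)
  have "h @ map \<pi> [0..<Suc (Suc n)] = (h @ map \<pi> [0..<Suc n]) @ [\<pi> (Suc n)]" by simp
  moreover have "last (h @ map \<pi> [0..<Suc n]) = \<pi> n" by simp
  ultimately show ?case
    using Suc assms(2) unfolding is_history_def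
    by (auto simp: successively_append_iff is_play_def hd_append simp del: upt_Suc)
qed

lemma is_history_vertices:
  assumes "is_game G" "is_history G v h" "v \<in> vertices G"
  shows "set h \<subseteq> vertices G"
  using assms(2)
proof (induction h rule: rev_induct)
  case (snoc x h)
  show ?case
  proof (cases "h = []")
    case True
    then show ?thesis using snoc.prems assms(3) by (simp add: is_history_def)
  next
    case False
    then have "is_history G v h" "(last h, x) \<in> edges G"
      using snoc.prems by (auto simp: is_history_def successively_append_iff)
    then show ?thesis using snoc.IH assms(1) by (auto simp: is_game_def)
  qed
qed simp

lemma play_vertices:
  assumes "is_game G" "v \<in> vertices G" "is_play G v \<pi>"
  shows "\<pi> n \<in> vertices G"
  using is_history_vertices[OF assms(1) is_history_prefix[OF assms(3), of n] assms(2)] by auto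

lemma outcome_unique:
  assumes G: "is_game G" "v \<in> vertices G"
    and 1: "is_play G v \<pi>" "\<forall>i\<in>players G. play_compatible G i (\<sigma> i) \<pi>"
    and 2: "is_play G v \<tau>" "\<forall>i\<in>players G. play_compatible G i (\<sigma> i) \<tau>"
  shows "\<pi> = \<tau>"
proof -
  have "map \<pi> [0..<Suc n] = map \<tau> [0..<Suc n]" for n
  proof (induction n)
    case 0
    then show ?case using 1 2 by (simp add: is_play_def)
  next
    case (Suc n)
    then have e: "\<pi> n = \<tau> n" by simp
    let ?i = "controller G (\<pi> n)"
    have "\<pi> n \<in> region G ?i" "?i \<in> players G"
      using play_vertices[OF G 1(1)] G(1) by (auto simp: region_def is_game_def)
    then have "\<pi> (Suc n) = \<sigma> ?i (map \<pi> [0..<Suc n])" "\<tau> (Suc n) = \<sigma> ?i (map \<tau> [0..<Suc n])"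
      using 1(2) 2(2) e unfolding play_compatible_def by auto
    then have "\<pi> (Suc n) = \<tau> (Suc n)" by (simp only: Suc)
    moreover have "map \<rho> [0..<Suc (Suc n)] = map \<rho> [0..<Suc n] @ [\<rho> (Suc n)]" for \<rho> :: "'b word"
      by simp
    ultimately show ?case by (simp only: Suc)
  qed
  from this[of n for n] have "\<pi> n = \<tau> n" for n by simp
  then show ?thesis by blast
qed

lemma outcome_eqI:
  assumes G: "is_game G" "v \<in> vertices G"
    and 1: "is_play G v \<pi>" "\<forall>i\<in>players G. play_compatible G i (\<sigma> i) \<pi>"
  shows "outcome G v \<sigma> = \<pi>"
  unfolding outcome_def using 1 outcome_unique[OF G] by (intro the_equality) blast+

lemma outcome_exists:
  assumes G: "is_game G" "v \<in> vertices G" and \<sigma>: "is_profile G v \<sigma>"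
  shows "\<exists>\<pi>. is_play G v \<pi> \<and> (\<forall>i\<in>players G. play_compatible G i (\<sigma> i) \<pi>)"
proof -
  define ext where "ext h = h @ [\<sigma> (controller G (last h)) h]" for h
  define H where "H n = (ext ^^ n) [v]" for n
  define \<pi> where "\<pi> n = last (H n)" for n
  have HS: "H (Suc n) = H n @ [\<pi> (Suc n)]" "\<pi> (Suc n) = \<sigma> (controller G (\<pi> n)) (H n)" for n
    by (simp_all add: H_def \<pi>_def ext_def)
  have Hm: "H n = map \<pi> [0..<Suc n]" for n
  proof (induction n)
    case 0 show ?case by (simp add: H_def \<pi>_def)
  next
    case (Suc n) then show ?case using HS(1)[of n] by simp
  qed
  have hist: "is_history G v (H n)" for n
  proof (induction n)
    case 0 show ?case by (simp add: H_def is_history_def)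
  next
    case (Suc n)
    let ?i = "controller G (\<pi> n)"
    have ne: "H n \<noteq> []" using Hm[of n] by simp
    have "\<pi> n \<in> vertices G"
      using is_history_vertices[OF G(1) Suc G(2)] ne by (auto simp: \<pi>_def)
    then have "\<pi> n \<in> region G ?i" "?i \<in> players G" using G(1) by (auto simp: region_def is_game_def)
    moreover have "H n = butlast (H n) @ [\<pi> n]" using ne by (simp add: \<pi>_def)
    ultimately have "(\<pi> n, \<pi> (Suc n)) \<in> edges G"
      using \<sigma> Suc HS(2)[of n] unfolding is_profile_def is_strategy_def by metis
    moreover have "last (H n) = \<pi> n" by (simp add: \<pi>_def)
    ultimately show ?case using Suc ne unfolding HS(1)
      by (simp add: is_history_def successively_append_iff)
  qed
  have "is_play G v \<pi>"
  proof -
    have "(\<pi> n, \<pi> (Suc n)) \<in> edges G" for n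
    proof -
      have "successively (\<lambda>u v. (u, v) \<in> edges G) (H n @ [\<pi> (Suc n)])"
        using hist[of "Suc n"] by (simp only: is_history_def HS(1))
      moreover have "H n \<noteq> []" using hist[of n] by (simp add: is_history_def)
      moreover have "last (H n) = \<pi> n" by (simp add: \<pi>_def)
      ultimately show ?thesis by (simp add: successively_append_iff)
    qed
    then show ?thesis by (simp add: is_play_def \<pi>_def H_def)
  qed
  moreover have "play_compatible G i (\<sigma> i) \<pi>" for i
    using HS(2) Hm by (auto simp: play_compatible_def region_def simp del: upt_Suc)
  ultimately show ?thesis by blast
qed

lemma outcome_props:
  assumes G: "is_game G" "v \<in> vertices G" and \<sigma>: "is_profile G v \<sigma>"
  shows "is_play G v (outcome G v \<sigma>)"
    and "\<And>i. i \<in> players G \<Longrightarrow> play_compatible G i (\<sigma> i) (outcome G v \<sigma>)"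
proof -
  obtain \<pi> where "is_play G v \<pi>" "\<forall>i\<in>players G. play_compatible G i (\<sigma> i) \<pi>"
    using outcome_exists[OF assms] by blast
  with outcome_eqI[OF G this] show "is_play G v (outcome G v \<sigma>)"
    and "\<And>i. i \<in> players G \<Longrightarrow> play_compatible G i (\<sigma> i) (outcome G v \<sigma>)" by auto
qed

text \<open>The outcomes of unilateral deviations are exactly the plays compatible with the
  strategies of all other players, so equilibria can be treated with plays in place of deviating
  strategies.\<close>

lemma fixed_NE_iff:
  assumes G: "is_game G" "v \<in> vertices G"
  shows "fixed_NE G L v \<sigma> \<longleftrightarrow> is_profile G v \<sigma> \<and>
    (\<forall>i\<in>players G - {L}. \<forall>\<pi>. is_play G v \<pi> \<and>
       (\<forall>k\<in>players G - {i}. play_compatible G k (\<sigma> k) \<pi>) \<longrightarrow>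
       payoff G \<pi> i \<le> payoff G (outcome G v \<sigma>) i)"
proof (cases "is_profile G v \<sigma>")
  case True
  have "(\<forall>s. is_strategy G v i s \<longrightarrow>
        payoff G (outcome G v (\<sigma>(i := s))) i \<le> payoff G (outcome G v \<sigma>) i) \<longleftrightarrow>
    (\<forall>\<pi>. is_play G v \<pi> \<and> (\<forall>k\<in>players G - {i}. play_compatible G k (\<sigma> k) \<pi>) \<longrightarrow>
       payoff G \<pi> i \<le> payoff G (outcome G v \<sigma>) i)" (is "?l \<longleftrightarrow> ?r")
    if i: "i \<in> players G" for i
  proof
    assume l: ?l
    show ?r
    proof (intro allI impI)
      fix \<pi> assume \<pi>: "is_play G v \<pi> \<and> (\<forall>k\<in>players G - {i}. play_compatible G k (\<sigma> k) \<pi>)"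
      \<comment> \<open>Follows the given play on its own prefixes and the old strategy elsewhere;
        this is a legal strategy whose outcome is that play.\<close>
      define s where "s h = (if h \<noteq> [] \<and> h = map \<pi> [0..<length h] then \<pi> (length h) else \<sigma> i h)" for h
      have s: "s (map \<pi> [0..<Suc n]) = \<pi> (Suc n)" for n
        unfolding s_def length_map length_upt by (simp del: upt_Suc)
      have "(u, s (h @ [u])) \<in> edges G" if "is_history G v (h @ [u])" "u \<in> region G i" for h u
      proof (cases "h @ [u] = map \<pi> [0..<length (h @ [u])]")
        case True
        then have "u = \<pi> (length h)" by simp
        then show ?thesis using True \<pi> by (simp add: s_def is_play_def)
      next
        case False
        then have "s (h @ [u]) = \<sigma> i (h @ [u])" unfolding s_def by presburger
        then show ?thesis using \<open>is_profile G v \<sigma>\<close> i that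
          by (auto simp: is_profile_def is_strategy_def)
      qed
      then have "is_strategy G v i s" by (auto simp: is_strategy_def)
      moreover have "outcome G v (\<sigma>(i := s)) = \<pi>"
        using \<pi> s by (intro outcome_eqI[OF G]) (auto simp: play_compatible_def simp del: upt_Suc)
      ultimately show "payoff G \<pi> i \<le> payoff G (outcome G v \<sigma>) i" using l by metis
    qed
  next
    assume r: ?r
    show ?l
    proof (intro allI impI)
      fix s assume s: "is_strategy G v i s"
      have p: "is_profile G v (\<sigma>(i := s))" using True s by (auto simp: is_profile_def)
      have "play_compatible G k (\<sigma> k) (outcome G v (\<sigma>(i := s)))" if "k \<in> players G - {i}" for k
        using outcome_props(2)[OF G p, of k] that by auto
      then show "payoff G (outcome G v (\<sigma>(i := s))) i \<le> payoff G (outcome G v \<sigma>) i"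
        using r outcome_props(1)[OF G p] by blast
    qed
  qed
  then show ?thesis using True by (simp add: fixed_NE_def)
qed (simp add: fixed_NE_def)

text \<open>Prefix independence: only what occurs infinitely often counts, so all subgames are
  played with the same payoff.\<close>

lemma subgame_parity:
  assumes "payoff G = parity_payoff \<kappa>" shows "subgame G h = G"
proof -
  have "(\<lambda>\<pi>. payoff G (h \<frown> \<pi>)) = payoff G"
    by (auto simp: assms parity_payoff_def fun_eq_iff)
  then show ?thesis by (simp add: subgame_def)
qed

section \<open>Positional determinacy\<close>

text \<open>The winning region is a nested fixpoint, one fixpoint per colour, so that for an arbitrary
  monotone one-step operator the approximation stages of the least fixpoints give progress measures.
  Determinacy is the duality of least and greatest fixpoints.\<close>

fun nested :: "((nat \<Rightarrow> 'd set) \<Rightarrow> 'd set) \<Rightarrow> (nat \<Rightarrow> bool) \<Rightarrow> nat \<Rightarrow> nat \<Rightarrow> (nat \<Rightarrow> 'd set) \<Rightarrow> 'd set" where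
  "nested Pre P k 0 X = Pre X"
| "nested Pre P k (Suc j) X =
     (if P k then lfp (\<lambda>Z. nested Pre P (Suc k) j (X(k := Z)))
      else gfp (\<lambda>Z. nested Pre P (Suc k) j (X(k := Z))))"

lemma nested_mono:
  assumes "\<And>X X'. (\<And>c. X c \<subseteq> X' c) \<Longrightarrow> Pre X \<subseteq> Pre X'" "\<And>c. X c \<subseteq> X' c"
  shows "nested Pre P k j X \<subseteq> nested Pre P k j X'"
  using assms(2)
proof (induction j arbitrary: k X X')
  case 0
  then show ?case using assms(1) by simp
next
  case (Suc j)
  have "nested Pre P (Suc k) j (X(k := Z)) \<subseteq> nested Pre P (Suc k) j (X'(k := Z))" for Z
    using Suc.prems by (intro Suc.IH) auto
  then show ?case by (auto intro!: lfp_mono gfp_mono)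
qed

lemma nested_mono_fun:
  assumes "\<And>X X'. (\<And>c. X c \<subseteq> X' c) \<Longrightarrow> Pre X \<subseteq> Pre X'"
  shows "mono (\<lambda>Z. nested Pre P k j (X(l := Z)))"
  using nested_mono[OF assms] by (intro monoI) auto

lemma nested_subset:
  assumes "\<And>X. Pre X \<subseteq> S"
  shows "nested Pre P k j X \<subseteq> S"
proof (induction j arbitrary: k X)
  case (Suc j)
  have F: "nested Pre P (Suc k) j (X(k := Z)) \<subseteq> S" for Z by (rule Suc)
  then have "lfp (\<lambda>Z. nested Pre P (Suc k) j (X(k := Z))) \<subseteq> S" by (rule lfp_lowerbound)
  moreover have "gfp (\<lambda>Z. nested Pre P (Suc k) j (X(k := Z))) \<subseteq> S"
    by (rule gfp_least) (use F in blast)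
  ultimately show ?case by simp
qed (use assms in simp)

text \<open>The condition of a progress measure for a move of colour \<open>c\<close>, with one rank
  \<open>r e\<close> for each colour \<open>e\<close> in \<open>P\<close>, that is, for each colour
  that must not be the least recurring one. Every rank of index up to \<open>c\<close> is compared
  separately, not lexicographically, and only that of index \<open>c\<close> has to
  decrease.\<close>

abbreviation drops :: "(nat \<Rightarrow> bool) \<Rightarrow> nat \<Rightarrow> nat \<Rightarrow> (nat \<Rightarrow> 'd \<Rightarrow> nat) \<Rightarrow> 'd \<Rightarrow> 'd \<Rightarrow> bool" where
  "drops P k c r d d' \<equiv> \<forall>e. P e \<and> k \<le> e \<and> e \<le> c \<longrightarrow> r e d' \<le> r e d \<and> (e = c \<longrightarrow> r e d' < r e d)"

abbreviation descends :: "(nat \<Rightarrow> bool) \<Rightarrow> nat \<Rightarrow> (nat \<Rightarrow> 'd \<Rightarrow> nat) \<Rightarrow> 'd \<Rightarrow> 'd \<Rightarrow> bool" where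
  "descends P c r d d' \<equiv> \<forall>e. P e \<and> e \<le> c \<longrightarrow> r e d' \<le> r e d \<and> (e = c \<longrightarrow> r e d' < r e d)"

text \<open>Colours not bound by a fixpoint keep their targets in \<open>X\<close>; a move of a
  bound colour must stay in \<open>W\<close> and respect the ranks.\<close>

abbreviation layer where
  "layer P k j X W r d \<equiv> \<lambda>c. if c < k \<or> k + j \<le> c then X c else {d' \<in> W. drops P k c r d d'}"

text \<open>Induction on the number of bound colours. At a greatest fixpoint unfolding suffices,
  since colour \<open>k\<close> then imposes no condition. At a least fixpoint the rank for
  \<open>k\<close> is the approximation stage; the ranks for higher colours, obtained from the
  induction hypothesis for each stage separately, are merged with the stage into one number.\<close>

lemma nested_ranks:
  assumes Pre: "\<forall>X X'. (\<forall>c. X c \<subseteq> X' c) \<longrightarrow> Pre X \<subseteq> Pre X'" "\<forall>X. Pre X \<subseteq> S" "finite S"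
  shows "\<exists>r :: nat \<Rightarrow> 'd \<Rightarrow> nat. \<forall>d\<in>nested Pre P k j X. d \<in> Pre (layer P k j X (nested Pre P k j X) r d)"
proof (induction j arbitrary: k X)
  case 0
  have "(\<lambda>c. if c < k \<or> k \<le> c then X c else A c) = X" for A :: "nat \<Rightarrow> 'd set" by (auto simp: fun_eq_iff)
  then show ?case by simp
next
  case (Suc j)
  have mono: "Pre X \<subseteq> Pre X'" if "\<And>c. X c \<subseteq> X' c" for X X' using Pre(1) that by blast
  have S: "Pre X \<subseteq> S" "finite S" for X using Pre(2,3) by blast+
  define F where "F Z = nested Pre P (Suc k) j (X(k := Z))" for Z
  have F: "mono F" unfolding F_def by (rule nested_mono_fun[OF mono])
  have FS: "F Z \<subseteq> S" for Z unfolding F_def by (rule nested_subset[OF S(1)])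
  show ?case
  proof (cases "P k")
    case False
    define Z where "Z = gfp F"
    have Z: "nested Pre P k (Suc j) X = Z" using False by (simp add: Z_def F_def[abs_def])
    have FZ: "F Z = Z" unfolding Z_def using gfp_unfold[OF F] by simp
    obtain r where r: "\<forall>d\<in>F Z. d \<in> Pre (layer P (Suc k) j (X(k := Z)) (F Z) r d)"
      using Suc.IH[of "Suc k" "X(k := Z)"] unfolding F_def by blast
    have "d \<in> Pre (layer P k (Suc j) X Z r d)" if "d \<in> Z" for d
    proof (rule subsetD[OF mono])
      show "d \<in> Pre (layer P (Suc k) j (X(k := Z)) Z r d)"
        using r that unfolding FZ by blast
      have sk: "Suc k \<le> e" if "P e" "k \<le> e" for e using that False by (cases "e = k") auto
      fix c
      consider "c < k \<or> k + Suc j \<le> c" | "c = k" | "k < c" "c < k + Suc j" by linarith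
      then show "layer P (Suc k) j (X(k := Z)) Z r d c \<subseteq> layer P k (Suc j) X Z r d c"
      proof cases
        case 2
        then have "(P e \<and> k \<le> e \<and> e \<le> c) = False" for e using False by (metis le_antisym)
        then show ?thesis using 2 by (simp only:) simp
      next
        case 3
        have eq: "P e \<and> Suc k \<le> e \<and> e \<le> c \<longleftrightarrow> P e \<and> k \<le> e \<and> e \<le> c" for e
          using sk[of e] by (auto dest: Suc_leD)
        show ?thesis using 3 by (simp only: eq) simp
      qed auto
    qed
    then show ?thesis unfolding Z by (intro exI[of _ r] ballI)
  next
    case True
    define Z where "Z = lfp F"
    have Z: "nested Pre P k (Suc j) X = Z" using True by (simp add: Z_def F_def[abs_def])
    \<comment> \<open>The approximants of the least fixpoint. By finiteness of \<open>S\<close> they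
      reach it after some \<open>N\<close> stages.\<close>
    define Y where "Y n = (F ^^ n) {}" for n
    have Y0: "Y 0 = {}" and YS: "Y (Suc n) = F (Y n)" for n by (simp_all add: Y_def)
    have Ymono1: "Y n \<subseteq> Y (Suc n)" for n
      by (induction n) (auto simp: Y0 YS dest: monoD[OF F, THEN subsetD])
    have Ymono: "n \<le> m \<Longrightarrow> Y n \<subseteq> Y m" for n m using lift_Suc_mono_le[of Y] Ymono1 by blast
    have YZ: "Y n \<subseteq> Z" for n
      by (induction n) (use F lfp_unfold[OF F] in \<open>auto simp: Y0 YS Z_def dest: monoD[THEN subsetD]\<close>)
    have fin: "finite Z" using FS lfp_unfold[OF F] S(2) unfolding Z_def by (metis finite_subset)
    have "\<exists>n. Z \<subseteq> Y n"
    proof -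
      let ?U = "\<Union>n. Y n"
      have "finite ?U" using YZ fin by (meson UN_least finite_subset)
      then obtain n where n: "?U \<subseteq> Y n"
      proof -
        assume *: "\<And>n. ?U \<subseteq> Y n \<Longrightarrow> thesis"
        have "finite A \<Longrightarrow> A \<subseteq> ?U \<Longrightarrow> \<exists>n. A \<subseteq> Y n" for A
        proof (induction A rule: finite_induct)
          case (insert a A)
          then obtain n m where "A \<subseteq> Y n" "a \<in> Y m" by blast
          then have "insert a A \<subseteq> Y (max n m)" using Ymono[of n "max n m"] Ymono[of m "max n m"] by auto
          then show ?case by blast
        qed simp
        then show thesis using \<open>finite ?U\<close> * by blast
      qed
      then have "F (Y n) \<subseteq> Y n" using YS by blast
      then have "Z \<subseteq> Y n" unfolding Z_def by (rule lfp_lowerbound)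
      then show ?thesis by blast
    qed
    then obtain N where N: "Z \<subseteq> Y N" by blast
    define lv where "lv d = (LEAST n. d \<in> Y (Suc n))" for d
    have lv: "d \<in> Y (Suc (lv d))" "lv d < N" if "d \<in> Z" for d
    proof -
      have dN: "d \<in> Y N" using N that by blast
      then have "N \<noteq> 0" using Y0 by (metis empty_iff)
      then have dn: "d \<in> Y (Suc (N - 1))" using dN by simp
      show "d \<in> Y (Suc (lv d))" unfolding lv_def by (rule LeastI) (rule dn)
      have "lv d \<le> N - 1" unfolding lv_def by (rule Least_le) (rule dn)
      then show "lv d < N" using \<open>N \<noteq> 0\<close> by simp
    qed
    have lv_le: "lv d \<le> n" if "d \<in> Y (Suc n)" for d n
      unfolding lv_def using that by (rule Least_le)
    have lv_less: "lv d < n" if "d \<in> Y n" for d n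
    proof (cases n)
      case (Suc m) then show ?thesis using lv_le[of d m] that by simp
    qed (use that Y0 in simp)
    define \<Phi> where "\<Phi> n r \<longleftrightarrow> (\<forall>d\<in>Y (Suc n). d \<in> Pre (layer P (Suc k) j (X(k := Y n)) (Y (Suc n)) r d))" for n and r :: "nat \<Rightarrow> 'd \<Rightarrow> nat"
    have "\<exists>r. \<Phi> n r" for n
      using Suc.IH[of "Suc k" "X(k := Y n)"] unfolding YS F_def \<Phi>_def .
    then obtain q where "\<And>n. \<Phi> n (q n)" by metis
    then have q: "\<And>n d. d \<in> Y (Suc n) \<Longrightarrow>
      d \<in> Pre (layer P (Suc k) j (X(k := Y n)) (Y (Suc n)) (q n) d)"
      unfolding \<Phi>_def by (rule bspec)
    \<comment> \<open>A strict bound on all inner ranks of stages below \<open>N\<close>, used as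
      the base of the merged ranks.\<close>
    define B where "B = Suc (Max ((\<lambda>(n, e, d). q n e d) ` ({..<N} \<times> {..k + j} \<times> Z)))"
    have B: "q n e d < B" if "n < N" "e \<le> k + j" "d \<in> Z" for n e d
    proof -
      have "q n e d \<le> Max ((\<lambda>(n, e, d). q n e d) ` ({..<N} \<times> {..k + j} \<times> Z))"
        using that fin by (intro Max_ge) (auto intro!: image_eqI[of _ _ "(n, e, d)"])
      then show ?thesis by (simp add: B_def)
    qed
    \<comment> \<open>Stage first, inner rank second: a move to an earlier stage lowers all ranks
      for colours above \<open>k\<close>, whatever the inner ranks are at that stage.\<close>
    define r where "r e d = (if e = k then lv d else lv d * B + q (lv d) e d)" for e d
    have "d \<in> Pre (layer P k (Suc j) X Z r d)" if d: "d \<in> Z" for d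
    proof (rule subsetD[OF mono])
      let ?n = "lv d"
      \<comment> \<open>At stage \<open>?n\<close> the set substituted for colour \<open>k\<close>
        is \<open>Y ?n\<close>. Hence a move of colour \<open>k\<close> leads to a strictly earlier
        stage and a move of a higher bound colour to one that is not later.\<close>
      show "d \<in> Pre (layer P (Suc k) j (X(k := Y ?n)) (Y (Suc ?n)) (q ?n) d)"
        by (rule q) (rule lv(1)[OF d])
      fix c
      consider "c < k \<or> k + Suc j \<le> c" | "c = k" | "k < c" "c < k + Suc j" by linarith
      then show "layer P (Suc k) j (X(k := Y ?n)) (Y (Suc ?n)) (q ?n) d c \<subseteq>
        layer P k (Suc j) X Z r d c"
      proof cases
        case 1
        then show ?thesis by auto
      next
        case 2
        then show ?thesis using YZ lv_less by (auto simp: r_def intro: less_imp_le)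
      next
        case 3
        have "d' \<in> Z \<and> (\<forall>e. P e \<and> k \<le> e \<and> e \<le> c \<longrightarrow> r e d' \<le> r e d \<and> (e = c \<longrightarrow> r e d' < r e d))"
          if d': "d' \<in> Y (Suc ?n)" and e': "\<forall>e. P e \<and> Suc k \<le> e \<and> e \<le> c \<longrightarrow>
        q ?n e d' \<le> q ?n e d \<and> (e = c \<longrightarrow> q ?n e d' < q ?n e d)" for d'
        proof (intro conjI allI impI)
          show d'Z: "d' \<in> Z" using d' YZ by blast
          fix e assume e: "P e \<and> k \<le> e \<and> e \<le> c"
          have le: "lv d' \<le> ?n" using lv_le[OF d'] .
          have "r e d' \<le> r e d \<and> (e = c \<longrightarrow> r e d' < r e d)"
          proof (cases "e = k")
            case True
            then show ?thesis using le 3 by (simp add: r_def)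
          next
            case ne: False
            show ?thesis
            proof (cases "lv d' = ?n")
              case True
              have "q ?n e d' \<le> q ?n e d \<and> (e = c \<longrightarrow> q ?n e d' < q ?n e d)"
                using e'[THEN spec, of e] e ne by simp
              then show ?thesis using True ne by (simp add: r_def)
            next
              case False
              have "r e d' < lv d' * B + B" using B[of "lv d'" e d'] lv(2)[OF d'Z] e 3 d'Z ne
                by (simp add: r_def)
              also have "\<dots> = Suc (lv d') * B" by simp
              also have "\<dots> \<le> ?n * B" using False le by (intro mult_le_mono1) simp
              also have "\<dots> \<le> r e d" using ne by (simp add: r_def)
              finally have "r e d' < r e d" .
              then show ?thesis by (intro conjI impI less_imp_le)
            qed
          qed
          then show "r e d' \<le> r e d" "e = c \<Longrightarrow> r e d' < r e d" by blast+
        qed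
        then show ?thesis using 3 by auto
      qed
    qed
    then show ?thesis unfolding Z by (intro exI[of _ r] ballI)
  qed
qed

section \<open>Duality of the nested fixpoints\<close>

lemma lfp_gfp_dual:
  fixes F :: "'a set \<Rightarrow> 'a set"
  assumes F: "mono F" and FS: "\<And>Z. F Z \<subseteq> S" and FI: "\<And>Z. F (Z \<inter> S) = F Z"
  shows "S - lfp F = gfp (\<lambda>Z. S - F (S - Z))" "S - gfp F = lfp (\<lambda>Z. S - F (S - Z))"
proof -
  let ?D = "\<lambda>Z. S - F (S - Z)"
  have D: "mono ?D"
  proof (rule monoI)
    fix A B :: "'a set" assume "A \<subseteq> B"
    then have "F (S - B) \<subseteq> F (S - A)" by (intro monoD[OF F]) auto
    then show "?D A \<subseteq> ?D B" by blast
  qed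
  have SS: "S - (S - Z) = Z \<inter> S" for Z by auto
  show "S - lfp F = gfp ?D"
  proof
    have "?D (S - lfp F) = S - lfp F" unfolding SS FI using lfp_unfold[OF F] by simp
    then show "S - lfp F \<subseteq> gfp ?D" by (intro gfp_upperbound) simp
    have g: "gfp ?D = S - F (S - gfp ?D)" using gfp_unfold[OF D] .
    have "F (S - gfp ?D) \<subseteq> S - gfp ?D" using g FS by blast
    then have "lfp F \<subseteq> S - gfp ?D" by (rule lfp_lowerbound)
    then show "gfp ?D \<subseteq> S - lfp F" using g by blast
  qed
  show "S - gfp F = lfp ?D"
  proof
    have "?D (S - gfp F) = S - gfp F" unfolding SS FI using gfp_unfold[OF F] by simp
    then show "lfp ?D \<subseteq> S - gfp F" by (intro lfp_lowerbound) simp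
    have g: "lfp ?D = S - F (S - lfp ?D)" using lfp_unfold[OF D] .
    have "S - lfp ?D \<subseteq> F (S - lfp ?D)" using g by blast
    then have "S - lfp ?D \<subseteq> gfp F" by (rule gfp_upperbound)
    then show "S - gfp F \<subseteq> lfp ?D" by blast
  qed
qed

lemma nested_restrict:
  assumes PI: "\<And>X. Pre (\<lambda>c. X c \<inter> S) = Pre X"
  shows "nested Pre P k j (\<lambda>c. X c \<inter> S) = nested Pre P k j X"
proof (induction j arbitrary: k X)
  case 0 then show ?case by (simp add: PI)
next
  case (Suc j)
  have "nested Pre P (Suc k) j ((\<lambda>c. X c \<inter> S)(k := Z)) = nested Pre P (Suc k) j (X(k := Z))" for Z
  proof -
    have "(\<lambda>c. ((\<lambda>c. X c \<inter> S)(k := Z)) c \<inter> S) = (\<lambda>c. (X(k := Z)) c \<inter> S)" by (auto simp: fun_eq_iff)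
    then show ?thesis using Suc[of "Suc k" "(\<lambda>c. X c \<inter> S)(k := Z)"] Suc[of "Suc k" "X(k := Z)"] by metis
  qed
  then show ?case by simp
qed

text \<open>Complementation in \<open>S\<close> exchanges least and greatest fixpoints one colour at
  a time. A double complement is an intersection with \<open>S\<close>, which is why the operator
  must depend on its arguments only inside \<open>S\<close>.\<close>

lemma nested_dual:
  assumes mono: "\<And>X X'. (\<And>c. X c \<subseteq> X' c) \<Longrightarrow> Pre X \<subseteq> Pre X'"
    and S: "\<And>X. Pre X \<subseteq> S" and PI: "\<And>X. Pre (\<lambda>c. X c \<inter> S) = Pre X"
  shows "S - nested Pre P k j X =
    nested (\<lambda>X. S - Pre (\<lambda>c. S - X c)) (\<lambda>e. \<not> P e) k j (\<lambda>c. S - X c)"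
proof (induction j arbitrary: k X)
  case 0
  have "(\<lambda>c. S - (S - X c)) = (\<lambda>c. X c \<inter> S)" by auto
  then show ?case by (simp add: PI)
next
  case (Suc j)
  let ?F = "\<lambda>Z. nested Pre P (Suc k) j (X(k := Z))"
  let ?Pre = "\<lambda>X. S - Pre (\<lambda>c. S - X c)"
  have PI': "?Pre (\<lambda>c. X c \<inter> S) = ?Pre X" for X
    by (rule arg_cong[where f = "\<lambda>Y. S - Pre Y"]) auto
  note restrict = nested_restrict[where S = S and Pre = Pre, OF PI]
    nested_restrict[where S = S and Pre = ?Pre, OF PI']
  have F: "mono ?F" by (rule nested_mono_fun[OF mono])
  have FS: "?F Z \<subseteq> S" for Z by (rule nested_subset[OF S])
  have FI: "?F (Z \<inter> S) = ?F Z" for Z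
  proof -
    have "(\<lambda>c. (X(k := Z \<inter> S)) c \<inter> S) = (\<lambda>c. (X(k := Z)) c \<inter> S)" by (auto simp: fun_eq_iff)
    then show ?thesis
      using restrict(1)[of P "Suc k" j "X(k := Z \<inter> S)"] restrict(1)[of P "Suc k" j "X(k := Z)"] by metis
  qed
  have D: "S - ?F (S - Z) = nested ?Pre (\<lambda>e. \<not> P e) (Suc k) j ((\<lambda>c. S - X c)(k := Z))" for Z
  proof -
    have "S - ?F (S - Z) = nested ?Pre (\<lambda>e. \<not> P e) (Suc k) j (\<lambda>c. S - (X(k := S - Z)) c)"
      by (rule Suc)
    moreover have "(\<lambda>c. (S - (X(k := S - Z)) c) \<inter> S) = (\<lambda>c. ((\<lambda>c. S - X c)(k := Z)) c \<inter> S)"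
      by (auto simp: fun_eq_iff)
    ultimately show ?thesis using restrict(2) by metis
  qed
  show ?case using lfp_gfp_dual[OF F FS FI] by (simp add: D)
qed

text \<open>One side picks a set \<open>C\<close> in \<open>A d\<close>, the other an element
  \<open>(c, d')\<close> of it, where \<open>c\<close> is the colour of the move. In
  \<open>W\<close> the ranks for even colours exclude an even least recurring colour; outside, every
  choice has an answer for which the ranks for odd colours exclude an odd one. The winning choices
  depend only on the present point and, for the second side, on \<open>C\<close>.\<close>

lemma positional_determinacy:
  fixes A :: "'d \<Rightarrow> (nat \<times> 'd) set set"
  assumes "finite (S :: 'd set)"
    and options: "\<forall>d\<in>S. \<forall>C\<in>A d. \<forall>c d'. (c, d') \<in> C \<longrightarrow> c < m \<and> d' \<in> S"
  shows "\<exists>W r r'. W \<subseteq> S \<and>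
    (\<forall>d\<in>W. \<exists>C\<in>A d. \<forall>(c, d')\<in>C. d' \<in> W \<and> descends even c r d d') \<and>
    (\<forall>d\<in>S - W. \<forall>C\<in>A d. \<exists>(c, d')\<in>C. d' \<in> S - W \<and> descends odd c r' d d')"
proof -
  have A: "c < m \<and> d' \<in> S" if "d \<in> S" "C \<in> A d" "(c, d') \<in> C" for d C c d'
    using options that by blast
  define Pre where "Pre X = {d\<in>S. \<exists>C\<in>A d. \<forall>z\<in>C. snd z \<in> X (fst z)}" for X :: "nat \<Rightarrow> 'd set"
  define Q where "Q X = S - Pre (\<lambda>c. S - X c)" for X
  have mono: "Pre X \<subseteq> Pre X'" if X: "\<And>c. X c \<subseteq> X' c" for X X'
  proof
    fix d assume "d \<in> Pre X"
    then obtain C where "d \<in> S" "C \<in> A d" "\<forall>z\<in>C. snd z \<in> X (fst z)" by (auto simp: Pre_def)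
    moreover from this have "\<forall>z\<in>C. snd z \<in> X' (fst z)" using X by blast
    ultimately show "d \<in> Pre X'" by (auto simp: Pre_def)
  qed
  have PS: "Pre X \<subseteq> S" for X by (auto simp: Pre_def)
  have PI: "Pre (\<lambda>c. X c \<inter> S) = Pre X" for X
  proof
    show "Pre (\<lambda>c. X c \<inter> S) \<subseteq> Pre X" by (rule mono) simp
    show "Pre X \<subseteq> Pre (\<lambda>c. X c \<inter> S)"
    proof
      fix d assume "d \<in> Pre X"
      then obtain C where C: "d \<in> S" "C \<in> A d" "\<forall>z\<in>C. snd z \<in> X (fst z)" by (auto simp: Pre_def)
      then have "\<forall>z\<in>C. snd z \<in> X (fst z) \<inter> S" using A[OF C(1,2)] by auto
      then show "d \<in> Pre (\<lambda>c. X c \<inter> S)" using C by (auto simp: Pre_def)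
    qed
  qed
  have Qmono: "Q X \<subseteq> Q X'" if "\<And>c. X c \<subseteq> X' c" for X X'
    using mono[of "\<lambda>c. S - X' c" "\<lambda>c. S - X c"] that unfolding Q_def by blast
  have QS: "Q X \<subseteq> S" for X by (auto simp: Q_def)
  have mono': "\<forall>X X'. (\<forall>c. X c \<subseteq> X' c) \<longrightarrow> Pre X \<subseteq> Pre X'"
    and Qmono': "\<forall>X X'. (\<forall>c. X c \<subseteq> X' c) \<longrightarrow> Q X \<subseteq> Q X'"
    and PS': "\<forall>X. Pre X \<subseteq> S" and QS': "\<forall>X. Q X \<subseteq> S"
    using mono Qmono PS QS by blast+
  \<comment> \<open>Colour 0 is bound outermost. All colours of moves are below \<open>m\<close> and
    hence bound; the empty set stands for the remaining ones, and \<open>S\<close> does in the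
    dual.\<close>
  define W where "W = nested Pre even 0 m (\<lambda>_. {})"
  have dual: "S - W = nested Q (\<lambda>e. \<not> even e) 0 m (\<lambda>c. S - {})"
    unfolding W_def Q_def[abs_def] by (rule nested_dual[where Pre = Pre and S = S, OF mono PS PI])
  obtain r where r: "\<forall>d\<in>W. d \<in> Pre (layer even 0 m (\<lambda>_. {}) W r d)"
    using nested_ranks[OF mono' PS' assms(1), of even 0 m "\<lambda>_. {}", folded W_def]
    by (elim exE) (rule that)
  obtain r' where r': "\<forall>d\<in>S - W. d \<in> Q (layer odd 0 m (\<lambda>_. S - {}) (S - W) r' d)"
    using nested_ranks[OF Qmono' QS' assms(1), of "\<lambda>e. \<not> even e" 0 m "\<lambda>c. S - {}", folded dual]
    by (elim exE) (rule that)
  show ?thesis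
  proof (rule exI[of _ W], rule exI[of _ r], rule exI[of _ r'], intro conjI ballI)
    show "W \<subseteq> S" unfolding W_def by (rule nested_subset[of Pre S, OF PS])
    fix d assume "d \<in> W"
    have "d \<in> Pre (layer even 0 m (\<lambda>_. {}) W r d)"
      using r[THEN bspec, OF \<open>d \<in> W\<close>] .
    then obtain C where C: "C \<in> A d"
      "\<forall>z\<in>C. snd z \<in> (if fst z < 0 \<or> 0 + m \<le> fst z then {}
     else {d' \<in> W. drops even 0 (fst z) r d d'})"
      unfolding Pre_def by blast
    have "case z of (c, d') \<Rightarrow> d' \<in> W \<and> descends even c r d d'" if "z \<in> C" for z
      using C(2)[THEN bspec, OF that] by (cases z) (simp split: if_splits)
    then show "\<exists>C\<in>A d. \<forall>(c, d')\<in>C. d' \<in> W \<and> descends even c r d d'"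
      using C(1) by (intro bexI[of _ C] ballI)
  next
    fix d C assume d: "d \<in> S - W" "C \<in> A d"
    let ?X = "\<lambda>c. if c < 0 \<or> 0 + m \<le> c then S - {}
     else {d' \<in> S - W. drops odd 0 c r' d d'}"
    have "d \<in> Q ?X" using r'[THEN bspec, OF d(1)] .
    then have "\<not> (\<forall>z\<in>C. snd z \<in> S - ?X (fst z))"
      using d unfolding Q_def Pre_def by blast
    then obtain z where z: "z \<in> C" "snd z \<notin> S - ?X (fst z)" by blast
    have zm: "fst z < m" "snd z \<in> S" using A[OF _ d(2), of "fst z" "snd z"] d(1) z(1) by auto
    then have "snd z \<in> ?X (fst z)" using z(2) by blast
    then have "case z of (c, d') \<Rightarrow> d' \<in> S - W \<and> descends odd c r' d d'"
      using zm by (cases z) (simp split: if_splits)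
    then show "\<exists>(c, d')\<in>C. d' \<in> S - W \<and> descends odd c r' d d'"
      using z(1) by (intro bexI[of _ z])
  qed
qed

text \<open>A play is cut into segments; on the ranks of the segments that see no smaller colour, colour \<open>e\<close>
  causes a descent.\<close>

lemma segment_parity:
  fixes col :: "nat \<Rightarrow> nat" and \<tau> :: "nat \<Rightarrow> nat" and R :: "nat \<Rightarrow> nat \<Rightarrow> nat"
  assumes fin: "finite (range col)" and \<tau>: "strict_mono \<tau>"
    and R: "\<And>k e. P e \<Longrightarrow> e \<in> range col \<Longrightarrow> \<forall>n\<in>{\<tau> k..<\<tau> (Suc k)}. e \<le> col n \<Longrightarrow>
      R e (Suc k) \<le> R e k \<and> ((\<exists>n\<in>{\<tau> k..<\<tau> (Suc k)}. col n = e) \<longrightarrow> R e (Suc k) < R e k)"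
  shows "\<not> P (Min (limit col))"
proof
  assume P: "P (Min (limit col))"
  let ?e = "Min (limit col)"
  have finl: "finite (limit col)" using fin limit_in_range finite_subset by metis
  have "limit col \<noteq> {}" using limit_nonempty[OF fin] by blast
  then have e: "?e \<in> limit col" using finl by (rule Min_in[rotated])
  obtain N where N: "limit col = range (suffix N col)" using limit_is_suffix[OF fin] by blast
  have ge: "?e \<le> col n" if "N \<le> n" for n
  proof -
    have "col n \<in> limit col" unfolding N using that by (auto intro!: image_eqI[of _ _ "n - N"])
    then show ?thesis using finl by simp
  qed
  have \<tau>k: "k \<le> \<tau> k" for k using strict_mono_imp_increasing[OF \<tau>] .
  have er: "?e \<in> range col" using e limit_in_range[of col] by (rule subsetD[rotated])
  have R1: "R ?e (Suc k) \<le> R ?e k" "(\<exists>n\<in>{\<tau> k..<\<tau> (Suc k)}. col n = ?e) \<Longrightarrow> R ?e (Suc k) < R ?e k"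
    if "N \<le> k" for k
  proof -
    have "\<forall>n\<in>{\<tau> k..<\<tau> (Suc k)}. ?e \<le> col n"
    proof
      fix n assume "n \<in> {\<tau> k..<\<tau> (Suc k)}"
      then have "N \<le> n" using \<tau>k[of k] that by simp
      then show "?e \<le> col n" by (rule ge)
    qed
    from R[OF P er this] show "R ?e (Suc k) \<le> R ?e k"
      "(\<exists>n\<in>{\<tau> k..<\<tau> (Suc k)}. col n = ?e) \<Longrightarrow> R ?e (Suc k) < R ?e k" by blast+
  qed
  \<comment> \<open>From \<open>N\<close> on no smaller colour is seen, so the rank of the least
    recurring colour never grows and ends up constant at its minimum. Any later occurrence of that
    colour would lower it.\<close>
  define m where "m = (LEAST x. \<exists>k\<ge>N. R ?e k = x)"
  have "\<exists>k\<ge>N. R ?e k = m" unfolding m_def by (rule LeastI[of _ "R ?e N"]) auto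
  then obtain k1 where k1: "N \<le> k1" "R ?e k1 = m" by blast
  have low: "m \<le> R ?e k" if "N \<le> k" for k unfolding m_def using that by (intro Least_le) auto
  have const: "R ?e k = m" if "k1 \<le> k" for k
    using that
  proof (induction k rule: dec_induct)
    case (step k)
    then show ?case using R1(1)[of k] low[of "Suc k"] k1(1) by linarith
  qed (rule k1(2))
  obtain n where n: "\<tau> k1 \<le> n" "col n = ?e"
    using e unfolding limit_iff_frequent INFM_nat_le by blast
  define k where "k = (LEAST k. n < \<tau> (Suc k))"
  have "n < \<tau> (Suc n)" using \<tau>k[of "Suc n"] by simp
  then have k: "n < \<tau> (Suc k)" unfolding k_def by (rule LeastI)
  have "k1 \<le> k"
  proof (rule ccontr)
    assume "\<not> k1 \<le> k"
    then have "\<tau> (Suc k) \<le> \<tau> k1" using \<tau> by (simp add: strict_mono_less_eq)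
    then show False using k n by simp
  qed
  moreover have "\<tau> k \<le> n"
  proof (cases k)
    case 0
    then show ?thesis using n(1) \<tau> \<open>k1 \<le> k\<close> by simp
  next
    case (Suc l)
    then have "\<not> n < \<tau> (Suc l)" unfolding k_def by (intro not_less_Least) simp
    then show ?thesis using Suc by simp
  qed
  ultimately have "\<exists>n\<in>{\<tau> k..<\<tau> (Suc k)}. col n = ?e" using k n(2) by (intro bexI[of _ n]) simp_all
  then have "R ?e (Suc k) < R ?e k" using R1(2)[of k] \<open>k1 \<le> k\<close> k1(1) by simp
  then show False using const[of k] const[of "Suc k"] \<open>k1 \<le> k\<close> by simp
qed

section \<open>Certificates\<close>

lemma limit_image:
  assumes "finite (range w)"
  shows "limit (\<lambda>n. f (w n)) = f ` limit w"
proof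
  show "f ` limit w \<subseteq> limit (\<lambda>n. f (w n))"
    using limit_o[of _ w f] by (auto simp: comp_def)
  show "limit (\<lambda>n. f (w n)) \<subseteq> f ` limit w"
  proof
    fix x assume "x \<in> limit (\<lambda>n. f (w n))"
    then have "\<exists>\<^sub>\<infinity>n. w n \<in> f -` {x} \<inter> range w" by (simp add: limit_iff_frequent)
    then have "limit w \<inter> (f -` {x} \<inter> range w) \<noteq> {}"
      using assms fin_ex_inf_eq_limit[of "f -` {x} \<inter> range w" w] by blast
    then show "x \<in> f ` limit w" by blast
  qed
qed

text \<open>A position of the product of the game with the machine is a transition that has just been
  chosen. A transition \<open>(p, u, q)\<close> read at a vertex of another player than Leader is padded
  to \<open>(p, u, q, u)\<close>.\<close>

type_synonym ('q, 'v) position = "'q \<times> 'v \<times> 'q \<times> 'v"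

abbreviation (input) src :: "('q, 'v) position \<Rightarrow> 'q" where "src y \<equiv> fst y"
abbreviation (input) vx :: "('q, 'v) position \<Rightarrow> 'v" where "vx y \<equiv> fst (snd y)"
abbreviation (input) tgt :: "('q, 'v) position \<Rightarrow> 'q" where "tgt y \<equiv> fst (snd (snd y))"

locale verification =
  fixes G :: "('p, 'v) game" and L :: 'p and v0 :: 'v and M :: "('q, 'v) mealy"
    and \<kappa> :: "'p \<Rightarrow> 'v \<Rightarrow> nat"
  assumes game: "is_game G" and L: "L \<in> players G" and v0: "v0 \<in> vertices G"
    and mealy: "is_mealy G L M" and payoff: "payoff G = parity_payoff \<kappa>"
begin

definition positions :: "('q, 'v) position set" where
  "positions = {(p, u, q, w). u \<in> vertices G \<and>
     (if controller G u = L then (p, u, q, w) \<in> mtransL M else (p, u, q) \<in> mtrans M \<and> w = u)}"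

definition own :: "('q, 'v) position \<Rightarrow> 'p" where
  "own y = controller G (vx y)"

definition succs :: "('q, 'v) position \<Rightarrow> 'v set" where
  "succs y = (if own y = L then {snd (snd (snd y))} else {v. (vx y, v) \<in> edges G})"

definition pplay :: "('q, 'v) position word \<Rightarrow> bool" where
  "pplay \<pi> \<longleftrightarrow> (\<forall>n. \<pi> n \<in> positions \<and> src (\<pi> (Suc n)) = tgt (\<pi> n) \<and> vx (\<pi> (Suc n)) \<in> succs (\<pi> n))"

definition starts :: "'q \<Rightarrow> 'v \<Rightarrow> ('q, 'v) position word \<Rightarrow> bool" where
  "starts q v \<pi> \<longleftrightarrow> src (\<pi> 0) = q \<and> vx (\<pi> 0) = v"

definition wins :: "'p \<Rightarrow> ('q, 'v) position word \<Rightarrow> bool" where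
  "wins j \<pi> \<longleftrightarrow> even (Min ((\<lambda>y. \<kappa> j (vx y)) ` limit \<pi>))"

text \<open>A key \<open>(j, q, v)\<close> stands for a deviation of player \<open>j\<close> to \<open>v\<close> in machine state \<open>q\<close> that the
  others answer by a proposal in which \<open>j\<close> loses; a key of Leader stands for a deviation that needs
  no punishment.\<close>

definition good :: "bool \<Rightarrow> ('p \<times> 'q \<times> 'v) set \<Rightarrow> ('q, 'v) position word \<Rightarrow> bool" where
  "good spe Dom \<pi> \<longleftrightarrow> (\<forall>n. own (\<pi> n) \<noteq> L \<longrightarrow> (\<forall>v\<in>succs (\<pi> n).
     (spe \<longrightarrow> (L, tgt (\<pi> n), v) \<in> Dom) \<and>
     (\<not> wins (own (\<pi> n)) \<pi> \<longrightarrow> (own (\<pi> n), tgt (\<pi> n), v) \<in> Dom)))"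

text \<open>The ranks are indexed by vertices, a vertex \<open>x\<close> standing for the colour
  \<open>\<kappa> j x\<close>: colours are written in binary, so a rank for every number up to the
  largest colour could not be listed. The colour of a deviation is the least one met on the proposal
  up to it.\<close>

definition punishing :: "('p \<times> 'q \<times> 'v) set \<Rightarrow> ('p \<times> 'q \<times> 'v \<Rightarrow> 'v \<Rightarrow> nat) \<Rightarrow>
    'p \<times> 'q \<times> 'v \<Rightarrow> ('q, 'v) position word \<Rightarrow> bool" where
  "punishing Dom r key \<pi> \<longleftrightarrow> (let j = fst key in \<not> wins j \<pi> \<and>
     (\<forall>n. own (\<pi> n) = j \<longrightarrow> (\<forall>v\<in>succs (\<pi> n). (j, tgt (\<pi> n), v) \<in> Dom \<and>
        (\<forall>x\<in>vertices G. even (\<kappa> j x) \<and> (\<forall>i\<le>n. \<kappa> j x \<le> \<kappa> j (vx (\<pi> i))) \<longrightarrow>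
           r (j, tgt (\<pi> n), v) x \<le> r key x \<and>
           ((\<exists>i\<le>n. \<kappa> j (vx (\<pi> i)) = \<kappa> j x) \<longrightarrow> r (j, tgt (\<pi> n), v) x < r key x)))))"

text \<open>For Nash equilibria only the main play has to be \<open>good\<close>. For subgame
  perfection each proposal has to be, as it becomes the outcome of a subgame.\<close>

definition certificate :: "bool \<Rightarrow> ('q, 'v) position word \<Rightarrow> ('p \<times> 'q \<times> 'v) set \<Rightarrow>
    ('p \<times> 'q \<times> 'v \<Rightarrow> ('q, 'v) position word) \<Rightarrow> ('p \<times> 'q \<times> 'v \<Rightarrow> 'v \<Rightarrow> nat) \<Rightarrow> bool" where
  "certificate spe main Dom P r \<longleftrightarrow>
     pplay main \<and> starts (minit M) v0 main \<and> good spe Dom main \<and>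
     (\<forall>(j, q, v)\<in>Dom. pplay (P (j, q, v)) \<and> starts q v (P (j, q, v)) \<and>
        (spe \<longrightarrow> good spe Dom (P (j, q, v))) \<and>
        (j \<noteq> L \<longrightarrow> punishing Dom r (j, q, v) (P (j, q, v))))"

lemma region_iff: "v \<in> region G i \<longleftrightarrow> v \<in> vertices G \<and> controller G v = i"
  by (simp add: region_def)

lemma edge_vertices: "(u, v) \<in> edges G \<Longrightarrow> u \<in> vertices G \<and> v \<in> vertices G"
  using game by (auto simp: is_game_def)

lemma position_facts:
  assumes "y \<in> positions"
  shows "src y \<in> mstates M" "vx y \<in> vertices G" "tgt y \<in> mstates M" "own y \<in> players G"
    "succs y \<noteq> {}" "v \<in> succs y \<Longrightarrow> (vx y, v) \<in> edges G" "succs y \<subseteq> vertices G"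
proof -
  obtain p u q w where y: "y = (p, u, q, w)" by (cases y)
  have u: "u \<in> vertices G" using assms by (simp add: positions_def y)
  then show "vx y \<in> vertices G" "own y \<in> players G"
    using game by (auto simp: y own_def is_game_def)
  have L: "(p, u, q, w) \<in> mtransL M" if "controller G u = L"
    using assms that by (simp add: positions_def y)
  have nL: "(p, u, q) \<in> mtrans M" if "controller G u \<noteq> L"
    using assms that by (simp add: positions_def y)
  show "src y \<in> mstates M" "tgt y \<in> mstates M"
    using L nL mealy by (cases "controller G u = L"; fastforce simp: y is_mealy_def)+
  show e: "(vx y, v) \<in> edges G" if "v \<in> succs y" for v
    using L mealy that by (cases "controller G u = L") (auto simp: y succs_def own_def is_mealy_def)
  show "succs y \<noteq> {}" using game u by (auto simp: succs_def y is_game_def)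
  show "succs y \<subseteq> vertices G" using e edge_vertices by blast
qed

lemma finite_positions: "finite positions"
proof -
  have "finite (mstates M)" "finite (vertices G)" using mealy game by (auto simp: is_mealy_def is_game_def)
  moreover have "positions \<subseteq> mstates M \<times> vertices G \<times> mstates M \<times> vertices G"
  proof
    fix y assume y: "y \<in> positions"
    obtain p u q w where yy: "y = (p, u, q, w)" by (cases y)
    have "w \<in> vertices G"
    proof (cases "controller G u = L")
      case True
      then have "(p, u, q, w) \<in> mtransL M" using y by (simp add: positions_def yy)
      then show ?thesis using mealy unfolding is_mealy_def by blast
    qed (use y in \<open>simp add: positions_def yy\<close>)
    then show "y \<in> mstates M \<times> vertices G \<times> mstates M \<times> vertices G"
      using position_facts(1,2,3)[OF y] by (simp add: yy)
  qed
  ultimately show ?thesis by (meson finite_SigmaI finite_subset)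
qed

lemma ex_position:
  assumes "q \<in> mstates M" "v \<in> vertices G"
  obtains y where "y \<in> positions" "src y = q" "vx y = v"
proof (cases "controller G v = L")
  case True
  then have "v \<in> region G L" using assms by (simp add: region_def)
  then obtain q' w where "(q, v, q', w) \<in> mtransL M"
    using assms mealy unfolding is_mealy_def by blast
  then show ?thesis using that[of "(q, v, q', w)"] True assms by (simp add: positions_def)
next
  case False
  then have "v \<in> vertices G - region G L" using assms by (simp add: region_def)
  then obtain q' where "(q, v, q') \<in> mtrans M"
    using assms mealy unfolding is_mealy_def by blast
  then show ?thesis using that[of "(q, v, q', v)"] False assms by (simp add: positions_def)
qed

text \<open>The machine has a transition for every state and vertex, so words never get stuck. This
  supplies moves after histories for which the certificate proposes nothing.\<close>

lemma ex_pplay: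
  assumes "q \<in> mstates M" "v \<in> vertices G"
  shows "\<exists>\<pi>. pplay \<pi> \<and> starts q v \<pi>"
proof -
  obtain y where y: "y \<in> positions" "src y = q" "vx y = v" using ex_position[OF assms] .
  have "\<exists>y'. y' \<in> positions \<and> src y' = tgt y \<and> vx y' \<in> succs y" if y: "y \<in> positions" for y
  proof -
    obtain v where v: "v \<in> succs y" using position_facts(5)[OF y] by blast
    then have "v \<in> vertices G" using position_facts(7)[OF y] by blast
    with position_facts(3)[OF y] obtain y' where "y' \<in> positions" "src y' = tgt y" "vx y' = v"
      by (rule ex_position)
    then show ?thesis using v by blast
  qed
  then obtain g where g: "\<And>y. y \<in> positions \<Longrightarrow> g y \<in> positions \<and> src (g y) = tgt y \<and> vx (g y) \<in> succs y"
    by metis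
  have "(g ^^ n) y \<in> positions" for n by (induction n) (use y g in auto)
  then have "pplay (\<lambda>n. (g ^^ n) y)" using g by (auto simp: pplay_def)
  then show ?thesis using y by (intro exI[of _ "\<lambda>n. (g ^^ n) y"]) (simp add: starts_def)
qed

lemma pplay_suffix: "pplay \<pi> \<Longrightarrow> pplay (suffix n \<pi>)"
  by (simp add: pplay_def)

lemma wins_suffix [simp]: "wins j (suffix n \<pi>) = wins j \<pi>"
  by (simp add: wins_def)

lemma good_suffix: "good spe Dom \<pi> \<Longrightarrow> good spe Dom (suffix n \<pi>)"
  by (simp add: good_def)

lemma pplay_range: "pplay \<pi> \<Longrightarrow> finite (range \<pi>)"
  using finite_positions by (meson finite_subset image_subsetI pplay_def)

lemma payoff_wins:
  assumes "pplay \<pi>"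
  shows "payoff G (\<lambda>n. vx (\<pi> n)) j = (if wins j \<pi> then 1 else 0)"
proof -
  have "limit (\<lambda>n. vx (\<pi> n)) = (\<lambda>y. vx y) ` limit \<pi>"
    using pplay_range[OF assms] by (rule limit_image)
  then show ?thesis by (simp add: payoff parity_payoff_def wins_def image_image)
qed

lemma pplay_is_play: "pplay \<pi> \<Longrightarrow> starts q v \<pi> \<Longrightarrow> is_play G v (\<lambda>n. vx (\<pi> n))"
  using position_facts(6) by (simp add: pplay_def is_play_def starts_def)

subsection \<open>Soundness\<close>

lemma certificate_key:
  assumes "certificate spe main Dom P r" "(j, q, v) \<in> Dom"
  shows "pplay (P (j, q, v))" "starts q v (P (j, q, v))" "spe \<Longrightarrow> good spe Dom (P (j, q, v))"
    "j \<noteq> L \<Longrightarrow> punishing Dom r (j, q, v) (P (j, q, v))"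
proof -
  have "case (j, q, v) of (j, q, v) \<Rightarrow> pplay (P (j, q, v)) \<and> starts q v (P (j, q, v)) \<and>
        (spe \<longrightarrow> good spe Dom (P (j, q, v))) \<and>
        (j \<noteq> L \<longrightarrow> punishing Dom r (j, q, v) (P (j, q, v)))"
    using assms unfolding certificate_def by (elim conjE) (rule bspec)
  then show "pplay (P (j, q, v))" "starts q v (P (j, q, v))" "spe \<Longrightarrow> good spe Dom (P (j, q, v))"
    "j \<noteq> L \<Longrightarrow> punishing Dom r (j, q, v) (P (j, q, v))" by simp_all
qed

lemma punishingD:
  assumes "punishing Dom r key \<pi>" "fst key = j" "own (\<pi> n) = j" "v \<in> succs (\<pi> n)"
  shows "(j, tgt (\<pi> n), v) \<in> Dom"
    and "x \<in> vertices G \<Longrightarrow> even (\<kappa> j x) \<Longrightarrow> \<forall>i\<le>n. \<kappa> j x \<le> \<kappa> j (vx (\<pi> i)) \<Longrightarrow>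
       r (j, tgt (\<pi> n), v) x \<le> r key x \<and>
       ((\<exists>i\<le>n. \<kappa> j (vx (\<pi> i)) = \<kappa> j x) \<longrightarrow> r (j, tgt (\<pi> n), v) x < r key x)"
  using assms(1,3,4) unfolding punishing_def Let_def assms(2) by blast+

lemma no_gap_enumerate:
  assumes "infinite (S :: nat set)" "enumerate S k < t" "t < enumerate S (Suc k)"
  shows "t \<notin> S"
  using assms by (auto simp: enumerate_Suc'' dest: not_less_Least)

text \<open>\<open>m t\<close> is what remains of the current proposal at time \<open>t\<close>;
  each step follows it or is a deviation of \<open>j\<close> to another proposal. If the switches
  end, \<open>j\<close> loses because the last proposal is lost; otherwise the parts between
  switches are the segments of \<open>segment_parity\<close>.\<close>

lemma chain_loses:
  assumes cert: "certificate spe main Dom P r" and j: "j \<noteq> L"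
    and m0: "(j, q0, w0) \<in> Dom" "m 0 = P (j, q0, w0)"
    and mS: "\<And>t. m (Suc t) = suffix 1 (m t) \<or> own (m t 0) = j \<and>
      (\<exists>v\<in>succs (m t 0). m (Suc t) = P (j, tgt (m t 0), v))"
  shows "\<not> wins j (\<lambda>t. m t 0)"
proof -
  have P: "pplay (P (j, q, v))" "starts q v (P (j, q, v))" "punishing Dom r (j, q, v) (P (j, q, v))"
    if "(j, q, v) \<in> Dom" for q v
    using certificate_key[OF cert that] j by simp_all
  have closed: "(j, tgt (\<pi> n), v) \<in> Dom" if "punishing Dom r (j, k) \<pi>" "own (\<pi> n) = j" "v \<in> succs (\<pi> n)" for k \<pi> n v
    using punishingD(1)[OF that(1) _ that(2,3)] by simp
  have inv: "\<exists>q v n. (j, q, v) \<in> Dom \<and> m t = suffix n (P (j, q, v))" for t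
  proof (induction t)
    case 0
    then show ?case using m0 by (intro exI[of _ q0] exI[of _ w0] exI[of _ 0]) auto
  next
    case (Suc t)
    then obtain q v n where k: "(j, q, v) \<in> Dom" "m t = suffix n (P (j, q, v))" by blast
    consider "m (Suc t) = suffix 1 (m t)"
      | v' where "own (m t 0) = j" "v' \<in> succs (m t 0)" "m (Suc t) = P (j, tgt (m t 0), v')"
      using mS by blast
    then show ?case
    proof cases
      case 1
      then have "m (Suc t) = suffix (n + 1) (P (j, q, v))" using k by simp
      then show ?thesis using k by blast
    next
      case 2
      have "(j, tgt (m t 0), v') \<in> Dom" using closed[OF P(3)[OF k(1)], of n v'] 2 k by simp
      then show ?thesis using 2(3)
        by (intro exI[of _ "tgt (m t 0)"] exI[of _ v'] exI[of _ 0]) simp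
    qed
  qed
  have mpos: "m t 0 \<in> positions" for t
    using inv[of t] P(1) by (auto simp: pplay_def)
  \<comment> \<open>Only deviations that change the remaining proposal are counted; the enumeration
    of their times cuts the play into segments.\<close>
  define Dv where "Dv = {t. m (Suc t) \<noteq> suffix 1 (m t)}"
  show ?thesis
  proof (cases "finite Dv")
    case True
    then obtain t0 where t0: "\<And>t. t0 \<le> t \<Longrightarrow> t \<notin> Dv"
      by (meson finite_nat_set_iff_bounded not_le)
    have "m (t0 + s) = suffix s (m t0)" for s
    proof (induction s)
      case (Suc s)
      have "m (Suc (t0 + s)) = suffix 1 (m (t0 + s))" using t0[of "t0 + s"] by (simp add: Dv_def)
      then show ?case using Suc by simp
    qed simp
    then have "suffix t0 (\<lambda>t. m t 0) = m t0" by (auto simp: fun_eq_iff)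
    then have "wins j (\<lambda>t. m t 0) = wins j (m t0)" using wins_suffix by metis
    moreover obtain q v n where k: "(j, q, v) \<in> Dom" "m t0 = suffix n (P (j, q, v))" using inv by blast
    moreover have "\<not> wins j (P (j, q, v))" using P(3)[OF k(1)] by (simp add: punishing_def Let_def)
    ultimately show ?thesis by simp
  next
    case inf: False
    define e where "e k = enumerate Dv k" for k
    have eD: "e k \<in> Dv" for k unfolding e_def using inf by (rule enumerate_in_set)
    have e_mono: "e k < e (Suc k)" for k unfolding e_def using inf by (simp add: enumerate_mono)
    have "\<exists>v. own (m (e k) 0) = j \<and> v \<in> succs (m (e k) 0) \<and> m (Suc (e k)) = P (j, tgt (m (e k) 0), v)" for k
      using mS[of "e k"] eD[of k] unfolding Dv_def by blast
    then obtain w where w: "\<And>k. own (m (e k) 0) = j" "\<And>k. w k \<in> succs (m (e k) 0)"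
      "\<And>k. m (Suc (e k)) = P (j, tgt (m (e k) 0), w k)" by metis
    define K where "K k = (j, tgt (m (e k) 0), w k)" for k
    have KD: "K k \<in> Dom" for k
    proof -
      obtain q v n where k: "(j, q, v) \<in> Dom" "m (e k) = suffix n (P (j, q, v))" using inv by blast
      then show ?thesis using closed[OF P(3)[OF k(1)], of n "w k"] w(1,2)[of k] by (simp add: K_def)
    qed
    have seg: "m (Suc (e k) + s) = suffix s (P (K k))" if "Suc (e k) + s \<le> e (Suc k)" for k s
      using that
    proof (induction s)
      case 0 then show ?case by (simp add: w(3) K_def)
    next
      case (Suc s)
      have "Suc (e k) + s \<notin> Dv"
        using no_gap_enumerate[OF inf, of k "Suc (e k) + s"] Suc.prems by (simp add: e_def)
      then have "m (Suc (Suc (e k) + s)) = suffix 1 (m (Suc (e k) + s))" by (simp add: Dv_def)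
      then show ?case using Suc by simp
    qed
    define col where "col n = \<kappa> j (vx (m n 0))" for n
    have finr: "finite (range (\<lambda>t. m t 0))" using mpos finite_positions by (meson finite_subset image_subsetI)
    have col: "limit col = (\<lambda>y. \<kappa> j (vx y)) ` limit (\<lambda>t. m t 0)"
      using limit_image[OF finr, of "\<lambda>y. \<kappa> j (vx y)"] by (simp add: col_def[abs_def])
    \<comment> \<open>Ranks are attached to vertices, so every colour on the play needs a vertex
      that carries it.\<close>
    define x where "x c = (SOME x. x \<in> vertices G \<and> \<kappa> j x = c)" for c
    have x: "x c \<in> vertices G \<and> \<kappa> j (x c) = c" if cr: "c \<in> range col" for c
    proof -
      obtain n where "c = col n" using cr by blast
      then have "\<exists>x. x \<in> vertices G \<and> \<kappa> j x = c"
        using position_facts(2)[OF mpos, of n] by (auto simp: col_def)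
      then show ?thesis unfolding x_def by (rule someI_ex)
    qed
    have "\<not> even (Min (limit col))"
    proof (rule segment_parity[where \<tau> = "\<lambda>k. Suc (e k)" and R = "\<lambda>c k. r (K k) (x c)"])
      have "range col = (\<lambda>y. \<kappa> j (vx y)) ` range (\<lambda>t. m t 0)" by (auto simp: col_def)
      then show "finite (range col)" using finr by simp
      show "strict_mono (\<lambda>k. Suc (e k))" using e_mono by (simp add: strict_mono_Suc_iff)
      fix k c assume c: "even c" "c \<in> range col" "\<forall>n\<in>{Suc (e k)..<Suc (e (Suc k))}. c \<le> col n"
      define n where "n = e (Suc k) - Suc (e k)"
      have at: "P (K k) i = m (Suc (e k) + i) 0" if "i \<le> n" for i
        using seg[of k i] that e_mono[of k] by (simp add: n_def)
      have n: "Suc (e k) + n = e (Suc k)" using e_mono[of k] by (simp add: n_def)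
      have pun: "punishing Dom r (K k) (P (K k))" using P(3) KD[of k] by (simp add: K_def)
      have an: "P (K k) n = m (e (Suc k)) 0" using at[of n] n by simp
      have key: "K (Suc k) = (j, tgt (P (K k) n), w (Suc k))"
        unfolding an by (simp add: K_def)
      have "own (P (K k) n) = j" "w (Suc k) \<in> succs (P (K k) n)" "fst (K k) = j"
        using w(1,2)[of "Suc k"] by (simp_all only: an) (simp add: K_def)
      note pun' = punishingD(2)[OF pun this(3,1,2), folded key]
      have "\<forall>i\<le>n. c \<le> \<kappa> j (vx (P (K k) i))"
        using c(3) n by (auto simp: at col_def)
      then have "r (K (Suc k)) (x c) \<le> r (K k) (x c) \<and>
           ((\<exists>i\<le>n. \<kappa> j (vx (P (K k) i)) = c) \<longrightarrow> r (K (Suc k)) (x c) < r (K k) (x c))"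
        using x[OF c(2)] c(1) pun'[of "x c"] by simp
      moreover have "\<exists>i\<le>n. \<kappa> j (vx (P (K k) i)) = c" if "t \<in> {Suc (e k)..<Suc (e (Suc k))}" "col t = c" for t
        using that n by (intro exI[of _ "t - Suc (e k)"]) (auto simp: at col_def)
      ultimately show "r (K (Suc k)) (x c) \<le> r (K k) (x c) \<and>
         ((\<exists>t\<in>{Suc (e k)..<Suc (e (Suc k))}. col t = c) \<longrightarrow> r (K (Suc k)) (x c) < r (K k) (x c))"
        by blast
    qed
    then show ?thesis by (simp add: wins_def col image_image)
  qed
qed

text \<open>A punishment is preferred. The key of Leader comes next: it continues with a
  \<open>good\<close> word, which subgame perfection requires even where nobody has to be punished.
  The last case covers histories on which no condition is imposed.\<close>

definition proposal where
  "proposal Dom P j q v = (if (j, q, v) \<in> Dom then P (j, q, v)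
     else if (L, q, v) \<in> Dom then P (L, q, v) else (SOME \<pi>. pplay \<pi> \<and> starts q v \<pi>))"

text \<open>The strategies remember what remains of the current proposal.\<close>

definition upd where
  "upd Dom P m v = (if v = vx (m 1) then suffix 1 m else proposal Dom P (own (m 0)) (tgt (m 0)) v)"

text \<open>The first vertex of the history is skipped, because \<open>main\<close> already stands
  there.\<close>

definition mem where
  "mem main Dom P h = foldl (upd Dom P) main (tl h)"

lemma mem_snoc: "h \<noteq> [] \<Longrightarrow> mem main Dom P (h @ [v]) = upd Dom P (mem main Dom P h) v"
  by (simp add: mem_def)

lemma history_concat:
  assumes "is_history G v0 (h @ [v])" "is_history G v h'"
  shows "is_history G v0 (h @ h')"
proof (cases "h = []")
  case True
  then show ?thesis using assms by (simp add: is_history_def)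
next
  case False
  have "successively (\<lambda>u v. (u, v) \<in> edges G) h" "(last h, v) \<in> edges G" "hd h = v0"
    using assms(1) False by (simp_all add: is_history_def successively_append_iff)
  then show ?thesis using assms(2) False by (simp add: is_history_def successively_append_iff)
qed

text \<open>All players run the same memory and play its next vertex. The memory contains the
  machine state and the chosen transition, so Leader's strategy conforms to the machine.\<close>

theorem certificate_sound:
  assumes cert: "certificate spe main Dom P r"
  shows "\<exists>\<sigma>. fixed_NE G L v0 \<sigma> \<and> (spe \<longrightarrow> fixed_SPE G L v0 \<sigma>) \<and> \<sigma> L \<in> Comp G L v0 M \<and>
    outcome G v0 \<sigma> = (\<lambda>n. vx (main n))"
proof -
  let ?mem = "mem main Dom P"
  define \<sigma> :: "('p, 'v) profile" where "\<sigma> i h = vx (?mem h 1)" for i h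
  define \<rho> where "\<rho> h = (if h = [] then minit M else tgt (?mem h 0))" for h
  have main: "pplay main" "starts (minit M) v0 main" "good spe Dom main"
    using cert by (auto simp: certificate_def)
  have P: "pplay (P (j, q, v)) \<and> starts q v (P (j, q, v)) \<and> (spe \<longrightarrow> good spe Dom (P (j, q, v)))"
    if "(j, q, v) \<in> Dom" for j q v
    using certificate_key[OF cert that] by simp
  have proposed: "pplay (proposal Dom P j q v) \<and> starts q v (proposal Dom P j q v)"
    if "q \<in> mstates M" "v \<in> vertices G" for j q v
  proof -
    have "pplay (SOME \<pi>. pplay \<pi> \<and> starts q v \<pi>) \<and> starts q v (SOME \<pi>. pplay \<pi> \<and> starts q v \<pi>)"
      by (rule someI_ex[OF ex_pplay[OF that]])
    then show ?thesis using P[of j q v] P[of L q v] unfolding proposal_def by presburger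
  qed
  have upd: "pplay (upd Dom P m v) \<and> starts (tgt (m 0)) v (upd Dom P m v)"
    if m: "pplay m" and v: "v \<in> vertices G" for m v
  proof (cases "v = vx (m 1)")
    case True
    then show ?thesis using m pplay_suffix[OF m, of 1] by (simp add: upd_def starts_def pplay_def)
  next
    case False
    have "m 0 \<in> positions" using m by (simp add: pplay_def)
    then show ?thesis using False proposed[OF _ v] position_facts(3)[of "m 0"] by (simp add: upd_def)
  qed
  have inv: "pplay (?mem h) \<and> starts (\<rho> (butlast h)) (last h) (?mem h)" if "is_history G v0 h" for h
    using that
  proof (induction h rule: rev_induct)
    case Nil then show ?case by (simp add: is_history_def)
  next
    case (snoc v h)
    show ?case
    proof (cases "h = []")
      case True
      then show ?thesis using main snoc.prems by (simp add: mem_def \<rho>_def is_history_def)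
    next
      case False
      have "v \<in> vertices G" using is_history_vertices[OF game snoc.prems v0] by auto
      moreover have "is_history G v0 h"
        using snoc.prems False by (simp add: is_history_def successively_append_iff)
      ultimately show ?thesis using upd[of "?mem h" v] snoc.IH False
        by (simp add: mem_snoc \<rho>_def)
    qed
  qed
  have strat: "is_strategy G v0 i (\<sigma> i)" for i
    unfolding is_strategy_def
  proof (intro allI impI)
    fix h v assume h: "is_history G v0 (h @ [v]) \<and> v \<in> region G i"
    then have m: "pplay (?mem (h @ [v]))" "vx (?mem (h @ [v]) 0) = v"
      using inv[of "h @ [v]"] by (auto simp: starts_def)
    then have "?mem (h @ [v]) 0 \<in> positions" "vx (?mem (h @ [v]) 1) \<in> succs (?mem (h @ [v]) 0)"
      by (auto simp: pplay_def)
    from position_facts(6)[OF this] m(2) show "(v, \<sigma> i (h @ [v])) \<in> edges G" by (simp add: \<sigma>_def)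
  qed
  have comp: "\<sigma> L \<in> Comp G L v0 M"
    unfolding Comp_def
  proof (intro CollectI conjI strat exI[of _ \<rho>] allI impI)
    show "\<rho> [] = minit M" by (simp add: \<rho>_def)
    fix h v assume h: "is_history G v0 (h @ [v])"
    let ?y = "?mem (h @ [v]) 0"
    have m: "pplay (?mem (h @ [v]))" "src ?y = \<rho> h" "vx ?y = v"
      using inv[OF h] by (auto simp: starts_def)
    have y: "?y \<in> positions" "vx (?mem (h @ [v]) 1) \<in> succs ?y" using m(1) by (auto simp: pplay_def)
    obtain p u q w where yy: "?y = (p, u, q, w)" by (cases ?y)
    show "(\<rho> h, v, \<rho> (h @ [v])) \<in> mtrans M" if "v \<notin> region G L"
      using y(1) m that unfolding positions_def by (auto simp: yy \<rho>_def region_iff)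
    show "(\<rho> h, v, \<rho> (h @ [v]), \<sigma> L (h @ [v])) \<in> mtransL M" if "v \<in> region G L"
      using y m that unfolding positions_def
      by (auto simp: yy \<rho>_def region_iff \<sigma>_def succs_def own_def)
  qed
  \<comment> \<open>Playing by the memory reproduces what remains of the proposal, which is
    therefore the outcome of the subgame.\<close>
  have mem_play: "?mem (h @ map (\<lambda>n. vx (?mem (h @ [v]) n)) [0..<Suc n]) = suffix n (?mem (h @ [v]))"
    if "is_history G v0 (h @ [v])" for h v n
  proof (induction n)
    case 0
    then show ?case using inv[OF that] by (simp add: starts_def)
  next
    case (Suc n)
    let ?z = "\<lambda>n. vx (?mem (h @ [v]) n)"
    have "?mem (h @ map ?z [0..<Suc (Suc n)]) = upd Dom P (?mem (h @ map ?z [0..<Suc n])) (?z (Suc n))"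
      using mem_snoc[of "h @ map ?z [0..<Suc n]"] by simp
    then show ?case using Suc by (simp add: upd_def)
  qed
  have profile: "is_profile G v (\<lambda>i h'. \<sigma> i (h @ h'))" if h: "is_history G v0 (h @ [v])" for h v
    unfolding is_profile_def is_strategy_def
  proof (intro ballI allI impI)
    fix i h' u assume "i \<in> players G" "is_history G v (h' @ [u]) \<and> u \<in> region G i"
    then show "(u, \<sigma> i (h @ h' @ [u])) \<in> edges G"
      using history_concat[OF h, of "h' @ [u]"]
        strat[of i, unfolded is_strategy_def, THEN spec, THEN spec, of "h @ h'" u] by simp
  qed
  have out: "outcome G v (\<lambda>i h'. \<sigma> i (h @ h')) = (\<lambda>n. vx (?mem (h @ [v]) n))"
    if h: "is_history G v0 (h @ [v])" for h v
  proof (rule outcome_eqI[OF game])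
    show "v \<in> vertices G" using is_history_vertices[OF game h v0] by simp
    show "is_play G v (\<lambda>n. vx (?mem (h @ [v]) n))"
      using inv[OF h] pplay_is_play by fastforce
    show "\<forall>i\<in>players G. play_compatible G i (\<lambda>h'. \<sigma> i (h @ h')) (\<lambda>n. vx (?mem (h @ [v]) n))"
      using mem_play[OF h] by (auto simp: play_compatible_def \<sigma>_def simp del: upt_Suc)
  qed
  have NE: "fixed_NE G L v (\<lambda>i h'. \<sigma> i (h @ h'))"
    if h: "is_history G v0 (h @ [v])" and gd: "good spe Dom (?mem (h @ [v]))" for h v
  proof -
    have v: "v \<in> vertices G" using is_history_vertices[OF game h v0] by simp
    let ?m = "?mem (h @ [v])"
    have mp: "pplay ?m" using inv[OF h] by blast
    have "payoff G \<zeta> j \<le> payoff G (outcome G v (\<lambda>i h'. \<sigma> i (h @ h'))) j"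
      if j: "j \<in> players G - {L}" and \<zeta>: "is_play G v \<zeta>"
        "\<forall>k\<in>players G - {j}. play_compatible G k (\<lambda>h'. \<sigma> k (h @ h')) \<zeta>" for j \<zeta>
    proof -
      define N where "N t = ?mem (h @ map \<zeta> [0..<Suc t])" for t
      have hist: "is_history G v0 (h @ map \<zeta> [0..<Suc t])" for t
        by (rule is_history_append_play[OF h \<zeta>(1)])
      have Nt: "pplay (N t)" "vx (N t 0) = \<zeta> t" for t
        using inv[OF hist, of t] by (auto simp: N_def starts_def)
      have N0: "N 0 = ?m" using \<zeta>(1) by (simp add: N_def is_play_def)
      have NS: "N (Suc t) = upd Dom P (N t) (\<zeta> (Suc t))" for t
        using mem_snoc[of "h @ map \<zeta> [0..<Suc t]"] by (simp add: N_def)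
      have pos: "N t 0 \<in> positions" for t using Nt(1)[of t] by (simp add: pplay_def)
      have own: "own (N t 0) = controller G (\<zeta> t)" for t using Nt(2)[of t] by (simp add: own_def)
      \<comment> \<open>The other players keep to the memory, so a switch to another proposal can
        happen only at vertices of \<open>j\<close>.\<close>
      have follow: "N (Suc t) = suffix 1 (N t)" if "own (N t 0) \<noteq> j" for t
      proof -
        let ?k = "controller G (\<zeta> t)"
        have "?k \<in> players G - {j}" "\<zeta> t \<in> region G ?k"
          using that own[of t] position_facts(2,4)[OF pos, of t] Nt(2)[of t] by (auto simp: region_def)
        then have "\<zeta> (Suc t) = \<sigma> ?k (h @ map \<zeta> [0..<Suc t])"
          using \<zeta>(2) unfolding play_compatible_def by blast
        then have "\<zeta> (Suc t) = vx (N t 1)" by (simp add: \<sigma>_def N_def)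
        then show ?thesis by (simp add: NS upd_def)
      qed
      have succ: "\<zeta> (Suc t) \<in> succs (N t 0)" if "own (N t 0) = j" for t
        using \<zeta>(1) Nt(2)[of t] that j by (auto simp: succs_def is_play_def)
      have \<zeta>eq: "\<zeta> = (\<lambda>t. vx (N t 0))" using Nt(2) by auto
      have Npos: "finite (range (\<lambda>t. N t 0))"
        using pos finite_positions by (meson finite_subset image_subsetI)
      have pay: "payoff G \<zeta> j = (if wins j (\<lambda>t. N t 0) then 1 else 0)"
      proof -
        have "limit \<zeta> = (\<lambda>y. vx y) ` limit (\<lambda>t. N t 0)"
          using limit_image[OF Npos, of "\<lambda>y. vx y"] by (subst \<zeta>eq)
        then show ?thesis by (simp add: payoff parity_payoff_def wins_def image_image)
      qed
      have "\<not> wins j (\<lambda>t. N t 0)" if lose: "\<not> wins j ?m"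
      proof (cases "\<exists>t. N (Suc t) \<noteq> suffix 1 (N t)")
        case False
        then have "N t = suffix t ?m" for t
          by (induction t) (auto simp: N0)
        then have "(\<lambda>t. N t 0) = ?m" by auto
        then show ?thesis using lose by simp
      next
        case True
        \<comment> \<open>The first departure from the outcome. If \<open>j\<close> loses the
          outcome, \<open>good\<close> provides a punishing key here.\<close>
        define t where "t = (LEAST t. N (Suc t) \<noteq> suffix 1 (N t))"
        have t: "N (Suc t) \<noteq> suffix 1 (N t)" unfolding t_def using True by (rule LeastI_ex)
        have before: "N s = suffix s ?m" if "s \<le> t" for s
          using that
        proof (induction s)
          case (Suc s)
          then have "N (Suc s) = suffix 1 (N s)"
            using not_less_Least[of s "\<lambda>t. N (Suc t) \<noteq> suffix 1 (N t)"] by (auto simp: t_def)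
          then show ?case using Suc by simp
        qed (simp add: N0)
        have oj: "own (N t 0) = j" using follow t by blast
        have "own (?m t) = j" "\<zeta> (Suc t) \<in> succs (?m t)" "tgt (N t 0) = tgt (?m t)"
          using oj succ[OF oj] before[of t] by simp_all
        then have keyD: "(j, tgt (N t 0), \<zeta> (Suc t)) \<in> Dom"
          using gd lose j unfolding good_def by auto
        have dev: "N (Suc s) = suffix 1 (N s) \<or> own (N s 0) = j \<and>
            N (Suc s) = proposal Dom P j (tgt (N s 0)) (\<zeta> (Suc s))" for s
          using follow[of s] by (cases "own (N s 0) = j") (auto simp: NS upd_def)
        have st: "N (Suc t) = P (j, tgt (N t 0), \<zeta> (Suc t))"
          using dev[of t] t keyD by (simp add: proposal_def)
        have "\<not> wins j (\<lambda>s. (\<lambda>s. N (Suc t + s)) s 0)"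
        proof (rule chain_loses[OF cert _ keyD])
          show "j \<noteq> L" using j by simp
          show "N (Suc t + 0) = P (j, tgt (N t 0), \<zeta> (Suc t))" using st by simp
          \<comment> \<open>Later deviations also find a key, by the closure condition built into
            \<open>punishing\<close>.\<close>
          have inv2: "\<exists>q v n. (j, q, v) \<in> Dom \<and> N (Suc t + s) = suffix n (P (j, q, v))" for s
          proof (induction s)
            case 0
            show ?case using keyD st
              by (intro exI[of _ "tgt (N t 0)"] exI[of _ "\<zeta> (Suc t)"] exI[of _ 0]) simp
          next
            case (Suc s)
            then obtain q v n where k: "(j, q, v) \<in> Dom" "N (Suc t + s) = suffix n (P (j, q, v))" by blast
            from dev[of "Suc t + s"] show ?case
            proof
              assume "N (Suc (Suc t + s)) = suffix 1 (N (Suc t + s))"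
              then have "N (Suc t + Suc s) = suffix (n + 1) (P (j, q, v))" using k by simp
              then show ?thesis using k by blast
            next
              assume d: "own (N (Suc t + s) 0) = j \<and>
                N (Suc (Suc t + s)) = proposal Dom P j (tgt (N (Suc t + s) 0)) (\<zeta> (Suc (Suc t + s)))"
              have "punishing Dom r (j, q, v) (P (j, q, v))"
                using certificate_key(4)[OF cert k(1)] j by simp
              then have "(j, tgt (N (Suc t + s) 0), \<zeta> (Suc (Suc t + s))) \<in> Dom"
                using d succ[of "Suc t + s"] k(2) unfolding punishing_def by (auto simp: Let_def)
              then show ?thesis using d
                by (intro exI[of _ "tgt (N (Suc t + s) 0)"] exI[of _ "\<zeta> (Suc (Suc t + s))"] exI[of _ 0])
                  (simp add: proposal_def)
            qed
          qed
          fix s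
          show "N (Suc t + Suc s) = suffix 1 (N (Suc t + s)) \<or> own (N (Suc t + s) 0) = j \<and>
            (\<exists>v\<in>succs (N (Suc t + s) 0). N (Suc t + Suc s) = P (j, tgt (N (Suc t + s) 0), v))"
          proof (cases "N (Suc t + Suc s) = suffix 1 (N (Suc t + s))")
            case False
            then have d: "own (N (Suc t + s) 0) = j"
                "N (Suc t + Suc s) = proposal Dom P j (tgt (N (Suc t + s) 0)) (\<zeta> (Suc (Suc t + s)))"
              using dev[of "Suc t + s"] by auto
            obtain q v n where k: "(j, q, v) \<in> Dom" "N (Suc t + s) = suffix n (P (j, q, v))"
              using inv2 by blast
            have "punishing Dom r (j, q, v) (P (j, q, v))"
              using certificate_key(4)[OF cert k(1)] j by simp
            then have "(j, tgt (N (Suc t + s) 0), \<zeta> (Suc (Suc t + s))) \<in> Dom"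
              using d(1) succ[of "Suc t + s"] k(2) unfolding punishing_def by (auto simp: Let_def)
            then show ?thesis using d succ[OF d(1)] by (auto simp: proposal_def)
          qed simp
        qed
        then have "\<not> wins j (suffix (Suc t) (\<lambda>t. N t 0))"
          by (simp add: suffix_def)
        then show ?thesis by simp
      qed
      then show ?thesis using pay payoff_wins[OF mp] out[OF h] by auto
    qed
    then show ?thesis using profile[OF h] fixed_NE_iff[OF game v] by blast
  qed
  \<comment> \<open>On a history compatible with Leader all departures are made by other players,
    for which \<open>good\<close> provides a key of Leader. So the memory is always a remainder of a
    \<open>good\<close> word, and that property is inherited by suffixes.\<close>
  have goodmem: "good spe Dom (?mem h) \<and> (\<forall>v\<in>succs (?mem h 0). own (?mem h 0) \<noteq> L \<longrightarrow> (L, tgt (?mem h 0), v) \<in> Dom)"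
    if spe: spe and "is_history G v0 h" "history_compatible G L (\<sigma> L) h" for h
  proof -
    have gd2: "good spe Dom m \<Longrightarrow> good spe Dom m \<and> (\<forall>v\<in>succs (m 0). own (m 0) \<noteq> L \<longrightarrow> (L, tgt (m 0), v) \<in> Dom)" for m
      using spe unfolding good_def by blast
    show ?thesis using that(2,3)
    proof (induction h rule: rev_induct)
      case Nil then show ?case by (simp add: is_history_def)
    next
      case (snoc v h)
      show ?case
      proof (cases "h = []")
        case True
        then show ?thesis using main(3) gd2 by (simp add: mem_def)
      next
        case False
        have hh: "is_history G v0 h" "(last h, v) \<in> edges G"
          using snoc.prems(1) False by (auto simp: is_history_def successively_append_iff)
        have hc: "history_compatible G L (\<sigma> L) h"
          using snoc.prems(2) unfolding history_compatible_def
          by (auto simp: nth_append) (metis Suc_lessD less_SucI take_append diff_is_0_eq' less_imp_le_nat append_Nil2 take_0 Suc_leI)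
        note IH = snoc.IH[OF hh(1) hc]
        show ?thesis
        proof (cases "v = vx (?mem h 1)")
          case True
          then have "?mem (h @ [v]) = suffix 1 (?mem h)" using False by (simp add: mem_snoc upd_def)
          then show ?thesis using gd2 good_suffix[of spe Dom "?mem h" 1] IH by metis
        next
          case dv: False
          have i: "pplay (?mem h)" "vx (?mem h 0) = last h" using inv[OF hh(1)] by (auto simp: starts_def)
          then have pos: "?mem h 0 \<in> positions" by (simp add: pplay_def)
          have "own (?mem h 0) \<noteq> L"
          proof
            assume "own (?mem h 0) = L"
            then have "last h \<in> region G L"
              using i position_facts(2)[OF pos] by (simp add: region_def own_def)
            moreover have "(h @ [v]) ! (length h - 1) = last h" "take (length h) (h @ [v]) = h"
              "(h @ [v]) ! length h = v" "Suc (length h - 1) = length h"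
              using False by (auto simp: nth_append last_conv_nth)
            ultimately have "v = \<sigma> L h"
              using snoc.prems(2) unfolding history_compatible_def
              by (metis length_append_singleton lessI)
            then show False using dv by (simp add: \<sigma>_def)
          qed
          moreover from this have "v \<in> succs (?mem h 0)" using hh(2) i by (simp add: succs_def)
          ultimately have LD: "(L, tgt (?mem h 0), v) \<in> Dom" using IH by blast
          have "?mem (h @ [v]) = proposal Dom P (own (?mem h 0)) (tgt (?mem h 0)) v"
            using False dv by (simp add: mem_snoc upd_def)
          then have "good spe Dom (?mem (h @ [v]))" using LD P spe by (auto simp: proposal_def)
          then show ?thesis by (rule gd2)
        qed
      qed
    qed
  qed
  have "fixed_NE G L v0 \<sigma>"
    using NE[of "[]" v0] main(3) by (simp add: is_history_def mem_def)
  moreover have "fixed_SPE G L v0 \<sigma>" if spe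
    unfolding fixed_SPE_def
  proof (intro conjI allI impI)
    show "is_profile G v0 \<sigma>" using strat by (simp add: is_profile_def)
    fix h v assume h: "is_history G v0 (h @ [v]) \<and> history_compatible G L (\<sigma> L) (h @ [v])"
    then have "good spe Dom (?mem (h @ [v]))" using goodmem[OF that, of "h @ [v]"] by blast
    then show "fixed_NE (subgame G h) L v (\<lambda>i h'. \<sigma> i (h @ h'))"
      using NE[of h v] h subgame_parity[OF payoff] by simp
  qed
  moreover have "outcome G v0 \<sigma> = (\<lambda>n. vx (main n))"
    using out[of "[]" v0] by (simp add: is_history_def mem_def)
  ultimately show ?thesis using comp by blast
qed

end

subsection \<open>Completeness\<close>

text \<open>The running minimum: the colour of the move that consists of following a word up to
  \<open>n\<close> and deviating there.\<close>

definition rmin :: "(nat \<Rightarrow> nat) \<Rightarrow> nat \<Rightarrow> nat" where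
  "rmin col n = Min (col ` {..n})"

lemma rmin_Suc: "rmin col (Suc n) = min (rmin col n) (col (Suc n))"
  by (simp add: rmin_def atMost_Suc min.commute)

lemma rmin_0 [simp]: "rmin col 0 = col 0"
  by (simp add: rmin_def)

lemma le_rmin_iff: "c \<le> rmin col n \<longleftrightarrow> (\<forall>i\<le>n. c \<le> col i)"
  by (auto simp: rmin_def)

lemma rmin_in: "rmin col n \<in> col ` {..n}"
  unfolding rmin_def by (rule Min_in) auto

lemma eq_rmin_iff: "\<forall>i\<le>n. c \<le> col i \<Longrightarrow> c = rmin col n \<longleftrightarrow> (\<exists>i\<le>n. col i = c)"
proof
  assume "\<forall>i\<le>n. c \<le> col i" "\<exists>i\<le>n. col i = c"
  then have "c \<le> rmin col n" "rmin col n \<le> c" by (auto simp: le_rmin_iff) (auto simp: rmin_def)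
  then show "c = rmin col n" by simp
next
  assume "c = rmin col n"
  then show "\<exists>i\<le>n. col i = c" using rmin_in[of col n] by auto
qed

context verification
begin

abbreviation colour :: "'p \<Rightarrow> ('q, 'v) position word \<Rightarrow> nat \<Rightarrow> nat" where
  "colour j \<pi> n \<equiv> \<kappa> j (vx (\<pi> n))"

text \<open>In this form position \<open>n\<close> matters only through its transition and the
  running minimum there, which is what survives the shortening to lassos.\<close>

lemma punishing_iff:
  "punishing Dom r (j, q, v) \<pi> \<longleftrightarrow> \<not> wins j \<pi> \<and>
     (\<forall>n. own (\<pi> n) = j \<longrightarrow> (\<forall>v'\<in>succs (\<pi> n). (j, tgt (\<pi> n), v') \<in> Dom \<and>
        (\<forall>x\<in>vertices G. even (\<kappa> j x) \<and> \<kappa> j x \<le> rmin (colour j \<pi>) n \<longrightarrow>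
           r (j, tgt (\<pi> n), v') x \<le> r (j, q, v) x \<and>
           (\<kappa> j x = rmin (colour j \<pi>) n \<longrightarrow> r (j, tgt (\<pi> n), v') x < r (j, q, v) x))))"
proof -
  have "(even (\<kappa> j x) \<and> (\<forall>i\<le>n. \<kappa> j x \<le> \<kappa> j (vx (\<pi> i))) \<longrightarrow> A \<and>
      ((\<exists>i\<le>n. \<kappa> j (vx (\<pi> i)) = \<kappa> j x) \<longrightarrow> B)) \<longleftrightarrow>
     (even (\<kappa> j x) \<and> \<kappa> j x \<le> rmin (colour j \<pi>) n \<longrightarrow> A \<and> (\<kappa> j x = rmin (colour j \<pi>) n \<longrightarrow> B))"
    for x n A B
    using eq_rmin_iff[of n "\<kappa> j x" "colour j \<pi>"] le_rmin_iff[of "\<kappa> j x" "colour j \<pi>" n] by blast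
  then show ?thesis unfolding punishing_def Let_def fst_conv by presburger
qed

context
  fixes \<sigma> :: "('p, 'v) profile" and \<rho> :: "'v list \<Rightarrow> 'q"
  assumes profile: "is_profile G v0 \<sigma>"
    and rho0: "\<rho> [] = minit M"
    and rho: "\<And>h v. is_history G v0 (h @ [v]) \<Longrightarrow>
      (v \<notin> region G L \<longrightarrow> (\<rho> h, v, \<rho> (h @ [v])) \<in> mtrans M) \<and>
      (v \<in> region G L \<longrightarrow> (\<rho> h, v, \<rho> (h @ [v]), \<sigma> L (h @ [v])) \<in> mtransL M)"
begin

definition move :: "'v list \<Rightarrow> 'v" where
  "move h = \<sigma> (controller G (last h)) h"

definition ext :: "'v list \<Rightarrow> 'v list" where
  "ext h = h @ [move h]"

definition tr :: "'v list \<Rightarrow> ('q, 'v) position" where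
  "tr h = (\<rho> (butlast h), last h, \<rho> h, if controller G (last h) = L then \<sigma> L h else last h)"

text \<open>The play prescribed by the profile after \<open>h\<close>, lifted to transitions and
  starting at the last vertex of \<open>h\<close>.\<close>

definition wordof :: "'v list \<Rightarrow> ('q, 'v) position word" where
  "wordof h n = tr ((ext ^^ n) h)"

definition CH :: "'v list set" where
  "CH = {h. is_history G v0 h \<and> history_compatible G L (\<sigma> L) h}"

lemma hist_ne: "is_history G v0 h \<Longrightarrow> h \<noteq> []"
  by (simp add: is_history_def)

lemma hist_last: "is_history G v0 h \<Longrightarrow> last h \<in> vertices G"
  using is_history_vertices[OF game _ v0] hist_ne by (metis last_in_set subsetD)

lemma hist_snoc: "is_history G v0 h \<Longrightarrow> (last h, v) \<in> edges G \<Longrightarrow> is_history G v0 (h @ [v])"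
  by (auto simp: is_history_def successively_append_iff)

lemma move_edge:
  assumes "is_history G v0 h" shows "(last h, move h) \<in> edges G"
proof -
  let ?i = "controller G (last h)"
  have "last h \<in> region G ?i" "?i \<in> players G"
    using hist_last[OF assms] game by (auto simp: region_def is_game_def)
  moreover have "h = butlast h @ [last h]" using hist_ne[OF assms] by simp
  ultimately show ?thesis using profile assms unfolding is_profile_def is_strategy_def move_def by metis
qed

lemma hist_ext: "is_history G v0 h \<Longrightarrow> is_history G v0 (ext h)"
  unfolding ext_def using hist_snoc move_edge by blast

lemma tr_position:
  assumes "is_history G v0 h" shows "tr h \<in> positions"
proof -
  have h: "h = butlast h @ [last h]" using hist_ne[OF assms] by simp
  have v: "last h \<in> vertices G" by (rule hist_last[OF assms])
  have "(last h \<notin> region G L \<longrightarrow> (\<rho> (butlast h), last h, \<rho> h) \<in> mtrans M) \<and>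
      (last h \<in> region G L \<longrightarrow> (\<rho> (butlast h), last h, \<rho> h, \<sigma> L h) \<in> mtransL M)"
    using rho[of "butlast h" "last h"] h assms by metis
  then show ?thesis using v by (auto simp: tr_def positions_def region_def)
qed

lemma tr_simps [simp]: "src (tr h) = \<rho> (butlast h)" "vx (tr h) = last h" "tgt (tr h) = \<rho> h"
  "own (tr h) = controller G (last h)"
  by (simp_all add: tr_def own_def)

lemma succs_tr: "succs (tr h) = (if controller G (last h) = L then {\<sigma> L h} else {v. (last h, v) \<in> edges G})"
  by (simp add: succs_def) (simp add: tr_def)

lemma hist_iter: "is_history G v0 h \<Longrightarrow> is_history G v0 ((ext ^^ n) h)"
  by (induction n) (auto intro: hist_ext)

lemma wordof_pplay:
  assumes "is_history G v0 h" shows "pplay (wordof h)" "starts (\<rho> (butlast h)) (last h) (wordof h)"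
proof -
  have "move k \<in> succs (tr k)" if "is_history G v0 k" for k
    using move_edge[OF that] by (auto simp: succs_tr move_def)
  then show "pplay (wordof h)"
    using hist_iter[OF assms] tr_position by (simp add: pplay_def wordof_def ext_def)
  show "starts (\<rho> (butlast h)) (last h) (wordof h)" by (simp add: starts_def wordof_def)
qed

lemma CH_ext: "h \<in> CH \<Longrightarrow> ext h \<in> CH"
  and CH_snoc: "h \<in> CH \<Longrightarrow> controller G (last h) \<noteq> L \<Longrightarrow> (last h, v) \<in> edges G \<Longrightarrow> h @ [v] \<in> CH"
proof -
  have *: "h @ [v] \<in> CH" if h: "h \<in> CH" and e: "(last h, v) \<in> edges G"
    and v: "controller G (last h) = L \<Longrightarrow> v = \<sigma> L h" for h v
  proof -
    have ne: "h \<noteq> []" using h hist_ne by (simp add: CH_def)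
    have "(h @ [v]) ! Suc n = \<sigma> L (take (Suc n) (h @ [v]))"
      if n: "Suc n < length (h @ [v])" "(h @ [v]) ! n \<in> region G L" for n
    proof (cases "Suc n < length h")
      case True
      then show ?thesis using n h by (simp add: CH_def history_compatible_def nth_append)
    next
      case False
      then have l: "Suc n = length h" using n by simp
      then have "h ! n = last h" using ne by (metis diff_Suc_1 last_conv_nth)
      then have "last h \<in> region G L" using n l by (simp add: nth_append)
      then show ?thesis using v l by (simp add: region_def)
    qed
    then show ?thesis using h e hist_snoc by (simp add: CH_def history_compatible_def)
  qed
  show "h \<in> CH \<Longrightarrow> ext h \<in> CH"
    unfolding ext_def using move_edge by (intro *) (auto simp: CH_def move_def)
  show "h \<in> CH \<Longrightarrow> controller G (last h) \<noteq> L \<Longrightarrow> (last h, v) \<in> edges G \<Longrightarrow> h @ [v] \<in> CH"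
    by (intro *) auto
qed

lemma CH_iter: "h \<in> CH \<Longrightarrow> (ext ^^ n) h \<in> CH"
  by (induction n) (auto intro: CH_ext)

lemma CH_dev:
  assumes "h \<in> CH" "own (wordof h n) \<noteq> L" "v \<in> succs (wordof h n)"
  shows "(ext ^^ n) h @ [v] \<in> CH"
  using CH_snoc[OF CH_iter[OF assms(1)], of n v] assms(2,3)
  by (simp add: wordof_def succs_tr)

section \<open>Plays on which a single player leaves the profile\<close>

definition dstep :: "'p \<Rightarrow> 'v list \<Rightarrow> 'v list \<Rightarrow> bool" where
  "dstep j h h' \<longleftrightarrow> (\<exists>v. h' = h @ [v] \<and> (last h, v) \<in> edges G \<and>
     (controller G (last h) \<noteq> j \<longrightarrow> v = move h))"

text \<open>The history-dependent counterpart of a region in which \<open>j\<close> is beaten: the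
  opponents are the actual strategies, which may react to the whole past.\<close>

definition safe :: "'p \<Rightarrow> 'v list \<Rightarrow> bool" where
  "safe j h \<longleftrightarrow> (\<forall>H. H 0 = h \<and> (\<forall>t. dstep j (H t) (H (Suc t))) \<longrightarrow>
     odd (Min (\<kappa> j ` limit (\<lambda>t. last (H t)))))"

lemma safe_step:
  assumes "safe j h" "dstep j h h'" shows "safe j h'"
  unfolding safe_def
proof (intro allI impI)
  fix H assume H: "H 0 = h' \<and> (\<forall>t. dstep j (H t) (H (Suc t)))"
  define H' where "H' t = (case t of 0 \<Rightarrow> h | Suc s \<Rightarrow> H s)" for t
  have "H' 0 = h \<and> (\<forall>t. dstep j (H' t) (H' (Suc t)))"
    using H assms(2) by (auto simp: H'_def split: nat.split)
  then have "odd (Min (\<kappa> j ` limit (\<lambda>t. last (H' t))))" using assms(1) unfolding safe_def by blast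
  moreover have "suffix 1 (\<lambda>t. last (H' t)) = (\<lambda>t. last (H t))" by (auto simp: H'_def)
  ultimately show "odd (Min (\<kappa> j ` limit (\<lambda>t. last (H t))))" by (metis limit_suffix)
qed

lemma dstep_ext: "is_history G v0 h \<Longrightarrow> dstep j h (ext h)"
  by (auto simp: dstep_def ext_def move_edge)

lemma safe_iter: "is_history G v0 h \<Longrightarrow> safe j h \<Longrightarrow> safe j ((ext ^^ n) h)"
  by (induction n) (auto intro: safe_step dstep_ext hist_iter)

lemma safe_dev:
  assumes "is_history G v0 h" "safe j h" "own (wordof h n) = j" "j \<noteq> L" "v \<in> succs (wordof h n)"
  shows "safe j ((ext ^^ n) h @ [v])"
proof (rule safe_step[OF safe_iter[OF assms(1,2)]])
  have c: "controller G (last ((ext ^^ n) h)) = j" using assms(3) by (simp add: wordof_def)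
  then have "(last ((ext ^^ n) h), v) \<in> edges G"
    using assms(4,5) unfolding wordof_def succs_tr by simp
  then show "dstep j ((ext ^^ n) h) ((ext ^^ n) h @ [v])" using c by (simp add: dstep_def)
qed

lemma limit_wordof: "is_history G v0 h \<Longrightarrow> limit (\<lambda>n. vx (wordof h n)) = vx ` limit (wordof h)"
  using limit_image[OF pplay_range[OF wordof_pplay(1)]] .

lemma safe_loses:
  assumes "is_history G v0 h" "safe j h" shows "\<not> wins j (wordof h)"
proof -
  have "odd (Min (\<kappa> j ` limit (\<lambda>t. last ((ext ^^ t) h))))"
    using assms(2)[unfolded safe_def, rule_format, of "\<lambda>t. (ext ^^ t) h"] dstep_ext hist_iter[OF assms(1)]
    by auto
  then show ?thesis using limit_wordof[OF assms(1)]
    by (simp add: wins_def wordof_def image_image)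
qed

lemma iter_prefix:
  "h = h0 @ [v] \<Longrightarrow> (ext ^^ n) h = h0 @ map (\<lambda>i. last ((ext ^^ i) h)) [0..<Suc n]"
  by (induction n) (auto simp: ext_def)

lemma outcome_wordof:
  assumes h: "is_history G v0 (h0 @ [v])"
  shows "outcome G v (\<lambda>i h'. \<sigma> i (h0 @ h')) = (\<lambda>n. vx (wordof (h0 @ [v]) n))"
proof (rule outcome_eqI[OF game hist_last[OF h, unfolded last_snoc]])
  show "is_play G v (\<lambda>n. vx (wordof (h0 @ [v]) n))"
    using pplay_is_play[OF wordof_pplay[OF h]] by simp
  show "\<forall>i\<in>players G. play_compatible G i (\<lambda>h'. \<sigma> i (h0 @ h')) (\<lambda>n. vx (wordof (h0 @ [v]) n))"
    unfolding play_compatible_def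
  proof (intro ballI allI impI)
    fix i n assume "vx (wordof (h0 @ [v]) n) \<in> region G i"
    then have "controller G (last ((ext ^^ n) (h0 @ [v]))) = i" by (simp add: wordof_def region_def)
    then have "vx (wordof (h0 @ [v]) (Suc n)) = \<sigma> i ((ext ^^ n) (h0 @ [v]))"
      by (simp add: wordof_def ext_def move_def)
    then show "vx (wordof (h0 @ [v]) (Suc n)) = \<sigma> i (h0 @ map (\<lambda>n. vx (wordof (h0 @ [v]) n)) [0..<Suc n])"
      using iter_prefix[OF refl, of n h0 v] by (simp add: wordof_def del: upt_Suc)
  qed
qed

text \<open>Payoffs are 0 and 1, so if \<open>j\<close> loses the equilibrium outcome, any won
  deviation would be an improvement.\<close>

lemma NE_safe:
  assumes h: "is_history G v0 (h0 @ [v])" and NE: "fixed_NE G L v (\<lambda>i h'. \<sigma> i (h0 @ h'))"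
    and j: "j \<in> players G" "j \<noteq> L" and lose: "\<not> wins j (wordof (h0 @ [v]))"
  shows "safe j (h0 @ [v])"
  unfolding safe_def
proof (intro allI impI)
  fix H assume H: "H 0 = h0 @ [v] \<and> (\<forall>t. dstep j (H t) (H (Suc t)))"
  let ?h = "h0 @ [v]"
  have v: "v \<in> vertices G" using hist_last[OF h] by simp
  define \<zeta> where "\<zeta> t = last (H t)" for t
  have HS: "H (Suc t) = H t @ [\<zeta> (Suc t)]" "(\<zeta> t, \<zeta> (Suc t)) \<in> edges G"
    "controller G (\<zeta> t) \<noteq> j \<Longrightarrow> \<zeta> (Suc t) = move (H t)" for t
    using H by (auto simp: dstep_def \<zeta>_def dest!: spec[of _ t])
  have Hm: "H t = h0 @ map \<zeta> [0..<Suc t]" for t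
  proof (induction t)
    case 0 then show ?case using H by (simp add: \<zeta>_def)
  next
    case (Suc t) then show ?case using HS(1)[of t] by simp
  qed
  have "is_play G v \<zeta>" using HS(2) H by (simp add: is_play_def \<zeta>_def)
  moreover have "\<forall>k\<in>players G - {j}. play_compatible G k (\<lambda>h'. \<sigma> k (h0 @ h')) \<zeta>"
    unfolding play_compatible_def
  proof (intro ballI allI impI)
    fix k n assume k: "k \<in> players G - {j}" "\<zeta> n \<in> region G k"
    then have "controller G (\<zeta> n) = k" by (simp add: region_def)
    then have "\<zeta> (Suc n) = \<sigma> k (H n)" using HS(3)[of n] k by (simp add: move_def \<zeta>_def)
    then show "\<zeta> (Suc n) = \<sigma> k (h0 @ map \<zeta> [0..<Suc n])" by (simp only: Hm)
  qed
  ultimately have "payoff G \<zeta> j \<le> payoff G (outcome G v (\<lambda>i h'. \<sigma> i (h0 @ h'))) j"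
    using NE j unfolding fixed_NE_iff[OF game v] by blast
  then have "payoff G \<zeta> j \<le> 0" using lose payoff_wins[OF wordof_pplay(1)[OF h], of j] outcome_wordof[OF h] by simp
  then show "odd (Min (\<kappa> j ` limit (\<lambda>t. last (H t))))"
    by (auto simp: payoff parity_payoff_def \<zeta>_def[abs_def] split: if_splits)
qed

section \<open>The game between histories and deviations\<close>

definition options :: "'p \<Rightarrow> 'v list \<Rightarrow> (nat \<times> 'q \<times> 'v) set" where
  "options j h = {(rmin (colour j (wordof h)) n, tgt (wordof h n), v) | n v.
     own (wordof h n) = j \<and> v \<in> succs (wordof h n)}"

definition base :: "'v list \<Rightarrow> 'q \<times> 'v" where
  "base h = (\<rho> (butlast h), last h)"

text \<open>At a pair of state and vertex one side chooses any history compatible with Leader that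
  ends there and whose continuation \<open>j\<close> loses; the other side chooses where
  \<open>j\<close> leaves that continuation. Histories with the same base thereby become
  interchangeable.\<close>

definition actions :: "'p \<Rightarrow> 'q \<times> 'v \<Rightarrow> (nat \<times> 'q \<times> 'v) set set" where
  "actions j d = {options j h | h. h \<in> CH \<and> base h = d \<and> \<not> wins j (wordof h)}"

text \<open>What is used of determinacy: a history with suitable ranks for every pair in
  \<open>W\<close>, and no safe history with its base outside.\<close>

definition prover_region :: "'p \<Rightarrow> ('q \<times> 'v) set \<Rightarrow> (nat \<Rightarrow> 'q \<times> 'v \<Rightarrow> nat) \<Rightarrow> bool" where
  "prover_region j W r \<longleftrightarrow> W \<subseteq> mstates M \<times> vertices G \<and>
     (\<forall>d\<in>W. \<exists>h\<in>CH. base h = d \<and> \<not> wins j (wordof h) \<and>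
        (\<forall>(c, d')\<in>options j h. d' \<in> W \<and> descends even c r d d')) \<and>
     (\<forall>h\<in>CH. safe j h \<longrightarrow> base h \<in> W)"

text \<open>Suppose a safe history had its base outside \<open>W\<close>. There every choice has an
  answer, in particular the choice of the actual history; these answers can be carried out one after
  another as real deviations of \<open>j\<close>. They compose to one play on which only
  \<open>j\<close> leaves the profile and whose least recurring colour is not odd, against
  safety.\<close>

lemma winning_region:
  assumes j: "j \<in> players G" "j \<noteq> L"
  shows "\<exists>W r. prover_region j W r"
proof -
  let ?S = "mstates M \<times> vertices G"
  define m where "m = Suc (Max (\<kappa> j ` vertices G))"
  have fin: "finite ?S" using mealy game by (auto simp: is_mealy_def is_game_def)
  have hist: "is_history G v0 h" if "h \<in> CH" for h using that by (simp add: CH_def)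
  have pos: "wordof h n \<in> positions" if "h \<in> CH" for h n
    using wordof_pplay(1)[OF hist[OF that]] by (simp add: pplay_def)
  have optS: "c < m \<and> d' \<in> ?S" if "h \<in> CH" "(c, d') \<in> options j h" for h c d'
  proof -
    obtain n v where n: "c = rmin (colour j (wordof h)) n" "d' = (tgt (wordof h n), v)" "v \<in> succs (wordof h n)"
      using \<open>(c, d') \<in> options j h\<close> by (auto simp: options_def)
    have "c \<in> \<kappa> j ` vertices G"
      using rmin_in[of "colour j (wordof h)" n] n(1) position_facts(2)[OF pos[OF that(1)]] by auto
    then have "c < m" using game by (simp add: m_def is_game_def less_Suc_eq_le)
    then show ?thesis using n position_facts(3,7)[OF pos[OF that(1)], of n] by auto
  qed
  have A0: "c < m \<and> d' \<in> ?S" if "d \<in> ?S" "C \<in> actions j d" "(c, d') \<in> C" for d C c d'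
  proof -
    obtain h where "C = options j h" "h \<in> CH" using \<open>C \<in> actions j d\<close> by (auto simp: actions_def)
    then show ?thesis using optS[of h c d'] \<open>(c, d') \<in> C\<close> by simp
  qed
  have A: "\<forall>d\<in>?S. \<forall>C\<in>actions j d. \<forall>c d'. (c, d') \<in> C \<longrightarrow> c < m \<and> d' \<in> ?S"
    using A0 by (intro ballI allI impI) 
  obtain W r r' where W0: "W \<subseteq> ?S \<and>
    (\<forall>d\<in>W. \<exists>C\<in>actions j d. \<forall>(c, d')\<in>C. d' \<in> W \<and> descends even c r d d') \<and>
    (\<forall>d\<in>?S - W. \<forall>C\<in>actions j d. \<exists>(c, d')\<in>C. d' \<in> ?S - W \<and> descends odd c r' d d')"
    using positional_determinacy[where S = ?S and A = "actions j" and m = m, OF fin A] by (elim exE) (rule that)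
  note W = conjunct1[OF W0] bspec[OF conjunct1[OF conjunct2[OF W0]]]
    bspec[OF bspec[OF conjunct2[OF conjunct2[OF W0]]]]
  have base: "base h \<in> ?S" if "h \<in> CH" for h
    using position_facts(1,2)[OF tr_position[OF hist[OF that]]] by (simp add: base_def)
  have "base h \<in> W" if h: "h \<in> CH" "safe j h" for h
  proof (rule ccontr)
    assume nW: "base h \<notin> W"
    let ?bad = "\<lambda>h. h \<in> CH \<and> safe j h \<and> base h \<in> ?S - W"
    define bad where "bad h \<longleftrightarrow> ?bad h" for h
    let ?rel = "\<lambda>h n v. own (wordof h n) = j \<and> v \<in> succs (wordof h n) \<and> ?bad ((ext ^^ n) h @ [v]) \<and>
      (\<forall>e. odd e \<and> e \<le> rmin (colour j (wordof h)) n \<longrightarrow>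
        r' e (base ((ext ^^ n) h @ [v])) \<le> r' e (base h) \<and>
        (e = rmin (colour j (wordof h)) n \<longrightarrow> r' e (base ((ext ^^ n) h @ [v])) < r' e (base h)))"
    define rel where "rel h n v \<longleftrightarrow> ?rel h n v" for h n v
    have "\<exists>n v. rel h n v" if "bad h" for h
    proof -
      have bad: "?bad h" using that unfolding bad_def .
      have o: "options j h \<in> actions j (base h)"
        using bad safe_loses[OF hist] by (auto simp: actions_def)
      have b: "base h \<in> ?S - W" using bad by (elim conjE)
      from W(3)[OF b o] obtain z where z: "z \<in> options j h" "case z of (c, d') \<Rightarrow> d' \<in> ?S - W \<and>
        descends odd c r' (base h) d'"
        by (rule bexE)
      obtain c d' where zz: "z = (c, d')" by (cases z)
      have c: "(c, d') \<in> options j h" "d' \<in> ?S - W"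
        "descends odd c r' (base h) d'"
        using z unfolding zz by simp_all
      from c(1) obtain n v where n: "c = rmin (colour j (wordof h)) n" "d' = (tgt (wordof h n), v)"
        "own (wordof h n) = j" "v \<in> succs (wordof h n)"
        by (auto simp: options_def)
      have d': "d' = base ((ext ^^ n) h @ [v])" by (simp add: n(2) base_def wordof_def)
      have hh: "h \<in> CH" "safe j h" using bad by blast+
      have "(ext ^^ n) h @ [v] \<in> CH" using CH_dev[OF hh(1), of n v] n(3,4) j by simp
      moreover have "safe j ((ext ^^ n) h @ [v])" by (rule safe_dev[OF hist[OF hh(1)] hh(2) n(3) j(2) n(4)])
      ultimately have "?rel h n v" using n(3,4) c(2,3) unfolding d' n(1) by blast
      then show ?thesis unfolding rel_def by (intro exI)
    qed
    then obtain fn fv where f0: "\<And>h. bad h \<Longrightarrow> rel h (fn h) (fv h)" by metis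
    have f: "?rel h (fn h) (fv h)" if "?bad h" for h
      using f0[of h] that unfolding bad_def rel_def by blast
    \<comment> \<open>The history after \<open>k\<close> deviations: the profile is followed for
      \<open>fn\<close> steps, then \<open>j\<close> deviates to \<open>fv\<close>.\<close>
    define hs where "hs k = ((\<lambda>h. (ext ^^ fn h) h @ [fv h]) ^^ k) h" for k
    have hs0: "hs 0 = h" and hsS: "hs (Suc k) = (ext ^^ fn (hs k)) (hs k) @ [fv (hs k)]" for k
      by (simp_all add: hs_def)
    have bad: "?bad (hs k)" for k
    proof (induction k)
      case 0 then show ?case using h nW base by (simp add: hs0)
    next
      case (Suc k)
      from f[OF Suc] show ?case unfolding hsS by (elim conjE, intro conjI)
    qed
    note rel = f[OF bad]
    \<comment> \<open>Start times of the segments; the successor counts the deviating step itself.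
      \<open>merge\<close> then glues the segments to a single sequence of histories.\<close>
    define \<tau> where "\<tau> k = (\<Sum>i<k. Suc (fn (hs i)))" for k
    have \<tau>S: "\<tau> (Suc k) = \<tau> k + Suc (fn (hs k))" for k by (simp add: \<tau>_def)
    have idx: "idx_sequence \<tau>" by (simp add: idx_sequence_def \<tau>S) (simp add: \<tau>_def)
    define H where "H = merge (\<lambda>k t. (ext ^^ (t - \<tau> k)) (hs k)) \<tau>"
    have H: "H t = (ext ^^ (t - \<tau> k)) (hs k)" if "\<tau> k \<le> t" "t < \<tau> (Suc k)" for t k
      unfolding H_def using that by (intro merge[OF idx]) simp
    have find: "\<exists>k. \<tau> k \<le> t \<and> t < \<tau> (Suc k)" for t
      using idx_sequence_interval[OF idx, of t] by auto
    have step: "dstep j (H t) (H (Suc t))" for t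
    proof -
      obtain k where k: "\<tau> k \<le> t" "t < \<tau> (Suc k)" using find by blast
      let ?s = "t - \<tau> k"
      have hk: "is_history G v0 ((ext ^^ ?s) (hs k))" using hist_iter hist bad by blast
      show ?thesis
      proof (cases "Suc t < \<tau> (Suc k)")
        case True
        then have "H (Suc t) = ext (H t)" using H[of k t] H[of k "Suc t"] k by (simp add: Suc_diff_le)
        then show ?thesis using dstep_ext[OF hk] H[OF k] by simp
      next
        case False
        then have t: "Suc t = \<tau> (Suc k)" using k by simp
        then have s: "?s = fn (hs k)" using \<tau>S[of k] by simp
        have "H (Suc t) = hs (Suc k)" using H[of "Suc k" "Suc t"] t \<tau>S[of "Suc k"] by simp
        then have "H (Suc t) = H t @ [fv (hs k)]" using H[OF k] s hsS by simp
        moreover have "controller G (last (H t)) = j" "fv (hs k) \<in> succs (tr (H t))"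
          using rel[of k] H[OF k] s by (simp_all add: wordof_def)
        ultimately show ?thesis using j by (auto simp: dstep_def succs_tr split: if_splits)
      qed
    qed
    have Hhist: "is_history G v0 (H t)" for t
      using find[of t] H hist_iter hist bad by metis
    have "H 0 = h" using H[of 0 0] \<tau>S[of 0] by (simp add: \<tau>_def hs0)
    then have odd: "odd (Min (\<kappa> j ` limit (\<lambda>t. last (H t))))"
      using h(2) step unfolding safe_def by blast
    have finr: "finite (range (\<lambda>t. last (H t)))"
      using hist_last[OF Hhist] game by (meson finite_subset image_subsetI is_game_def)
    define col where "col t = \<kappa> j (last (H t))" for t
    have col: "col (\<tau> k + i) = colour j (wordof (hs k)) i" if "i \<le> fn (hs k)" for k i
      using H[of k "\<tau> k + i"] that by (simp add: col_def wordof_def \<tau>S)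
    \<comment> \<open>The answers outside \<open>W\<close> lower the ranks for odd colours from one
      deviation to the next, which is the situation of \<open>segment_parity\<close> with
      \<open>odd\<close> in place of \<open>even\<close>.\<close>
    have "\<not> odd (Min (limit col))"
    proof (rule segment_parity[where \<tau> = \<tau> and R = "\<lambda>e k. r' e (base (hs k))"])
      have "range col = \<kappa> j ` range (\<lambda>t. last (H t))" by (auto simp: col_def)
      then show "finite (range col)" using finr by simp
      show "strict_mono \<tau>" by (simp add: strict_mono_Suc_iff \<tau>S)
      fix k e assume e: "odd e" "\<forall>n\<in>{\<tau> k..<\<tau> (Suc k)}. e \<le> col n"
      let ?n = "fn (hs k)"
      have ge: "\<forall>i\<le>?n. e \<le> colour j (wordof (hs k)) i"
      proof (intro allI impI)
        fix i assume "i \<le> ?n"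
        then show "e \<le> colour j (wordof (hs k)) i"
          using e(2)[THEN bspec, of "\<tau> k + i"] col[of i k] \<tau>S[of k] by simp
      qed
      have 1: "e \<le> rmin (colour j (wordof (hs k))) ?n" using ge by (simp add: le_rmin_iff)
      have 2: "e = rmin (colour j (wordof (hs k))) ?n" if t: "\<exists>n\<in>{\<tau> k..<\<tau> (Suc k)}. col n = e"
      proof -
        obtain n where n: "n \<in> {\<tau> k..<\<tau> (Suc k)}" "col n = e" using t by blast
        then have "n - \<tau> k \<le> ?n" "colour j (wordof (hs k)) (n - \<tau> k) = e"
          using col[of "n - \<tau> k" k] \<tau>S[of k] by auto
        then show ?thesis unfolding eq_rmin_iff[OF ge] by blast
      qed
      show "r' e (base (hs (Suc k))) \<le> r' e (base (hs k)) \<and>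
        ((\<exists>n\<in>{\<tau> k..<\<tau> (Suc k)}. col n = e) \<longrightarrow> r' e (base (hs (Suc k))) < r' e (base (hs k)))"
      proof -
        have "\<forall>e. odd e \<and> e \<le> rmin (colour j (wordof (hs k))) ?n \<longrightarrow>
           r' e (base (hs (Suc k))) \<le> r' e (base (hs k)) \<and>
           (e = rmin (colour j (wordof (hs k))) ?n \<longrightarrow> r' e (base (hs (Suc k))) < r' e (base (hs k)))"
          using rel[of k] unfolding hsS by (elim conjE)
        from this[THEN spec, of e] e(1) 1 have
          "r' e (base (hs (Suc k))) \<le> r' e (base (hs k))"
          "e = rmin (colour j (wordof (hs k))) ?n \<Longrightarrow> r' e (base (hs (Suc k))) < r' e (base (hs k))"
          by blast+
        then show ?thesis using 2 by blast
      qed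
    qed
    then show False using odd limit_image[OF finr, of "\<kappa> j"] by (simp add: col_def[abs_def])
  qed
  moreover have "\<exists>h\<in>CH. base h = d \<and> \<not> wins j (wordof h) \<and>
       (\<forall>(c, d')\<in>options j h. d' \<in> W \<and> descends even c r d d')" if "d \<in> W" for d
  proof -
    obtain C where C: "C \<in> actions j d" "\<forall>(c, d')\<in>C. d' \<in> W \<and> descends even c r d d'" using W(2)[OF \<open>d \<in> W\<close>] ..
    then obtain h where "C = options j h" "h \<in> CH" "base h = d" "\<not> wins j (wordof h)"
      by (auto simp: actions_def)
    then show ?thesis using C(2) by (intro bexI[of _ h]) simp_all
  qed
  ultimately have "prover_region j W r" using W(1) unfolding prover_region_def by blast
  then show ?thesis by blast
qed

text \<open>The positional solution selects one history per key, whose continuation becomes the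
  proposal. The punishing keys demanded by \<open>good\<close> exist because a lost equilibrium
  outcome makes the history and its deviations safe, and safe histories have their base in
  \<open>W\<close>; those demanded by \<open>punishing\<close> exist because \<open>W\<close> is
  closed under the deviations considered.\<close>

lemma certificate_from_profile:
  assumes NE: "fixed_NE G L v0 \<sigma>" and SPE: "spe \<Longrightarrow> fixed_SPE G L v0 \<sigma>"
  shows "\<exists>Dom P r. certificate spe (wordof [v0]) Dom P r \<and> Dom \<subseteq> players G \<times> mstates M \<times> vertices G"
proof -
  have "\<forall>j. \<exists>z. j \<in> players G - {L} \<longrightarrow> prover_region j (fst z) (snd z)"
  proof
    fix j
    show "\<exists>z. j \<in> players G - {L} \<longrightarrow> prover_region j (fst z) (snd z)"
    proof (cases "j \<in> players G - {L}")
      case True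
      then obtain W r where "prover_region j W r" using winning_region[of j] by blast
      then show ?thesis by (intro exI[of _ "(W, r)"]) simp
    qed blast
  qed
  then obtain z where z: "\<forall>j. j \<in> players G - {L} \<longrightarrow> prover_region j (fst (z j)) (snd (z j))"
    by (elim exE[OF choice])
  define W where "W j = fst (z j)" for j
  define r where "r j = snd (z j)" for j
  have WR: "prover_region j (W j) (r j)" if "j \<in> players G - {L}" for j
    using z that unfolding W_def r_def by blast
  have W: "\<And>j. j \<in> players G - {L} \<Longrightarrow> W j \<subseteq> mstates M \<times> vertices G"
    "\<And>j h. j \<in> players G - {L} \<Longrightarrow> h \<in> CH \<Longrightarrow> safe j h \<Longrightarrow> base h \<in> W j"
    using WR unfolding prover_region_def by blast+
  have W2: "\<exists>h\<in>CH. base h = d \<and> \<not> wins j (wordof h) \<and>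
       (\<forall>(c, d')\<in>options j h. d' \<in> W j \<and> descends even c (r j) d d')"
    if "j \<in> players G - {L}" "d \<in> W j" for j d
    using WR[OF that(1)] that(2) unfolding prover_region_def by (elim conjE) (rule bspec)
  define Dom where "Dom = {(j, q, v). j \<in> players G - {L} \<and> (q, v) \<in> W j} \<union> {(L, q, v) | q v. \<exists>h\<in>CH. base h = (q, v)}"
  have hist: "is_history G v0 h" if "h \<in> CH" for h using that by (simp add: CH_def)
  define answer where "answer j q v h \<longleftrightarrow> h \<in> CH \<and> base h = (q, v) \<and> (j \<noteq> L \<longrightarrow> \<not> wins j (wordof h) \<and>
       (\<forall>(c, d')\<in>options j h. d' \<in> W j \<and> descends even c (r j) (q, v) d'))" for j q v h
  have ex_answer: "\<exists>h. answer j q v h" if D: "(j, q, v) \<in> Dom" for j q v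
  proof (cases "j = L")
    case True
    then show ?thesis using D by (auto simp: Dom_def answer_def)
  next
    case False
    then have "j \<in> players G - {L}" "(q, v) \<in> W j" using D by (auto simp: Dom_def)
    from W2[OF this] show ?thesis unfolding answer_def by blast
  qed
  define hh where "hh j q v = (SOME h. answer j q v h)" for j q v
  have ans: "answer j q v (hh j q v)" if "(j, q, v) \<in> Dom" for j q v
    unfolding hh_def using ex_answer[OF that] by (rule someI_ex)
  have hh: "\<And>j q v. (j, q, v) \<in> Dom \<Longrightarrow> hh j q v \<in> CH"
    "\<And>j q v. (j, q, v) \<in> Dom \<Longrightarrow> base (hh j q v) = (q, v)"
    "\<And>j q v. (j, q, v) \<in> Dom \<Longrightarrow> j \<noteq> L \<Longrightarrow> \<not> wins j (wordof (hh j q v))"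
    "\<And>j q v c d'. (j, q, v) \<in> Dom \<Longrightarrow> j \<noteq> L \<Longrightarrow> (c, d') \<in> options j (hh j q v) \<Longrightarrow> d' \<in> W j \<and>
       descends even c (r j) (q, v) d'"
  proof -
    fix j q v assume D: "(j, q, v) \<in> Dom"
    note a = ans[OF D, unfolded answer_def]
    show "hh j q v \<in> CH" "base (hh j q v) = (q, v)"
      by (rule conjunct1[OF a], rule conjunct1[OF conjunct2[OF a]])
    assume jL: "j \<noteq> L"
    note b = mp[OF conjunct2[OF conjunct2[OF a]] jL]
    show "\<not> wins j (wordof (hh j q v))" by (rule conjunct1[OF b])
    fix c d' assume o: "(c, d') \<in> options j (hh j q v)"
    from bspec[OF conjunct2[OF b] o] show "d' \<in> W j \<and>
       descends even c (r j) (q, v) d'"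
      by (rule case_prodD)
  qed
  define P where "P = (\<lambda>(j, q, v). wordof (hh j q v))"
  \<comment> \<open>Passes from ranks indexed by colours to ranks indexed by vertices.\<close>
  define R where "R = (\<lambda>(j, q, v) x. r j (\<kappa> j x) (q, v))"
  have good: "good spe Dom (wordof (h0 @ [v]))"
    if h: "h0 @ [v] \<in> CH" and NE: "fixed_NE G L v (\<lambda>i h'. \<sigma> i (h0 @ h'))" for h0 v
    unfolding good_def
  proof (intro allI impI ballI conjI)
    fix n v' assume n: "own (wordof (h0 @ [v]) n) \<noteq> L" "v' \<in> succs (wordof (h0 @ [v]) n)"
    let ?h = "h0 @ [v]" let ?h' = "(ext ^^ n) ?h @ [v']" let ?j = "own (wordof ?h n)"
    have h': "?h' \<in> CH" by (rule CH_dev[OF h n])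
    have b: "base ?h' = (tgt (wordof ?h n), v')" by (simp add: base_def wordof_def)
    show "(L, tgt (wordof ?h n), v') \<in> Dom" using h' b by (auto simp: Dom_def)
    assume lose: "\<not> wins ?j (wordof ?h)"
    have "wordof ?h n \<in> positions" using wordof_pplay(1)[OF hist[OF h]] by (simp add: pplay_def)
    then have j: "?j \<in> players G" by (rule position_facts(4))
    have "safe ?j ?h" by (rule NE_safe[OF hist[OF h] NE j n(1) lose])
    then have "safe ?j ?h'" using safe_dev[OF hist[OF h] _ refl n(1,2)] by blast
    then have "base ?h' \<in> W ?j" using W(2) j n(1) h' by blast
    then show "(?j, tgt (wordof ?h n), v') \<in> Dom" using j n(1) b by (simp add: Dom_def)
  qed
  have v0CH: "[v0] \<in> CH" by (simp add: CH_def is_history_def history_compatible_def)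
  have "good spe Dom (wordof [v0])" using good[of "[]" v0] v0CH NE by simp
  moreover have "starts (minit M) v0 (wordof [v0])"
    using wordof_pplay(2)[OF hist[OF v0CH]] rho0 by simp
  moreover have "pplay (wordof [v0])" by (rule wordof_pplay(1)[OF hist[OF v0CH]])
  moreover have "pplay (P (j, q, v)) \<and> starts q v (P (j, q, v)) \<and> (spe \<longrightarrow> good spe Dom (P (j, q, v))) \<and>
      (j \<noteq> L \<longrightarrow> punishing Dom R (j, q, v) (P (j, q, v)))" if D: "(j, q, v) \<in> Dom" for j q v
  proof (intro conjI impI)
    let ?h = "hh j q v"
    have h: "is_history G v0 ?h" using hist hh(1)[OF D] by blast
    have P: "P (j, q, v) = wordof ?h" by (simp add: P_def)
    show "pplay (P (j, q, v))" "starts q v (P (j, q, v))"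
      using wordof_pplay[OF h] hh(2)[OF D] by (simp_all add: P base_def)
    show "good spe Dom (P (j, q, v))" if spe
    proof -
      obtain h0 w where hw: "?h = h0 @ [w]" using hist_ne[OF h] by (metis rev_exhaust)
      have "fixed_NE (subgame G h0) L w (\<lambda>i h'. \<sigma> i (h0 @ h'))"
        using SPE[OF that] hh(1)[OF D] unfolding fixed_SPE_def CH_def hw by blast
      then show ?thesis using good[of h0 w] hh(1)[OF D] subgame_parity[OF payoff] by (simp add: P hw)
    qed
    assume jL: "j \<noteq> L"
    then have jp: "j \<in> players G - {L}" using D by (auto simp: Dom_def)
    show "punishing Dom R (j, q, v) (P (j, q, v))"
      unfolding punishing_iff P
    proof (intro conjI allI impI ballI)
      show "\<not> wins j (wordof ?h)" by (rule hh(3)[OF D jL])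
      fix n v' assume n: "own (wordof ?h n) = j" "v' \<in> succs (wordof ?h n)"
      have opt: "(rmin (colour j (wordof ?h)) n, tgt (wordof ?h n), v') \<in> options j ?h"
        using n by (auto simp: options_def)
      note o = hh(4)[OF D jL opt]
      show "(j, tgt (wordof ?h n), v') \<in> Dom" using o jp by (simp add: Dom_def)
      fix x assume x: "even (\<kappa> j x) \<and> \<kappa> j x \<le> rmin (colour j (wordof ?h)) n"
      note o' = mp[OF spec[OF conjunct2[OF o], of "\<kappa> j x"] x]
      show "R (j, tgt (wordof ?h n), v') x \<le> R (j, q, v) x"
        using conjunct1[OF o'] by (simp only: R_def prod.case)
      assume "\<kappa> j x = rmin (colour j (wordof ?h)) n"
      from mp[OF conjunct2[OF o'] this] show "R (j, tgt (wordof ?h n), v') x < R (j, q, v) x"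
        by (simp only: R_def prod.case)
    qed
  qed
  ultimately have "certificate spe (wordof [v0]) Dom P R" unfolding certificate_def by blast
  moreover have "Dom \<subseteq> players G \<times> mstates M \<times> vertices G"
  proof -
    have "base h \<in> mstates M \<times> vertices G" if "h \<in> CH" for h
      using position_facts(1,2)[OF tr_position[OF hist[OF that]]] by (simp add: base_def)
    then show ?thesis using W(1) L by (fastforce simp: Dom_def)
  qed
  ultimately show ?thesis by blast
qed

end

theorem certificate_complete:
  assumes NE: "fixed_NE G L v0 \<sigma>" and SPE: "spe \<Longrightarrow> fixed_SPE G L v0 \<sigma>" and comp: "\<sigma> L \<in> Comp G L v0 M"
  shows "\<exists>main Dom P r. certificate spe main Dom P r \<and> Dom \<subseteq> players G \<times> mstates M \<times> vertices G \<and>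
    outcome G v0 \<sigma> = (\<lambda>n. vx (main n))"
proof -
  have profile: "is_profile G v0 \<sigma>" using NE by (simp add: fixed_NE_def)
  obtain \<rho> where \<rho>: "\<rho> [] = minit M"
    "\<And>h v. is_history G v0 (h @ [v]) \<Longrightarrow>
      (v \<notin> region G L \<longrightarrow> (\<rho> h, v, \<rho> (h @ [v])) \<in> mtrans M) \<and>
      (v \<in> region G L \<longrightarrow> (\<rho> h, v, \<rho> (h @ [v]), \<sigma> L (h @ [v])) \<in> mtransL M)"
    using comp unfolding Comp_def by blast
  show ?thesis
    using certificate_from_profile[OF profile \<rho> NE SPE] outcome_wordof[OF profile \<rho>, of "[]" v0]
    by (simp add: is_history_def) blast
qed

end

subsection \<open>Lassos\<close>

abbreviation walk :: "('a \<times> 'a) set \<Rightarrow> 'a list \<Rightarrow> bool" where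
  "walk E \<equiv> successively (\<lambda>x y. (x, y) \<in> E)"

lemma relpow_path:
  assumes "(a, b) \<in> E ^^ k" "0 < k"
  shows "\<exists>ws. length ws = k \<and> ws \<noteq> [] \<and> last ws = b \<and> walk E (a # ws)"
proof -
  obtain f where f: "f 0 = a" "f k = b" "\<forall>i<k. (f i, f (Suc i)) \<in> E"
    using assms(1) by (auto simp: relpow_fun_conv)
  define ws where "ws = map f [Suc 0..<Suc k]"
  have aws: "a # ws = map f [0..<Suc k]"
    by (simp add: ws_def f(1)[symmetric] upt_conv_Cons del: upt_Suc)
  have "walk E (map f [0..<Suc m])" if "m \<le> k" for m
    using that
  proof (induction m)
    case (Suc m)
    then show ?case using f(3) by (simp add: successively_append_iff)
  qed simp
  moreover have "last ws = b" using assms(2) f(2) by (simp add: ws_def last_map)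
  ultimately show ?thesis using aws assms(2)
    by (intro exI[of _ ws]) (auto simp: ws_def simp del: upt_Suc)
qed

lemma closed_walk:
  assumes conn: "\<And>b c. b \<in> S \<Longrightarrow> c \<in> S \<Longrightarrow> \<exists>ws. length ws \<le> B \<and> ws \<noteq> [] \<and> last ws = c \<and>
      walk E (b # ws) \<and> set ws \<subseteq> S"
    and "set zs \<subseteq> S" "b \<in> S" "c \<in> S"
  shows "\<exists>ws. length ws \<le> (length zs + 1) * B \<and> ws \<noteq> [] \<and> last ws = c \<and>
      walk E (b # ws) \<and> set ws \<subseteq> S \<and> set zs \<subseteq> set ws"
  using assms(2,3)
proof (induction zs arbitrary: b)
  case Nil
  then show ?case using conn[of b c] assms(4) by auto
next
  case (Cons z zs)
  obtain us where us: "length us \<le> B" "us \<noteq> []" "last us = z"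
      "walk E (b # us)" "set us \<subseteq> S"
    using conn[of b z] Cons.prems by auto
  obtain ws where ws: "length ws \<le> (length zs + 1) * B" "ws \<noteq> []" "last ws = c"
      "walk E (z # ws)" "set ws \<subseteq> S" "set zs \<subseteq> set ws"
    using Cons.IH[of z] Cons.prems by auto
  have "walk E ((b # us) @ ws)"
    unfolding successively_append_iff using us ws by (cases ws) auto
  moreover have "z \<in> set us" using us by auto
  ultimately show ?case using us ws by (intro exI[of _ "us @ ws"]) auto
qed

definition lasso_word :: "'a list \<times> 'a list \<Rightarrow> 'a word" where
  "lasso_word l = fst l \<frown> (snd l)\<^sup>\<omega>"

text \<open>One unrolling, closed up by the first element of the loop, shows all steps of the
  infinite word.\<close>

lemma lasso_step:
  assumes "loop \<noteq> []" and s: "successively R (pre @ loop @ [hd loop])"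
  shows "R (lasso_word (pre, loop) n) (lasso_word (pre, loop) (Suc n))"
proof -
  let ?l = "pre @ loop @ [hd loop]"
  have R: "R (?l ! i) (?l ! Suc i)" if "Suc i < length ?l" for i
    using s that unfolding successively_conv_nth by blast
  have 1: "lasso_word (pre, loop) i = ?l ! i" if "i \<le> length pre + length loop" for i
  proof (cases "i < length pre")
    case False
    then obtain m where m: "i = length pre + m" by (metis le_Suc_ex not_less)
    show ?thesis
    proof (cases "m = length loop")
      case True
      then show ?thesis using assms(1) m by (simp add: lasso_word_def nth_append hd_conv_nth)
    next
      case False
      then show ?thesis using that assms(1) m by (simp add: lasso_word_def nth_append)
    qed
  qed (simp add: lasso_word_def nth_append)
  show ?thesis
  proof (cases "n < length pre + length loop")
    case True
    then show ?thesis using 1[of n] 1[of "Suc n"] R[of n] by simp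
  next
    case False
    define m where "m = (n - length pre) mod length loop"
    have ml: "m < length loop" using assms(1) by (simp add: m_def)
    have "lasso_word (pre, loop) n = loop ! m" using False assms(1) by (simp add: lasso_word_def m_def)
    moreover have "lasso_word (pre, loop) (Suc n) = (loop @ [hd loop]) ! Suc m"
    proof -
      have "Suc n - length pre = Suc (n - length pre)" using False by simp
      then have "(Suc n - length pre) mod length loop = (if Suc m = length loop then 0 else Suc m)"
        by (simp add: m_def mod_Suc)
      then show ?thesis using False assms(1) ml
        by (auto simp: lasso_word_def nth_append hd_conv_nth)
    qed
    moreover have "R (?l ! (length pre + m)) (?l ! Suc (length pre + m))" using ml by (intro R) simp
    ultimately show ?thesis using ml by (simp add: nth_append)
  qed
qed

lemma lasso_word_0: "loop \<noteq> [] \<Longrightarrow> lasso_word (pre, loop) 0 = hd (pre @ loop)"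
  by (cases pre) (auto simp: lasso_word_def hd_conv_nth)

text \<open>The prefix is a short path in the graph of all steps of \<open>w\<close>, the loop a
  closed walk through all recurring points in the graph of the late steps. With \<open>n\<close>
  points there are at most \<open>n ^ 2\<close> steps, which bounds the length of a path, and the
  loop joins at most \<open>n + 1\<close> paths.\<close>

lemma lasso_exists:
  assumes fin: "finite (range w)"
  shows "\<exists>l. snd l \<noteq> [] \<and> lasso_word l 0 = w 0 \<and>
     (\<forall>n. \<exists>m. lasso_word l n = w m \<and> lasso_word l (Suc n) = w (Suc m)) \<and> set (snd l) = limit w \<and>
     length (fst l) \<le> card (range w) ^ 2 \<and> length (snd l) \<le> (card (range w) + 1) * card (range w) ^ 2"
proof -
  define E where "E = range (\<lambda>n. (w n, w (Suc n)))"
  have ER: "E \<subseteq> range w \<times> range w" by (auto simp: E_def)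
  then have finE: "finite E" using fin by (meson finite_SigmaI finite_subset)
  have cE: "card E \<le> card (range w) ^ 2"
    using card_mono[OF _ ER] fin by (simp add: card_cartesian_product power2_eq_square)
  obtain N where N: "limit w = range (suffix N w)" using limit_is_suffix[OF fin] by blast
  have inl: "w n \<in> limit w" if "N \<le> n" for n
    unfolding N using that by (auto intro!: image_eqI[of _ _ "n - N"])
  \<comment> \<open>The steps made from \<open>N\<close> on. They visit only recurring points and
    join any two of these.\<close>
  define E' where "E' = (\<lambda>n. (w n, w (Suc n))) ` {N..}"
  have E'E: "E' \<subseteq> E" by (auto simp: E'_def E_def)
  have finE': "finite E'" using finE E'E finite_subset by blast
  have cE': "card E' \<le> card (range w) ^ 2" using card_mono[OF finE E'E] cE by simp
  have conn: "\<exists>ws. length ws \<le> card (range w) ^ 2 \<and> ws \<noteq> [] \<and> last ws = c \<and>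
      walk E' (b # ws) \<and> set ws \<subseteq> limit w"
    if bc: "b \<in> limit w" "c \<in> limit w" for b c
  proof -
    obtain n1 where n1: "N \<le> n1" "w n1 = b"
      using bc(1) unfolding limit_iff_frequent INFM_nat_le by blast
    obtain n2 where n2: "Suc n1 \<le> n2" "w n2 = c"
      using bc(2) unfolding limit_iff_frequent INFM_nat_le by blast
    have "(b, c) \<in> E' ^^ (n2 - n1)"
      unfolding relpow_fun_conv using n1 n2
      by (intro exI[of _ "\<lambda>i. w (n1 + i)"]) (auto simp: E'_def)
    then obtain k where k: "0 < k" "k \<le> card E'" "(b, c) \<in> E' ^^ k"
      using relpow_finite_bounded1[OF finE', of "n2 - n1"] n2(1) by auto
    obtain ws where ws: "length ws = k" "ws \<noteq> []" "last ws = c" "walk E' (b # ws)"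
      using relpow_path[OF k(3,1)] by blast
    have "set ws \<subseteq> limit w"
    proof
      fix y assume "y \<in> set ws"
      then obtain i where i: "i < length ws" "y = ws ! i" by (auto simp: in_set_conv_nth)
      then have "((b # ws) ! i, (b # ws) ! Suc i) \<in> E'"
        using ws(4) unfolding successively_conv_nth by simp
      then show "y \<in> limit w" using i inl by (auto simp: E'_def)
    qed
    then show ?thesis using ws k(2) cE' by (intro exI[of _ ws]) auto
  qed
  have finl: "finite (limit w)" using fin limit_in_range finite_subset by metis
  obtain zs where zs: "set zs = limit w" "distinct zs" using finite_distinct_list[OF finl] by blast
  have lzs: "length zs \<le> card (range w)"
    using card_mono[OF fin limit_in_range[of w]] distinct_card[OF zs(2)] zs(1) by simp
  let ?a = "w N"
  have a: "?a \<in> limit w" by (rule inl) simp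
  obtain ws where ws: "length ws \<le> (length zs + 1) * card (range w) ^ 2" "ws \<noteq> []" "last ws = ?a"
      "walk E' (?a # ws)" "set ws \<subseteq> limit w" "set zs \<subseteq> set ws"
    using closed_walk[OF conn, of zs ?a ?a] zs(1) a by auto
  have "(w 0, ?a) \<in> E ^^ N" unfolding relpow_fun_conv by (intro exI[of _ w]) (auto simp: E_def)
  then obtain k where k: "k \<le> card E" "(w 0, ?a) \<in> E ^^ k" using relpow_finite_bounded[OF finE, of N] by auto
  obtain f where f: "f 0 = w 0" "f k = ?a" "\<forall>i<k. (f i, f (Suc i)) \<in> E"
    using k(2) by (auto simp: relpow_fun_conv)
  define pre where "pre = map f [0..<k]"
  define loop where "loop = ?a # butlast ws"
  have loopws: "loop @ [hd loop] = ?a # ws" using ws(2,3) append_butlast_last_id[of ws] by (simp add: loop_def)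
  have sp: "walk E (map f [0..<m] @ [f m])" if "m \<le> k" for m
    using that
  proof (induction m)
    case (Suc m)
    then show ?case using f(3) by (simp add: successively_append_iff)
  qed simp
  have sE: "walk E (?a # ws)"
    using ws(4) E'E by (auto simp: successively_conv_nth)
  have step: "walk E (pre @ loop @ [hd loop])"
    unfolding loopws using sp[of k] sE by (simp add: pre_def successively_append_iff f(2))
  have loop: "loop \<noteq> []" by (simp add: loop_def)
  have "\<exists>m. lasso_word (pre, loop) n = w m \<and> lasso_word (pre, loop) (Suc n) = w (Suc m)" for n
    using lasso_step[OF loop step, of n] by (auto simp: E_def)
  moreover have "lasso_word (pre, loop) 0 = w 0"
    unfolding lasso_word_0[OF loop] using f(1,2)
    by (cases k) (auto simp: pre_def loop_def upt_conv_Cons simp del: upt_Suc)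
  moreover have "set loop = limit w"
  proof -
    have "set ws = limit w" using ws(5,6) zs(1) by auto
    moreover have "set ws = insert ?a (set (butlast ws))"
      using ws(2,3) by (metis append_butlast_last_id list.simps(15) rotate1.simps(2) set_rotate1)
    ultimately show ?thesis by (simp add: loop_def)
  qed
  moreover have "length pre \<le> card (range w) ^ 2" using k(1) cE by (simp add: pre_def)
  moreover have "length loop \<le> (card (range w) + 1) * card (range w) ^ 2"
  proof -
    have "length loop = length ws" using ws(2) by (simp add: loop_def)
    also have "\<dots> \<le> (card (range w) + 1) * card (range w) ^ 2"
      using ws(1) lzs by (meson add_le_mono1 mult_le_mono1 order_trans)
    finally show ?thesis .
  qed
  ultimately show ?thesis using loop by (intro exI[of _ "(pre, loop)"]) simp
qed

lemma limit_lasso: "snd l \<noteq> [] \<Longrightarrow> limit (lasso_word l) = set (snd l)"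
  by (simp add: lasso_word_def)

text \<open>A punishing proposal has conditions on the least colour up to a position, which a lasso
  made of the same steps could change. Pairing each point with this minimum before shortening
  preserves it; the number of pairs is at most a square, hence the fourth powers.\<close>

lemma colour_lasso_exists:
  fixes \<pi> :: "'a word" and col :: "'a \<Rightarrow> nat"
  assumes fin: "finite (range \<pi>)"
  shows "\<exists>l. snd l \<noteq> [] \<and> lasso_word l 0 = \<pi> 0 \<and>
     (\<forall>n. \<exists>m. lasso_word l n = \<pi> m \<and> lasso_word l (Suc n) = \<pi> (Suc m)) \<and> limit (lasso_word l) = limit \<pi> \<and>
     (\<forall>n. \<exists>m. lasso_word l n = \<pi> m \<and> rmin (\<lambda>i. col (lasso_word l i)) n = rmin (\<lambda>i. col (\<pi> i)) m) \<and>
     length (fst l) \<le> card (range \<pi>) ^ 4 \<and> length (snd l) \<le> (card (range \<pi>) ^ 2 + 1) * card (range \<pi>) ^ 4"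
proof -
  let ?c = "card (range \<pi>)"
  define w where "w n = (\<pi> n, rmin (\<lambda>i. col (\<pi> i)) n)" for n
  have rw: "range w \<subseteq> range \<pi> \<times> col ` range \<pi>"
  proof -
    have "rmin (\<lambda>i. col (\<pi> i)) n \<in> col ` range \<pi>" for n
      using rmin_in[of "\<lambda>i. col (\<pi> i)" n] by auto
    then show ?thesis by (auto simp: w_def)
  qed
  then have finw: "finite (range w)" using fin by (meson finite_SigmaI finite_imageI finite_subset)
  have cw: "card (range w) \<le> ?c ^ 2"
  proof -
    have "card (range w) \<le> card (range \<pi> \<times> col ` range \<pi>)" using rw fin by (intro card_mono) auto
    also have "\<dots> \<le> ?c * ?c" using card_image_le[OF fin, of col] by (simp add: card_cartesian_product)
    finally show ?thesis by (simp add: power2_eq_square)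
  qed
  obtain l where l: "snd l \<noteq> []" "lasso_word l 0 = w 0"
     "\<forall>n. \<exists>m. lasso_word l n = w m \<and> lasso_word l (Suc n) = w (Suc m)" "set (snd l) = limit w"
     "length (fst l) \<le> card (range w) ^ 2" "length (snd l) \<le> (card (range w) + 1) * card (range w) ^ 2"
    using lasso_exists[OF finw] by blast
  define l' where "l' = (map fst (fst l), map fst (snd l))"
  have l'w: "lasso_word l' n = fst (lasso_word l n)" for n
    using l(1) by (simp add: l'_def lasso_word_def conc_def)
  \<comment> \<open>The lasso has the first pair of the paired word, and its consecutive pairs are
    consecutive there. This already determines the second component as the running minimum of the
    first.\<close>
  have rm: "snd (lasso_word l n) = rmin (\<lambda>i. col (lasso_word l' i)) n" for n
  proof (induction n)
    case 0 then show ?case using l(2) by (simp add: l'w w_def)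
  next
    case (Suc n)
    obtain m where m: "lasso_word l n = w m" "lasso_word l (Suc n) = w (Suc m)" using l(3) by blast
    then show ?case using Suc by (simp add: rmin_Suc l'w w_def)
  qed
  have "\<exists>m. lasso_word l' n = \<pi> m \<and> lasso_word l' (Suc n) = \<pi> (Suc m)" for n
    using l(3)[THEN spec, of n] by (auto simp: l'w w_def)
  moreover have "\<exists>m. lasso_word l' n = \<pi> m \<and> rmin (\<lambda>i. col (lasso_word l' i)) n = rmin (\<lambda>i. col (\<pi> i)) m" for n
    using l(3)[THEN spec, of n] rm[of n] by (auto simp: l'w w_def)
  moreover have "limit (lasso_word l') = limit \<pi>"
  proof -
    have "limit (lasso_word l') = fst ` limit w" using l(1,4) by (subst limit_lasso) (auto simp: l'_def)
    also have "\<dots> = limit \<pi>" using limit_image[OF finw, of fst] by (simp add: w_def)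
    finally show ?thesis .
  qed
  moreover have "length (fst l') \<le> ?c ^ 4" "length (snd l') \<le> (?c ^ 2 + 1) * ?c ^ 4"
  proof -
    have s: "card (range w) ^ 2 \<le> ?c ^ 4" using power_mono[OF cw, of 2] by (simp flip: power_mult)
    show "length (fst l') \<le> ?c ^ 4" using l(5) s by (simp add: l'_def)
    have "(card (range w) + 1) * card (range w) ^ 2 \<le> (?c ^ 2 + 1) * ?c ^ 4"
      using cw s by (intro mult_mono) auto
    then show "length (snd l') \<le> (?c ^ 2 + 1) * ?c ^ 4" using l(6) by (simp add: l'_def)
  qed
  moreover have "snd l' \<noteq> []" using l(1) by (simp add: l'_def)
  moreover have "lasso_word l' 0 = \<pi> 0" unfolding l'w l(2) by (simp add: w_def)
  ultimately show ?thesis by blast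
qed

section \<open>Certificates made of short lassos\<close>

context verification
begin

text \<open>The bound on loops from \<open>colour_lasso_exists\<close>, which also dominates the
  bound on prefixes.\<close>

definition lasso_bound :: nat where
  "lasso_bound = (card positions ^ 2 + 1) * card positions ^ 4"

definition shortens :: "'p \<Rightarrow> ('q, 'v) position word \<Rightarrow> ('q, 'v) position list \<times> ('q, 'v) position list \<Rightarrow> bool" where
  "shortens j \<pi> l \<longleftrightarrow> snd l \<noteq> [] \<and> lasso_word l 0 = \<pi> 0 \<and>
     (\<forall>n. \<exists>m. lasso_word l n = \<pi> m \<and> lasso_word l (Suc n) = \<pi> (Suc m)) \<and> limit (lasso_word l) = limit \<pi> \<and>
     (\<forall>n. \<exists>m. lasso_word l n = \<pi> m \<and> rmin (colour j (lasso_word l)) n = rmin (colour j \<pi>) m) \<and>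
     length (fst l) \<le> lasso_bound \<and> length (snd l) \<le> lasso_bound"

lemma ex_shortens:
  assumes "pplay \<pi>" shows "\<exists>l. shortens j \<pi> l"
proof -
  have fin: "finite (range \<pi>)" by (rule pplay_range[OF assms])
  have "card (range \<pi>) \<le> card positions"
    using assms finite_positions by (intro card_mono) (auto simp: pplay_def)
  then have c: "card (range \<pi>) ^ 4 \<le> card positions ^ 4" "card (range \<pi>) ^ 2 \<le> card positions ^ 2"
    by (simp_all add: power_mono)
  have b1: "card (range \<pi>) ^ 4 \<le> lasso_bound"
    using c(1) unfolding lasso_bound_def by (simp add: trans_le_add2 trans_le_add1)
  have b2: "(card (range \<pi>) ^ 2 + 1) * card (range \<pi>) ^ 4 \<le> lasso_bound"
    unfolding lasso_bound_def using c by (intro mult_mono) auto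
  from colour_lasso_exists[OF fin, of "\<lambda>y. \<kappa> j (vx y)"] obtain l where
    l: "snd l \<noteq> []" "lasso_word l 0 = \<pi> 0"
     "\<forall>n. \<exists>m. lasso_word l n = \<pi> m \<and> lasso_word l (Suc n) = \<pi> (Suc m)" "limit (lasso_word l) = limit \<pi>"
     "\<forall>n. \<exists>m. lasso_word l n = \<pi> m \<and> rmin (colour j (lasso_word l)) n = rmin (colour j \<pi>) m"
     "length (fst l) \<le> card (range \<pi>) ^ 4" "length (snd l) \<le> (card (range \<pi>) ^ 2 + 1) * card (range \<pi>) ^ 4"
    by blast
  have "shortens j \<pi> l"
    unfolding shortens_def by (intro conjI l order_trans[OF l(6) b1] order_trans[OF l(7) b2])
  then show ?thesis ..
qed

lemma shortens_pplay: "pplay \<pi> \<Longrightarrow> shortens j \<pi> l \<Longrightarrow> pplay (lasso_word l)"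
  unfolding pplay_def shortens_def by metis

lemma shortens_wins: "shortens j \<pi> l \<Longrightarrow> wins i (lasso_word l) = wins i \<pi>"
  by (simp add: shortens_def wins_def)

lemma shortens_good:
  assumes "shortens j \<pi> l" "good spe Dom \<pi>" shows "good spe Dom (lasso_word l)"
  unfolding good_def shortens_wins[OF assms(1)]
proof (intro allI impI)
  fix n assume o: "own (lasso_word l n) \<noteq> L"
  obtain m where m: "lasso_word l n = \<pi> m" using assms(1) unfolding shortens_def by blast
  show "\<forall>v\<in>succs (lasso_word l n). (spe \<longrightarrow> (L, tgt (lasso_word l n), v) \<in> Dom) \<and>
     (\<not> wins (own (lasso_word l n)) \<pi> \<longrightarrow> (own (lasso_word l n), tgt (lasso_word l n), v) \<in> Dom)"
    using assms(2) o unfolding good_def m by blast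
qed

text \<open>Each place of the lasso copies a place of the word together with its running minimum,
  and \<open>punishing_iff\<close> speaks of nothing else at a place.\<close>

lemma shortens_punishing:
  assumes s: "shortens j \<pi> l" and p: "punishing Dom r (j, q, v) \<pi>"
  shows "punishing Dom r (j, q, v) (lasso_word l)"
  unfolding punishing_iff shortens_wins[OF s]
proof (intro conjI allI impI)
  show "\<not> wins j \<pi>" using p by (simp add: punishing_iff)
  fix n assume o: "own (lasso_word l n) = j"
  obtain m where m: "lasso_word l n = \<pi> m" "rmin (colour j (lasso_word l)) n = rmin (colour j \<pi>) m"
    using s unfolding shortens_def by blast
  show "\<forall>v'\<in>succs (lasso_word l n). (j, tgt (lasso_word l n), v') \<in> Dom \<and>
        (\<forall>x\<in>vertices G. even (\<kappa> j x) \<and> \<kappa> j x \<le> rmin (colour j (lasso_word l)) n \<longrightarrow>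
           r (j, tgt (lasso_word l n), v') x \<le> r (j, q, v) x \<and>
           (\<kappa> j x = rmin (colour j (lasso_word l)) n \<longrightarrow> r (j, tgt (lasso_word l n), v') x < r (j, q, v) x))"
    unfolding m by (rule mp[OF spec[OF conjunct2[OF p[unfolded punishing_iff]]] o[unfolded m]])
qed

text \<open>Only the order of the ranks matters, so they can be bounded by the number of keys.\<close>

lemma certificate_small_ranks:
  assumes cert: "certificate spe main Dom P r" and fin: "finite Dom"
  shows "\<exists>r'. certificate spe main Dom P r' \<and> (\<forall>k x. r' k x \<le> card Dom)"
proof -
  \<comment> \<open>The new rank counts the smaller values taken on keys at the same vertex. It
    keeps the order between keys and is at most their number.\<close>
  define below where "below k x = {n \<in> (\<lambda>k'. r k' x) ` Dom. n < r k x}" for k x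
  define r' where "r' k x = card (below k x)" for k x
  have finb: "finite (below k x)" for k x using fin by (simp add: below_def)
  have "r' k x \<le> card Dom" for k x
  proof -
    have "r' k x \<le> card ((\<lambda>k'. r k' x) ` Dom)"
      unfolding r'_def using fin by (intro card_mono) (auto simp: below_def)
    then show ?thesis using card_image_le[OF fin, of "\<lambda>k'. r k' x"] by simp
  qed
  moreover have le: "r' k x \<le> r' k' x" if "r k x \<le> r k' x" for k k' x
    unfolding r'_def using that finb by (intro card_mono) (auto simp: below_def)
  moreover have less: "r' k x < r' k' x" if "r k x < r k' x" "k \<in> Dom" for k k' x
  proof -
    have "r k x \<in> below k' x" "r k x \<notin> below k x" using that by (auto simp: below_def)
    moreover have "below k x \<subseteq> below k' x" using that by (auto simp: below_def)
    ultimately show ?thesis unfolding r'_def using finb by (intro psubset_card_mono) auto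
  qed
  have "punishing Dom r' (j, q, v) \<pi>" if p: "punishing Dom r (j, q, v) \<pi>" for j q v \<pi>
    unfolding punishing_iff
  proof (intro conjI allI impI ballI)
    show "\<not> wins j \<pi>" using p by (simp add: punishing_iff)
    fix n v' assume n: "own (\<pi> n) = j" "v' \<in> succs (\<pi> n)"
    note a = bspec[OF mp[OF spec[OF conjunct2[OF p[unfolded punishing_iff]]] n(1)] n(2)]
    show D: "(j, tgt (\<pi> n), v') \<in> Dom" by (rule conjunct1[OF a])
    fix x assume x: "x \<in> vertices G" "even (\<kappa> j x) \<and> \<kappa> j x \<le> rmin (colour j \<pi>) n"
    note b = mp[OF bspec[OF conjunct2[OF a] x(1)] x(2)]
    show "r' (j, tgt (\<pi> n), v') x \<le> r' (j, q, v) x" by (rule le[OF conjunct1[OF b]])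
    assume "\<kappa> j x = rmin (colour j \<pi>) n"
    then show "r' (j, tgt (\<pi> n), v') x < r' (j, q, v) x" by (rule less[OF mp[OF conjunct2[OF b]] D])
  qed
  then have "certificate spe main Dom P r'"
    using cert unfolding certificate_def by (auto split: prod.splits)
  ultimately show ?thesis by blast
qed

theorem lasso_certificate:
  assumes cert: "certificate spe main Dom P r" and fin: "finite Dom"
  shows "\<exists>ml Pl r'. certificate spe (lasso_word ml) Dom (\<lambda>k. lasso_word (Pl k)) r' \<and>
     (\<forall>j. wins j (lasso_word ml) = wins j main) \<and> (\<forall>k x. r' k x \<le> card Dom) \<and>
     (\<forall>l\<in>insert ml (Pl ` Dom). snd l \<noteq> [] \<and> length (fst l) \<le> lasso_bound \<and> length (snd l) \<le> lasso_bound)"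
proof -
  obtain r' where r': "certificate spe main Dom P r'" "\<forall>k x. r' k x \<le> card Dom"
    using certificate_small_ranks[OF assms] by blast
  have main: "pplay main" "starts (minit M) v0 main" "good spe Dom main"
    using cert by (auto simp: certificate_def)
  obtain ml where ml: "shortens L main ml" using ex_shortens[OF main(1)] by blast
  define Pl where "Pl k = (SOME l. shortens (fst k) (P k) l)" for k
  have Pl: "shortens j (P (j, q, v)) (Pl (j, q, v))" if "(j, q, v) \<in> Dom" for j q v
    using someI_ex[OF ex_shortens[OF certificate_key(1)[OF r'(1) that]], of j] by (simp add: Pl_def)
  have "certificate spe (lasso_word ml) Dom (\<lambda>k. lasso_word (Pl k)) r'"
    unfolding certificate_def
  proof (intro conjI ballI)
    show "pplay (lasso_word ml)" by (rule shortens_pplay[OF main(1) ml])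
    show "starts (minit M) v0 (lasso_word ml)" using main(2) ml by (simp add: starts_def shortens_def)
    show "good spe Dom (lasso_word ml)" by (rule shortens_good[OF ml main(3)])
    fix k assume k: "k \<in> Dom"
    obtain j q v where jqv: "k = (j, q, v)" by (cases k)
    note key = certificate_key[OF r'(1) k[unfolded jqv]] and s = Pl[OF k[unfolded jqv]]
    show "case k of (j, q, v) \<Rightarrow> pplay (lasso_word (Pl (j, q, v))) \<and> starts q v (lasso_word (Pl (j, q, v))) \<and>
      (spe \<longrightarrow> good spe Dom (lasso_word (Pl (j, q, v)))) \<and>
      (j \<noteq> L \<longrightarrow> punishing Dom r' (j, q, v) (lasso_word (Pl (j, q, v))))"
      unfolding jqv prod.case
    proof (intro conjI impI)
      show "pplay (lasso_word (Pl (j, q, v)))" by (rule shortens_pplay[OF key(1) s])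
      show "starts q v (lasso_word (Pl (j, q, v)))" using key(2) s by (simp add: starts_def shortens_def)
      show "spe \<Longrightarrow> good spe Dom (lasso_word (Pl (j, q, v)))" by (rule shortens_good[OF s key(3)])
      show "j \<noteq> L \<Longrightarrow> punishing Dom r' (j, q, v) (lasso_word (Pl (j, q, v)))"
        by (rule shortens_punishing[OF s key(4)])
    qed
  qed
  moreover have "\<forall>j. wins j (lasso_word ml) = wins j main" using shortens_wins[OF ml] by blast
  moreover have "\<forall>l\<in>insert ml (Pl ` Dom). snd l \<noteq> [] \<and> length (fst l) \<le> lasso_bound \<and> length (snd l) \<le> lasso_bound"
  proof
    fix l assume "l \<in> insert ml (Pl ` Dom)"
    then consider "l = ml" | j q v where "(j, q, v) \<in> Dom" "l = Pl (j, q, v)" by fast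
    then have "\<exists>j \<pi>. shortens j \<pi> l" using ml Pl by cases blast+
    then show "snd l \<noteq> [] \<and> length (fst l) \<le> lasso_bound \<and> length (snd l) \<le> lasso_bound"
      unfolding shortens_def by blast
  qed
  ultimately show ?thesis using r'(2) by blast
qed

end

section \<open>Checking certificates\<close>

lemma lasso_word_nth:
  assumes "snd l \<noteq> []" "i < length (fst l) + 2 * length (snd l)"
  shows "lasso_word l i = (fst l @ snd l @ snd l) ! i"
proof -
  consider "i < length (fst l)"
    | m where "i = length (fst l) + m" "m < length (snd l)"
    | m where "i = length (fst l) + (length (snd l) + m)" "m < length (snd l)"
  proof (cases "i < length (fst l)")
    case False
    then obtain m where m: "i = length (fst l) + m" by (metis le_Suc_ex not_less)
    show ?thesis
    proof (cases "m < length (snd l)")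
      case True then show ?thesis using m that by blast
    next
      case f: False
      then obtain m' where "m = length (snd l) + m'" by (metis le_Suc_ex not_less)
      then show ?thesis using m assms that(3)[of m'] by simp
    qed
  qed (use that in blast)
  then show ?thesis
    by cases (use assms(1) in \<open>simp_all add: lasso_word_def nth_append\<close>)
qed

lemma lasso_word_range:
  assumes "snd l \<noteq> []" shows "range (lasso_word l) = set (fst l) \<union> set (snd l)"
proof -
  have "range ((snd l)\<^sup>\<omega>) = set (snd l)"
  proof
    show "range ((snd l)\<^sup>\<omega>) \<subseteq> set (snd l)" using assms by auto
    show "set (snd l) \<subseteq> range ((snd l)\<^sup>\<omega>)"
    proof
      fix y assume "y \<in> set (snd l)"
      then obtain i where "i < length (snd l)" "snd l ! i = y" unfolding in_set_conv_nth by blast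
      then have "(snd l)\<^sup>\<omega> i = y" using assms by (simp add: iter_nth)
      then show "y \<in> range ((snd l)\<^sup>\<omega>)" by blast
    qed
  qed
  then show ?thesis by (simp add: lasso_word_def)
qed

text \<open>Once the loop has been traversed, everything has been visited and only the place in the
  loop matters. Hence two rounds exhibit every combination of current position and visited
  set.\<close>

lemma lasso_word_prefix:
  assumes "snd l \<noteq> []"
  shows "\<exists>n' < length (fst l) + 2 * length (snd l). lasso_word l n' = lasso_word l n \<and>
    lasso_word l ` {..n'} = lasso_word l ` {..n}"
proof (cases "n < length (fst l) + 2 * length (snd l)")
  case False
  let ?p = "length (fst l)" and ?k = "length (snd l)"
  define n' where "n' = ?p + ?k + (n - ?p) mod ?k"
  have k: "0 < ?k" using assms by simp
  have "n' < ?p + 2 * ?k" using k by (simp add: n'_def)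
  moreover have "lasso_word l n' = lasso_word l n"
  proof -
    have "lasso_word l n' = (snd l)\<^sup>\<omega> (?k + (n - ?p) mod ?k)" by (simp add: lasso_word_def n'_def add.assoc)
    also have "\<dots> = snd l ! ((n - ?p) mod ?k)" using k by simp
    also have "\<dots> = lasso_word l n" using False k by (simp add: lasso_word_def)
    finally show ?thesis .
  qed
  moreover have all: "lasso_word l ` {..m} = range (lasso_word l)" if "?p + ?k \<le> m" for m
  proof
    have "set (fst l) \<union> set (snd l) \<subseteq> lasso_word l ` {..m}"
    proof
      fix y assume "y \<in> set (fst l) \<union> set (snd l)"
      then have "y \<in> set (fst l @ snd l)" by simp
      then obtain i where i: "i < ?p + ?k" "(fst l @ snd l) ! i = y"
        unfolding in_set_conv_nth length_append by blast
      then have "lasso_word l i = y"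
        using lasso_word_nth[OF assms, of i] by (cases "i < ?p") (auto simp: nth_append)
      then show "y \<in> lasso_word l ` {..m}" using i that by (intro image_eqI[of _ _ i]) auto
    qed
    then show "range (lasso_word l) \<subseteq> lasso_word l ` {..m}" using lasso_word_range[OF assms] by simp
  qed auto
  have "?p + ?k \<le> n" using False by simp
  moreover have "?p + ?k \<le> n'" by (simp add: n'_def)
  ultimately show ?thesis using all by blast
qed auto

section \<open>The certificate checker as a function on lists\<close>

type_synonym npos = "nat \<times> nat \<times> nat \<times> nat"
type_synonym lasso = "npos list \<times> npos list"
type_synonym entry = "(nat \<times> nat \<times> nat) \<times> lasso \<times> nat list"

definition pos_list :: "(nat \<times> nat \<times> nat) list \<Rightarrow> npos list \<Rightarrow> npos list" where
  "pos_list ma mL = map (\<lambda>t. (fst t, fst (snd t), snd (snd t), fst (snd t))) ma @ mL"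

definition succ_list :: "nat list \<Rightarrow> (nat \<times> nat) list \<Rightarrow> nat \<Rightarrow> npos \<Rightarrow> nat list" where
  "succ_list ow ar l y = (if nthd 0 ow (fst (snd y)) = l then [snd (snd (snd y))]
     else map snd (filter (\<lambda>a. fst a = fst (snd y)) ar))"

definition col :: "nat list list \<Rightarrow> nat \<Rightarrow> nat \<Rightarrow> nat" where
  "col co j x = nthd 0 (nthd [] co j) x"

definition lasso_ok :: "nat list \<Rightarrow> (nat \<times> nat) list \<Rightarrow> nat \<Rightarrow> npos list \<Rightarrow> lasso \<Rightarrow> bool" where
  "lasso_ok ow ar l ys z \<longleftrightarrow> snd z \<noteq> [] \<and> (\<forall>y\<in>set (fst z @ snd z). y \<in> set ys) \<and>
     (\<forall>e\<in>set (zip (fst z @ snd z) (tl (fst z @ snd z) @ [hd (snd z)])).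
        fst (snd e) = fst (snd (snd (fst e))) \<and> fst (snd (snd e)) \<in> set (succ_list ow ar l (fst e)))"

definition starts_at :: "nat \<Rightarrow> nat \<Rightarrow> lasso \<Rightarrow> bool" where
  "starts_at q v z \<longleftrightarrow> fst (hd (fst z @ snd z)) = q \<and> fst (snd (hd (fst z @ snd z))) = v"

text \<open>The parity condition on the loop, phrased with a witness so that no minimum has to be
  computed.\<close>

definition wins_loop :: "nat list list \<Rightarrow> nat \<Rightarrow> npos list \<Rightarrow> bool" where
  "wins_loop co j ws \<longleftrightarrow> (\<exists>y\<in>set ws. even (col co j (fst (snd y))) \<and>
     (\<forall>y'\<in>set ws. col co j (fst (snd y)) \<le> col co j (fst (snd y'))))"

definition good_lasso :: "nat list \<Rightarrow> (nat \<times> nat) list \<Rightarrow> nat list list \<Rightarrow> nat \<Rightarrow> bool \<Rightarrow>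
    (nat \<times> nat \<times> nat) list \<Rightarrow> lasso \<Rightarrow> bool" where
  "good_lasso ow ar co l spe keys z \<longleftrightarrow>
     (\<forall>y\<in>set (fst z @ snd z). nthd 0 ow (fst (snd y)) \<noteq> l \<longrightarrow>
        (\<forall>v\<in>set (succ_list ow ar l y). (spe \<longrightarrow> (l, fst (snd (snd y)), v) \<in> set keys) \<and>
           (\<not> wins_loop co (nthd 0 ow (fst (snd y))) (snd z) \<longrightarrow>
              (nthd 0 ow (fst (snd y)), fst (snd (snd y)), v) \<in> set keys)))"

text \<open>In a reversed prefix the head is the current position and the elements are the visited
  ones.\<close>

definition rev_prefixes :: "'a list \<Rightarrow> 'a list list" where
  "rev_prefixes xs = fold (\<lambda>x acc. (x # hd acc) # acc) xs [[]]"

text \<open>The loop is unrolled twice, which is enough by \<open>lasso_word_prefix\<close>. All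
  entries with the required key are tested because a table may list a key repeatedly.\<close>

definition punish_ok :: "nat list \<Rightarrow> (nat \<times> nat) list \<Rightarrow> nat list list \<Rightarrow> nat \<Rightarrow>
    entry list \<Rightarrow> entry \<Rightarrow> bool" where
  "punish_ok ow ar co l tab e \<longleftrightarrow> (let j = fst (fst e) in
     \<not> wins_loop co j (snd (fst (snd e))) \<and>
     (\<forall>zs\<in>set (rev_prefixes (fst (fst (snd e)) @ snd (fst (snd e)) @ snd (fst (snd e)))).
        zs \<noteq> [] \<and> nthd 0 ow (fst (snd (hd zs))) = j \<longrightarrow>
        (\<forall>v\<in>set (succ_list ow ar l (hd zs)). (j, fst (snd (snd (hd zs))), v) \<in> set (map fst tab) \<and>
           (\<forall>e'\<in>set tab. fst e' = (j, fst (snd (snd (hd zs))), v) \<longrightarrow>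
              (\<forall>x\<in>set [0..<length ow]. even (col co j x) \<and>
                 (\<forall>y\<in>set zs. col co j x \<le> col co j (fst (snd y))) \<longrightarrow>
                 nthd 0 (snd (snd e')) x \<le> nthd 0 (snd (snd e)) x \<and>
                 ((\<exists>y\<in>set zs. col co j (fst (snd y)) = col co j x) \<longrightarrow>
                    nthd 0 (snd (snd e')) x < nthd 0 (snd (snd e)) x))))))"

text \<open>The pair \<open>tn\<close> is a sign and an absolute value. Leader's payoff is 0 or 1,
  so it is at most the threshold iff the latter is not negative and, for payoff 1, the numerator
  reaches the denominator.\<close>

definition check_cert where
  "check_cert spe ow ar co l s tn td ms ys c \<longleftrightarrow>
     lasso_ok ow ar l ys (fst c) \<and> starts_at ms s (fst c) \<and>
     good_lasso ow ar co l spe (map fst (snd c)) (fst c) \<and>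
     \<not> fst tn \<and> (wins_loop co l (snd (fst c)) \<longrightarrow> td \<le> snd tn) \<and>
     (\<forall>e\<in>set (snd c). fst (fst e) < length co \<and> lasso_ok ow ar l ys (fst (snd e)) \<and>
        starts_at (fst (snd (fst e))) (snd (snd (fst e))) (fst (snd e)) \<and>
        (spe \<longrightarrow> good_lasso ow ar co l spe (map fst (snd c)) (fst (snd e))) \<and>
        (fst (fst e) \<noteq> l \<longrightarrow> punish_ok ow ar co l (snd c) e))"

lemma set_rev_prefixes: "set (rev_prefixes xs) = {rev (take k xs) | k. k \<le> length xs}"
proof -
  have "hd (rev_prefixes xs) = rev xs \<and> set (rev_prefixes xs) = {rev (take k xs) | k. k \<le> length xs}"
  proof (induction xs rule: rev_induct)
    case Nil then show ?case by (simp add: rev_prefixes_def)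
  next
    case (snoc x xs)
    have "rev_prefixes (xs @ [x]) = (x # hd (rev_prefixes xs)) # rev_prefixes xs"
      by (simp add: rev_prefixes_def)
    moreover have "{rev (take k (xs @ [x])) | k. k \<le> length (xs @ [x])} =
        insert (rev (xs @ [x])) {rev (take k xs) | k. k \<le> length xs}"
    proof (intro set_eqI iffI)
      fix z assume "z \<in> {rev (take k (xs @ [x])) | k. k \<le> length (xs @ [x])}"
      then obtain k where "k \<le> Suc (length xs)" "z = rev (take k (xs @ [x]))" by auto
      then show "z \<in> insert (rev (xs @ [x])) {rev (take k xs) | k. k \<le> length xs}"
        by (cases "k = Suc (length xs)") auto
    next
      fix z assume "z \<in> insert (rev (xs @ [x])) {rev (take k xs) | k. k \<le> length xs}"
      then consider "z = rev (xs @ [x])" | k where "k \<le> length xs" "z = rev (take k xs)" by auto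
      then show "z \<in> {rev (take k (xs @ [x])) | k. k \<le> length (xs @ [x])}"
      proof cases
        case 1 then show ?thesis by (intro CollectI exI[of _ "length (xs @ [x])"]) simp
      next
        case 2 then show ?thesis by (intro CollectI exI[of _ k]) simp
      qed
    qed
    ultimately show ?case using snoc by simp
  qed
  then show ?thesis ..
qed

lemma ball_atMost: "(\<forall>i\<in>{..n::nat}. Q i) \<longleftrightarrow> (\<forall>i\<le>n. Q i)" and
  bex_atMost: "(\<exists>i\<in>{..n::nat}. Q i) \<longleftrightarrow> (\<exists>i\<le>n. Q i)"
  by auto

definition counterexample :: "bool \<Rightarrow> parity_instance \<Rightarrow> (nat, nat) profile \<Rightarrow> bool" where
  "counterexample spe I \<sigma> \<longleftrightarrow> fixed_NE (inst_game I) (leader I) (source I) \<sigma> \<and>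
     (spe \<longrightarrow> fixed_SPE (inst_game I) (leader I) (source I) \<sigma>) \<and>
     \<sigma> (leader I) \<in> Comp (inst_game I) (leader I) (source I) (inst_mealy I) \<and>
     payoff (inst_game I) (outcome (inst_game I) (source I) \<sigma>) (leader I) \<le> of_rat (inst_threshold I)"

section \<open>Correctness of the checker\<close>

locale instance_verification =
  fixes I :: parity_instance
  assumes inst: "is_instance I"
begin

abbreviation "K \<equiv> \<lambda>i v. colours I ! i ! v"

sublocale verification "inst_game I" "leader I" "source I" "inst_mealy I" K
proof
  show "is_game (inst_game I)" "leader I \<in> players (inst_game I)" "source I \<in> vertices (inst_game I)"
    "is_mealy (inst_game I) (leader I) (inst_mealy I)" using inst by (auto simp: is_instance_def)
qed (simp add: inst_game_def)

abbreviation "G \<equiv> inst_game I"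
abbreviation "MI \<equiv> inst_mealy I"
abbreviation "ow \<equiv> owners I"
abbreviation "ar \<equiv> arcs I"
abbreviation "co \<equiv> colours I"
abbreviation "ld \<equiv> leader I"

definition ys :: "npos list" where "ys = pos_list (marcs I) (marcsL I)"

lemma game_simps [simp]:
  "players G = {..<length co}" "vertices G = {..<length ow}"
  "controller G v = ow ! v" "edges G = set ar"
  "mstates MI = {..<mcount I}" "minit MI = mstart I"
  by (simp_all add: inst_game_def inst_mealy_def)

lemma mtrans_inst: "mtrans MI = set (marcs I)" "mtransL MI = set (marcsL I)"
  by (simp_all add: inst_mealy_def)

lemma col_eq [simp]: "j < length co \<Longrightarrow> x < length ow \<Longrightarrow> col co j x = K j x"
proof -
  assume a: "j < length co" "x < length ow"
  then have "length (co ! j) = length ow" using inst by (auto simp: is_instance_def)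
  then show ?thesis using a by (simp add: col_def)
qed

text \<open>In a machine the two kinds of transitions read at vertices of the right owner, so the
  case distinction in \<open>positions\<close> is automatic.\<close>

lemma set_ys: "set ys = positions"
proof (intro set_eqI)
  fix y :: npos
  obtain p u q w where y: "y = (p, u, q, w)" by (cases y)
  have 1: "u < length ow \<and> ow ! u \<noteq> ld" if "(p, u, q) \<in> set (marcs I)"
    using mealy that unfolding is_mealy_def mtrans_inst by (auto simp: region_def)
  have 2: "u < length ow \<and> ow ! u = ld" if "(p, u, q, w) \<in> set (marcsL I)"
    using mealy that unfolding is_mealy_def mtrans_inst by (auto simp: region_def)
  have "y \<in> set ys \<longleftrightarrow> ((p, u, q) \<in> set (marcs I) \<and> w = u) \<or> (p, u, q, w) \<in> set (marcsL I)"
    by (force simp: ys_def pos_list_def y image_iff)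
  also have "\<dots> \<longleftrightarrow> y \<in> positions"
    using 1 2 by (auto simp: positions_def y mtrans_inst)
  finally show "y \<in> set ys \<longleftrightarrow> y \<in> positions" .
qed

lemma own_eq [simp]: "own y = ow ! fst (snd y)"
  by (simp add: own_def)

lemma own_less [simp]: "y \<in> positions \<Longrightarrow> ow ! fst (snd y) < length co"
  using position_facts(4) by simp

lemma vx_less [simp]: "y \<in> positions \<Longrightarrow> fst (snd y) < length ow"
  using position_facts(2) by simp

lemma set_succ_list [simp]: "y \<in> positions \<Longrightarrow> set (succ_list ow ar ld y) = succs y"
  using vx_less[of y] by (cases y) (auto simp: succ_list_def succs_def image_iff nthd_def split: if_splits)

lemma zip_shift_nth:
  assumes "ws \<noteq> []"
  shows "set (zip (us @ ws) (tl (us @ ws) @ [hd ws])) =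
    {((us @ ws @ [hd ws]) ! i, (us @ ws @ [hd ws]) ! Suc i) | i. i < length us + length ws}"
proof -
  have "tl (us @ ws) @ [hd ws] = tl (us @ ws @ [hd ws])" using assms by (cases us) auto
  moreover have n: "(us @ ws) ! i = (us @ ws @ [hd ws]) ! i" if "i < length (us @ ws)" for i
    using nth_append_left[OF that, of "[hd ws]"] by simp
  moreover have "tl (us @ ws @ [hd ws]) ! i = (us @ ws @ [hd ws]) ! Suc i" if "i < length (us @ ws)" for i
    using that by (intro nth_tl) simp
  ultimately have "zip (us @ ws) (tl (us @ ws) @ [hd ws]) =
      map (\<lambda>i. ((us @ ws @ [hd ws]) ! i, (us @ ws @ [hd ws]) ! Suc i)) [0..<length (us @ ws)]"
    by (intro nth_equalityI) (simp_all del: append_assoc)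
  then have "set (zip (us @ ws) (tl (us @ ws) @ [hd ws])) =
      (\<lambda>i. ((us @ ws @ [hd ws]) ! i, (us @ ws @ [hd ws]) ! Suc i)) ` {0..<length (us @ ws)}"
    by (simp only: set_map set_upt)
  then show ?thesis by (auto simp: image_iff)
qed

lemma lasso_ok_iff:
  "lasso_ok ow ar ld ys z \<longleftrightarrow> snd z \<noteq> [] \<and> pplay (lasso_word z)"
proof (cases "snd z = []")
  case False
  obtain us ws where z: "z = (us, ws)" by (cases z)
  have ws: "ws \<noteq> []" using False z by simp
  let ?l = "us @ ws @ [hd ws]"
  have nth: "?l ! i = lasso_word z i" if "i \<le> length us + length ws" for i
  proof -
    obtain x xs where "ws = x # xs" using ws by (cases ws) auto
    then have "us @ ws @ ws = ?l @ xs" by simp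
    then have "?l ! i = (us @ ws @ ws) ! i" using that by (simp only: nth_append length_append) simp
    then show ?thesis using lasso_word_nth[of z i] that ws z by (cases ws) (simp_all del: append_Cons append.simps nth_append)
  qed
  let ?R = "\<lambda>y y'. src y' = tgt y \<and> vx y' \<in> succs y"
  show ?thesis
  proof
    assume ok: "lasso_ok ow ar ld ys z"
    then have pos: "set us \<union> set ws \<subseteq> positions" by (auto simp: lasso_ok_def z set_ys)
    have "?R (?l ! i) (?l ! Suc i)" if "i < length us + length ws" for i
    proof -
      have "?l ! i \<in> set (us @ ws)" using that by (auto simp: nth_append)
      then have p: "?l ! i \<in> positions" using pos by auto
      have "(?l ! i, ?l ! Suc i) \<in> set (zip (us @ ws) (tl (us @ ws) @ [hd ws]))"
        unfolding zip_shift_nth[OF ws] using that by blast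
      then show ?thesis using ok p unfolding lasso_ok_def z by fastforce
    qed
    then have "successively ?R ?l" by (simp add: successively_conv_nth)
    from lasso_step[OF ws this] have "?R (lasso_word z n) (lasso_word z (Suc n))" for n by (simp add: z)
    moreover have "lasso_word z n \<in> positions" for n
      using lasso_word_range[of z] pos False by (auto simp: z)
    ultimately show "snd z \<noteq> [] \<and> pplay (lasso_word z)" using False by (simp add: pplay_def)
  next
    assume r: "snd z \<noteq> [] \<and> pplay (lasso_word z)"
    then have "\<forall>n. lasso_word z n \<in> positions" unfolding pplay_def by blast
    from spec[OF this] have "range (lasso_word z) \<subseteq> positions" by (intro image_subsetI)
    then have pos: "set us \<union> set ws \<subseteq> positions"
      using lasso_word_range[of z] False unfolding z by simp
    have "fst (snd e) = fst (snd (snd (fst e))) \<and> fst (snd (snd e)) \<in> set (succ_list ow ar ld (fst e))"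
      if m: "e \<in> set (zip (us @ ws) (tl (us @ ws) @ [hd ws]))" for e
    proof -
      obtain i where i: "i < length us + length ws" "e = (?l ! i, ?l ! Suc i)"
        using m unfolding zip_shift_nth[OF ws] by blast
      have "i \<le> length us + length ws" "Suc i \<le> length us + length ws" using i(1) by simp_all
      then have e: "e = (lasso_word z i, lasso_word z (Suc i))" unfolding i(2) by (simp only: nth)
      from r have "lasso_word z i \<in> positions \<and> src (lasso_word z (Suc i)) = tgt (lasso_word z i) \<and>
          vx (lasso_word z (Suc i)) \<in> succs (lasso_word z i)" unfolding pplay_def
        by (elim conjE) (erule allE[of _ i])
      then show ?thesis unfolding e by simp
    qed
    then show "lasso_ok ow ar ld ys z"
      using pos ws by (auto simp: lasso_ok_def z set_ys)
  qed
qed (simp add: lasso_ok_def)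

lemma starts_at_iff: "snd z \<noteq> [] \<Longrightarrow> starts_at q v z \<longleftrightarrow> starts q v (lasso_word z)"
  using lasso_word_0[of "snd z" "fst z"] by (simp add: starts_at_def starts_def)

lemma wins_loop_iff:
  assumes z: "snd z \<noteq> []" "pplay (lasso_word z)" and j: "j < length co"
  shows "wins_loop co j (snd z) \<longleftrightarrow> wins j (lasso_word z)"
proof -
  let ?f = "\<lambda>y. K j (fst (snd y))"
  have pos: "y \<in> positions" if "y \<in> set (snd z)" for y
  proof -
    have "y \<in> range (lasso_word z)" using lasso_word_range[OF z(1)] that by blast
    then show ?thesis using z(2) by (auto simp: pplay_def)
  qed
  have "wins_loop co j (snd z) \<longleftrightarrow>
      (\<exists>y\<in>set (snd z). even (?f y) \<and> (\<forall>y'\<in>set (snd z). ?f y \<le> ?f y'))"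
    unfolding wins_loop_def using pos j by simp
  also have "\<dots> \<longleftrightarrow> even (Min (?f ` set (snd z)))"
  proof
    assume "\<exists>y\<in>set (snd z). even (?f y) \<and> (\<forall>y'\<in>set (snd z). ?f y \<le> ?f y')"
    then obtain y where y: "y \<in> set (snd z)" "even (?f y)" "\<forall>y'\<in>set (snd z). ?f y \<le> ?f y'" by blast
    then have "Min (?f ` set (snd z)) = ?f y" by (intro Min_eqI) auto
    then show "even (Min (?f ` set (snd z)))" using y by simp
  next
    assume e: "even (Min (?f ` set (snd z)))"
    have "Min (?f ` set (snd z)) \<in> ?f ` set (snd z)" using z(1) by (intro Min_in) auto
    then obtain y where y: "y \<in> set (snd z)" "Min (?f ` set (snd z)) = ?f y" by blast
    have "?f y \<le> ?f y'" if "y' \<in> set (snd z)" for y'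
      unfolding y(2)[symmetric] using that by (intro Min_le) auto
    then show "\<exists>y\<in>set (snd z). even (?f y) \<and> (\<forall>y'\<in>set (snd z). ?f y \<le> ?f y')"
      using y e by (intro bexI[of _ y]) auto
  qed
  finally show ?thesis by (simp add: wins_def limit_lasso[OF z(1)])
qed

lemma good_lasso_iff:
  assumes z: "snd z \<noteq> []" "pplay (lasso_word z)"
  shows "good_lasso ow ar co ld spe keys z \<longleftrightarrow>
    good spe (set keys) (lasso_word z)"
proof -
  have r: "set (fst z @ snd z) = range (lasso_word z)" using lasso_word_range[OF z(1)] by simp
  have p: "lasso_word z n \<in> positions" for n using z(2) by (simp add: pplay_def)
  show ?thesis
    unfolding good_lasso_def good_def r
    using p by (simp add: wins_loop_iff[OF z])
qed

definition ranked :: "entry list \<Rightarrow> entry \<Rightarrow> npos word \<Rightarrow> nat \<Rightarrow> nat \<Rightarrow> bool" where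
  "ranked tab e w n v \<longleftrightarrow> (let j = fst (fst e); k = (j, tgt (w n), v) in k \<in> fst ` set tab \<and>
     (\<forall>e'\<in>set tab. fst e' = k \<longrightarrow>
        (\<forall>x\<in>{..<length ow}. even (K j x) \<and> (\<forall>i\<le>n. K j x \<le> K j (vx (w i))) \<longrightarrow>
           nthd 0 (snd (snd e')) x \<le> nthd 0 (snd (snd e)) x \<and>
           ((\<exists>i\<le>n. K j (vx (w i)) = K j x) \<longrightarrow> nthd 0 (snd (snd e')) x < nthd 0 (snd (snd e)) x))))"

lemma punish_ok_iff:
  assumes z: "snd (fst (snd e)) \<noteq> []" "pplay (lasso_word (fst (snd e)))"
    and j: "fst (fst e) = j" "j < length co"
  shows "punish_ok ow ar co ld tab e \<longleftrightarrow>
    \<not> wins j (lasso_word (fst (snd e))) \<and>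
    (\<forall>n. own (lasso_word (fst (snd e)) n) = j \<longrightarrow>
       (\<forall>v\<in>succs (lasso_word (fst (snd e)) n). ranked tab e (lasso_word (fst (snd e))) n v))"
proof -
  define l where "l = fst (snd e)"
  define w where "w = lasso_word l"
  define Q where "Q y Y \<longleftrightarrow> (own y = j \<longrightarrow> (\<forall>v\<in>succs y.
       (j, tgt y, v) \<in> fst ` set tab \<and>
       (\<forall>e'\<in>set tab. fst e' = (j, tgt y, v) \<longrightarrow>
          (\<forall>x\<in>{..<length ow}. even (K j x) \<and> (\<forall>y\<in>Y. K j x \<le> K j (vx y)) \<longrightarrow>
             nthd 0 (snd (snd e')) x \<le> nthd 0 (snd (snd e)) x \<and>
             ((\<exists>y\<in>Y. K j (vx y) = K j x) \<longrightarrow> nthd 0 (snd (snd e')) x < nthd 0 (snd (snd e)) x)))))" for y :: npos and Y :: "npos set"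
  have p: "w n \<in> positions" for n using z(2) by (simp add: pplay_def w_def l_def)
  define fl where "fl = fst l @ snd l @ snd l"
  have len: "length fl = length (fst l) + 2 * length (snd l)" by (simp add: fl_def)
  have nth: "fl ! i = w i" if "i < length fl" for i
    using lasso_word_nth[of l i] that z(1) len by (simp add: w_def l_def fl_def)
  have zs: "zs \<in> set (rev_prefixes fl) \<and> zs \<noteq> [] \<longleftrightarrow> (\<exists>n<length fl. zs = rev (map w [0..<Suc n]))" for zs
  proof
    assume "zs \<in> set (rev_prefixes fl) \<and> zs \<noteq> []"
    then obtain k where k: "k \<le> length fl" "zs = rev (take k fl)" and "zs \<noteq> []"
      unfolding set_rev_prefixes by blast
    then have "k \<noteq> 0" by (intro notI) simp
    with k obtain n where n: "k = Suc n" by (cases k) auto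
    have "take k fl = map w [0..<Suc n]"
      using k(1) nth n by (intro nth_equalityI) (simp_all del: upt_Suc append_assoc)
    then show "\<exists>n<length fl. zs = rev (map w [0..<Suc n])" using k n by (intro exI[of _ n]) simp
  next
    assume "\<exists>n<length fl. zs = rev (map w [0..<Suc n])"
    then obtain n where n: "n < length fl" "zs = rev (map w [0..<Suc n])" by blast
    have "take (Suc n) fl = map w [0..<Suc n]"
      using n(1) nth by (intro nth_equalityI) (simp_all del: upt_Suc append_assoc)
    then have "zs = rev (take (Suc n) fl)" using n(2) by simp
    then show "zs \<in> set (rev_prefixes fl) \<and> zs \<noteq> []"
      using n unfolding set_rev_prefixes by (auto intro!: exI[of _ "Suc n"])
  qed
  have hd: "hd (rev (map w [0..<Suc n])) = w n" "set (rev (map w [0..<Suc n])) = w ` {..n}" for n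
    by (auto simp: atMost_Suc_eq_insert_0 lessThan_Suc_atMost atLeast0LessThan simp del: upt_Suc) (simp add: hd_rev)
  define B where "B zs \<longleftrightarrow> (nthd 0 ow (fst (snd (hd zs))) = j \<longrightarrow>
        (\<forall>v\<in>set (succ_list ow ar ld (hd zs)). (j, fst (snd (snd (hd zs))), v) \<in> set (map fst tab) \<and>
           (\<forall>e'\<in>set tab. fst e' = (j, fst (snd (snd (hd zs))), v) \<longrightarrow>
              (\<forall>x\<in>set [0..<length ow]. even (col co j x) \<and>
                 (\<forall>y\<in>set zs. col co j x \<le> col co j (fst (snd y))) \<longrightarrow>
                 nthd 0 (snd (snd e')) x \<le> nthd 0 (snd (snd e)) x \<and>
                 ((\<exists>y\<in>set zs. col co j (fst (snd y)) = col co j x) \<longrightarrow>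
                    nthd 0 (snd (snd e')) x < nthd 0 (snd (snd e)) x)))))" for zs
  have body: "B (rev (map w [0..<Suc n])) = Q (w n) (w ` {..n})" for n
    unfolding B_def Q_def hd using p j(2) by (simp add: atLeast0LessThan del: upt_Suc)
  have "punish_ok ow ar co ld tab e \<longleftrightarrow>
      \<not> wins_loop co j (snd l) \<and> (\<forall>zs\<in>set (rev_prefixes fl). zs \<noteq> [] \<longrightarrow> B zs)"
    unfolding punish_ok_def Let_def j(1) l_def[symmetric] fl_def[symmetric] B_def imp_conjL ..
  also have "(\<forall>zs\<in>set (rev_prefixes fl). zs \<noteq> [] \<longrightarrow> B zs) \<longleftrightarrow> (\<forall>n<length fl. Q (w n) (w ` {..n}))"
  proof (intro iffI allI impI ballI)
    fix n
    assume a: "\<forall>zs\<in>set (rev_prefixes fl). zs \<noteq> [] \<longrightarrow> B zs" and n: "n < length fl"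
    have m: "rev (map w [0..<Suc n]) \<in> set (rev_prefixes fl) \<and> rev (map w [0..<Suc n]) \<noteq> []"
      unfolding zs using n by blast
    show "Q (w n) (w ` {..n})" using mp[OF bspec[OF a conjunct1[OF m]] conjunct2[OF m]] unfolding body .
  next
    fix zs' assume a: "\<forall>n<length fl. Q (w n) (w ` {..n})" and "zs' \<in> set (rev_prefixes fl)" "zs' \<noteq> []"
    then obtain n where n: "n < length fl" "zs' = rev (map w [0..<Suc n])" using zs by blast
    show "B zs'" unfolding n(2) body using a n(1) by blast
  qed
  \<comment> \<open>The condition depends only on the current position and the visited set, and two
    rounds of the loop exhibit all such combinations.\<close>
  also have "(\<forall>n<length fl. Q (w n) (w ` {..n})) \<longleftrightarrow> (\<forall>n. Q (w n) (w ` {..n}))"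
  proof
    assume a: "\<forall>n<length fl. Q (w n) (w ` {..n})"
    show "\<forall>n. Q (w n) (w ` {..n})"
    proof
      fix n
      obtain n' where "n' < length fl" "w n' = w n" "w ` {..n'} = w ` {..n}"
        using lasso_word_prefix[of l n] z(1) unfolding len w_def l_def by blast
      then show "Q (w n) (w ` {..n})" using a by metis
    qed
  qed blast
  also have "wins_loop co j (snd l) \<longleftrightarrow> wins j w"
    unfolding l_def w_def by (rule wins_loop_iff[OF z j(2)])
  finally show ?thesis unfolding Q_def l_def w_def ranked_def by (simp add: ball_atMost bex_atMost j(1) Let_def)
qed

abbreviation "check spe \<equiv> check_cert spe ow ar co ld (source I)
  (tnum I < 0, nat \<bar>tnum I\<bar>) (tden I) (mstart I) ys"

lemma threshold_iff:
  "(if w then 1 else 0) \<le> (of_rat (inst_threshold I) :: real) \<longleftrightarrow>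
    \<not> tnum I < 0 \<and> (w \<longrightarrow> tden I \<le> nat \<bar>tnum I\<bar>)"
proof -
  have d: "0 < tden I" using inst by (simp add: is_instance_def)
  have "(of_rat (inst_threshold I) :: real) = real_of_int (tnum I) / real (tden I)"
    by (simp add: inst_threshold_def of_rat_divide)
  then show ?thesis using d by (auto simp: zero_le_divide_iff le_divide_eq)
qed

lemma check_sound:
  assumes c: "check spe c"
  shows "\<exists>\<sigma>. counterexample spe I \<sigma>"
proof -
  obtain m tab where mt: "c = (m, tab)" by (cases c)
  define keys where "keys = map fst tab"
  \<comment> \<open>Repeated keys are resolved by choice, which is harmless since the conditions
    were tested for all entries with the key.\<close>
  define ent where "ent k = (SOME e. e \<in> set tab \<and> fst e = k)" for k
  define P where "P k = lasso_word (fst (snd (ent k)))" for k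
  define r where "r k x = nthd 0 (snd (snd (ent k))) x" for k x
  have ent: "ent k \<in> set tab \<and> fst (ent k) = k" if "k \<in> set keys" for k
  proof -
    have "\<exists>e. e \<in> set tab \<and> fst e = k" using that unfolding keys_def set_map by blast
    from someI_ex[OF this] show ?thesis unfolding ent_def .
  qed
  from c have m: "snd m \<noteq> []" "pplay (lasso_word m)" "starts_at (mstart I) (source I) m"
      "good_lasso ow ar co ld spe keys m"
      "\<not> tnum I < 0" "wins_loop co ld (snd m) \<longrightarrow> tden I \<le> nat \<bar>tnum I\<bar>"
    unfolding check_cert_def mt lasso_ok_iff keys_def fst_conv snd_conv by blast+
  have tab: "fst (fst e) < length co \<and> snd (fst (snd e)) \<noteq> [] \<and> pplay (lasso_word (fst (snd e))) \<and>
      starts_at (fst (snd (fst e))) (snd (snd (fst e))) (fst (snd e)) \<and>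
      (spe \<longrightarrow> good_lasso ow ar co ld spe keys (fst (snd e))) \<and>
      (fst (fst e) \<noteq> ld \<longrightarrow> punish_ok ow ar co ld tab e)"
    if "e \<in> set tab" for e
    using c that unfolding check_cert_def mt lasso_ok_iff keys_def by simp
  have entry: "pplay (P (j, q, v)) \<and> starts q v (P (j, q, v)) \<and> (spe \<longrightarrow> good spe (set keys) (P (j, q, v))) \<and>
      (j \<noteq> ld \<longrightarrow> punishing (set keys) r (j, q, v) (P (j, q, v)))"
    if k: "(j, q, v) \<in> set keys" for j q v
  proof -
    define e where "e = ent (j, q, v)"
    have e: "e \<in> set tab" "fst e = (j, q, v)" using ent[OF k] by (simp_all add: e_def)
    note t = tab[OF e(1)]
    have ne: "snd (fst (snd e)) \<noteq> []" and pp: "pplay (lasso_word (fst (snd e)))" using t by blast+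
    have Pe: "P (j, q, v) = lasso_word (fst (snd e))" by (simp add: P_def e_def)
    have j: "j < length co" using t e(2) by simp
    have "starts q v (P (j, q, v))" unfolding Pe using t starts_at_iff[OF ne] e(2) by simp
    moreover have "spe \<longrightarrow> good spe (set keys) (P (j, q, v))"
      unfolding Pe using t good_lasso_iff[OF ne pp] by blast
    moreover have "punishing (set keys) r (j, q, v) (P (j, q, v))" if "j \<noteq> ld"
    proof -
      have "punish_ok ow ar co ld tab e" using t e(2) that by simp
      then have p: "\<not> wins j (lasso_word (fst (snd e)))"
        "own (lasso_word (fst (snd e)) n) = j \<Longrightarrow> v \<in> succs (lasso_word (fst (snd e)) n) \<Longrightarrow>
          ranked tab e (lasso_word (fst (snd e))) n v" for n v
        using punish_ok_iff[OF ne pp, of j tab] e(2) j by (simp_all del: own_eq)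
      show ?thesis
        unfolding punishing_def Let_def fst_conv Pe
      proof (intro conjI allI impI ballI p(1))
        fix n v' assume own: "own (lasso_word (fst (snd e)) n) = j" and v': "v' \<in> succs (lasso_word (fst (snd e)) n)"
        let ?k = "(j, tgt (lasso_word (fst (snd e)) n), v')"
        note p2 = p(2)[OF own v', unfolded ranked_def Let_def e(2) fst_conv]
        show k: "?k \<in> set keys" using p2 by (simp add: keys_def)
        fix x assume x: "x \<in> vertices G"
          "even (K j x) \<and> (\<forall>i\<le>n. K j x \<le> K j (vx (lasso_word (fst (snd e)) i)))"
        have x1: "x \<in> {..<length ow}" using x(1) by simp
        from mp[OF bspec[OF mp[OF bspec[OF conjunct2[OF p2] conjunct1[OF ent[OF k]]]
              conjunct2[OF ent[OF k]]] x1] x(2)]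
        have "r ?k x \<le> r (j, q, v) x \<and>
          ((\<exists>i\<le>n. K j (vx (lasso_word (fst (snd e)) i)) = K j x) \<longrightarrow> r ?k x < r (j, q, v) x)"
          unfolding r_def e_def .
        then show "r ?k x \<le> r (j, q, v) x"
          "\<exists>i\<le>n. K j (vx (lasso_word (fst (snd e)) i)) = K j x \<Longrightarrow> r ?k x < r (j, q, v) x" by blast+
      qed
    qed
    ultimately show ?thesis using pp Pe by simp
  qed
  have "certificate spe (lasso_word m) (set keys) P r"
    unfolding certificate_def
  proof (intro conjI ballI)
    fix k assume k: "k \<in> set keys"
    obtain j q v where kk: "k = (j, q, v)" by (cases k)
    show "case k of (j, q, v) \<Rightarrow> pplay (P (j, q, v)) \<and> starts q v (P (j, q, v)) \<and>
        (spe \<longrightarrow> good spe (set keys) (P (j, q, v))) \<and>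
        (j \<noteq> ld \<longrightarrow> punishing (set keys) r (j, q, v) (P (j, q, v)))"
      using entry[OF k[unfolded kk]] unfolding kk prod.case .
  qed (use m(2) m(3)[unfolded starts_at_iff[OF m(1)]] m(4)[unfolded good_lasso_iff[OF m(1,2)]] in simp_all)
  from certificate_sound[OF this] obtain \<sigma> where s: "fixed_NE G ld (source I) \<sigma>"
    "spe \<longrightarrow> fixed_SPE G ld (source I) \<sigma>"
    "\<sigma> ld \<in> Comp G ld (source I) MI"
    "outcome G (source I) \<sigma> = (\<lambda>n. vx (lasso_word m n))" by blast
  have "ld < length co" using L by simp
  from wins_loop_iff[OF m(1,2) this]
  have "payoff G (outcome G (source I) \<sigma>) ld \<le> of_rat (inst_threshold I)"
    unfolding s(4) payoff_wins[OF m(2)] threshold_iff using m(5,6) by simp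
  with s(1-3) show ?thesis unfolding counterexample_def by blast
qed

lemma check_complete:
  assumes "counterexample spe I \<sigma>"
  shows "\<exists>ml tab. check spe (ml, tab) \<and> distinct (map fst tab) \<and>
    set (map fst tab) \<subseteq> {..<length co} \<times> {..<mcount I} \<times> {..<length ow} \<and>
    (\<forall>l\<in>insert ml ((\<lambda>e. fst (snd e)) ` set tab). length (fst l) \<le> lasso_bound \<and> length (snd l) \<le> lasso_bound) \<and>
    (\<forall>e\<in>set tab. length (snd (snd e)) = length ow \<and> (\<forall>a\<in>set (snd (snd e)). a \<le> length tab))"
proof -
  have NE: "fixed_NE G ld (source I) \<sigma>" and SPE: "spe \<Longrightarrow> fixed_SPE G ld (source I) \<sigma>"
    and comp: "\<sigma> ld \<in> Comp G ld (source I) MI"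
    and pay: "payoff G (outcome G (source I) \<sigma>) ld \<le> of_rat (inst_threshold I)"
    using assms unfolding counterexample_def by blast+
  obtain main Dom P0 r0 where c0: "certificate spe main Dom P0 r0"
    and Dom: "Dom \<subseteq> players G \<times> mstates MI \<times> vertices G"
    and out: "outcome G (source I) \<sigma> = (\<lambda>n. vx (main n))"
    using certificate_complete[OF NE SPE comp] by blast
  have fin: "finite Dom" by (rule finite_subset[OF Dom]) (simp add: finite_cartesian_product)
  obtain ml Pl r where cert: "certificate spe (lasso_word ml) Dom (\<lambda>k. lasso_word (Pl k)) r"
    and wins: "\<forall>j. wins j (lasso_word ml) = wins j main" and r: "\<forall>k x. r k x \<le> card Dom"
    and len: "\<forall>l\<in>insert ml (Pl ` Dom). snd l \<noteq> [] \<and> length (fst l) \<le> lasso_bound \<and> length (snd l) \<le> lasso_bound"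
    using lasso_certificate[OF c0 fin] by blast
  obtain ks where ks: "set ks = Dom" "distinct ks" using finite_distinct_list[OF fin] by blast
  define ent where "ent k = (k, Pl k, map (r k) [0..<length ow])" for k :: "nat \<times> nat \<times> nat"
  define tab where "tab = map ent ks"
  have keys: "map fst tab = ks" by (simp add: tab_def ent_def comp_def)
  have ml: "snd ml \<noteq> []" "pplay (lasso_word ml)" using len cert by (simp_all add: certificate_def)
  have L': "ld < length co" using L by simp
  have main: "pplay main" using c0 by (simp add: certificate_def)
  have entry: "fst (fst e) < length co \<and> lasso_ok ow ar ld ys (fst (snd e)) \<and>
        starts_at (fst (snd (fst e))) (snd (snd (fst e))) (fst (snd e)) \<and>
        (spe \<longrightarrow> good_lasso ow ar co ld spe (map fst tab) (fst (snd e))) \<and>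
        (fst (fst e) \<noteq> ld \<longrightarrow> punish_ok ow ar co ld tab e)"
    if "e \<in> set tab" for e
  proof -
    obtain k where "k \<in> set ks" "e = ent k" using \<open>e \<in> set tab\<close> unfolding tab_def set_map by blast
    moreover obtain j q v where "k = (j, q, v)" by (cases k)
    ultimately have k: "(j, q, v) \<in> Dom" "e = ent (j, q, v)" using ks by simp_all
    have e: "fst e = (j, q, v)" "fst (snd e) = Pl (j, q, v)"
      "snd (snd e) = map (r (j, q, v)) [0..<length ow]" by (simp_all add: k ent_def)
    note key = certificate_key[OF cert k(1)]
    have ne: "snd (fst (snd e)) \<noteq> []" using len k(1) e(2) by simp
    have pp: "pplay (lasso_word (fst (snd e)))" using key e(2) by simp
    have j: "j < length co" using Dom k(1) by auto
    have "punish_ok ow ar co ld tab e" if nl: "j \<noteq> ld"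
    proof (rule iffD2[OF punish_ok_iff[OF ne pp _ j]])
      show "fst (fst e) = j" by (simp add: e)
      have pu: "punishing Dom r (j, q, v) (lasso_word (Pl (j, q, v)))" using key nl by simp
      show "\<not> wins j (lasso_word (fst (snd e))) \<and> (\<forall>n. own (lasso_word (fst (snd e)) n) = j \<longrightarrow>
          (\<forall>v\<in>succs (lasso_word (fst (snd e)) n). ranked tab e (lasso_word (fst (snd e))) n v))"
        unfolding ranked_def Let_def e(1) fst_conv
      proof (intro conjI allI impI ballI)
        show "\<not> wins j (lasso_word (fst (snd e)))" 
          using pu unfolding punishing_def Let_def fst_conv e(2) by blast
      next
        fix n v' assume own: "own (lasso_word (fst (snd e)) n) = j" and v': "v' \<in> succs (lasso_word (fst (snd e)) n)"
        let ?k = "(j, tgt (lasso_word (fst (snd e)) n), v')"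
        note p2 = punishingD[OF pu fst_conv own[unfolded e(2)] v'[unfolded e(2)], folded e(2)]
        have "?k \<in> set ks" using p2(1) unfolding ks(1) .
        then show "?k \<in> fst ` set tab" unfolding keys[symmetric] set_map .
        fix e' x assume e': "e' \<in> set tab" "fst e' = ?k" and x: "x \<in> {..<length ow}"
          "even (K j x) \<and> (\<forall>i\<le>n. K j x \<le> K j (vx (lasso_word (fst (snd e)) i)))"
        have "e' = ent ?k" using e' by (auto simp: tab_def ent_def)
        then have 1: "nthd 0 (snd (snd e')) x = r ?k x" and 2: "nthd 0 (snd (snd e)) x = r (j, q, v) x"
          using x(1) by (simp_all add: k(2) ent_def)
        show "nthd 0 (snd (snd e')) x \<le> nthd 0 (snd (snd e)) x"
          "\<exists>i\<le>n. K j (vx (lasso_word (fst (snd e)) i)) = K j x \<Longrightarrow>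
             nthd 0 (snd (snd e')) x < nthd 0 (snd (snd e)) x"
          unfolding 1 2 using x p2(2)[of x] by simp_all
      qed
    qed
    moreover have "starts_at q v (fst (snd e))" using starts_at_iff[OF ne] key e(2) by simp
    moreover have "spe \<longrightarrow> good_lasso ow ar co ld spe (map fst tab) (fst (snd e))"
      unfolding good_lasso_iff[OF ne pp] keys ks(1) using key e(2) by simp
    moreover have "lasso_ok ow ar ld ys (fst (snd e))"
      unfolding lasso_ok_iff using ne pp by blast
    ultimately show ?thesis using j by (simp add: e)
  qed
  have "check spe (ml, tab)"
    unfolding check_cert_def fst_conv snd_conv
  proof (intro conjI ballI)
    show "lasso_ok ow ar ld ys ml" unfolding lasso_ok_iff using ml by blast
    show "starts_at (mstart I) (source I) ml"
      unfolding starts_at_iff[OF ml(1)] using cert by (simp add: certificate_def)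
    show "good_lasso ow ar co ld spe (map fst tab) ml"
      unfolding good_lasso_iff[OF ml] keys ks(1) using cert by (simp add: certificate_def)
    have "wins_loop co ld (snd ml) = wins ld main"
      using wins_loop_iff[OF ml L'] wins by simp
    with pay[unfolded out payoff_wins[OF main] threshold_iff]
    show "\<not> tnum I < 0" "wins_loop co ld (snd ml) \<longrightarrow> tden I \<le> nat \<bar>tnum I\<bar>" by blast+
  qed (use entry in blast)+
  moreover have "distinct (map fst tab)" unfolding keys by (rule ks)
  moreover have "set (map fst tab) \<subseteq> {..<length co} \<times> {..<mcount I} \<times> {..<length ow}"
    unfolding keys using ks Dom by simp
  moreover have "\<forall>l\<in>insert ml ((\<lambda>e. fst (snd e)) ` set tab). length (fst l) \<le> lasso_bound \<and> length (snd l) \<le> lasso_bound"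
    using len ks(1) by (simp add: tab_def ent_def)
  moreover have "length tab = card Dom" using distinct_card[OF ks(2)] ks(1) by (simp add: tab_def)
  then have "\<forall>e\<in>set tab. length (snd (snd e)) = length ow \<and> (\<forall>a\<in>set (snd (snd e)). a \<le> length tab)"
    using r by (auto simp: tab_def ent_def)
  ultimately show ?thesis by blast
qed

text \<open>The number of states is written in binary, so its code alone would allow exponentially
  many. It is bounded by the number of transitions, because every state has one at the
  source.\<close>

lemma instance_sizes:
  "length ow \<le> length (encode I)" "length co \<le> length (encode I)"
  "length ys \<le> length (encode I)" "mcount I \<le> length ys"
proof -
  have len: "length xs \<le> length (enc_list f xs)" for f :: "'x \<Rightarrow> bool list" and xs
    by (induction xs) auto
  show "length ow \<le> length (encode I)" "length co \<le> length (encode I)"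
    using len[of "ow" enc_nat] len[of "co" "enc_list enc_nat"] by (simp_all add: encode_def)
  show "length ys \<le> length (encode I)"
    using len[of "marcs I" "enc_prod enc_nat (enc_prod enc_nat enc_nat)"]
      len[of "marcsL I" "enc_prod enc_nat (enc_prod enc_nat (enc_prod enc_nat enc_nat))"]
    by (simp add: encode_def ys_def pos_list_def)
  have "p \<in> src ` set ys" if "p < mcount I" for p
  proof -
    have "\<exists>q w. (p, source I, q, w) \<in> positions"
    proof (cases "source I \<in> region G ld")
      case True
      then obtain q w where "(p, source I, q, w) \<in> mtransL MI"
        using mealy \<open>p < mcount I\<close> unfolding is_mealy_def by force
      then show ?thesis using True by (auto simp: positions_def region_def)
    next
      case False
      then have "source I \<in> vertices G - region G ld" using v0 by blast
      then obtain q where "(p, source I, q) \<in> mtrans MI"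
        using mealy \<open>p < mcount I\<close> unfolding is_mealy_def by force
      then show ?thesis using False v0 by (auto simp: positions_def region_def)
    qed
    then obtain q w where "(p, source I, q, w) \<in> set ys" unfolding set_ys by blast
    then show ?thesis by force
  qed
  then have "{..<mcount I} \<subseteq> src ` set ys" by blast
  then have "mcount I \<le> card (src ` set ys)" using card_mono[of "src ` set ys" "{..<mcount I}"] by simp
  also have "\<dots> \<le> length ys" using card_image_le[of "set ys" src] card_length[of ys] by simp
  finally show "mcount I \<le> length ys" .
qed

end

section \<open>Length of encoded certificates\<close>

definition enc_lasso :: "lasso \<Rightarrow> bool list" where
  "enc_lasso = enc_prod (enc_list (enc_prod enc_nat (enc_prod enc_nat (enc_prod enc_nat enc_nat))))
     (enc_list (enc_prod enc_nat (enc_prod enc_nat (enc_prod enc_nat enc_nat))))"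

definition enc_entry :: "entry \<Rightarrow> bool list" where
  "enc_entry = enc_prod (enc_prod enc_nat (enc_prod enc_nat enc_nat)) (enc_prod enc_lasso (enc_list enc_nat))"

definition enc_cert :: "lasso \<times> entry list \<Rightarrow> bool list" where
  "enc_cert = enc_prod enc_lasso (enc_list enc_entry)"

lemma length_enc_list_le:
  "\<forall>x\<in>set xs. length (f x) \<le> B \<Longrightarrow> length xs \<le> n \<Longrightarrow> length (enc_list f xs) \<le> 1 + n * (1 + B)"
proof (induction xs arbitrary: n)
  case (Cons x xs)
  then obtain m where "n = Suc m" by (cases n) auto
  then show ?case using Cons.IH[of m] Cons.prems by simp
qed simp

lemma length_enc_nat: "length (enc_nat n) \<le> 2 * n + 1"
proof -
  have "length (enc_list (\<lambda>b. [b]) xs) = 2 * length xs + 1" for xs :: "bool list"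
    by (induction xs) auto
  then show ?thesis using length_binary[of n] by (simp add: enc_nat_def)
qed

text \<open>Two lists of at most \<open>(N ^ 2 + 1) * N ^ 4\<close> positions, each of four numbers
  of at most \<open>2 * N + 1\<close> bits.\<close>

definition lasso_size :: "nat \<Rightarrow> nat" where
  "lasso_size N = 2 * (1 + (N ^ 2 + 1) * N ^ 4 * (1 + 4 * (2 * N + 1)))"

text \<open>The main lasso and at most \<open>N ^ 3\<close> entries, each with a key of three
  numbers, a lasso, and at most \<open>N\<close> ranks that do not exceed the number of
  entries.\<close>

definition cert_size :: "nat \<Rightarrow> nat" where
  "cert_size N = lasso_size N + (1 + N ^ 3 * (1 + (3 * (2 * N + 1) + (lasso_size N + (1 + N * (1 + (2 * N ^ 3 + 1)))))))"

lemma pbd_cert_size: "pbd cert_size"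
  unfolding cert_size_def lasso_size_def by (intro pbd_intros)

context instance_verification
begin

lemma card_positions: "card positions \<le> length (encode I)"
  using card_length[of ys] instance_sizes(3) by (simp add: set_ys)

lemma lasso_bound_le: "lasso_bound \<le> (length (encode I) ^ 2 + 1) * length (encode I) ^ 4"
  unfolding lasso_bound_def using card_positions by (intro mult_le_mono add_mono power_mono) auto

lemma positions_bound:
  "(p, u, q, w) \<in> positions \<Longrightarrow> p \<le> length (encode I) \<and> u \<le> length (encode I) \<and>
    q \<le> length (encode I) \<and> w \<le> length (encode I)"
proof -
  let ?N = "length (encode I)"
  assume a: "(p, u, q, w) \<in> positions"
  have u: "u < length ow" using a by (simp add: positions_def)
  have "p < mcount I \<and> q < mcount I \<and> w < length ow"
    using a mealy u unfolding positions_def is_mealy_def by (auto split: if_splits)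
  then show ?thesis using u instance_sizes by linarith
qed

lemma lasso_ok_size:
  assumes "lasso_ok ow ar ld ys l" "length (fst l) \<le> lasso_bound" "length (snd l) \<le> lasso_bound"
  shows "length (enc_lasso l) \<le> lasso_size (length (encode I))"
proof -
  let ?N = "length (encode I)"
  let ?e = "enc_prod enc_nat (enc_prod enc_nat (enc_prod enc_nat enc_nat))"
  have "length (?e y) \<le> 4 * (2 * ?N + 1)" if "y \<in> set (fst l) \<union> set (snd l)" for y
  proof -
    obtain p u q w where y: "y = (p, u, q, w)" by (cases y)
    have "y \<in> positions" using assms(1) that by (auto simp: lasso_ok_def set_ys)
    then have "p \<le> ?N" "u \<le> ?N" "q \<le> ?N" "w \<le> ?N" using positions_bound y by blast+
    then show ?thesis
      using length_enc_nat[of p] length_enc_nat[of u] length_enc_nat[of q] length_enc_nat[of w] by (simp add: y)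
  qed
  then have "length (enc_list ?e xs) \<le> 1 + (?N ^ 2 + 1) * ?N ^ 4 * (1 + 4 * (2 * ?N + 1))"
    if "xs = fst l \<or> xs = snd l" for xs
    using that assms(2,3) lasso_bound_le by (intro length_enc_list_le) auto
  from this[of "fst l"] this[of "snd l"] show ?thesis
    by (cases l) (simp add: enc_lasso_def lasso_size_def)
qed

lemma check_complete_bounded:
  assumes "counterexample spe I \<sigma>"
  shows "\<exists>c. check spe c \<and> length (enc_cert c) \<le> cert_size (length (encode I))"
proof -
  let ?N = "length (encode I)"
  obtain ml tab where chk: "check spe (ml, tab)" and dist: "distinct (map fst tab)"
    and keys: "set (map fst tab) \<subseteq> {..<length co} \<times> {..<mcount I} \<times> {..<length ow}"
    and len: "\<forall>l\<in>insert ml ((\<lambda>e. fst (snd e)) ` set tab). length (fst l) \<le> lasso_bound \<and> length (snd l) \<le> lasso_bound"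
    and ranks: "\<forall>e\<in>set tab. length (snd (snd e)) = length ow \<and> (\<forall>a\<in>set (snd (snd e)). a \<le> length tab)"
    using check_complete[OF assms] by blast
  have m: "mcount I \<le> ?N" using instance_sizes by linarith
  have "length tab = card (set (map fst tab))" using distinct_card[OF dist] by simp
  also have "\<dots> \<le> card ({..<length co} \<times> {..<mcount I} \<times> {..<length ow})"
    using keys by (intro card_mono) auto
  also have "\<dots> = length co * (mcount I * length ow)" by (simp add: card_cartesian_product)
  also have "\<dots> \<le> ?N * (?N * ?N)" using instance_sizes m by (intro mult_le_mono)
  finally have tab: "length tab \<le> ?N ^ 3" by (simp add: power3_eq_cube mult.assoc)
  have "length (enc_entry e) \<le> 3 * (2 * ?N + 1) + (lasso_size ?N + (1 + ?N * (1 + (2 * ?N ^ 3 + 1))))"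
    if e: "e \<in> set tab" for e
  proof -
    obtain j q v l r where el: "e = ((j, q, v), l, r)" by (cases e) auto
    have "(j, q, v) \<in> set (map fst tab)" using e el by force
    then have "(j, q, v) \<in> {..<length co} \<times> {..<mcount I} \<times> {..<length ow}" using keys by blast
    then have "j \<le> ?N" "q \<le> ?N" "v \<le> ?N" using instance_sizes m by auto
    then have 1: "length (enc_prod enc_nat (enc_prod enc_nat enc_nat) (j, q, v)) \<le> 3 * (2 * ?N + 1)"
      using length_enc_nat[of j] length_enc_nat[of q] length_enc_nat[of v] by simp
    have "\<forall>e\<in>set tab. lasso_ok ow ar ld ys (fst (snd e))"
      using chk unfolding check_cert_def snd_conv by blast
    from bspec[OF this e] have "lasso_ok ow ar ld ys l" by (simp add: el)
    moreover have "length (fst l) \<le> lasso_bound \<and> length (snd l) \<le> lasso_bound" using len e el by force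
    ultimately have 2: "length (enc_lasso l) \<le> lasso_size ?N" using lasso_ok_size by blast
    have r: "length r = length ow" "\<forall>a\<in>set r. a \<le> length tab" using ranks e el by auto
    have "\<forall>a\<in>set r. length (enc_nat a) \<le> 2 * ?N ^ 3 + 1"
    proof
      fix a assume "a \<in> set r"
      then have "a \<le> ?N ^ 3" using r(2) tab by auto
      then show "length (enc_nat a) \<le> 2 * ?N ^ 3 + 1" using length_enc_nat[of a] by linarith
    qed
    then have "length (enc_list enc_nat r) \<le> 1 + ?N * (1 + (2 * ?N ^ 3 + 1))"
      using r(1) instance_sizes(1) by (intro length_enc_list_le) auto
    then show ?thesis using 1 2 by (simp add: el enc_entry_def)
  qed
  then have "length (enc_list enc_entry tab) \<le>
      1 + ?N ^ 3 * (1 + (3 * (2 * ?N + 1) + (lasso_size ?N + (1 + ?N * (1 + (2 * ?N ^ 3 + 1))))))"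
    using tab by (intro length_enc_list_le) auto
  moreover have "length (enc_lasso ml) \<le> lasso_size ?N"
    using chk len by (intro lasso_ok_size) (auto simp: check_cert_def)
  ultimately have "length (enc_cert (ml, tab)) \<le> cert_size ?N" by (simp add: enc_cert_def cert_size_def)
  with chk show ?thesis by blast
qed

end

section \<open>Parsing\<close>

text \<open>Returning the rest of the word lets decoders of self-delimiting codes be chained. The
  behaviour of a decoder on words that start with no code is left open.\<close>

definition codec :: "('a :: treeable \<Rightarrow> bool list) \<Rightarrow> (bool list \<Rightarrow> 'a \<times> bool list) \<Rightarrow> bool" where
  "codec f d \<longleftrightarrow> pt f \<and> pt d \<and> (\<forall>x r. d (f x @ r) = (x, r))"

lemma codec_bit: "codec (\<lambda>b. [b]) (\<lambda>w. (hd w, tl w))"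
  unfolding codec_def by (auto intro!: pt_intros)

lemma codec_prod:
  assumes "codec f d" "codec g e"
  shows "codec (enc_prod f g) (\<lambda>w. ((fst (d w), fst (e (snd (d w)))), snd (e (snd (d w)))))"
proof -
  have p: "pt f" "pt d" "pt g" "pt e" using assms by (auto simp: codec_def)
  have "enc_prod f g = (\<lambda>z. f (fst z) @ g (snd z))" by (auto simp: fun_eq_iff)
  moreover have "pt (\<lambda>z. f (fst z) @ g (snd z))"
    by (intro pt_intros pt_comp[OF p(1)] pt_comp[OF p(3)])
  moreover have "pt (\<lambda>w. ((fst (d w), fst (e (snd (d w)))), snd (e (snd (d w)))))"
    by (intro pt_intros pt_comp[OF p(2)] pt_comp[OF p(4)])
  ultimately show ?thesis using assms by (auto simp: codec_def)
qed

text \<open>The fold over the symbols of \<open>w\<close> is only a clock; at most one element is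
  parsed per tick, and the Boolean records that the end mark was read. The length test protects
  against element decoders that return a longer rest on malformed words, so sizes stay polynomial on
  every input.\<close>

definition parse_step where
  "parse_step d w (z :: 'b) s = (if snd (snd s) \<or> fst (snd s) = [] \<or> \<not> length (fst (snd s)) \<le> length w then s
     else if \<not> hd (fst (snd s)) then (fst s, tl (fst (snd s)), True)
     else (fst (d (tl (fst (snd s)))) # fst s, snd (d (tl (fst (snd s)))), False))"

definition parse_list where
  "parse_list d w = (rev (fst (fold (parse_step d w) w ([], w, False))),
     fst (snd (fold (parse_step d w) w ([], w, False))))"

lemma parse_list_eq:
  assumes d: "\<And>x r. d (f x @ r) = (x, r)"
  shows "parse_list d (enc_list f xs @ r) = (xs, r)"
proof -
  have fin: "fold (parse_step d w) zs (acc, r, True) = (acc, r, True)" for w zs acc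
    by (induction zs) (auto simp: parse_step_def)
  have parse: "length xs < length zs \<Longrightarrow> length (enc_list f xs @ r) \<le> length w \<Longrightarrow>
    fold (parse_step d w) zs (acc, enc_list f xs @ r, False) = (rev xs @ acc, r, True)" for w zs acc
  proof (induction xs arbitrary: zs acc)
    case Nil
    then obtain z zs' where "zs = z # zs'" by (cases zs) auto
    moreover have "parse_step d w z (acc, False # r, False) = (acc, r, True)"
      using Nil by (simp add: parse_step_def)
    ultimately show ?case using fin by simp
  next
    case (Cons x xs)
    then obtain z zs' where zs: "zs = z # zs'" by (cases zs) auto
    have "parse_step d w z (acc, enc_list f (x # xs) @ r, False) = (x # acc, enc_list f xs @ r, False)"
      using Cons.prems d by (simp add: parse_step_def)
    then show ?case using Cons.IH[of zs' "x # acc"] Cons.prems by (simp add: zs)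
  qed
  have "length xs < length (enc_list f xs)" by (induction xs) auto
  then have "length xs < length (enc_list f xs @ r)" by simp
  from parse[OF this order_refl, of "[]"] show ?thesis by (simp add: parse_list_def del: fold_append)
qed

lemma pt_parse_list:
  fixes d :: "bool list \<Rightarrow> 'a :: treeable \<times> bool list"
  assumes d: "pt d" shows "pt (parse_list d)"
proof -
  obtain b where b: "pbd b" "\<And>x. sz (d x) \<le> b (sz x)" "mono b" using pt_bound[OF d] by blast
  have "pt (\<lambda>w. fold (parse_step d w) w ([], w, False))"
  proof (rule pt_fold_add[where B = "\<lambda>n. b (4 * n + 1) + 5"])
    show "pbd (\<lambda>n. b (4 * n + 1) + 5)" by (intro pbd_intros pbd_comp[OF b(1)])
    fix w and y :: bool and a :: "'a list \<times> bool list \<times> bool"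
    obtain acc rest e where a: "a = (acc, rest, e)" by (cases a)
    show "sz (parse_step d w y a) \<le> sz a + (b (4 * sz w + 1) + 5)"
    proof (cases "e \<or> rest = [] \<or> \<not> length rest \<le> length w \<or> \<not> hd rest")
      case True
      then show ?thesis using sz_tl[of rest] by (cases e) (auto simp: parse_step_def a)
    next
      case False
      have "sz rest \<le> 4 * sz w + 1" using False sz_bits[of rest] length_le_sz[of w] by linarith
      then have "sz (tl rest) \<le> 4 * sz w + 1" using sz_tl[of rest] by linarith
      then have "sz (d (tl rest)) \<le> b (4 * sz w + 1)" using b(2)[of "tl rest"] monoD[OF b(3)] order_trans by blast
      then show ?thesis using False by (cases "d (tl rest)") (simp add: parse_step_def a)
    qed
  next
    show "pt (\<lambda>z. parse_step d (fst z) (fst (snd z) :: bool) (snd (snd z)))"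
      unfolding parse_step_def by (intro pt_intros pt_comp[OF d])
  qed (intro pt_intros)+
  note fold = this
  show ?thesis unfolding parse_list_def by (intro pt_intros fold)
qed

lemma codec_list:
  assumes "codec f d" shows "codec (enc_list f) (parse_list d)"
proof -
  have p: "pt f" "pt d" "\<And>x r. d (f x @ r) = (x, r)" using assms by (auto simp: codec_def)
  have "enc_list f xs = concat (map (\<lambda>x. True # f x) xs) @ [False]" for xs by (induction xs) auto
  then have "enc_list f = (\<lambda>xs. concat (map (\<lambda>x. True # f x) xs) @ [False])" by blast
  moreover have "pt (\<lambda>xs. concat (map (\<lambda>x. True # f x) xs) @ [False])"
    by (intro pt_intros pt_comp[OF p(1)])
  ultimately show ?thesis using pt_parse_list[OF p(2)] parse_list_eq[of d f, OF p(3)] by (simp add: codec_def)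
qed

lemma codec_nat: "\<exists>d. codec enc_nat d"
proof -
  define d where "d = parse_list (\<lambda>w. (hd w, tl w) :: bool \<times> bool list)"
  have c: "codec (enc_list (\<lambda>b. [b])) d" unfolding d_def by (rule codec_list[OF codec_bit])
  then have p: "pt (enc_list (\<lambda>b :: bool. [b]))" "pt d" by (auto simp: codec_def)
  have "pt (\<lambda>n. enc_list (\<lambda>b. [b]) (binary n))" by (intro pt_comp[OF p(1)] pt_intros)
  then have "pt enc_nat" by (simp add: enc_nat_def[abs_def])
  moreover have "pt (\<lambda>w. (nat_of_bits (fst (d w)), snd (d w)))" by (intro pt_intros pt_comp[OF p(2)])
  ultimately have "codec enc_nat (\<lambda>w. (nat_of_bits (fst (d w)), snd (d w)))"
    using c by (simp add: codec_def enc_nat_def)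
  then show ?thesis using exI[of "codec enc_nat"] by blast
qed

lemma codec_ex:
  "\<exists>d. codec f d \<Longrightarrow> \<exists>d. codec (enc_list f) d"
  "\<exists>d. codec f d \<Longrightarrow> \<exists>d. codec g d \<Longrightarrow> \<exists>d. codec (enc_prod f g) d"
  using codec_list codec_prod by blast+

type_synonym inst = "nat list \<times> (nat \<times> nat) list \<times> nat list list \<times> nat \<times> nat \<times> (bool \<times> nat) \<times>
  nat \<times> nat \<times> nat \<times> (nat \<times> nat \<times> nat) list \<times> npos list"

definition enc_inst :: "inst \<Rightarrow> bool list" where
  "enc_inst = enc_prod (enc_list enc_nat) (enc_prod (enc_list (enc_prod enc_nat enc_nat))
     (enc_prod (enc_list (enc_list enc_nat)) (enc_prod enc_nat (enc_prod enc_nat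
     (enc_prod (enc_prod (\<lambda>b. [b]) enc_nat) (enc_prod enc_nat (enc_prod enc_nat (enc_prod enc_nat
     (enc_prod (enc_list (enc_prod enc_nat (enc_prod enc_nat enc_nat)))
       (enc_list (enc_prod enc_nat (enc_prod enc_nat (enc_prod enc_nat enc_nat)))))))))))))"

lemma codec_inst: "\<exists>d. codec enc_inst d"
  unfolding enc_inst_def using codec_nat codec_bit by (intro codec_ex) blast+

lemma codec_cert: "\<exists>d. codec enc_cert d"
  unfolding enc_cert_def enc_lasso_def enc_entry_def using codec_nat by (intro codec_ex)

text \<open>A pair \<open>(s, n)\<close> stands for an integer with sign \<open>s\<close> and absolute value \<open>n\<close>.\<close>

definition inst_of :: "parity_instance \<Rightarrow> inst" where
  "inst_of I = (owners I, arcs I, colours I, leader I, source I, (tnum I < 0, nat \<bar>tnum I\<bar>), tden I,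
     mcount I, mstart I, marcs I, marcsL I)"

lemma enc_inst_of: "enc_inst (inst_of I) = encode I"
  by (simp add: enc_inst_def inst_of_def encode_def enc_int_def)

text \<open>Excludes minus zero, which encodes no integer.\<close>

definition canonical :: "bool \<times> nat \<Rightarrow> bool" where
  "canonical z \<longleftrightarrow> (fst z \<longrightarrow> snd z \<noteq> 0)"

lemma canonical_inst:
  "canonical tn \<longleftrightarrow> (\<exists>I. (ow, ar, co, l, s, tn, td, mc, ms, ma, mL) = inst_of I)"
proof
  assume "canonical tn"
  then have "(ow, ar, co, l, s, tn, td, mc, ms, ma, mL) = inst_of \<lparr>owners = ow, arcs = ar, colours = co,
      leader = l, source = s, tnum = (if fst tn then - int (snd tn) else int (snd tn)), tden = td,
      mcount = mc, mstart = ms, marcs = ma, marcsL = mL\<rparr>"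
    by (cases tn) (auto simp: inst_of_def canonical_def)
  then show "\<exists>I. (ow, ar, co, l, s, tn, td, mc, ms, ma, mL) = inst_of I" ..
qed (auto simp: inst_of_def canonical_def)

lemma encode_inject: "encode I = encode J \<Longrightarrow> I = J"
proof -
  assume e: "encode I = encode J"
  obtain d where "codec enc_inst d" using codec_inst by blast
  then have "d (enc_inst i @ []) = (i, [])" for i unfolding codec_def by blast
  from this[of "inst_of I"] this[of "inst_of J"] have "inst_of I = inst_of J" using e by (simp add: enc_inst_of)
  then show ?thesis
    unfolding inst_of_def by (intro parity_instance.equality) (auto simp: abs_if split: if_splits)
qed

section \<open>Instances are recognisable in polynomial time\<close>

definition valid_game :: "nat list \<Rightarrow> (nat \<times> nat) list \<Rightarrow> nat list list \<Rightarrow> nat \<Rightarrow> nat \<Rightarrow> nat \<Rightarrow> bool" where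
  "valid_game ow ar co l s td \<longleftrightarrow> (\<forall>i\<in>set ow. i < length co) \<and>
     (\<forall>a\<in>set ar. fst a < length ow \<and> snd a < length ow) \<and>
     (\<forall>u\<in>set [0..<length ow]. \<exists>a\<in>set ar. fst a = u) \<and> (\<forall>c\<in>set co. length c = length ow) \<and>
     l < length co \<and> s < length ow \<and> 0 < td"

text \<open>Running through all states below \<open>mc\<close> could take exponential time. The test
  \<open>mc \<le> length ys\<close>, which every instance passes, makes it possible to run through
  the indices of the list instead.\<close>

definition valid_mealy :: "nat list \<Rightarrow> (nat \<times> nat) list \<Rightarrow> nat \<Rightarrow> nat \<Rightarrow> nat \<Rightarrow>
    (nat \<times> nat \<times> nat) list \<Rightarrow> npos list \<Rightarrow> npos list \<Rightarrow> bool" where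
  "valid_mealy ow ar l mc ms ma mL ys \<longleftrightarrow> ms < mc \<and> mc \<le> length ys \<and>
     (\<forall>t\<in>set ma. fst t < mc \<and> fst (snd t) < length ow \<and> nthd 0 ow (fst (snd t)) \<noteq> l \<and> snd (snd t) < mc) \<and>
     (\<forall>t\<in>set mL. fst t < mc \<and> fst (snd t) < length ow \<and> nthd 0 ow (fst (snd t)) = l \<and>
        fst (snd (snd t)) < mc \<and> (fst (snd t), snd (snd (snd t))) \<in> set ar) \<and>
     (\<forall>p\<in>set [0..<length ys]. p < mc \<longrightarrow> (\<forall>u\<in>set [0..<length ow]. \<exists>y\<in>set ys. fst y = p \<and> fst (snd y) = u))"

text \<open>At most one transition per state and vertex; that there is one is checked in
  \<open>valid_mealy\<close>.\<close>

definition valid_det :: "npos list \<Rightarrow> bool" where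
  "valid_det ys \<longleftrightarrow> (\<forall>y\<in>set ys. \<forall>y'\<in>set ys. fst y = fst y' \<and> fst (snd y) = fst (snd y') \<longrightarrow> y = y')"

definition valid_inst :: "bool \<Rightarrow> parity_instance \<Rightarrow> bool" where
  "valid_inst det I \<longleftrightarrow> valid_game (owners I) (arcs I) (colours I) (leader I) (source I) (tden I) \<and>
     valid_mealy (owners I) (arcs I) (leader I) (mcount I) (mstart I) (marcs I) (marcsL I) (pos_list (marcs I) (marcsL I)) \<and>
     (det \<longrightarrow> valid_det (pos_list (marcs I) (marcsL I)))"

lemma set_pos_list: "(p, u, q, w) \<in> set (pos_list ma mL) \<longleftrightarrow> ((p, u, q) \<in> set ma \<and> w = u) \<or> (p, u, q, w) \<in> set mL"
  by (force simp: pos_list_def image_iff)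

lemma valid_game_iff:
  "valid_game (owners I) (arcs I) (colours I) (leader I) (source I) (tden I) \<longleftrightarrow>
    is_game (inst_game I) \<and> (\<forall>c\<in>set (colours I). length c = length (owners I)) \<and>
    leader I \<in> players (inst_game I) \<and> source I \<in> vertices (inst_game I) \<and> 0 < tden I"
proof -
  have "(\<forall>i\<in>set (owners I). i < length (colours I)) \<longleftrightarrow> (\<forall>v<length (owners I). owners I ! v < length (colours I))"
    by (auto simp: all_set_conv_all_nth)
  moreover have "(\<forall>a\<in>set (arcs I). fst a < length (owners I) \<and> snd a < length (owners I)) \<longleftrightarrow>
      set (arcs I) \<subseteq> {..<length (owners I)} \<times> {..<length (owners I)}" by force
  moreover have "(\<forall>u<length (owners I). \<exists>a\<in>set (arcs I). fst a = u) \<longleftrightarrow>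
      (\<forall>u<length (owners I). \<exists>v. (u, v) \<in> set (arcs I))" by force
  ultimately show ?thesis
    unfolding valid_game_def is_game_def inst_game_def by (simp add: Ball_def)
qed

lemma valid_mealyD:
  assumes "valid_mealy (owners I) (arcs I) (leader I) (mcount I) (mstart I) (marcs I) (marcsL I) (pos_list (marcs I) (marcsL I))"
    and game: "is_game (inst_game I)"
  shows "is_mealy (inst_game I) (leader I) (inst_mealy I)"
proof -
  let ?ys = "pos_list (marcs I) (marcsL I)"
  have ma: "p < mcount I \<and> u < length (owners I) \<and> owners I ! u \<noteq> leader I \<and> q < mcount I"
    if t: "(p, u, q) \<in> set (marcs I)" for p u q
  proof -
    have "\<forall>t\<in>set (marcs I). fst t < mcount I \<and> fst (snd t) < length (owners I) \<and>
      nthd 0 (owners I) (fst (snd t)) \<noteq> leader I \<and> snd (snd t) < mcount I"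
      using assms(1) unfolding valid_mealy_def by blast
    from bspec[OF this t] show ?thesis by auto
  qed
  have mL: "p < mcount I \<and> u < length (owners I) \<and> owners I ! u = leader I \<and> q < mcount I \<and> (u, v) \<in> set (arcs I)"
    if t: "(p, u, q, v) \<in> set (marcsL I)" for p u q v
  proof -
    have "\<forall>t\<in>set (marcsL I). fst t < mcount I \<and> fst (snd t) < length (owners I) \<and>
      nthd 0 (owners I) (fst (snd t)) = leader I \<and> fst (snd (snd t)) < mcount I \<and>
      (fst (snd t), snd (snd (snd t))) \<in> set (arcs I)"
      using assms(1) unfolding valid_mealy_def by blast
    from bspec[OF this t] show ?thesis by auto
  qed
  have arc: "v < length (owners I)" if "(u, v) \<in> set (arcs I)" for u v
    using game that by (auto simp: is_game_def inst_game_def)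
  have tot: "\<exists>q w. (p, u, q, w) \<in> set ?ys" if pu: "p < mcount I" "u < length (owners I)" for p u
  proof -
    have "mcount I \<le> length ?ys" using assms(1) by (simp add: valid_mealy_def)
    then have "p \<in> set [0..<length ?ys]" "u \<in> set [0..<length (owners I)]" using pu by simp_all
    moreover have "\<forall>p\<in>set [0..<length ?ys]. p < mcount I \<longrightarrow>
        (\<forall>u\<in>set [0..<length (owners I)]. \<exists>y\<in>set ?ys. fst y = p \<and> fst (snd y) = u)"
      using assms(1) unfolding valid_mealy_def by blast
    ultimately obtain y where "y \<in> set ?ys" "fst y = p" "fst (snd y) = u" using pu(1) by blast
    moreover obtain p' u' q w where "y = (p', u', q, w)" by (rule prod_cases4)
    ultimately show ?thesis by auto
  qed
  show ?thesis
    unfolding is_mealy_def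
  proof (intro conjI ballI)
    show "minit (inst_mealy I) \<in> mstates (inst_mealy I)" using assms(1) by (simp add: valid_mealy_def inst_mealy_def)
    show "mtrans (inst_mealy I) \<subseteq> mstates (inst_mealy I) \<times>
        (vertices (inst_game I) - region (inst_game I) (leader I)) \<times> mstates (inst_mealy I)"
      using ma by (auto simp: inst_mealy_def inst_game_def region_def)
    show "mtransL (inst_mealy I) \<subseteq> mstates (inst_mealy I) \<times>
        region (inst_game I) (leader I) \<times> mstates (inst_mealy I) \<times> vertices (inst_game I)"
      using mL arc by (fastforce simp: inst_mealy_def inst_game_def region_def)
    show "case x of (p, u, q, v) \<Rightarrow> (u, v) \<in> edges (inst_game I)" if "x \<in> mtransL (inst_mealy I)" for x
      using that mL by (cases x) (auto simp: inst_mealy_def inst_game_def)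
    show "\<exists>q. (p, u, q) \<in> mtrans (inst_mealy I)"
      if "p \<in> mstates (inst_mealy I)" "u \<in> vertices (inst_game I) - region (inst_game I) (leader I)" for p u
      using tot[of p u] that mL by (auto simp: inst_mealy_def inst_game_def region_def set_pos_list)
    show "\<exists>q v. (p, u, q, v) \<in> mtransL (inst_mealy I)"
      if "p \<in> mstates (inst_mealy I)" "u \<in> region (inst_game I) (leader I)" for p u
      using tot[of p u] that ma by (auto simp: inst_mealy_def inst_game_def region_def set_pos_list)
  qed (simp add: inst_mealy_def)
qed

context instance_verification
begin

lemma position_ex: "p < mcount I \<Longrightarrow> u < length ow \<Longrightarrow> \<exists>q w. (p, u, q, w) \<in> set ys"
proof -
  assume p: "p < mcount I" and u: "u < length ow"
  have m: "is_mealy G ld MI" by (rule mealy)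
  show "\<exists>q w. (p, u, q, w) \<in> set ys"
  proof (cases "ow ! u = ld")
    case True
    then have "\<exists>q v. (p, u, q, v) \<in> mtransL MI"
      using m p u unfolding is_mealy_def by (simp add: region_def)
    then show ?thesis by (auto simp: ys_def set_pos_list mtrans_inst)
  next
    case False
    then have "\<exists>q. (p, u, q) \<in> mtrans MI"
      using m p u unfolding is_mealy_def by (simp add: region_def)
    then show ?thesis by (auto simp: ys_def set_pos_list mtrans_inst)
  qed
qed

lemma valid_mealyI:
  "valid_mealy ow ar ld (mcount I) (mstart I) (marcs I) (marcsL I) ys"
  unfolding valid_mealy_def
proof (intro conjI)
  have m: "is_mealy G ld MI" by (rule mealy)
  show "mstart I < mcount I" using m by (simp add: is_mealy_def)
  show "mcount I \<le> length ys" by (rule instance_sizes)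
  show "\<forall>t\<in>set (marcs I). fst t < mcount I \<and> fst (snd t) < length ow \<and>
      nthd 0 ow (fst (snd t)) \<noteq> ld \<and> snd (snd t) < mcount I"
    using m unfolding is_mealy_def mtrans_inst by (auto simp: region_def)
  show "\<forall>t\<in>set (marcsL I). fst t < mcount I \<and> fst (snd t) < length ow \<and>
      nthd 0 ow (fst (snd t)) = ld \<and> fst (snd (snd t)) < mcount I \<and>
      (fst (snd t), snd (snd (snd t))) \<in> set ar"
    using m unfolding is_mealy_def mtrans_inst by (force simp: region_def)
  show "\<forall>p\<in>set [0..<length ys]. p < mcount I \<longrightarrow> (\<forall>u\<in>set [0..<length ow]. \<exists>y\<in>set ys. fst y = p \<and> fst (snd y) = u)"
  proof (intro ballI impI)
    fix p u assume "p < mcount I" "u \<in> set [0..<length ow]"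
    then obtain q w where "(p, u, q, w) \<in> set ys" using position_ex[of p u] by auto
    then show "\<exists>y\<in>set ys. fst y = p \<and> fst (snd y) = u" by force
  qed
qed

lemma valid_det_iff:
  "valid_det ys \<longleftrightarrow> is_deterministic G ld MI"
proof
  assume "valid_det ys"
  then have d: "q = q' \<and> w = w'" if "(p, u, q, w) \<in> set ys" "(p, u, q', w') \<in> set ys" for p u q w q' w'
    using that unfolding valid_det_def by force
  show "is_deterministic G ld MI"
    unfolding is_deterministic_def
  proof (intro conjI ballI)
    fix p u assume pu: "p \<in> mstates MI" "u \<in> vertices G - region G ld"
    then obtain q where q: "(p, u, q) \<in> mtrans MI" using mealy unfolding is_mealy_def by meson
    show "\<exists>!q. (p, u, q) \<in> mtrans MI"
    proof (rule ex1I[of _ q])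
      show "q' = q" if "(p, u, q') \<in> mtrans MI" for q'
        using d[of p u q u q' u] q that by (simp add: ys_def set_pos_list mtrans_inst)
    qed (rule q)
  next
    fix p u assume pu: "p \<in> mstates MI" "u \<in> region G ld"
    then obtain q v where q: "(p, u, q, v) \<in> mtransL MI" using mealy unfolding is_mealy_def by meson
    show "\<exists>!(q, v). (p, u, q, v) \<in> mtransL MI"
    proof (rule ex1I[of _ "(q, v)"])
      fix z assume "case z of (q, v) \<Rightarrow> (p, u, q, v) \<in> mtransL MI"
      then show "z = (q, v)"
        using d[of p u q v "fst z" "snd z"] q by (cases z) (simp add: ys_def set_pos_list mtrans_inst)
    qed (use q in simp)
  qed
next
  assume det: "is_deterministic G ld MI"
  show "valid_det ys"
    unfolding valid_det_def
  proof (intro ballI impI)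
    fix y y' assume y: "y \<in> set ys" "y' \<in> set ys" "fst y = fst y' \<and> fst (snd y) = fst (snd y')"
    obtain p u q w where yy: "y = (p, u, q, w)" by (cases y)
    obtain q' w' where yy': "y' = (p, u, q', w')" using y(3) by (cases y') (auto simp: yy)
    have pos: "(p, u, q, w) \<in> positions" "(p, u, q', w') \<in> positions" using y unfolding set_ys yy yy' by blast+
    then have u: "u \<in> vertices G" by (auto simp: positions_def)
    have p: "p \<in> mstates MI"
      using pos(1) mealy unfolding positions_def is_mealy_def by (auto split: if_splits)
    show "y = y'"
    proof (cases "u \<in> region G ld")
      case True
      then have t: "(p, u, q, w) \<in> mtransL MI" "(p, u, q', w') \<in> mtransL MI"
        using pos by (auto simp: positions_def region_def)
      have "\<exists>!z. case z of (q, v) \<Rightarrow> (p, u, q, v) \<in> mtransL MI"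
        using det p True unfolding is_deterministic_def by blast
      then have "(q, w) = (q', w')" using t by (auto elim!: ex1E)
      then show ?thesis by (simp add: yy yy')
    next
      case False
      then have t: "(p, u, q) \<in> mtrans MI" "(p, u, q') \<in> mtrans MI" "w = u" "w' = u"
        using pos u by (auto simp: positions_def region_def)
      have "u \<in> vertices G - region G ld" using u False by blast
      then have "\<exists>!q. (p, u, q) \<in> mtrans MI" using det p unfolding is_deterministic_def by blast
      then show ?thesis using t by (auto simp: yy yy')
    qed
  qed
qed

end

lemma valid_inst_iff:
  "valid_inst det I \<longleftrightarrow> is_instance I \<and> (det \<longrightarrow> is_deterministic (inst_game I) (leader I) (inst_mealy I))"
proof
  assume v: "valid_inst det I"
  then have "is_instance I"
    using valid_game_iff[of I] valid_mealyD[of I] by (auto simp: valid_inst_def is_instance_def)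
  then interpret instance_verification I by unfold_locales
  show "is_instance I \<and> (det \<longrightarrow> is_deterministic (inst_game I) (leader I) (inst_mealy I))"
    using v inst valid_det_iff by (simp add: valid_inst_def ys_def)
next
  assume a: "is_instance I \<and> (det \<longrightarrow> is_deterministic (inst_game I) (leader I) (inst_mealy I))"
  then interpret instance_verification I by unfold_locales simp
  show "valid_inst det I"
    using a inst valid_det_iff valid_mealyI valid_game_iff[of I]
    by (simp add: valid_inst_def ys_def is_instance_def)
qed

lemma sz_take: "sz (take k xs) \<le> sz xs"
proof (induction xs arbitrary: k)
  case (Cons x xs)
  then show ?case by (cases k) (auto simp: sz_def)
qed simp

text \<open>A step adds a whole prefix to the accumulator, so the intermediate sizes are bounded
  quadratically and directly.\<close>

lemma pt_rev_prefixes [pt_intros]: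
  fixes l :: "'a :: treeable \<Rightarrow> 'b :: treeable list"
  assumes l: "pt l" shows "pt (\<lambda>x. rev_prefixes (l x))"
  unfolding rev_prefixes_def
proof -
  obtain b where b: "pbd b" "\<And>x. sz (l x) \<le> b (sz x)" using pt_bound[OF l] by blast
  let ?B = "\<lambda>n. (b n + 1) * (b n + 1) + 1"
  show "pt (\<lambda>x. fold (\<lambda>x acc. (x # hd acc) # acc) (l x) [[]])"
  proof (rule pt_fold)
  show "pbd ?B" by (intro pbd_intros b)
  fix x k
  let ?xs = "take k (l x)"
  have "length (rev_prefixes ys) = length ys + 1" for ys :: "'b list"
    unfolding rev_prefixes_def by (induction ys rule: rev_induct) auto
  then have "length (rev_prefixes ?xs) \<le> b (sz x) + 1"
    using length_le_sz[of ?xs] sz_take[of k "l x"] b(2)[of x] by simp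
  moreover have "sz zs + 1 \<le> b (sz x) + 1" if zs: "zs \<in> set (rev_prefixes ?xs)" for zs
  proof -
    obtain m where "zs = rev (take m ?xs)" using zs unfolding set_rev_prefixes by blast
    then have "sz zs \<le> sz ?xs" using sz_take[of m ?xs] by simp
    then show ?thesis using sz_take[of k "l x"] b(2)[of x] by simp
  qed
  then have "(\<Sum>zs\<leftarrow>rev_prefixes ?xs. sz zs + 1) \<le> (\<Sum>zs\<leftarrow>rev_prefixes ?xs. b (sz x) + 1)"
    by (intro sum_list_mono)
  ultimately have "sz (rev_prefixes ?xs) \<le> ?B (sz x)"
    unfolding sz_list[of "rev_prefixes ?xs"] sum_list_triv
    using mult_right_mono[of "length (rev_prefixes ?xs)" "b (sz x) + 1" "b (sz x) + 1"] by simp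
  then show "sz (fold (\<lambda>x acc. (x # hd acc) # acc) ?xs [[]]) \<le> ?B (sz x)"
    unfolding rev_prefixes_def .
qed (intro pt_intros l)+
qed

section \<open>Membership in coNP\<close>

definition checker :: "bool \<Rightarrow> inst \<Rightarrow> lasso \<times> entry list \<Rightarrow> bool" where
  "checker spe i c = (case i of (ow, ar, co, l, s, tn, td, mc, ms, ma, mL) \<Rightarrow>
     check_cert spe ow ar co l s tn td ms (pos_list ma mL) c)"

definition recognise :: "bool \<Rightarrow> inst \<Rightarrow> bool" where
  "recognise det i = (case i of (ow, ar, co, l, s, tn, td, mc, ms, ma, mL) \<Rightarrow>
     canonical tn \<and> valid_game ow ar co l s td \<and> valid_mealy ow ar l mc ms ma mL (pos_list ma mL) \<and>
     (det \<longrightarrow> valid_det (pos_list ma mL)))"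

lemma pt_recognise: "pt (recognise det)"
  unfolding recognise_def[abs_def] canonical_def valid_game_def valid_mealy_def valid_det_def pos_list_def
  by (intro pt_intros)

lemma pt_checker: "pt (\<lambda>z. checker spe (fst z) (snd z))"
  unfolding checker_def check_cert_def pos_list_def lasso_ok_def starts_at_def good_lasso_def wins_loop_def
    punish_ok_def succ_list_def col_def Let_def
  by (intro pt_intros)

lemma recognise_inst_of: "recognise det (inst_of I) = valid_inst det I"
  by (auto simp: recognise_def inst_of_def valid_inst_def canonical_def)

lemma recognise_ex: "recognise det i \<Longrightarrow> \<exists>I. i = inst_of I"
  using canonical_inst by (auto simp: recognise_def split: prod.splits)

definition verified :: "bool \<Rightarrow> parity_instance \<Rightarrow> bool" where
  "verified spe I = (if spe
     then subgame_perfect_verified (inst_game I) (leader I) (source I) (inst_threshold I) (inst_mealy I)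
     else nash_verified (inst_game I) (leader I) (source I) (inst_threshold I) (inst_mealy I))"

definition problem :: "bool \<Rightarrow> bool \<Rightarrow> language" where
  "problem spe det = {encode I | I. is_instance I \<and>
     (det \<longrightarrow> is_deterministic (inst_game I) (leader I) (inst_mealy I)) \<and> verified spe I}"

lemma problem_eq:
  "nash_rational_verification = problem False False"
  "det_nash_rational_verification = problem False True"
  "subgame_perfect_rational_verification = problem True False"
  "det_subgame_perfect_rational_verification = problem True True"
  by (auto simp: verified_def nash_rational_verification_def det_nash_rational_verification_def problem_def
    subgame_perfect_rational_verification_def det_subgame_perfect_rational_verification_def is_det_instance_def)

lemma fixed_SPE_imp_NE:
  assumes "fixed_SPE G L v0 \<sigma>" shows "fixed_NE G L v0 \<sigma>"
proof -
  have "is_history G v0 ([] @ [v0]) \<and> history_compatible G L (\<sigma> L) ([] @ [v0])"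
    by (simp add: is_history_def history_compatible_def)
  then have "fixed_NE (subgame G []) L v0 (\<lambda>i h'. \<sigma> i ([] @ h'))"
    using assms unfolding fixed_SPE_def by blast
  then show ?thesis by (simp add: subgame_def)
qed

lemma not_verified_iff: "\<not> verified spe I \<longleftrightarrow> (\<exists>\<sigma>. counterexample spe I \<sigma>)"
  using fixed_SPE_imp_NE[of "inst_game I" "leader I" "source I"]
  unfolding verified_def counterexample_def subgame_perfect_verified_def nash_verified_def not_less[symmetric]
  by (cases spe) auto

lemma checker_iff:
  assumes "is_instance I"
  shows "checker spe (inst_of I) c \<Longrightarrow> \<not> verified spe I"
    and "\<not> verified spe I \<Longrightarrow> \<exists>c. length (enc_cert c) \<le> cert_size (length (encode I)) \<and> checker spe (inst_of I) c"
proof -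
  interpret instance_verification I using assms by unfold_locales
  have ck: "checker spe (inst_of I) c = check spe c" for c
    by (simp add: checker_def inst_of_def ys_def)
  show "checker spe (inst_of I) c \<Longrightarrow> \<not> verified spe I"
    unfolding ck not_verified_iff by (rule check_sound)
  show "\<not> verified spe I \<Longrightarrow> \<exists>c. length (enc_cert c) \<le> cert_size (length (encode I)) \<and> checker spe (inst_of I) c"
    unfolding ck not_verified_iff using check_complete_bounded by blast
qed

theorem problem_coNP: "problem spe det \<in> coNP_class"
proof -
  obtain di where di: "codec enc_inst di" using codec_inst by blast
  obtain dc where dc: "codec enc_cert dc" using codec_cert by blast
  define db where "db = parse_list (\<lambda>w. (hd w, tl w) :: bool \<times> bool list)"
  have db: "codec (enc_list (\<lambda>b. [b])) db" unfolding db_def by (rule codec_list[OF codec_bit])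
  \<comment> \<open>The decoder returns something on every word. Encoding the result again and
    comparing tells whether \<open>x\<close> is an encoding at all.\<close>
  define V where "V x \<longleftrightarrow> enc_inst (fst (di x)) = x \<and> recognise det (fst (di x))" for x
  \<comment> \<open>Words that encode no instance lie in the complement of the problem, so they are
    accepted with any certificate.\<close>
  define R where "R = {w. \<not> V (fst (db w)) \<or> checker spe (fst (di (fst (db w)))) (fst (dc (snd (db w))))}"
  have p: "pt di" "pt dc" "pt db" "pt enc_inst" using di dc db by (simp_all add: codec_def)
  have V: "V x \<longleftrightarrow> (\<exists>I. x = encode I \<and> is_instance I \<and>
      (det \<longrightarrow> is_deterministic (inst_game I) (leader I) (inst_mealy I)) \<and> fst (di x) = inst_of I)" for x
  proof
    assume v: "V x"
    then obtain I where I: "fst (di x) = inst_of I" using recognise_ex unfolding V_def by blast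
    then show "\<exists>I. x = encode I \<and> is_instance I \<and>
      (det \<longrightarrow> is_deterministic (inst_game I) (leader I) (inst_mealy I)) \<and> fst (di x) = inst_of I"
      using v by (auto simp: V_def recognise_inst_of enc_inst_of valid_inst_iff intro!: exI[of _ I])
  qed (auto simp: V_def recognise_inst_of enc_inst_of valid_inst_iff)
  have dix: "fst (di (encode I)) = inst_of I" for I
  proof -
    have "di (enc_inst (inst_of I) @ []) = (inst_of I, [])" using di unfolding codec_def by blast
    then show ?thesis by (simp add: enc_inst_of)
  qed
  have "pt (\<lambda>w. (fst (di (fst (db w))), fst (dc (snd (db w)))))"
    by (intro pt_intros pt_comp[OF p(1)] pt_comp[OF p(2)] p)
  from pt_comp[OF pt_checker this]
  have ck: "pt (\<lambda>w. checker spe (fst (di (fst (db w)))) (fst (dc (snd (db w)))))" by simp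
  have "pt (\<lambda>w. \<not> V (fst (db w)) \<or> checker spe (fst (di (fst (db w)))) (fst (dc (snd (db w)))))"
    unfolding V_def by (intro pt_intros ck pt_comp[OF p(1)] pt_comp[OF p(4)] pt_comp[OF pt_recognise] p)
  then have R: "R \<in> P_class" by (intro pt_decidable) (simp add: R_def)
  have dbx: "db (pair_word x u) = (x, u)" for x u using db by (simp add: codec_def pair_word_def)
  obtain q :: "nat poly" where q: "\<And>n. cert_size n \<le> poly q n" using pbd_cert_size unfolding pbd_def by blast
  have "x \<in> - problem spe det \<longleftrightarrow> (\<exists>u. length u \<le> poly q (length x) \<and> pair_word x u \<in> R)" for x
  proof (cases "V x")
    case False
    then have "x \<notin> problem spe det" using V[of x] dix unfolding problem_def by blast
    moreover have "pair_word x [] \<in> R" using False by (simp add: R_def dbx)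
    ultimately show ?thesis by (intro iffI exI[of _ "[]"]) auto
  next
    case True
    then obtain I where I: "x = encode I" "is_instance I"
      "det \<longrightarrow> is_deterministic (inst_game I) (leader I) (inst_mealy I)" "fst (di x) = inst_of I"
      unfolding V by blast
    have "x \<in> problem spe det \<longleftrightarrow> verified spe I"
      using I encode_inject unfolding problem_def by blast
    moreover have "pair_word x u \<in> R \<longleftrightarrow> checker spe (inst_of I) (fst (dc u))" for u
      using True I(4) by (simp add: R_def dbx)
    moreover have "(\<exists>u. length u \<le> poly q (length x) \<and> checker spe (inst_of I) (fst (dc u))) \<longleftrightarrow> \<not> verified spe I"
    proof
      assume "\<not> verified spe I"
      then obtain c where c: "length (enc_cert c) \<le> cert_size (length (encode I))" "checker spe (inst_of I) c"
        using checker_iff(2)[OF I(2)] by blast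
      have "dc (enc_cert c @ []) = (c, [])" using dc unfolding codec_def by blast
      then show "\<exists>u. length u \<le> poly q (length x) \<and> checker spe (inst_of I) (fst (dc u))"
        using c q[of "length x"] I(1) by (intro exI[of _ "enc_cert c"]) auto
    next
      assume "\<exists>u. length u \<le> poly q (length x) \<and> checker spe (inst_of I) (fst (dc u))"
      then show "\<not> verified spe I" using checker_iff(1)[OF I(2)] by blast
    qed
    ultimately show ?thesis by simp
  qed
  then show ?thesis using R unfolding coNP_class_def NP_class_def by blast
qed

section \<open>From satisfiability to games\<close>

definition satisfiable :: "('x \<times> bool) list list \<Rightarrow> bool" where
  "satisfiable \<phi> \<longleftrightarrow> (\<exists>\<nu>. \<forall>c\<in>set \<phi>. \<exists>l\<in>set c. \<nu> (fst l) = snd l)"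

definition neg :: "'x \<times> bool \<Rightarrow> 'x \<times> bool" where
  "neg l = (fst l, \<not> snd l)"

text \<open>Vertex 0 is a sink, the vertices \<open>1, \<dots>, length \<phi>\<close> are the clauses, and the
  others are the occurrences of literals. An occurrence is described by its clause and its literal.\<close>

definition describe :: "('x \<times> bool) list list \<Rightarrow> (nat \<times> ('x \<times> bool) list) list" where
  "describe \<phi> = map (\<lambda>_. (0, [])) ([] # \<phi>) @
     concat (map (\<lambda>z. map (\<lambda>l. (Suc (fst z), [l])) (snd z)) (zip [0..<length \<phi>] \<phi>))"

text \<open>Player 0 is Leader, player 1 moves at the clauses, and player \<open>v + 1\<close> at the occurrence \<open>v\<close>.
  The owner of an occurrence loses if the play stays away from the sink and meets the complementary
  literal infinitely often.\<close>

definition cnf_inst :: "('x \<times> bool) list list \<Rightarrow> parity_instance" where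
  "cnf_inst \<phi> =
     \<lparr>owners = map (\<lambda>z. if fst (snd z) = 0 then 1 else Suc (fst z)) (zip [0..<length (describe \<phi>)] (describe \<phi>)),
      arcs = (0, 0) # concat (map (\<lambda>z. if fst (snd z) = 0 then []
        else [(fst (snd z), fst z), (fst z, if fst (snd z) < length \<phi> then Suc (fst (snd z)) else 1), (fst z, 0)])
        (zip [0..<length (describe \<phi>)] (describe \<phi>))),
      colours = (0 # map (\<lambda>_. 1) (tl (describe \<phi>))) #
        map (\<lambda>d. map (\<lambda>d'. if fst d = 0 then 0 else if snd d' = map neg (snd d) then 1 else 2) (describe \<phi>)) (describe \<phi>),
      leader = 0, source = 1, tnum = 0, tden = 1, mcount = 1, mstart = 0,
      marcs = map (\<lambda>v. (0, v, 0)) [0..<length (describe \<phi>)], marcsL = []\<rparr>"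

lemma infinite_mod_class:
  assumes "j < (m :: nat)" shows "infinite {k. k mod m = j}"
proof -
  have "inj (\<lambda>i. i * m + j)" using assms by (auto simp: inj_on_def)
  moreover have "range (\<lambda>i. i * m + j) \<subseteq> {k. k mod m = j}" using assms by auto
  ultimately show ?thesis by (meson finite_subset range_inj_infinite)
qed

lemma limit_subset_tail:
  assumes "\<And>k. 0 < k \<Longrightarrow> \<pi> k \<in> S" shows "limit \<pi> \<subseteq> S"
proof
  fix x assume "x \<in> limit \<pi>"
  then have "\<exists>\<^sub>\<infinity>k. \<pi> k = x" by (simp add: limit_def)
  then obtain k where "k > 0" "\<pi> k = x" unfolding INFM_nat by blast
  then show "x \<in> S" using assms[of k] by simp
qed

lemma zip_upt: "set (zip [0..<length xs] xs) = (\<lambda>i. (i, xs ! i)) ` {..<length xs}"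
proof -
  have "zip [0..<length xs] xs = map (\<lambda>i. (i, xs ! i)) [0..<length xs]" by (intro nth_equalityI) simp_all
  then show ?thesis by (simp add: atLeast0LessThan)
qed

section \<open>The game of a formula without empty clauses\<close>

locale cnf_game =
  fixes \<phi> :: "('x \<times> bool) list list"
  assumes nonempty: "\<phi> \<noteq> []" "[] \<notin> set \<phi>"
begin

abbreviation "m \<equiv> length \<phi>"
abbreviation "ds \<equiv> describe \<phi>"
abbreviation "n \<equiv> length ds"
abbreviation "I \<equiv> cnf_inst \<phi>"
abbreviation "G \<equiv> inst_game I"
abbreviation "nx c \<equiv> if c < m then Suc c else 1"

definition occ :: "nat \<Rightarrow> nat \<Rightarrow> 'x \<times> bool \<Rightarrow> bool" where
  "occ v j l \<longleftrightarrow> m < v \<and> v < n \<and> j < m \<and> l \<in> set (\<phi> ! j) \<and> ds ! v = (Suc j, [l])"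

definition occs :: "(nat \<times> ('x \<times> bool) list) list" where
  "occs = concat (map (\<lambda>z. map (\<lambda>l. (Suc (fst z), [l])) (snd z)) (zip [0..<m] \<phi>))"

lemma ds_eq: "ds = map (\<lambda>_. (0, [])) ([] # \<phi>) @ occs"
  by (simp add: describe_def occs_def)

lemma set_occs: "d \<in> set occs \<longleftrightarrow> (\<exists>j l. j < m \<and> l \<in> set (\<phi> ! j) \<and> d = (Suc j, [l]))"
  by (force simp: occs_def set_zip)

lemma n_gt: "m < n"
  by (simp add: ds_eq)

lemma ds_nonempty [simp]: "ds \<noteq> []"
  by (simp add: ds_eq)

lemma one_less: "1 < n"
proof -
  have "0 < m" using nonempty(1) by simp
  then show ?thesis using n_gt by linarith
qed

lemma ds_small: "v \<le> m \<Longrightarrow> ds ! v = (0, [])"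
proof -
  assume "v \<le> m"
  then have v: "v < length (map (\<lambda>_. (0, [])) ([] # \<phi>))" by simp
  show ?thesis unfolding ds_eq nth_append_left[OF v] using v by (subst nth_map) simp_all
qed

lemma ds_large: "m < v \<Longrightarrow> v < n \<Longrightarrow> \<exists>j l. occ v j l"
proof -
  assume v: "m < v" "v < n"
  then have "ds ! v = occs ! (v - Suc m)" "v - Suc m < length occs"
    unfolding ds_eq by (auto simp: nth_append)
  then have "ds ! v \<in> set occs" by simp
  then show ?thesis unfolding set_occs occ_def using v by blast
qed

lemma occ_ex: "j < m \<Longrightarrow> l \<in> set (\<phi> ! j) \<Longrightarrow> \<exists>v. occ v j l"
proof -
  assume jl: "j < m" "l \<in> set (\<phi> ! j)"
  then have "(Suc j, [l]) \<in> set occs" unfolding set_occs by blast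
  then obtain i where "i < length occs" "occs ! i = (Suc j, [l])" by (auto simp: in_set_conv_nth)
  then have "ds ! (Suc m + i) = (Suc j, [l])" "Suc m + i < n" by (simp_all add: ds_eq nth_append)
  then show ?thesis using jl unfolding occ_def by (intro exI[of _ "Suc m + i"]) simp
qed

lemma vertex_cases:
  assumes "v < n"
  obtains "v = 0" | j where "v = Suc j" "j < m" | j l where "occ v j l"
proof -
  consider "v = 0" | "0 < v \<and> v \<le> m" | "m < v" by linarith
  then show thesis
  proof cases
    case 3 then show thesis using ds_large[OF _ assms] that(3) by blast
  qed (use that in \<open>auto simp: gr0_conv_Suc\<close>)
qed

lemma arc_iff:
  "(a, b) \<in> set (arcs I) \<longleftrightarrow> a = 0 \<and> b = 0 \<or>
     (\<exists>v j l. occ v j l \<and> (a = Suc j \<and> b = v \<or> a = v \<and> b = nx (Suc j) \<or> a = v \<and> b = 0))"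
proof -
  let ?F = "\<lambda>z :: nat \<times> nat \<times> ('x \<times> bool) list. if fst (snd z) = 0 then []
        else [(fst (snd z), fst z), (fst z, nx (fst (snd z))), (fst z, 0)]"
  let ?B = "\<lambda>v. \<exists>j l. occ v j l \<and> (a = Suc j \<and> b = v \<or> a = v \<and> b = nx (Suc j) \<or> a = v \<and> b = 0)"
  have e1: "(a, b) \<in> set (arcs I) \<longleftrightarrow> a = 0 \<and> b = 0 \<or> (\<exists>v<n. (a, b) \<in> set (?F (v, ds ! v)))"
    unfolding cnf_inst_def parity_instance.simps list.set set_concat set_map zip_upt insert_iff
      UN_iff image_image bex_simps prod.inject by (simp only: Bex_def lessThan_iff)
  have e2: "(a, b) \<in> set (?F (v, ds ! v)) \<longleftrightarrow>
      (\<exists>j l. occ v j l \<and> (a = Suc j \<and> b = v \<or> a = v \<and> b = nx (Suc j) \<or> a = v \<and> b = 0))" if "v < n" for v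
  proof (cases "v \<le> m")
    case True then show ?thesis by (simp add: ds_small occ_def)
  next
    case False
    with ds_large[of v] \<open>v < n\<close> obtain j l where o: "occ v j l" by (meson not_le)
    then have u: "occ v j' l' \<longleftrightarrow> j' = j \<and> l' = l" for j' l' by (auto simp: occ_def)
    have "ds ! v = (Suc j, [l])" using o by (simp add: occ_def)
    then show ?thesis unfolding u by auto
  qed
  have e3: "occ v j l \<Longrightarrow> v < n" for v j l by (simp add: occ_def)
  have "(\<exists>v<n. (a, b) \<in> set (?F (v, ds ! v))) \<longleftrightarrow> (\<exists>v<n. ?B v)"
    by (intro ex_cong1 conj_cong refl e2)
  also have "\<dots> \<longleftrightarrow> (\<exists>v. ?B v)" by (intro ex_cong1) (use e3 in blast)
  finally show ?thesis unfolding e1 by (rule arg_cong)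
qed

lemma occ_arcs:
  assumes "occ v j l"
  shows "(Suc j, v) \<in> set (arcs I)" "(v, nx (Suc j)) \<in> set (arcs I)" "(v, 0) \<in> set (arcs I)"
  unfolding arc_iff using assms by blast+

lemma owner_simps: "length (owners I) = n" "v < n \<Longrightarrow> owners I ! v = (if v \<le> m then 1 else Suc v)"
proof -
  show "length (owners I) = n" by (simp add: cnf_inst_def)
  assume v: "v < n"
  have "owners I ! v = (if fst (ds ! v) = 0 then 1 else Suc v)" using v by (simp add: cnf_inst_def)
  then show "owners I ! v = (if v \<le> m then 1 else Suc v)"
    using ds_small[of v] ds_large[of v] v by (cases "v \<le> m") (auto simp: occ_def)
qed

lemma colour_simps:
  "length (colours I) = Suc n"
  "v < n \<Longrightarrow> colours I ! 0 ! v = (if v = 0 then 0 else 1)"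
  "v < n \<Longrightarrow> u \<le> m \<Longrightarrow> colours I ! Suc u ! v = 0"
  "v < n \<Longrightarrow> occ u j l \<Longrightarrow> colours I ! Suc u ! v = (if snd (ds ! v) = [neg l] then 1 else 2)"
proof -
  show "length (colours I) = Suc n" by (simp add: cnf_inst_def)
  show "v < n \<Longrightarrow> colours I ! 0 ! v = (if v = 0 then 0 else 1)"
    by (cases v) (simp_all add: cnf_inst_def)
  show "v < n \<Longrightarrow> u \<le> m \<Longrightarrow> colours I ! Suc u ! v = 0"
    using n_gt by (simp add: cnf_inst_def ds_small del: length_greater_0_conv)
  show "v < n \<Longrightarrow> occ u j l \<Longrightarrow> colours I ! Suc u ! v = (if snd (ds ! v) = [neg l] then 1 else 2)"
    by (simp add: cnf_inst_def occ_def)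
qed

lemma game_facts [simp]:
  "players G = {..<Suc n}" "vertices G = {..<n}" "controller G v = owners I ! v" "edges G = set (arcs I)"
  "payoff G = parity_payoff (\<lambda>i v. colours I ! i ! v)"
  using owner_simps(1) colour_simps(1) by (simp_all add: inst_game_def)

lemma arc_less: "(a, b) \<in> set (arcs I) \<Longrightarrow> a < n \<and> b < n"
  using n_gt by (auto simp: arc_iff occ_def)

lemma is_game: "is_game G"
  unfolding is_game_def
proof (intro conjI ballI)
  show "controller G v \<in> players G" if "v \<in> vertices G" for v
    using that n_gt by (simp add: owner_simps(2))
  show "edges G \<subseteq> vertices G \<times> vertices G" using arc_less by auto
  fix u assume "u \<in> vertices G"
  then have "u < n" by simp
  then show "\<exists>v. (u, v) \<in> edges G"
  proof (cases rule: vertex_cases)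
    case (2 j)
    then have "\<phi> ! j \<noteq> []" using nonempty(2) nth_mem[of j \<phi>] by metis
    then have "hd (\<phi> ! j) \<in> set (\<phi> ! j)" by simp
    then show ?thesis using occ_ex[OF 2(2)] occ_arcs(1) unfolding 2(1) game_facts by blast
  next
    case 1 then show ?thesis by (auto simp: arc_iff)
  next
    case (3 j l) then show ?thesis unfolding game_facts using occ_arcs(3) by blast
  qed
qed auto

lemma mealy_simps:
  "mstates (inst_mealy I) = {0}" "minit (inst_mealy I) = 0" "mtransL (inst_mealy I) = {}"
  "mtrans (inst_mealy I) = (\<lambda>v. (0, v, 0)) ` {..<n}"
  by (auto simp: inst_mealy_def cnf_inst_def)

lemma is_det_instance: "is_det_instance I"
proof -
  have r: "region G 0 = {}" by (auto simp: region_def owner_simps(2))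
  have "is_mealy G 0 (inst_mealy I)"
    unfolding is_mealy_def r by (auto simp: mealy_simps)
  moreover have "is_deterministic G 0 (inst_mealy I)"
    unfolding is_deterministic_def r by (auto simp: mealy_simps)
  moreover have "\<forall>c\<in>set (colours I). length c = length (owners I)"
    using n_gt by (auto simp: cnf_inst_def)
  moreover have "leader I = 0" "tden I = 1" "source I = 1" by (simp_all add: cnf_inst_def)
  moreover have "1 < n" by (rule one_less)
  ultimately show ?thesis using is_game by (simp add: is_det_instance_def is_instance_def)
qed

text \<open>Leader owns no vertex and the machine has one state, so the constant map witnesses
  conformity of any strategy.\<close>

lemma comp_leader: "s \<in> Comp G 0 1 (inst_mealy I)"
proof -
  have r: "region G 0 = {}" by (auto simp: region_def owner_simps(2))
  have "0 < m" using nonempty(1) by simp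
  then have v: "1 \<in> vertices G" using n_gt by (simp del: length_greater_0_conv)
  have "v < n" if "is_history G 1 (h @ [v])" for h v
    using is_history_vertices[OF is_game that v] by simp
  then show ?thesis unfolding Comp_def r
    by (auto simp: is_strategy_def r mealy_simps intro!: exI[of _ "\<lambda>_. 0"])
qed

lemma play_less: "is_play G v \<pi> \<Longrightarrow> v < n \<Longrightarrow> \<pi> k < n"
proof -
  assume p: "is_play G v \<pi>" and v: "v < n"
  then have "(\<pi> k, \<pi> (Suc k)) \<in> set (arcs I)" by (simp add: is_play_def)
  then show ?thesis using arc_less by blast
qed

lemma finite_limit: "is_play G v \<pi> \<Longrightarrow> v < n \<Longrightarrow> finite (limit \<pi>) \<and> limit \<pi> \<noteq> {} \<and> limit \<pi> \<subseteq> {..<n}"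
proof -
  assume p: "is_play G v \<pi>" and v: "v < n"
  have r: "range \<pi> \<subseteq> {..<n}" using play_less[OF p v] by auto
  then have fr: "finite (range \<pi>)" using finite_subset by blast
  have "limit \<pi> \<subseteq> range \<pi>" by (rule limit_in_range)
  then show ?thesis using r fr limit_nonempty[OF fr] finite_subset by blast
qed

lemma payoff_const:
  assumes "is_play G v \<pi>" "v < n" "\<And>x. x \<in> limit \<pi> \<Longrightarrow> colours I ! i ! x = c"
  shows "payoff G \<pi> i = (if even c then 1 else 0)"
proof -
  have "(\<lambda>x. colours I ! i ! x) ` limit \<pi> = {c}" using finite_limit[OF assms(1,2)] assms(3) by auto
  then show ?thesis by (simp add: parity_payoff_def)
qed

lemma payoff_le_1: "payoff G \<pi> i \<le> 1" "0 \<le> payoff G \<pi> i"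
  by (simp_all add: parity_payoff_def)

lemma sink_arc: "(0, b) \<in> set (arcs I) \<longleftrightarrow> b = 0"
  by (auto simp: arc_iff occ_def)

lemma sink_stays: "is_play G v \<pi> \<Longrightarrow> \<pi> k = 0 \<Longrightarrow> \<pi> (k + i) = 0"
proof (induction i)
  case (Suc i)
  have "(\<pi> (k + i), \<pi> (Suc (k + i))) \<in> set (arcs I)" using Suc.prems(1) by (simp add: is_play_def)
  moreover have "\<pi> (k + i) = 0" using Suc by simp
  ultimately show ?case using sink_arc by simp
qed simp

lemma sink_limit: "is_play G v \<pi> \<Longrightarrow> \<pi> k = 0 \<Longrightarrow> limit \<pi> = {0}"
proof -
  assume p: "is_play G v \<pi>" "\<pi> k = 0"
  have z: "\<pi> i = 0" if "k \<le> i" for i using sink_stays[OF p, of "i - k"] that by simp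
  have "x = 0" if "x \<in> limit \<pi>" for x
  proof -
    from that have "\<exists>\<^sub>\<infinity>i. \<pi> i = x" by (simp add: limit_def)
    then obtain i where "i \<ge> k" "\<pi> i = x" unfolding INFM_nat_le by blast
    then show ?thesis using z by simp
  qed
  moreover have "0 \<in> limit \<pi>" unfolding limit_def INFM_nat_le using z by (auto intro: max.cobounded1 max.cobounded2)
  ultimately show ?thesis by blast
qed

text \<open>Leader loses only if the sink is avoided, so the play cycles through all clauses
  forever. Recurring occurrences never carry complementary literals, since the owner of one of them
  would lose and could win by leaving for the sink; so they define a valuation.\<close>

lemma equilibrium_satisfiable:
  assumes NE: "fixed_NE G 0 1 \<sigma>" and pay: "payoff G (outcome G 1 \<sigma>) 0 \<le> 0"
  shows "satisfiable \<phi>"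
proof -
  have one: "1 < n" by (rule one_less)
  then have v1: "1 \<in> vertices G" by simp
  have prof: "is_profile G 1 \<sigma>" using NE by (simp add: fixed_NE_def)
  define \<pi> where "\<pi> = outcome G 1 \<sigma>"
  have play: "is_play G 1 \<pi>" and compat: "play_compatible G i (\<sigma> i) \<pi>" if "i \<in> players G" for i
    using outcome_props[OF is_game v1 prof] that unfolding \<pi>_def by blast+
  have play: "is_play G 1 \<pi>" using play[of 0] by simp
  have less: "\<pi> k < n" for k by (rule play_less[OF play one])
  have arc: "(\<pi> k, \<pi> (Suc k)) \<in> set (arcs I)" for k using play by (simp add: is_play_def)
  have no_sink: "\<pi> k \<noteq> 0" for k
  proof
    assume "\<pi> k = 0"
    then have "limit \<pi> = {0}" using sink_limit[OF play] by blast
    then have "payoff G \<pi> 0 = 1" using payoff_const[OF play one, of 0 0] colour_simps(2)[of 0] n_gt by simp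
    then show False using pay by (simp add: \<pi>_def)
  qed
  have next_occ: "\<exists>l. occ (\<pi> (Suc k)) j l" if "\<pi> k = Suc j" "j < m" for k j
    using arc[of k] no_sink[of "Suc k"] that unfolding arc_iff by (auto simp: occ_def)
  have next_clause: "\<pi> (Suc k) = nx (Suc j)" if "occ (\<pi> k) j l" for k j l
  proof -
    have "occ (\<pi> k) j' l' \<Longrightarrow> j' = j" for j' l' using that by (simp add: occ_def)
    moreover have "m < \<pi> k" using that by (simp add: occ_def)
    ultimately show ?thesis using arc[of k] no_sink[of "Suc k"] no_sink[of k] unfolding arc_iff
      by (auto simp: occ_def)
  qed
  have m: "0 < m" using nonempty(1) by simp
  \<comment> \<open>Clauses and occurrences alternate, and the clauses come in cyclic order,
    starting with the first one at vertex 1.\<close>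
  have even: "\<pi> (2 * k) = Suc (k mod m)" for k
  proof (induction k)
    case 0 then show ?case using play by (simp add: is_play_def)
  next
    case (Suc k)
    obtain l where "occ (\<pi> (Suc (2 * k))) (k mod m) l" using next_occ[OF Suc] m by auto
    then have "\<pi> (Suc (Suc (2 * k))) = nx (Suc (k mod m))" by (rule next_clause)
    moreover have "k mod m < m" using m by (rule mod_less_divisor)
    then have "Suc (k mod m) < m \<longleftrightarrow> Suc (k mod m) \<noteq> m" by linarith
    ultimately show ?case by (simp add: mod_Suc)
  qed
  have odd: "\<exists>l. occ (\<pi> (Suc (2 * k))) (k mod m) l" for k using next_occ[OF even] m by simp
  \<comment> \<open>Each clause is met infinitely often and finitely many vertices are available for
    the pick, so some occurrence in it recurs.\<close>
  have visited: "\<exists>v l. v \<in> limit \<pi> \<and> occ v j l" if j: "j < m" for j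
  proof -
    have "finite ((\<lambda>k. \<pi> (Suc (2 * k))) ` {k. k mod m = j})"
      using less by (intro finite_subset[OF _ finite_lessThan[of n]]) auto
    from pigeonhole_infinite[OF infinite_mod_class[OF j] this] obtain k where
      k: "k mod m = j" "infinite {i \<in> {k. k mod m = j}. \<pi> (Suc (2 * i)) = \<pi> (Suc (2 * k))}" by blast
    let ?S = "{i \<in> {k. k mod m = j}. \<pi> (Suc (2 * i)) = \<pi> (Suc (2 * k))}"
    have "inj_on (\<lambda>i. Suc (2 * i)) ?S" by (auto simp: inj_on_def)
    then have "infinite ((\<lambda>i. Suc (2 * i)) ` ?S)" using k(2) finite_image_iff by blast
    moreover have "(\<lambda>i. Suc (2 * i)) ` ?S \<subseteq> {i. \<pi> i = \<pi> (Suc (2 * k))}" by auto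
    ultimately have "infinite {i. \<pi> i = \<pi> (Suc (2 * k))}" by (rule infinite_super[rotated])
    then have "\<pi> (Suc (2 * k)) \<in> limit \<pi>" by (simp add: limit_def Inf_many_def)
    then show ?thesis using odd[of k] k(1) by blast
  qed
  have consistent: False if v: "v \<in> limit \<pi>" "occ v j l" and u: "u \<in> limit \<pi>" "occ u j' (neg l)" for v j l u j'
  proof -
    let ?i = "Suc v"
    have i: "?i \<in> players G - {0}" using v(2) by (simp add: occ_def)
    have col: "colours I ! ?i ! x = (if snd (ds ! x) = [neg l] then 1 else 2)" if "x < n" for x
      using colour_simps(4)[OF that v(2)] .
    have "Min ((\<lambda>x. colours I ! ?i ! x) ` limit \<pi>) = 1"
    proof (rule Min_eqI)
      show "finite ((\<lambda>x. colours I ! ?i ! x) ` limit \<pi>)" using finite_limit[OF play one] by simp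
      show "1 \<in> (\<lambda>x. colours I ! ?i ! x) ` limit \<pi>"
        using u col[of u] by (intro image_eqI[of _ _ u]) (simp_all add: occ_def)
      show "1 \<le> y" if "y \<in> (\<lambda>x. colours I ! ?i ! x) ` limit \<pi>" for y
        using that finite_limit[OF play one] by (auto simp: col subset_iff)
    qed
    then have pay0: "payoff G \<pi> ?i = 0" by (simp add: parity_payoff_def)
    obtain k where k: "\<pi> k = v" using subsetD[OF limit_in_range v(1)] by blast
    \<comment> \<open>The owner of \<open>v\<close> follows the play to a visit of \<open>v\<close>
      and leaves for the sink, which has the even colour 2 for this player.\<close>
    define \<tau> where "\<tau> i = (if i \<le> k then \<pi> i else 0)" for i
    have "(v, 0) \<in> set (arcs I)" using v(2) unfolding arc_iff by blast
    then have "(\<tau> i, \<tau> (Suc i)) \<in> set (arcs I)" for i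
      using arc[of i] k by (cases "i = k") (auto simp: \<tau>_def sink_arc)
    then have tplay: "is_play G 1 \<tau>" using play by (simp add: is_play_def \<tau>_def)
    have "play_compatible G i' (\<sigma> i') \<tau>" if i': "i' \<in> players G - {?i}" for i'
      unfolding play_compatible_def
    proof (intro allI impI)
      fix x assume x: "\<tau> x \<in> region G i'"
      consider "x < k" | "x = k" | "k < x" by linarith
      then show "\<tau> (Suc x) = \<sigma> i' (map \<tau> [0..<Suc x])"
      proof cases
        case 1
        then have "map \<tau> [0..<Suc x] = map \<pi> [0..<Suc x]" by (auto simp: \<tau>_def)
        moreover have "\<tau> x = \<pi> x" "\<tau> (Suc x) = \<pi> (Suc x)" using 1 by (simp_all add: \<tau>_def)
        moreover have "\<pi> x \<in> region G i' \<longrightarrow> \<pi> (Suc x) = \<sigma> i' (map \<pi> [0..<Suc x])"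
          using compat[of i'] i' unfolding play_compatible_def by blast
        ultimately show ?thesis using x by (simp only:)
      next
        case 2
        then have "owners I ! v = i'" using x k by (simp add: region_def \<tau>_def)
        then have False using i' v(2) by (simp add: owner_simps(2) occ_def)
        then show ?thesis ..
      next
        case 3
        have "is_history G 1 (map \<tau> [0..<Suc x])" by (rule is_history_prefix[OF tplay])
        then have "(\<tau> x, \<sigma> i' (map \<tau> [0..<Suc x])) \<in> edges G"
          using prof i' x unfolding is_profile_def is_strategy_def by auto
        then show ?thesis using 3 sink_arc by (simp add: \<tau>_def)
      qed
    qed
    then have "payoff G \<tau> ?i \<le> payoff G \<pi> ?i"
      using NE i tplay unfolding fixed_NE_iff[OF is_game v1] \<pi>_def by blast
    moreover have "limit \<tau> = {0}" using sink_limit[OF tplay, of "Suc k"] by (simp add: \<tau>_def)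
    then have "payoff G \<tau> ?i = 1"
      using payoff_const[OF tplay one, of ?i 2] ds_small[of 0] n_gt by (simp add: col)
    ultimately show False using pay0 by simp
  qed
  \<comment> \<open>True iff a positive occurrence recurs. If a negative occurrence recurs,
    consistency rules that out.\<close>
  define \<nu> where "\<nu> x \<longleftrightarrow> (\<exists>v j. v \<in> limit \<pi> \<and> occ v j (x, True))" for x
  have "\<exists>l\<in>set c. \<nu> (fst l) = snd l" if c: "c \<in> set \<phi>" for c
  proof -
    obtain j where j: "j < m" "\<phi> ! j = c" using c by (auto simp: in_set_conv_nth)
    obtain v l where v: "v \<in> limit \<pi>" "occ v j l" using visited[OF j(1)] by blast
    have "\<nu> (fst l) = snd l"
    proof (cases "snd l")
      case True
      then have "l = (fst l, True)" by (simp add: prod_eq_iff)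
      then show ?thesis using v True unfolding \<nu>_def by metis
    next
      case False
      then have "neg l = (fst l, True)" by (simp add: neg_def)
      then show ?thesis using False consistent[OF v] unfolding \<nu>_def by metis
    qed
    then show ?thesis using v(2) j(2) by (auto simp: occ_def)
  qed
  then show ?thesis unfolding satisfiable_def by blast
qed

text \<open>The profile is positional and an equilibrium from every vertex, and all subgames
  coincide with the game up to the start; hence it is subgame perfect at once.\<close>

lemma satisfiable_equilibrium:
  assumes "satisfiable \<phi>"
  shows "\<exists>\<sigma>. fixed_SPE G 0 1 \<sigma> \<and> payoff G (outcome G 1 \<sigma>) 0 \<le> 0"
proof -
  obtain \<nu> where \<nu>: "\<forall>c\<in>set \<phi>. \<exists>l\<in>set c. \<nu> (fst l) = snd l" using assms unfolding satisfiable_def by blast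
  define tr where "tr v \<longleftrightarrow> (\<exists>j l. occ v j l \<and> \<nu> (fst l) = snd l)" for v
  \<comment> \<open>Clauses pick an occurrence of a true literal, true occurrences go on to the next
    clause, false ones leave for the sink.\<close>
  define f where "f v = (if v = 0 then 0 else if v \<le> m then (SOME u. \<exists>l. occ u (v - 1) l \<and> \<nu> (fst l) = snd l)
    else if tr v then nx (fst (ds ! v)) else 0)" for v
  have f_clause: "\<exists>l. occ (f (Suc j)) j l \<and> \<nu> (fst l) = snd l" if j: "j < m" for j
  proof -
    obtain l where l: "l \<in> set (\<phi> ! j)" "\<nu> (fst l) = snd l" using bspec[OF \<nu> nth_mem[OF j]] by blast
    then have "\<exists>u l. occ u j l \<and> \<nu> (fst l) = snd l" using occ_ex[OF j] by blast
    from someI_ex[OF this] show ?thesis using j by (simp add: f_def)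
  qed
  have f_occ: "f v = (if tr v then nx (Suc j) else 0)" if "occ v j l" for v j l
    using that by (auto simp: f_def occ_def)
  have tr_iff: "tr v \<longleftrightarrow> \<nu> (fst l) = snd l" if "occ v j l" for v j l
  proof -
    have "l' = l" if "occ v j' l'" for j' l' using that \<open>occ v j l\<close> by (simp add: occ_def)
    then show ?thesis unfolding tr_def using that by blast
  qed
  have f0: "f 0 = 0" by (simp add: f_def)
  have f_arc: "(v, f v) \<in> set (arcs I)" if "v < n" for v
    using that
  proof (cases rule: vertex_cases)
    case 1 then show ?thesis by (simp add: f0 sink_arc)
  next
    case (2 j)
    obtain l where "occ (f (Suc j)) j l" using f_clause[OF 2(2)] by blast
    then show ?thesis unfolding 2(1) by (rule occ_arcs)
  next
    case (3 j l) then show ?thesis unfolding f_occ[OF 3] using occ_arcs by simp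
  qed
  have f_good: "f v = 0 \<or> (\<exists>j<m. f v = Suc j) \<or> tr (f v)" if "v < n" for v
    using that
  proof (cases rule: vertex_cases)
    case 1 then show ?thesis by (simp add: f0)
  next
    case (2 j) then show ?thesis using f_clause[OF 2(2)] by (auto simp: tr_def)
  next
    case (3 j l)
    then have "j < m" by (simp add: occ_def)
    then show ?thesis unfolding f_occ[OF 3] using nonempty(1) by auto
  qed
  have f_less: "f v < n" if "v < n" for v using f_arc[OF that] arc_less by blast
  have NE: "fixed_NE G 0 v \<sigma>' \<and> outcome G v \<sigma>' = (\<lambda>k. (f ^^ k) v)"
    if v: "v < n" and pos: "\<forall>i h. h \<noteq> [] \<longrightarrow> \<sigma>' i h = f (last h)" for v \<sigma>'
  proof -
    have v': "v \<in> vertices G" using v by simp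
    define \<pi> where "\<pi> k = (f ^^ k) v" for k
    have less: "\<pi> k < n" for k by (induction k) (simp_all add: \<pi>_def v f_less)
    have suc: "\<pi> (Suc k) = f (\<pi> k)" for k by (simp add: \<pi>_def)
    have play: "is_play G v \<pi>" using f_arc[OF less] by (simp add: is_play_def suc) (simp add: \<pi>_def)
    have compat: "play_compatible G i (\<sigma>' i) \<tau> \<longleftrightarrow> (\<forall>k. \<tau> k \<in> region G i \<longrightarrow> \<tau> (Suc k) = f (\<tau> k))" for i \<tau>
      using pos by (simp add: play_compatible_def)
    have prof: "is_profile G v \<sigma>'"
      unfolding is_profile_def is_strategy_def using pos f_arc by (auto simp: region_def)
    have out: "outcome G v \<sigma>' = \<pi>"
      by (rule outcome_eqI[OF is_game v' play]) (simp add: compat suc)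
    have good: "limit \<pi> \<subseteq> {x. x = 0 \<or> (\<exists>j<m. x = Suc j) \<or> tr x}"
    proof (rule limit_subset_tail)
      fix k :: nat assume "0 < k"
      then obtain k' where "k = Suc k'" by (cases k) auto
      then show "\<pi> k \<in> {x. x = 0 \<or> (\<exists>j<m. x = Suc j) \<or> tr x}" using f_good[OF less[of k']] suc by simp
    qed
    have "payoff G \<tau> i \<le> payoff G \<pi> i"
      if i: "i \<in> players G - {0}" and \<tau>: "is_play G v \<tau>" "\<forall>k\<in>players G - {i}. play_compatible G k (\<sigma>' k) \<tau>" for i \<tau>
    proof -
      obtain u where u: "i = Suc u" "u < n" using i by (cases i) auto
      show ?thesis
      proof (cases "u \<le> m")
        case True
        have "x < n" if "x \<in> limit \<pi>" for x using finite_limit[OF play v] that by auto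
        then have "colours I ! i ! x = 0" if "x \<in> limit \<pi>" for x
          using colour_simps(3)[OF _ True] that u(1) by simp
        from payoff_const[OF play v this] have "payoff G \<pi> i = 1" by simp
        then show ?thesis using payoff_le_1(1) by simp
      next
        case False
        then obtain j l where o: "occ u j l" using ds_large[OF _ u(2)] by (meson not_le)
        have col: "colours I ! i ! x = (if snd (ds ! x) = [neg l] then 1 else 2)" if "x < n" for x
          using colour_simps(4)[OF that o] u(1) by simp
        have win: "payoff G \<pi> i = 1" if safe: "\<And>x. x \<in> limit \<pi> \<Longrightarrow> snd (ds ! x) \<noteq> [neg l]"
        proof -
          have "x < n" if "x \<in> limit \<pi>" for x using finite_limit[OF play v] that by auto
          then have "colours I ! i ! x = 2" if "x \<in> limit \<pi>" for x using col safe that by simp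
          from payoff_const[OF play v this] show ?thesis by simp
        qed
        have not_neg: "snd (ds ! x) \<noteq> [neg l]" if "x \<le> m" for x using ds_small[OF that] by simp
        \<comment> \<open>For a true \<open>u\<close> the complementary literal is false and does
          not recur. For a false \<open>u\<close> the owner is in the sink after one step if the
          play starts at \<open>u\<close>; otherwise the play never meets \<open>u\<close>, since
          the profile enters only true occurrences, and the owner gets no chance to deviate.\<close>
        consider (true) "tr u" | (false) "\<not> tr u" "v = u" | (avoid) "\<not> tr u" "v \<noteq> u" by blast
        then show ?thesis
        proof cases
          case true
          have "snd (ds ! x) \<noteq> [neg l]" if x: "x \<in> limit \<pi>" for x
          proof (cases "x \<le> m")
            case f: False
            then have "tr x" using x good by auto
            then obtain j' l' where "occ x j' l'" "\<nu> (fst l') = snd l'" unfolding tr_def by blast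
            then show ?thesis using true tr_iff[OF o] by (auto simp: occ_def neg_def)
          qed (rule not_neg)
          then show ?thesis using win payoff_le_1(1) by simp
        next
          case false
          then have "\<pi> 1 = 0" using f_occ[OF o] by (simp add: \<pi>_def)
          then have "limit \<pi> = {0}" using sink_limit[OF play] by blast
          then show ?thesis using win not_neg[of 0] payoff_le_1(1) by simp
        next
          case avoid
          have "\<tau> k = \<pi> k \<and> \<pi> k \<noteq> u" for k
          proof (induction k)
            case 0 then show ?case using \<tau>(1) avoid by (simp add: is_play_def \<pi>_def)
          next
            case (Suc k)
            have "m < u" using o by (simp add: occ_def)
            then have ne: "owners I ! \<tau> k \<noteq> i"
              using Suc less[of k] u by (auto simp: owner_simps(2) split: if_splits)
            have "owners I ! \<tau> k \<in> players G"
              using Suc less[of k] n_gt by (auto simp: owner_simps(2))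
            then have "\<tau> (Suc k) = f (\<tau> k)"
              using \<tau>(2) ne Suc less[of k] unfolding compat by (auto simp: region_def)
            moreover have "f (\<pi> k) \<noteq> u" using f_good[OF less[of k]] avoid(1) \<open>m < u\<close> by auto
            ultimately show ?case using Suc suc by simp
          qed
          then have "\<tau> = \<pi>" by auto
          then show ?thesis by simp
        qed
      qed
    qed
    then have "fixed_NE G 0 v \<sigma>'" unfolding fixed_NE_iff[OF is_game v'] out using prof by blast
    then show ?thesis using out unfolding \<pi>_def by simp
  qed
  define \<sigma> :: "nat \<Rightarrow> nat list \<Rightarrow> nat" where "\<sigma> i h = f (last h)" for i h
  have one: "1 < n" by (rule one_less)
  then have v1: "1 \<in> vertices G" by simp
  have NE1: "fixed_NE G 0 1 \<sigma>" and out: "outcome G 1 \<sigma> = (\<lambda>k. (f ^^ k) 1)"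
    using NE[OF one, of \<sigma>] by (auto simp: \<sigma>_def)
  have "fixed_NE (subgame G h) 0 v (\<lambda>i h'. \<sigma> i (h @ h'))" if "is_history G 1 (h @ [v])" for h v
  proof -
    have "v < n" using is_history_vertices[OF is_game that v1] by simp
    then have "fixed_NE G 0 v (\<lambda>i h'. \<sigma> i (h @ h'))" using NE[of v "\<lambda>i h'. \<sigma> i (h @ h')"] by (simp add: \<sigma>_def)
    then show ?thesis by (simp only: subgame_parity[OF game_facts(5)])
  qed
  then have SPE: "fixed_SPE G 0 1 \<sigma>" using NE1 unfolding fixed_SPE_def fixed_NE_def[of G] by blast
  have play: "is_play G 1 (\<lambda>k. (f ^^ k) 1)"
    using outcome_props(1)[OF is_game v1, of \<sigma>] NE1 unfolding out fixed_NE_def by blast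
  have loop: "(\<exists>j<m. (f ^^ k) 1 = Suc j) \<or> tr ((f ^^ k) 1)" for k
  proof (induction k)
    case 0 then show ?case using nonempty(1) by auto
  next
    case (Suc k)
    then show ?case
    proof
      assume "\<exists>j<m. (f ^^ k) 1 = Suc j"
      then obtain j where j: "j < m" "(f ^^ k) 1 = Suc j" by blast
      have "tr (f (Suc j))" using f_clause[OF j(1)] unfolding tr_def by blast
      then show ?thesis using j(2) by simp
    next
      assume t: "tr ((f ^^ k) 1)"
      then obtain j l where "occ ((f ^^ k) 1) j l" unfolding tr_def by blast
      moreover from this have "j < m" by (simp add: occ_def)
      ultimately show ?thesis using f_occ t nonempty(1) by auto
    qed
  qed
  have "x \<noteq> 0" if "x \<in> limit (\<lambda>k. (f ^^ k) 1)" for x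
  proof -
    have "x \<in> range (\<lambda>k. (f ^^ k) 1)" by (rule subsetD[OF limit_in_range that])
    then obtain k where "x = (f ^^ k) 1" by blast
    then show ?thesis using loop[of k] by (auto simp: tr_def occ_def)
  qed
  moreover have "x < n" if "x \<in> limit (\<lambda>k. (f ^^ k) 1)" for x using finite_limit[OF play one] that by auto
  ultimately have "colours I ! 0 ! x = 1" if "x \<in> limit (\<lambda>k. (f ^^ k) 1)" for x
    using colour_simps(2) that by simp
  from payoff_const[OF play one this] have "payoff G (\<lambda>k. (f ^^ k) 1) 0 = 0" by simp
  then show ?thesis using SPE out by auto
qed

lemma cnf_problem: "encode I \<in> problem spe det \<longleftrightarrow> \<not> satisfiable \<phi>"
proof -
  have inst: "is_instance I" "is_deterministic G (leader I) (inst_mealy I)"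
    using is_det_instance by (auto simp: is_det_instance_def)
  have I: "leader I = 0" "source I = 1" "inst_threshold I = 0"
    by (simp_all add: cnf_inst_def inst_threshold_def)
  have "encode I \<in> problem spe det \<longleftrightarrow> verified spe I"
    using inst encode_inject unfolding problem_def by blast
  also have "\<dots> \<longleftrightarrow> \<not> satisfiable \<phi>"
  proof -
    have "satisfiable \<phi> \<longleftrightarrow> (\<exists>\<sigma>. counterexample spe I \<sigma>)"
    proof
      assume "satisfiable \<phi>"
      then obtain \<sigma> where "fixed_SPE G 0 1 \<sigma>" "payoff G (outcome G 1 \<sigma>) 0 \<le> 0"
        using satisfiable_equilibrium by blast
      then have "counterexample spe I \<sigma>"
        unfolding counterexample_def I of_rat_0 using fixed_SPE_imp_NE[of G 0 1 \<sigma>] comp_leader[of "\<sigma> 0"] by blast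
      then show "\<exists>\<sigma>. counterexample spe I \<sigma>" by (rule exI[of _ \<sigma>])
    next
      assume "\<exists>\<sigma>. counterexample spe I \<sigma>"
      then show "satisfiable \<phi>"
        using equilibrium_satisfiable unfolding counterexample_def I of_rat_0 by blast
    qed
    then show ?thesis using not_verified_iff by blast
  qed
  finally show ?thesis .
qed

end

lemma pt_describe [pt_intros]: "pt f \<Longrightarrow> pt (\<lambda>x. describe (f x))"
  unfolding describe_def by (intro pt_intros)

lemma pt_cnf_encoding: "pt (\<lambda>\<phi> :: ('x :: treeable \<times> bool) list list. encode (cnf_inst \<phi>))"
proof -
  obtain d where "codec enc_inst d" using codec_inst by blast
  then have e: "pt enc_inst" by (simp add: codec_def)
  have "pt (\<lambda>\<phi> :: ('x \<times> bool) list list. inst_of (cnf_inst \<phi>))"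
    unfolding inst_of_def cnf_inst_def parity_instance.simps neg_def[abs_def] by (intro pt_intros)
  from pt_comp[OF e this] show ?thesis by (simp add: enc_inst_of)
qed

section \<open>Computation tableaux\<close>

text \<open>The facts are, in this order: the state at a time; the cell of the head of a tape; the symbol in a
  cell; the scanned symbol; the symbol written; the movement made.\<close>

datatype fact = St nat nat | Hd nat nat nat | Sy nat nat nat nat | Sc nat nat nat | Wr nat nat nat | Mv nat nat nat

fun fact_code :: "fact \<Rightarrow> nat list" where
  "fact_code (St t q) = [0, t, q]"
| "fact_code (Hd t i c) = [1, t, i, c]"
| "fact_code (Sy t i c a) = [2, t, i, c, a]"
| "fact_code (Sc t i a) = [3, t, i, a]"
| "fact_code (Wr t i a) = [4, t, i, a]"
| "fact_code (Mv t i d) = [5, t, i, d]"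

instantiation fact :: treeable
begin
definition "tree_of f = tree_of (fact_code f)"
instance
proof
  fix x y :: fact
  show "tree_of x = tree_of y \<Longrightarrow> x = y" by (cases x; cases y) (auto simp: tree_of_fact_def simp del: tree_of_list.simps)
qed
end

lemma pt_fact_iff: "pt (f :: 'a :: treeable \<Rightarrow> fact) \<longleftrightarrow> pt (\<lambda>x. fact_code (f x))"
  unfolding pt_def tree_of_fact_def ..

lemma pt_facts [pt_intros]:
  "pt t \<Longrightarrow> pt q \<Longrightarrow> pt (\<lambda>x. St (t x) (q x))"
  "pt t \<Longrightarrow> pt i \<Longrightarrow> pt c \<Longrightarrow> pt (\<lambda>x. Hd (t x) (i x) (c x))"
  "pt t \<Longrightarrow> pt i \<Longrightarrow> pt c \<Longrightarrow> pt a \<Longrightarrow> pt (\<lambda>x. Sy (t x) (i x) (c x) (a x))"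
  "pt t \<Longrightarrow> pt i \<Longrightarrow> pt a \<Longrightarrow> pt (\<lambda>x. Sc (t x) (i x) (a x))"
  "pt t \<Longrightarrow> pt i \<Longrightarrow> pt a \<Longrightarrow> pt (\<lambda>x. Wr (t x) (i x) (a x))"
  "pt t \<Longrightarrow> pt i \<Longrightarrow> pt d \<Longrightarrow> pt (\<lambda>x. Mv (t x) (i x) (d x))"
  unfolding pt_fact_iff fact_code.simps by (intro pt_intros; assumption)+

text \<open>The steps of a run are described by implications only. Uniqueness of states or symbols
  is never stated: the facts of the actual run are forced, additional true facts do no harm, and
  only the clauses on the final state forbid anything.\<close>

definition horn :: "fact list \<Rightarrow> fact \<Rightarrow> (fact \<times> bool) list" where
  "horn ps c = (c, True) # map (\<lambda>p. (p, False)) ps"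

lemma horn_true: "(\<exists>l\<in>set (horn ps c). \<nu> (fst l) = snd l) \<longleftrightarrow> ((\<forall>p\<in>set ps. \<nu> p) \<longrightarrow> \<nu> c)"
  by (auto simp: horn_def)

fun move_code :: "move \<Rightarrow> nat" where
  "move_code Move_Left = 0" | "move_code Stay = 1" | "move_code Move_Right = 2"

text \<open>A halted machine idles, so acceptance within a time bound becomes acceptance at that
  bound.\<close>

definition next_act :: "tm \<Rightarrow> nat \<Rightarrow> nat list \<Rightarrow> nat \<times> (nat \<times> move) list" where
  "next_act M q xs = (if q = accept M \<or> q = reject M then (q, map (\<lambda>a. (a, Stay)) xs) else delta M q xs)"

text \<open>The machine is fixed, so its finite table is a constant of the reduction and
  \<open>delta\<close> is never computed by it.\<close>

definition transitions :: "tm \<Rightarrow> (nat \<times> nat list \<times> nat \<times> nat list \<times> nat list) list" where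
  "transitions M = map (\<lambda>z. (fst z, snd z, fst (next_act M (fst z) (snd z)),
       map fst (snd (next_act M (fst z) (snd z))), map (\<lambda>a. move_code (snd a)) (snd (next_act M (fst z) (snd z)))))
     (List.product [0..<states M] (List.n_lists (tapes M) [0..<symbols M]))"

text \<open>Cell \<open>length ts\<close> is the start position of the heads. The list \<open>specs\<close> gives the possible initial
  contents of the cells of the first tape; \<open>[0, 1, 2]\<close> marks the cells of the certificate.\<close>

definition initial_clauses :: "tm \<Rightarrow> nat list \<Rightarrow> nat list list \<Rightarrow> (fact \<times> bool) list list" where
  "initial_clauses M ts specs =
     horn [] (St 0 (start M)) #
     map (\<lambda>i. horn [] (Hd 0 i (length ts))) [0..<tapes M] @
     map (\<lambda>z. map (\<lambda>a. (Sy 0 0 (fst z) a, True)) (snd z)) (zip [0..<length specs] specs) @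
     concat (map (\<lambda>i. map (\<lambda>c. horn [] (Sy 0 i c 0)) [0..<length specs]) [1..<tapes M]) @
     map (\<lambda>z. if snd z = ([0, 1, 2], [0, 1, 2]) then horn [Sy 0 0 (fst z) 0] (Sy 0 0 (Suc (fst z)) 0)
       else horn [] (St 0 (start M))) (zip [0..<length specs] (zip specs (tl specs)))"

definition transition_clauses :: "tm \<Rightarrow> nat \<Rightarrow> (fact \<times> bool) list list" where
  "transition_clauses M t = concat (map (\<lambda>z. map (\<lambda>c.
       horn (St t (fst z) # map (\<lambda>e. Sc t (fst e) (snd e)) (zip [0..<tapes M] (fst (snd z)))) c)
       (St (Suc t) (fst (snd (snd z))) #
         map (\<lambda>e. Wr t (fst e) (snd e)) (zip [0..<tapes M] (fst (snd (snd (snd z))))) @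
         map (\<lambda>e. Mv t (fst e) (snd e)) (zip [0..<tapes M] (snd (snd (snd (snd z)))))))
     (transitions M))"

text \<open>A symbol persists if the head is at another cell \<open>c'\<close>. For
  \<open>c = c'\<close> a clause that is already present fills the place, which avoids an empty
  clause.\<close>

definition tape_clauses :: "tm \<Rightarrow> nat list \<Rightarrow> nat \<Rightarrow> nat \<Rightarrow> (fact \<times> bool) list list" where
  "tape_clauses M cs t i = concat (map (\<lambda>c.
     [horn [Hd t i c, Mv t i 1] (Hd (Suc t) i c), horn [Hd t i c, Mv t i 2] (Hd (Suc t) i (Suc c)),
      horn [Hd t i (Suc c), Mv t i 0] (Hd (Suc t) i c)] @
     concat (map (\<lambda>a.
       [horn [Hd t i c, Sy t i c a] (Sc t i a), horn [Hd t i c, Wr t i a] (Sy (Suc t) i c a)] @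
       map (\<lambda>c'. if c = c' then horn [] (St 0 (start M)) else horn [Hd t i c', Sy t i c a] (Sy (Suc t) i c a)) cs)
       [0..<symbols M])) cs)"

definition tableau :: "tm \<Rightarrow> nat list \<Rightarrow> nat list list \<Rightarrow> (fact \<times> bool) list list" where
  "tableau M ts specs = initial_clauses M ts specs @
     concat (map (\<lambda>t. transition_clauses M t @
       concat (map (\<lambda>i. tape_clauses M [0..<length specs] t i) [0..<tapes M])) [0..<length ts]) @
     map (\<lambda>q. [(St (length ts) q, False)]) (filter (\<lambda>q. q \<noteq> accept M) [0..<states M])"

lemma pt_horn [pt_intros]: "pt ps \<Longrightarrow> pt c \<Longrightarrow> pt (\<lambda>x. horn (ps x) (c x))"
  unfolding horn_def by (intro pt_intros)

lemma pt_tableau: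
  assumes ts: "pt ts" and specs: "pt specs" shows "pt (\<lambda>x. tableau M (ts x) (specs x))"
proof -
  have i: "pt (\<lambda>x. initial_clauses M (ts x) (specs x))"
    unfolding initial_clauses_def by (intro pt_intros pt_comp[OF ts] pt_comp[OF specs])
  have tr: "pt (\<lambda>x. transition_clauses M (t x))" if "pt t" for t :: "'b :: treeable \<Rightarrow> nat"
    unfolding transition_clauses_def by (intro pt_intros pt_comp[OF that])
  have ta: "pt (\<lambda>x. tape_clauses M (cs x) (t x) (j x))" if "pt cs" "pt t" "pt j"
    for cs :: "'b :: treeable \<Rightarrow> nat list" and t j
    unfolding tape_clauses_def by (intro pt_intros pt_comp[OF that(1)] pt_comp[OF that(2)] pt_comp[OF that(3)])
  show ?thesis unfolding tableau_def by (intro pt_intros i tr ta pt_comp[OF ts] pt_comp[OF specs])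
qed

section \<open>Runs of a machine and their tableaux\<close>

locale machine =
  fixes M :: tm
  assumes tm: "is_tm M"
begin

text \<open>With \<open>next_act\<close> the case of a halted machine moves into the transition
  function, so one formula covers all steps.\<close>

lemma step_eq:
  "step M cfg = (fst (next_act M (fst cfg) (map scanned (snd cfg))),
     map2 act (snd (next_act M (fst cfg) (map scanned (snd cfg)))) (snd cfg))"
proof -
  have "map2 act (map (\<lambda>a. (a, Stay)) (map scanned ts)) ts = ts" for ts
  proof (induction ts)
    case (Cons p ts) then show ?case by (cases p) (simp add: fun_upd_idem)
  qed simp
  then show ?thesis by (cases cfg) (auto simp: step_def halted_def next_act_def case_prod_unfold)
qed

definition wf :: "config \<Rightarrow> bool" where
  "wf cfg \<longleftrightarrow> fst cfg < states M \<and> length (snd cfg) = tapes M \<and> (\<forall>p\<in>set (snd cfg). \<forall>z. snd p z < symbols M)"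

lemma next_act_bounds:
  assumes "q < states M" "length xs = tapes M" "set xs \<subseteq> {..<symbols M}"
  shows "fst (next_act M q xs) < states M" "length (snd (next_act M q xs)) = tapes M"
    "fst ` set (snd (next_act M q xs)) \<subseteq> {..<symbols M}"
proof -
  have "case delta M q xs of (q', as) \<Rightarrow>
           q' < states M \<and> length as = tapes M \<and> fst ` set as \<subseteq> {..<symbols M}"
    using tm assms unfolding is_tm_def by (elim conjE allE[of _ q] allE[of _ xs]) simp
  then have "fst (delta M q xs) < states M \<and> length (snd (delta M q xs)) = tapes M \<and>
      fst ` set (snd (delta M q xs)) \<subseteq> {..<symbols M}"
    unfolding case_prod_unfold .
  then show "fst (next_act M q xs) < states M" "length (snd (next_act M q xs)) = tapes M"
    "fst ` set (snd (next_act M q xs)) \<subseteq> {..<symbols M}"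
    using assms by (simp_all add: next_act_def image_image)
qed

lemma scanned_bounds:
  assumes "wf cfg"
  shows "length (map scanned (snd cfg)) = tapes M" "set (map scanned (snd cfg)) \<subseteq> {..<symbols M}"
  using assms by (auto simp: wf_def)

lemma wf_run: "wf (run M w t)"
proof (induction t)
  case 0
  have "1 \<le> tapes M" "3 \<le> symbols M" "start M < states M" using tm by (auto simp: is_tm_def)
  then show ?case by (auto simp: wf_def run_def initial_def input_tape_def bit_symbol_def)
next
  case (Suc t)
  define cfg where "cfg = run M w t"
  have w: "wf cfg" using Suc by (simp add: cfg_def)
  have q: "fst cfg < states M" using w by (simp add: wf_def)
  note b = next_act_bounds[OF q scanned_bounds[OF w]]
  have "snd (act a p) z < symbols M" if "a \<in> set (snd (next_act M (fst cfg) (map scanned (snd cfg))))" "p \<in> set (snd cfg)" for a p z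
  proof -
    have "fst a < symbols M" using b(3) that(1) by auto
    then show ?thesis using w that(2) by (cases a; cases p) (auto simp: wf_def)
  qed
  note cell = this
  let ?as = "snd (next_act M (fst cfg) (map scanned (snd cfg)))"
  have "snd p z < symbols M" if p: "p \<in> set (map2 act ?as (snd cfg))" for p z
  proof -
    obtain e where e: "e \<in> set (zip ?as (snd cfg))" "p = act (fst e) (snd e)"
      using p by (auto simp: case_prod_unfold)
    then have "fst e \<in> set ?as" "snd e \<in> set (snd cfg)"
      using set_zip_leftD[of "fst e" "snd e"] set_zip_rightD[of "fst e" "snd e"] by simp_all
    then show ?thesis unfolding e(2) by (rule cell)
  qed
  then have "wf (step M cfg)"
    unfolding wf_def step_eq fst_conv snd_conv using b(1,2) w by (simp add: wf_def)
  then show ?case by (simp add: run_def cfg_def)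
qed

abbreviation "state w t \<equiv> fst (run M w t)"
abbreviation "pos w t i \<equiv> fst (snd (run M w t) ! i)"
abbreviation "cell w t i \<equiv> snd (snd (run M w t) ! i)"

definition acts where "acts w t = next_act M (state w t) (map scanned (snd (run M w t)))"

lemma tapes_pos: "0 < tapes M"
  using tm by (simp add: is_tm_def)

lemma scan_eq: "i < tapes M \<Longrightarrow> map scanned (snd (run M w t)) ! i = cell w t i (pos w t i)"
  using wf_run[of w t] by (cases "snd (run M w t) ! i") (simp add: wf_def)

lemma run_0:
  "state w 0 = start M" "i < tapes M \<Longrightarrow> pos w 0 i = 0"
  "i < tapes M \<Longrightarrow> cell w 0 i = (if i = 0 then snd (input_tape w) else (\<lambda>_. 0))"
proof -
  show "state w 0 = start M" by (simp add: run_def initial_def)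
  assume i: "i < tapes M"
  show "pos w 0 i = 0" using i by (cases i) (simp_all add: run_def initial_def input_tape_def)
  show "cell w 0 i = (if i = 0 then snd (input_tape w) else (\<lambda>_. 0))"
    using i by (cases i) (simp_all add: run_def initial_def input_tape_def fun_eq_iff)
qed

lemma run_Suc:
  "state w (Suc t) = fst (acts w t)"
  "i < tapes M \<Longrightarrow> pos w (Suc t) i = shift (snd (snd (acts w t) ! i)) (pos w t i)"
  "i < tapes M \<Longrightarrow> cell w (Suc t) i = (cell w t i)(pos w t i := fst (snd (acts w t) ! i))"
proof -
  have s: "run M w (Suc t) = (fst (acts w t), map2 act (snd (acts w t)) (snd (run M w t)))"
    by (simp add: run_def step_eq acts_def)
  then show "state w (Suc t) = fst (acts w t)" by simp
  assume i: "i < tapes M"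
  have w: "wf (run M w t)" by (rule wf_run)
  have q: "state w t < states M" using w by (simp add: wf_def)
  have l: "length (snd (acts w t)) = tapes M" "length (snd (run M w t)) = tapes M"
    using next_act_bounds(2)[OF q scanned_bounds[OF w]] w by (simp_all add: acts_def wf_def)
  have "snd (run M w (Suc t)) ! i = act (snd (acts w t) ! i) (snd (run M w t) ! i)"
    using i l by (simp add: s)
  then show "pos w (Suc t) i = shift (snd (snd (acts w t) ! i)) (pos w t i)"
    "cell w (Suc t) i = (cell w t i)(pos w t i := fst (snd (acts w t) ! i))"
    by (cases "snd (acts w t) ! i"; cases "snd (run M w t) ! i"; simp)+
qed

lemma acts_bounds:
  "state w t < states M" "length (snd (acts w t)) = tapes M"
  "i < tapes M \<Longrightarrow> fst (snd (acts w t) ! i) < symbols M"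
  "i < tapes M \<Longrightarrow> cell w t i z < symbols M"
proof -
  have w: "wf (run M w t)" by (rule wf_run)
  then show q: "state w t < states M" by (simp add: wf_def)
  note b = next_act_bounds[OF q scanned_bounds[OF w], folded acts_def]
  show l: "length (snd (acts w t)) = tapes M" by (rule b)
  show "fst (snd (acts w t) ! i) < symbols M" if "i < tapes M"
  proof -
    have "fst (snd (acts w t) ! i) \<in> fst ` set (snd (acts w t))" using l that by simp
    from subsetD[OF b(3) this] show ?thesis by simp
  qed
  show "i < tapes M \<Longrightarrow> cell w t i z < symbols M" using w by (auto simp: wf_def)
qed

lemma acts_transition:
  "(state w t, map scanned (snd (run M w t)), fst (acts w t), map fst (snd (acts w t)),
    map (\<lambda>a. move_code (snd a)) (snd (acts w t))) \<in> set (transitions M)"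
proof -
  let ?xs = "map scanned (snd (run M w t))"
  have "(state w t, ?xs) \<in> set (List.product [0..<states M] (List.n_lists (tapes M) [0..<symbols M]))"
    using scanned_bounds[OF wf_run[of w t]] acts_bounds(1)[of w t] by (simp add: set_n_lists atLeast0LessThan)
  then show ?thesis unfolding transitions_def acts_def set_map by (rule rev_image_eqI) simp
qed

definition holds :: "(fact \<Rightarrow> bool) \<Rightarrow> (fact \<times> bool) list list \<Rightarrow> bool" where
  "holds \<nu> cls \<longleftrightarrow> (\<forall>c\<in>set cls. \<exists>l\<in>set c. \<nu> (fst l) = snd l)"

lemma holds_simps:
  "holds \<nu> (xs @ ys) \<longleftrightarrow> holds \<nu> xs \<and> holds \<nu> ys"
  "holds \<nu> (concat (map F l)) \<longleftrightarrow> (\<forall>x\<in>set l. holds \<nu> (F x))"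
  "holds \<nu> (map G l) \<longleftrightarrow> (\<forall>x\<in>set l. \<exists>e\<in>set (G x). \<nu> (fst e) = snd e)"
  "holds \<nu> (c # xs) \<longleftrightarrow> (\<exists>e\<in>set c. \<nu> (fst e) = snd e) \<and> holds \<nu> xs"
  "holds \<nu> []"
  by (auto simp: holds_def)

lemma ball_lessThan: "(\<forall>i\<in>{..<n :: nat}. Q i) \<longleftrightarrow> (\<forall>i<n. Q i)"
  by auto

lemma holds_initial:
  "holds \<nu> (initial_clauses M ts specs) \<longleftrightarrow> \<nu> (St 0 (start M)) \<and> (\<forall>i<tapes M. \<nu> (Hd 0 i (length ts))) \<and>
     (\<forall>c<length specs. \<exists>a\<in>set (specs ! c). \<nu> (Sy 0 0 c a)) \<and>
     (\<forall>i c. 0 < i \<and> i < tapes M \<and> c < length specs \<longrightarrow> \<nu> (Sy 0 i c 0)) \<and>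
     (\<forall>c. Suc c < length specs \<and> specs ! c = [0, 1, 2] \<and> specs ! Suc c = [0, 1, 2] \<and> \<nu> (Sy 0 0 c 0) \<longrightarrow>
        \<nu> (Sy 0 0 (Suc c) 0))"
    (is "?l \<longleftrightarrow> ?a \<and> ?b \<and> ?c \<and> ?d \<and> ?e")
proof -
  have z: "zip [0..<length specs] (zip specs (tl specs)) =
      map (\<lambda>c. (c, specs ! c, specs ! Suc c)) [0..<length specs - 1]"
    by (intro nth_equalityI) (simp_all add: nth_tl)
  have "?l \<longleftrightarrow> ?a \<and> ?b \<and> ?c \<and> (\<forall>i\<in>{1..<tapes M}. \<forall>c\<in>{0..<length specs}. \<nu> (Sy 0 i c 0)) \<and>
     (\<forall>c\<in>{0..<length specs - 1}. if (specs ! c, specs ! Suc c) = ([0, 1, 2], [0, 1, 2])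
       then \<nu> (Sy 0 0 c 0) \<longrightarrow> \<nu> (Sy 0 0 (Suc c) 0) else ?a)"
    unfolding initial_clauses_def z holds_simps horn_true zip_upt
    by (simp add: horn_true if_distrib[of set] if_distrib[of "\<lambda>S. \<exists>e\<in>S. _ e"] atLeast0LessThan ball_lessThan cong: if_cong)
  also have "\<dots> \<longleftrightarrow> ?a \<and> ?b \<and> ?c \<and> ?d \<and> ?e" by (auto simp: Suc_le_eq less_diff_conv)
  finally show ?thesis .
qed

lemma holds_transition:
  "holds \<nu> (transition_clauses M t) \<longleftrightarrow> (\<forall>(q, xs, q', bs, ds)\<in>set (transitions M).
     \<nu> (St t q) \<and> (\<forall>e\<in>set (zip [0..<tapes M] xs). \<nu> (Sc t (fst e) (snd e))) \<longrightarrow>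
     \<nu> (St (Suc t) q') \<and> (\<forall>e\<in>set (zip [0..<tapes M] bs). \<nu> (Wr t (fst e) (snd e))) \<and>
       (\<forall>e\<in>set (zip [0..<tapes M] ds). \<nu> (Mv t (fst e) (snd e))))"
  unfolding transition_clauses_def holds_simps horn_true case_prod_unfold
  by (intro ball_cong refl) auto

lemma holds_tape:
  "holds \<nu> (tape_clauses M [0..<n] t i) \<longleftrightarrow> (\<forall>c<n.
     (\<nu> (Hd t i c) \<and> \<nu> (Mv t i 1) \<longrightarrow> \<nu> (Hd (Suc t) i c)) \<and>
     (\<nu> (Hd t i c) \<and> \<nu> (Mv t i 2) \<longrightarrow> \<nu> (Hd (Suc t) i (Suc c))) \<and>
     (\<nu> (Hd t i (Suc c)) \<and> \<nu> (Mv t i 0) \<longrightarrow> \<nu> (Hd (Suc t) i c)) \<and>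
     (\<forall>a<symbols M. (\<nu> (Hd t i c) \<and> \<nu> (Sy t i c a) \<longrightarrow> \<nu> (Sc t i a)) \<and>
        (\<nu> (Hd t i c) \<and> \<nu> (Wr t i a) \<longrightarrow> \<nu> (Sy (Suc t) i c a)) \<and>
        (\<forall>c'<n. if c = c' then \<nu> (St 0 (start M))
          else \<nu> (Hd t i c') \<and> \<nu> (Sy t i c a) \<longrightarrow> \<nu> (Sy (Suc t) i c a))))"
  unfolding tape_clauses_def holds_simps
  by (simp add: horn_true if_distrib[of set] if_distrib[of "\<lambda>S. \<exists>e\<in>S. _ e"] atLeast0LessThan ball_lessThan
    holds_simps(5) cong: if_cong)

lemma holds_tableau:
  "holds \<nu> (tableau M ts specs) \<longleftrightarrow> holds \<nu> (initial_clauses M ts specs) \<and>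
     (\<forall>t<length ts. holds \<nu> (transition_clauses M t) \<and>
        (\<forall>i<tapes M. holds \<nu> (tape_clauses M [0..<length specs] t i))) \<and>
     (\<forall>q<states M. q \<noteq> accept M \<longrightarrow> \<not> \<nu> (St (length ts) q))"
  unfolding tableau_def holds_simps by (auto simp: atLeast0LessThan)

lemma pos_bound: "i < tapes M \<Longrightarrow> \<bar>pos w t i\<bar> \<le> int t"
proof (induction t)
  case (Suc t)
  have "\<bar>shift d p\<bar> \<le> \<bar>p\<bar> + 1" for d p by (cases d) auto
  from this[of "snd (snd (acts w t) ! i)" "pos w t i"] show ?case using Suc by (simp add: run_Suc)
qed (simp add: run_0)

lemma transition_zip:
  assumes "length xs = tapes M"
  shows "(\<forall>e\<in>set (zip [0..<tapes M] xs). Q (fst e) (snd e)) \<longleftrightarrow> (\<forall>i<tapes M. Q i (xs ! i))"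
  unfolding assms[symmetric] zip_upt by auto

text \<open>By induction on time all facts of the actual run are true; the heads stay within
  \<open>length ts\<close> cells of the start, so no fact leaves the represented range. At the end
  the state of the run is true, while all states but the accepting one are forbidden.\<close>

lemma tableau_sound:
  assumes h: "holds \<nu> (tableau M ts specs)" and N: "2 * length ts < length specs"
    and init: "\<And>c. c < length specs \<Longrightarrow> \<nu> (Sy 0 0 c (snd (input_tape w) (int c - int (length ts))))"
  shows "state w (length ts) = accept M"
proof -
  let ?T = "length ts" and ?N = "length specs"
  have h0: "holds \<nu> (initial_clauses M ts specs)"
    and htr: "\<And>t. t < ?T \<Longrightarrow> holds \<nu> (transition_clauses M t)"
    and hta: "\<And>t i. t < ?T \<Longrightarrow> i < tapes M \<Longrightarrow> holds \<nu> (tape_clauses M [0..<?N] t i)"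
    and hf: "\<forall>q<states M. q \<noteq> accept M \<longrightarrow> \<not> \<nu> (St ?T q)"
    using h unfolding holds_tableau by blast+
  note h0 = h0[unfolded holds_initial]
  define P where "P t \<longleftrightarrow> \<nu> (St t (state w t)) \<and> (\<forall>i<tapes M. \<nu> (Hd t i (nat (pos w t i + int ?T)))) \<and>
    (\<forall>i<tapes M. \<forall>c<?N. \<nu> (Sy t i c (cell w t i (int c - int ?T))))" for t
  have "t \<le> ?T \<Longrightarrow> P t" for t
  proof (induction t)
    case 0
    have "\<nu> (Sy 0 i c (cell w 0 i (int c - int ?T)))" if "i < tapes M" "c < ?N" for i c
      using that init[OF that(2)] h0 by (cases "i = 0") (simp_all add: run_0)
    then show ?case using h0 by (simp add: P_def run_0)
  next
    case (Suc t)
    then have t: "t < ?T" and IH: "P t" by simp_all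
    \<comment> \<open>The cell under the head. It is positive at times before the last, so a move to
      the left is represented too.\<close>
    define hd where "hd i = nat (pos w t i + int ?T)" for i
    have hd: "int (hd i) = pos w t i + int ?T" "hd i < ?N" "0 < hd i" if "i < tapes M" for i
      using pos_bound[OF that, of w t] t N by (auto simp: hd_def)
    have Hd: "\<nu> (Hd t i (hd i))" if "i < tapes M" for i using IH that by (simp add: P_def hd_def)
    have Sy: "\<nu> (Sy t i c (cell w t i (int c - int ?T)))" if "i < tapes M" "c < ?N" for i c
      using IH that by (simp add: P_def)
    note tape = hta[OF t, unfolded holds_tape, rule_format]
    have Sc: "\<nu> (Sc t i (map scanned (snd (run M w t)) ! i))" if i: "i < tapes M" for i
    proof -
      have "int (hd i) - int ?T = pos w t i" using hd(1)[OF i] by simp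
      then have "\<nu> (Sy t i (hd i) (cell w t i (pos w t i)))" using Sy[OF i hd(2)[OF i]] by simp
      then show ?thesis using tape[OF i hd(2)[OF i]] acts_bounds(4)[OF i] Hd[OF i] by (simp only: scan_eq[OF i])
    qed
    let ?as = "snd (acts w t)"
    have len: "length (map scanned (snd (run M w t))) = tapes M" by (rule scanned_bounds(1)[OF wf_run])
    have "\<nu> (St t (state w t)) \<and> (\<forall>e\<in>set (zip [0..<tapes M] (map scanned (snd (run M w t)))). \<nu> (Sc t (fst e) (snd e))) \<longrightarrow>
      \<nu> (St (Suc t) (fst (acts w t))) \<and>
      (\<forall>e\<in>set (zip [0..<tapes M] (map fst ?as)). \<nu> (Wr t (fst e) (snd e))) \<and>
      (\<forall>e\<in>set (zip [0..<tapes M] (map (\<lambda>a. move_code (snd a)) ?as)). \<nu> (Mv t (fst e) (snd e)))"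
      using bspec[OF htr[OF t, unfolded holds_transition] acts_transition[of w t]] unfolding prod.case .
    moreover have "\<nu> (St t (state w t))" using IH by (simp add: P_def)
    ultimately have St: "\<nu> (St (Suc t) (fst (acts w t)))"
      and WM: "\<forall>i<tapes M. \<nu> (Wr t i (map fst ?as ! i))" "\<forall>i<tapes M. \<nu> (Mv t i (map (\<lambda>a. move_code (snd a)) ?as ! i))"
      using Sc acts_bounds(2)[of w t] transition_zip[OF len, of "\<lambda>i a. \<nu> (Sc t i a)"]
        transition_zip[of "map fst ?as" "\<lambda>i a. \<nu> (Wr t i a)"]
        transition_zip[of "map (\<lambda>a. move_code (snd a)) ?as" "\<lambda>i a. \<nu> (Mv t i a)"]
      by (simp_all only: length_map) blast+
    have Wr: "\<nu> (Wr t i (fst (?as ! i)))" and Mv: "\<nu> (Mv t i (move_code (snd (?as ! i))))" if "i < tapes M" for i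
      using WM that acts_bounds(2)[of w t] by auto
    have "\<nu> (Hd (Suc t) i (nat (pos w (Suc t) i + int ?T)))" if i: "i < tapes M" for i
    proof (cases "snd (?as ! i)")
      case Move_Left
      obtain c where c: "hd i = Suc c" using hd(3)[OF i] by (cases "hd i") auto
      have "nat (pos w (Suc t) i + int ?T) = c" using c hd(1)[OF i] by (simp add: run_Suc(2)[OF i] Move_Left)
      moreover have "c < ?N" using c hd(2)[OF i] by simp
      ultimately show ?thesis using tape[OF i, of c] Hd[OF i] Mv[OF i] by (simp add: c Move_Left)
    next
      case Stay
      have "nat (pos w (Suc t) i + int ?T) = hd i" by (simp add: run_Suc(2)[OF i] Stay hd_def)
      then show ?thesis using tape[OF i hd(2)[OF i]] Hd[OF i] Mv[OF i] by (simp add: Stay)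
    next
      case Move_Right
      have "nat (pos w (Suc t) i + int ?T) = Suc (hd i)" using hd(1)[OF i] by (simp add: run_Suc(2)[OF i] Move_Right)
      then show ?thesis using tape[OF i hd(2)[OF i]] Hd[OF i] Mv[OF i] by (simp add: Move_Right)
    qed
    moreover have "\<nu> (Sy (Suc t) i c (cell w (Suc t) i (int c - int ?T)))" if i: "i < tapes M" and c: "c < ?N" for i c
    proof (cases "c = hd i")
      case True
      then have "int c - int ?T = pos w t i" using hd(1)[OF i] by simp
      then have "cell w (Suc t) i (int c - int ?T) = fst (?as ! i)" by (simp add: run_Suc(3)[OF i])
      then show ?thesis using tape[OF i c] acts_bounds(3)[OF i] Hd[OF i] Wr[OF i] True by simp
    next
      case False
      then have "int c - int ?T \<noteq> pos w t i" using hd(1)[OF i] by auto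
      then have "cell w (Suc t) i (int c - int ?T) = cell w t i (int c - int ?T)" by (simp add: run_Suc(3)[OF i])
      then show ?thesis
        using tape[OF i c] acts_bounds(4)[OF i] Hd[OF i] Sy[OF i c] False hd(2)[OF i] by metis
    qed
    ultimately show ?case using St by (simp add: P_def run_Suc(1))
  qed
  then have "\<nu> (St ?T (state w ?T))" by (simp add: P_def)
  then show ?thesis using hf acts_bounds(1) by blast
qed

fun truth :: "bool list \<Rightarrow> nat \<Rightarrow> fact \<Rightarrow> bool" where
  "truth w T (St t q) \<longleftrightarrow> state w t = q"
| "truth w T (Hd t i c) \<longleftrightarrow> pos w t i = int c - int T"
| "truth w T (Sy t i c a) \<longleftrightarrow> cell w t i (int c - int T) = a"
| "truth w T (Sc t i a) \<longleftrightarrow> cell w t i (pos w t i) = a"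
| "truth w T (Wr t i a) \<longleftrightarrow> fst (snd (acts w t) ! i) = a"
| "truth w T (Mv t i d) \<longleftrightarrow> move_code (snd (snd (acts w t) ! i)) = d"

lemma transitionsD:
  assumes "(q, xs, q', bs, ds) \<in> set (transitions M)"
  shows "length xs = tapes M" "q' = fst (next_act M q xs)" "bs = map fst (snd (next_act M q xs))"
    "ds = map (\<lambda>a. move_code (snd a)) (snd (next_act M q xs))" "q < states M" "set xs \<subseteq> {..<symbols M}"
  using assms by (auto simp: transitions_def set_n_lists)

lemma tableau_complete:
  assumes acc: "state w (length ts) = accept M"
    and init: "\<And>c. c < length specs \<Longrightarrow> snd (input_tape w) (int c - int (length ts)) \<in> set (specs ! c)"
    and guess: "\<And>c. Suc c < length specs \<Longrightarrow> specs ! c = [0, 1, 2] \<Longrightarrow> specs ! Suc c = [0, 1, 2] \<Longrightarrow>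
      snd (input_tape w) (int c - int (length ts)) = 0 \<Longrightarrow> snd (input_tape w) (int (Suc c) - int (length ts)) = 0"
  shows "holds (truth w (length ts)) (tableau M ts specs)"
  unfolding holds_tableau
proof (intro conjI allI impI)
  let ?T = "length ts" and ?N = "length specs"
  let ?\<nu> = "truth w ?T"
  show "holds ?\<nu> (initial_clauses M ts specs)"
    unfolding holds_initial using init guess tapes_pos by (auto simp: run_0)
  show "\<not> ?\<nu> (St ?T q)" if "q \<noteq> accept M" for q using acc that by simp
  fix t
  show "holds ?\<nu> (transition_clauses M t)"
    unfolding holds_transition
  proof (intro ballI, clarify)
    fix q xs q' bs ds
    assume tr: "(q, xs, q', bs, ds) \<in> set (transitions M)" and st: "?\<nu> (St t q)"
      and sc: "\<forall>e\<in>set (zip [0..<tapes M] xs). ?\<nu> (Sc t (fst e) (snd e))"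
    have q: "q = state w t" using st by simp
    have len: "length (snd (run M w t)) = tapes M" using wf_run[of w t] by (simp add: wf_def)
    have "xs = map scanned (snd (run M w t))"
    proof (rule nth_equalityI)
      show "length xs = length (map scanned (snd (run M w t)))" using transitionsD(1)[OF tr] len by simp
      fix i assume "i < length xs"
      then have i: "i < tapes M" using transitionsD(1)[OF tr] by simp
      then show "xs ! i = map scanned (snd (run M w t)) ! i"
        using iffD1[OF transition_zip[OF transitionsD(1)[OF tr]] sc] unfolding scan_eq[OF i] by simp
    qed
    then have na: "next_act M q xs = acts w t" by (simp add: acts_def q)
    show "?\<nu> (St (Suc t) q') \<and> (\<forall>e\<in>set (zip [0..<tapes M] bs). ?\<nu> (Wr t (fst e) (snd e))) \<and>
        (\<forall>e\<in>set (zip [0..<tapes M] ds). ?\<nu> (Mv t (fst e) (snd e)))"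
      using transitionsD(2,3,4)[OF tr] acts_bounds(2)[of w t]
        transition_zip[of bs "\<lambda>i a. ?\<nu> (Wr t i a)"] transition_zip[of ds "\<lambda>i a. ?\<nu> (Mv t i a)"]
      unfolding na by (simp add: run_Suc(1))
  qed
  fix i assume i: "i < tapes M"
  have mv: "pos w (Suc t) i = pos w t i + int (move_code (snd (snd (acts w t) ! i))) - 1"
    unfolding run_Suc(2)[OF i] by (cases "snd (snd (acts w t) ! i)") simp_all
  show "holds ?\<nu> (tape_clauses M [0..<?N] t i)"
    unfolding holds_tape using mv by (auto simp: run_Suc(3)[OF i] run_0)
qed

lemma halted_stays:
  assumes "state w n = accept M \<or> state w n = reject M" "n \<le> m"
  shows "state w m = state w n"
  using assms(2)
proof (induction m rule: dec_induct)
  case (step m)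
  then show ?case using assms(1) by (simp add: run_Suc(1) acts_def next_act_def)
qed simp

end

section \<open>Reduction of NP to satisfiability\<close>

lemma pair_word_append: "pair_word x u = pair_word x [] @ u"
  by (simp add: pair_word_def)

lemma length_pair_word: "length (pair_word x u) = 2 * length x + 1 + length u"
proof -
  have "length (enc_list (\<lambda>b. [b]) x) = 2 * length x + 1" by (induction x) auto
  then show ?thesis by (simp add: pair_word_def)
qed

text \<open>The blank margins cover all cells that a head can reach in \<open>length ts\<close>
  steps to either side of the word, which starts at cell \<open>length ts\<close>.\<close>

definition tape_specs :: "nat list \<Rightarrow> nat list \<Rightarrow> bool list \<Rightarrow> nat list list" where
  "tape_specs ts us x = map (\<lambda>_. [0]) ts @ map (\<lambda>b. [if b then 2 else 1]) x @
     map (\<lambda>_. [0, 1, 2]) us @ map (\<lambda>_. [0]) (0 # ts)"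

lemma tape_specs_nth:
  assumes "c < length (tape_specs ts us x)"
  shows "c < length ts \<Longrightarrow> tape_specs ts us x ! c = [0]"
    "c = length ts + i \<Longrightarrow> i < length x \<Longrightarrow> tape_specs ts us x ! c = [bit_symbol (x ! i)]"
    "c = length ts + length x + i \<Longrightarrow> i < length us \<Longrightarrow> tape_specs ts us x ! c = [0, 1, 2]"
    "length ts + length x + length us \<le> c \<Longrightarrow> tape_specs ts us x ! c = [0]"
  using assms by (auto simp: tape_specs_def nth_append bit_symbol_def nth_Cons split: nat.split)

lemma tape_specs_guess:
  assumes "c < length (tape_specs ts us x)" "tape_specs ts us x ! c = [0, 1, 2]"
  shows "length ts + length x \<le> c \<and> c < length ts + length x + length us"
proof (rule ccontr)
  assume n: "\<not> ?thesis"
  consider "c < length ts" | i where "c = length ts + i" "i < length x" | "length ts + length x + length us \<le> c"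
  proof (cases "length ts \<le> c \<and> c < length ts + length x")
    case True
    then show ?thesis using that(2)[of "c - length ts"] by auto
  qed (use n that in linarith)
  then show False using tape_specs_nth[OF assms(1)] assms(2) by cases auto
qed

theorem NP_reduces_to_satisfiability:
  assumes "A \<in> NP_class"
  shows "\<exists>f :: bool list \<Rightarrow> (fact \<times> bool) list list. pt f \<and> (\<forall>x. f x \<noteq> [] \<and> [] \<notin> set (f x)) \<and>
    (\<forall>x. x \<in> A \<longleftrightarrow> satisfiable (f x))"
proof -
  obtain R p where R: "R \<in> P_class" and
    A: "\<And>x. x \<in> A \<longleftrightarrow> (\<exists>u. length u \<le> poly p (length x) \<and> pair_word x u \<in> R)"
    using assms unfolding NP_class_def by blast
  obtain M r where tm: "is_tm M" and
    M: "\<And>w. \<exists>n\<le>poly r (length w). fst (run M w n) = (if w \<in> R then accept M else reject M)"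
    using R unfolding P_class_def by blast
  interpret machine M by unfold_locales (rule tm)
  \<comment> \<open>\<open>1 + 2 * n + poly p n\<close> bounds the length of the pair of an input
    and a certificate; the tableau covers the time of the verifier on that length.\<close>
  define q where "q = pcompose r ([:1, 2:] + p)"
  have q: "poly q n = poly r (1 + 2 * n + poly p n)" for n by (simp add: q_def poly_pcompose mult.commute)
  obtain fT :: "bool list \<Rightarrow> nat list" where fT: "pt fT" "\<forall>xs. length (fT xs) = poly q (length xs)"
    using pt_polynomial_list by blast
  obtain fP :: "bool list \<Rightarrow> nat list" where fP: "pt fP" "\<forall>xs. length (fP xs) = poly p (length xs)"
    using pt_polynomial_list by blast
  define S where "S x = tape_specs (fT x) (fP x) (pair_word x [])" for x
  define f where "f x = tableau M (fT x) (S x)" for x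
  have "pt (\<lambda>x. pair_word x [])"
    unfolding pair_word_def using codec_list[OF codec_bit] by (auto intro!: pt_intros simp: codec_def)
  then have "pt S" unfolding S_def[abs_def] tape_specs_def by (intro pt_intros fT fP)
  then have "pt f" unfolding f_def[abs_def] by (intro pt_tableau fT)
  moreover have "f x \<noteq> []" for x by (simp add: f_def tableau_def initial_clauses_def)
  moreover have "[] \<notin> set (f x)" for x
  proof -
    have h: "horn ps c \<noteq> []" "[] \<noteq> horn ps c" for ps c by (simp_all add: horn_def)
    have "s \<noteq> []" if "s \<in> set (S x)" for s using that by (auto simp: S_def tape_specs_def)
    then have "[] \<notin> set (initial_clauses M (fT x) (S x))"
      unfolding initial_clauses_def using h by (auto dest!: set_zip_rightD split: if_splits)
    moreover have "[] \<notin> set (transition_clauses M t)" for t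
      unfolding transition_clauses_def using h by auto
    moreover have "[] \<notin> set (tape_clauses M cs t i)" for cs t i
      unfolding tape_clauses_def using h by auto
    ultimately show ?thesis unfolding f_def tableau_def by auto
  qed
  moreover have "x \<in> A \<longleftrightarrow> satisfiable (f x)" for x
  proof -
    let ?T = "length (fT x)" and ?P = "length (fP x)" and ?y = "pair_word x []" and ?N = "length (S x)"
    let ?L = "length ?y"
    have N: "?N = 2 * ?T + ?L + ?P + 1" by (simp add: S_def tape_specs_def)
    have "x \<in> A \<longleftrightarrow> (\<exists>u. length u \<le> ?P \<and> state (pair_word x u) ?T = accept M)"
    proof -
      have "pair_word x u \<in> R \<longleftrightarrow> state (pair_word x u) ?T = accept M" if u: "length u \<le> ?P" for u
      proof -
        let ?w = "pair_word x u"
        obtain n where n: "n \<le> poly r (length ?w)" "state ?w n = (if ?w \<in> R then accept M else reject M)"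
          using M by blast
        have "poly r (length ?w) \<le> ?T"
          using u fT(2) fP(2) by (simp add: q length_pair_word) (intro poly_nat_mono, simp)
        then have "state ?w ?T = state ?w n" using n by (intro halted_stays) auto
        moreover have "accept M \<noteq> reject M" using tm by (simp add: is_tm_def)
        ultimately show ?thesis using n(2) by simp
      qed
      then show ?thesis unfolding A fP(2)[rule_format, symmetric] by blast
    qed
    also have "\<dots> \<longleftrightarrow> (\<exists>\<nu>. holds \<nu> (f x))"
    proof
      assume "\<exists>u. length u \<le> ?P \<and> state (pair_word x u) ?T = accept M"
      then obtain u where u: "length u \<le> ?P" "state (pair_word x u) ?T = accept M" by blast
      let ?w = "pair_word x u"
      have len: "length ?w = ?L + length u" by (simp add: length_pair_word)
      have nth: "i < ?L \<Longrightarrow> ?w ! i = ?y ! i" for i by (subst pair_word_append) (simp add: nth_append)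
      have "holds (truth ?w ?T) (f x)"
        unfolding f_def
      proof (rule tableau_complete[OF u(2)])
        fix c assume c: "c < ?N"
        note sp = tape_specs_nth[OF c[unfolded S_def], folded S_def]
        consider "c < ?T" | i where "c = ?T + i" "i < ?L" | i where "c = ?T + ?L + i" "i < ?P" | "?T + ?L + ?P \<le> c"
          by (metis add.assoc le_Suc_ex less_or_eq_imp_le nat_add_left_cancel_less not_less)
        then show "snd (input_tape ?w) (int c - int ?T) \<in> set (S x ! c)"
        proof cases
          case 1 then show ?thesis using sp(1) by (simp add: input_tape_def)
        next
          case (2 i) then show ?thesis using sp(2)[OF 2] len nth by (simp add: input_tape_def)
        next
          case (3 i) then show ?thesis using sp(3)[OF 3] by (simp add: input_tape_def bit_symbol_def)
        next
          case 4 then show ?thesis using sp(4) len u(1) by (simp add: input_tape_def)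
        qed
      next
        fix c assume "Suc c < ?N" "S x ! c = [0, 1, 2]" and 0: "snd (input_tape ?w) (int c - int ?T) = 0"
        then have "?T + ?L \<le> c" using tape_specs_guess[of c "fT x" "fP x" ?y] by (simp add: S_def)
        then show "snd (input_tape ?w) (int (Suc c) - int ?T) = 0"
          using 0 by (auto simp: input_tape_def bit_symbol_def split: if_splits)
      qed
      then show "\<exists>\<nu>. holds \<nu> (f x)" by blast
    next
      assume "\<exists>\<nu>. holds \<nu> (f x)"
      then obtain \<nu> where \<nu>: "holds \<nu> (tableau M (fT x) (S x))" unfolding f_def by blast
      then have init: "holds \<nu> (initial_clauses M (fT x) (S x))" unfolding holds_tableau by blast
      have cells: "\<exists>a\<in>set (S x ! c). \<nu> (Sy 0 0 c a)" if "c < ?N" for c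
        using init that unfolding holds_initial by blast
      define g where "g i = ?T + ?L + i" for i
      have gN: "g i < ?N" if "i < ?P" for i using that N by (simp add: g_def)
      have gS: "S x ! g i = [0, 1, 2]" if "i < ?P" for i
        using tape_specs_nth(3)[of "g i" "fT x" "fP x" ?y i] gN[OF that] that by (simp add: S_def g_def)
      have propagate: "\<nu> (Sy 0 0 (g (Suc i)) 0)" if "Suc i < ?P" "\<nu> (Sy 0 0 (g i) 0)" for i
      proof -
        have "Suc (g i) = g (Suc i)" by (simp add: g_def)
        then show ?thesis using init that gN[of "Suc i"] gS[of "Suc i"] gS[of i] unfolding holds_initial
          by (metis Suc_lessD)
      qed
      \<comment> \<open>A valuation may make several symbols true in a guessed cell, so a
        certificate has to be read off: it ends at the first cell where the blank is true, from
        which blanks propagate to the right, and before that a bit is set iff symbol 2 is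
        true.\<close>
      define k where "k = (LEAST i. i = ?P \<or> \<nu> (Sy 0 0 (g i) 0))"
      have k: "k = ?P \<or> \<nu> (Sy 0 0 (g k) 0)" unfolding k_def by (rule LeastI[of _ ?P]) simp
      have kP: "k \<le> ?P" unfolding k_def by (rule Least_le) simp
      have less: "\<not> \<nu> (Sy 0 0 (g i) 0)" if "i < k" for i using not_less_Least[OF that[unfolded k_def]] by blast
      have ge: "\<nu> (Sy 0 0 (g i) 0)" if "k \<le> i" "i < ?P" for i
        using that
      proof (induction i rule: dec_induct)
        case base then show ?case using k by simp
      next
        case (step i) then show ?case using propagate[of i] by simp
      qed
      define u where "u = map (\<lambda>i. \<nu> (Sy 0 0 (g i) 2)) [0..<k]"
      let ?w = "pair_word x u"
      have len: "length ?w = ?L + k" by (simp add: length_pair_word u_def)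
      have nth: "i < ?L \<Longrightarrow> ?w ! i = ?y ! i" for i by (subst pair_word_append) (simp add: nth_append)
      have nth': "i < k \<Longrightarrow> ?w ! (?L + i) = \<nu> (Sy 0 0 (g i) 2)" for i
        by (subst pair_word_append) (simp add: nth_append u_def)
      have "state ?w ?T = accept M"
      proof (rule tableau_sound[OF \<nu>])
        show "2 * ?T < ?N" using N by simp
        fix c assume c: "c < ?N"
        note sp = tape_specs_nth[OF c[unfolded S_def], folded S_def]
        consider "c < ?T" | i where "c = ?T + i" "i < ?L" | i where "c = ?T + ?L + i" "i < ?P" | "?T + ?L + ?P \<le> c"
          by (metis add.assoc le_Suc_ex less_or_eq_imp_le nat_add_left_cancel_less not_less)
        then show "\<nu> (Sy 0 0 c (snd (input_tape ?w) (int c - int ?T)))"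
        proof cases
          case 1 then show ?thesis using cells[OF c] sp(1) by (simp add: input_tape_def)
        next
          case (2 i) then show ?thesis using cells[OF c] sp(2)[OF 2] len nth by (simp add: input_tape_def)
        next
          case (3 i)
          have c': "c = g i" by (simp add: 3 g_def)
          have z: "int c - int ?T = int (?L + i)" by (simp add: 3)
          show ?thesis
          proof (cases "i < k")
            case True
            then have "snd (input_tape ?w) (int (?L + i)) = bit_symbol (?w ! (?L + i))"
              using len by (simp add: input_tape_def del: of_nat_add)
            then have "snd (input_tape ?w) (int c - int ?T) = bit_symbol (\<nu> (Sy 0 0 c 2))"
              unfolding z nth'[OF True] c'[symmetric] .
            then show ?thesis using cells[OF c] less[OF True] unfolding c' gS[OF 3(2)] by (auto simp: bit_symbol_def)
          next
            case False
            then have "snd (input_tape ?w) (int c - int ?T) = 0" using len unfolding z by (simp add: input_tape_def)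
            then show ?thesis using ge[of i] False 3(2) c' by simp
          qed
        next
          case 4 then show ?thesis using cells[OF c] sp(4) len kP by (simp add: input_tape_def)
        qed
      qed
      moreover have "length u \<le> ?P" using kP by (simp add: u_def)
      ultimately show "\<exists>u. length u \<le> ?P \<and> state (pair_word x u) ?T = accept M" by blast
    qed
    also have "\<dots> \<longleftrightarrow> satisfiable (f x)" by (simp add: holds_def satisfiable_def)
    finally show ?thesis .
  qed
  ultimately show ?thesis by blast
qed

section \<open>coNP-completeness\<close>

theorem problem_hard:
  assumes "B \<in> coNP_class"
  shows "poly_time_reducible B (problem spe det)"
proof -
  have "- B \<in> NP_class" using assms by (simp add: coNP_class_def)
  then obtain f :: "bool list \<Rightarrow> (fact \<times> bool) list list" where f: "pt f" "\<forall>x. f x \<noteq> [] \<and> [] \<notin> set (f x)"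
    "\<forall>x. x \<in> - B \<longleftrightarrow> satisfiable (f x)"
    using NP_reduces_to_satisfiability by blast
  have "pt (\<lambda>x. encode (cnf_inst (f x)))" by (rule pt_comp[OF pt_cnf_encoding f(1)])
  moreover have "x \<in> B \<longleftrightarrow> encode (cnf_inst (f x)) \<in> problem spe det" for x
  proof -
    interpret cnf_game "f x" by unfold_locales (use f(2) in auto)
    show ?thesis using cnf_problem[of spe det] f(3) by blast
  qed
  ultimately show ?thesis unfolding poly_time_reducible_def using pt_computable by blast
qed

theorem problem_complete: "coNP_complete (problem spe det)"
  unfolding coNP_complete_def using problem_coNP problem_hard by blast

theorem theorem14:
  shows "coNP_complete nash_rational_verification \<and>
         coNP_complete det_nash_rational_verification \<and>
         coNP_complete subgame_perfect_rational_verification \<and>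
         coNP_complete det_subgame_perfect_rational_verification"
  unfolding problem_eq by (intro conjI problem_complete)

end
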